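(* Let $\mathbb{F}$ be a field. For $n\ge 1$ define elements $\gamma_n(x)\in\mathrm{St}^2(\mathbb{F}^n)_{\mathrm{GL}(\mathbb{F}^n)}$ to correspond to the integer $(-1)^{n(n-1)/2}$ under the isomorphism $\mathrm{St}^2(\mathbb{F}^n)_{\mathrm{GL}(\mathbb{F}^n)}\xrightarrow{\cong}\mathbb{Z}$ induced by the pairing $\langle-,-\rangle$, and let $\gamma_0(x)=1$. Then the induced map $$\Gamma_{\mathbb{Z}}[x]=\bigoplus_{n\ge0}\mathbb{Z}\{\gamma_n(x)\}\longrightarrow\mathbb{Z}1\oplus\bigoplus_{n\ge1}\mathrm{St}^2(\mathbb{F}^n)_{\mathrm{GL}(\mathbb{F}^n)}$$ from the divided power algebra on a generator $x$ is a ring isomorphism. More generally, for any commutative ring $\Bbbk$ these maps give an isomorphism of $\Bbbk$-algebras $\Gamma_{\Bbbk}[x]\cong\Bbbk1\oplus\bigoplus_{n\ge1}\mathrm{St}^2_{\Bbbk}(\mathbb{F}^n)_{\mathrm{GL}(\mathbb{F}^n)}$.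
   Context: For a non-zero finite-dimensional $\mathbb{F}$-vector space $V$ of dimension $n$, let $T(V)$ be the Tits building (realisation of the nerve of the poset of proper non-zero subspaces), $\mathrm{St}(V)=\widetilde{H}_{n-2}(T(V);\mathbb{Z})$ the Steinberg module ($=\mathbb{Z}$ if $n=1$), $\mathrm{St}^2(V)=\mathrm{St}(V)\otimes_{\mathbb{Z}}\mathrm{St}(V)$ with the diagonal $\mathrm{GL}(V)$-action, and $\mathrm{St}^2_{\Bbbk}(V)=\Bbbk\otimes_{\mathbb{Z}}\mathrm{St}^2(V)$. $\mathrm{St}(V)$ is a subgroup of the free abelian group on the complete flags of $V$ (top-dimensional augmented simplicial chains of $T(V)$); $\langle-,-\rangle\colon\mathrm{St}(V)\otimes\mathrm{St}(V)\to\mathbb{Z}$ is the restriction of the form for which complete flags are orthonormal. It induces an isomorphism $\mathrm{St}^2(V)_{\mathrm{GL}(V)}\cong\mathbb{Z}$. Apartments: an ordered direct sum decomposition $\mathbf{L}=(L_1,\dots,L_n)$ of $V$ into lines defines the apartment class $a_{\mathbf{L}}=\sum_{\sigma\in\mathfrak{S}_n}\mathrm{sign}(\sigma)F_\sigma\in\mathrm{St}(V)$, where $F_\sigma$ is the complete flag with terms $L_{\sigma(1)}\oplus\dots\oplus L_{\sigma(i)}$; these classes span $\mathrm{St}(V)$. Products: let $D^1(V)_\bullet$ be the pointed simplicial set of chains $V_0\subset\dots\subset V_p$ of subspaces of $V$, with chains not satisfying $V_0=0$, $V_p=V$ collapsed to the basepoint; its realisation is equivalent to the double suspension of $T(V)$,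 so $\widetilde{H}_n(D^1(V))=\mathrm{St}(V)$. The maps $D^1(V)_p\wedge D^1(W)_p\to D^1(V\oplus W)_p$ taking termwise direct sums induce products $\mathrm{St}(V)\otimes\mathrm{St}(W)\to\mathrm{St}(V\oplus W)$, with $a_{\mathbf{L}}\cdot a_{\mathbf{L}'}=a_{\mathbf{L}''}$, $\mathbf{L}''$ the concatenation. The product $\mathrm{St}^2(V)\otimes\mathrm{St}^2(W)\to\mathrm{St}^2(V\oplus W)$ is the tensor square of this, where $\mathrm{St}(V)$ has degree $\dim V$ and the Koszul sign rule is used: $(a\otimes b)\cdot(c\otimes d)=(-1)^{\dim(V)\dim(W)}(a\cdot c)\otimes(b\cdot d)$. On coinvariants this makes $\Bbbk1\oplus\bigoplus_{n\ge1}\mathrm{St}^2_\Bbbk(\mathbb{F}^n)_{\mathrm{GL}_n(\mathbb{F})}$ a commutative graded $\Bbbk$-algebra. $\Gamma_{\Bbbk}[x]$ is the free $\Bbbk$-module on $\gamma_n(x)$, $n\ge0$, with $\gamma_0(x)=1$ and $\gamma_m(x)\gamma_n(x)=\binom{m+n}{n}\gamma_{m+n}(x)$. *)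

theory Defs
  imports "Jordan_Normal_Form.VS_Connect" "HOL-Algebra.Free_Abelian_Groups" "HOL-Algebra.IntRing"
begin

section \<open>Tensor products and coinvariants of abelian groups\<close>

text \<open>
  Abelian groups are (multiplicatively written) commutative groups in the sense of HOL-Algebra.
  The tensor product over the integers is the free abelian group on the pairs, modulo
  the subgroup generated by the biadditivity relations; its elements are cosets.
\<close>

type_synonym ('a, 'b) tensor = "('a \<times> 'b \<Rightarrow>\<^sub>0 int) set"

definition tensor_relations ::
  "('a, 'm) monoid_scheme \<Rightarrow> ('b, 'n) monoid_scheme \<Rightarrow> ('a \<times> 'b \<Rightarrow>\<^sub>0 int) set" where
  "tensor_relations G H =
     generate (free_Abelian_group (carrier G \<times> carrier H))
       ({frag_of (a \<otimes>\<^bsub>G\<^esub> a', b) - frag_of (a, b) - frag_of (a', b) | a a' b.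
           a \<in> carrier G \<and> a' \<in> carrier G \<and> b \<in> carrier H} \<union>
        {frag_of (a, b \<otimes>\<^bsub>H\<^esub> b') - frag_of (a, b) - frag_of (a, b') | a b b'.
           a \<in> carrier G \<and> b \<in> carrier H \<and> b' \<in> carrier H})"

definition tensor_group ::
  "('a, 'm) monoid_scheme \<Rightarrow> ('b, 'n) monoid_scheme \<Rightarrow> ('a, 'b) tensor monoid" where
  "tensor_group G H = free_Abelian_group (carrier G \<times> carrier H) Mod tensor_relations G H"

definition pure_tensor ::
  "('a, 'm) monoid_scheme \<Rightarrow> ('b, 'n) monoid_scheme \<Rightarrow> 'a \<Rightarrow> 'b \<Rightarrow> ('a, 'b) tensor" where
  "pure_tensor G H a b =
     tensor_relations G H #>\<^bsub>free_Abelian_group (carrier G \<times> carrier H)\<^esub> frag_of (a, b)"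

text \<open>
  \<open>tensor_lift K f\<close> is the homomorphism into \<open>K\<close> induced by a biadditive map \<open>f\<close>: the linear
  extension of \<open>f\<close> to formal sums of pairs is evaluated on the representatives of a coset.
  Here and below, \<open>the_elem\<close> is used for maps induced on quotients; the set it is applied to
  is a singleton because the map in question is compatible with the relations.
\<close>

definition tensor_lift ::
  "('c, 'm) monoid_scheme \<Rightarrow> ('a \<Rightarrow> 'b \<Rightarrow> 'c) \<Rightarrow> ('a, 'b) tensor \<Rightarrow> 'c" where
  "tensor_lift K f Z =
     the_elem ((\<lambda>c. finprod K (\<lambda>p. f (fst p) (snd p) [^]\<^bsub>K\<^esub> Poly_Mapping.lookup c p)
       (Poly_Mapping.keys c)) ` Z)"

text \<open>The coinvariants of \<open>M\<close> under a group acting through the set \<open>A\<close> of endomorphisms.\<close>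

definition coinvariant_relations :: "('a, 'm) monoid_scheme \<Rightarrow> ('a \<Rightarrow> 'a) set \<Rightarrow> 'a set" where
  "coinvariant_relations M A =
     generate M {\<alpha> x \<otimes>\<^bsub>M\<^esub> inv\<^bsub>M\<^esub> x | \<alpha> x. \<alpha> \<in> A \<and> x \<in> carrier M}"

definition coinvariants :: "('a, 'm) monoid_scheme \<Rightarrow> ('a \<Rightarrow> 'a) set \<Rightarrow> 'a set monoid" where
  "coinvariants M A = M Mod coinvariant_relations M A"

definition coinvariant_class :: "('a, 'm) monoid_scheme \<Rightarrow> ('a \<Rightarrow> 'a) set \<Rightarrow> 'a \<Rightarrow> 'a set" where
  "coinvariant_class M A x = coinvariant_relations M A #>\<^bsub>M\<^esub> x"


section \<open>The Tits building and the Steinberg module of \<open>F\<^sup>n\<close>\<close>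

type_synonym 'f flag = "'f vec set list"
type_synonym 'f chain = "'f flag \<Rightarrow>\<^sub>0 int"

definition GL :: "nat \<Rightarrow> 'f::field mat set" where
  "GL n = {g \<in> carrier_mat n n. invertible_mat g}"

definition proper_subspaces :: "nat \<Rightarrow> 'f::field vec set set" where
  "proper_subspaces n =
     {U. subspace class_ring U (module_vec TYPE('f) n) \<and> U \<noteq> {0\<^sub>v n} \<and> U \<noteq> carrier_vec n}"

text \<open>
  The non-degenerate simplices with \<open>k\<close> vertices (dimension \<open>k - 1\<close>) of the nerve of the poset
  of proper non-zero subspaces, including the empty simplex for \<open>k = 0\<close>. For
  \<open>n \<ge> 1\<close> and \<open>k = n - 1\<close> these are the complete flags, without their terms \<open>0\<close> and \<open>F\<^sup>n\<close>.
\<close>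

definition tits_simplices :: "nat \<Rightarrow> nat \<Rightarrow> 'f::field flag set" where
  "tits_simplices n k = {xs. length xs = k \<and> set xs \<subseteq> proper_subspaces n \<and> sorted_wrt (\<subset>) xs}"

text \<open>The augmented simplicial boundary; a vertex is sent to the empty simplex.\<close>

definition tits_boundary :: "'f::field chain \<Rightarrow> 'f chain" where
  "tits_boundary = frag_extend (\<lambda>xs. \<Sum>i<length xs.
     frag_cmul ((-1) ^ i) (frag_of (take i xs @ drop (Suc i) xs)))"

text \<open>
  The reduced homology of the building in its top degree \<open>n - 2\<close>. There are no
  simplices of dimension \<open>n - 1\<close>, so this is the group of cycles.
  For \<open>n = 1\<close> it is the free abelian group on the empty simplex.
\<close>

definition steinberg :: "nat \<Rightarrow> 'f::field chain monoid" where
  "steinberg n = (free_Abelian_group (tits_simplices n (n - 1)))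
     \<lparr>carrier := {c \<in> carrier (free_Abelian_group (tits_simplices n (n - 1))). tits_boundary c = 0}\<rparr>"

definition steinberg_act :: "'f::field mat \<Rightarrow> 'f chain \<Rightarrow> 'f chain" where
  "steinberg_act g = frag_extend (\<lambda>xs. frag_of (map (\<lambda>U. (\<lambda>v. g *\<^sub>v v) ` U) xs))"

definition steinberg_pairing :: "'f::field chain \<Rightarrow> 'f chain \<Rightarrow> int" where
  "steinberg_pairing a b =
     (\<Sum>x\<in>Poly_Mapping.keys a. Poly_Mapping.lookup a x * Poly_Mapping.lookup b x)"


section \<open>The product of Steinberg modules\<close>

text \<open>\<open>F\<^sup>m \<oplus> F\<^sup>n\<close> is identified with \<open>F\<^sup>m\<^sup>+\<^sup>n\<close> by concatenation of vectors.\<close>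

definition subspace_oplus :: "'f::field vec set \<Rightarrow> 'f vec set \<Rightarrow> 'f vec set" where
  "subspace_oplus U W = {u @\<^sub>v w | u w. u \<in> U \<and> w \<in> W}"

text \<open>The simplex \<open>0 = V\<^sub>0 \<subset> \<dots> \<subset> V\<^sub>n = F\<^sup>n\<close> of \<open>D\<^sup>1(F\<^sup>n)\<close> corresponding to a complete flag.\<close>

definition full_flag :: "nat \<Rightarrow> 'f::field flag \<Rightarrow> 'f flag" where
  "full_flag n xs = {0\<^sub>v n} # xs @ [carrier_vec n]"

text \<open>
  The product on homology is induced by the termwise direct sum
  \<open>D\<^sup>1(F\<^sup>m) \<and> D\<^sup>1(F\<^sup>n) \<rightarrow> D\<^sup>1(F\<^sup>m\<^sup>+\<^sup>n)\<close>, that is, it is the Eilenberg--Zilber shuffle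
  map followed by termwise direct sum.  An \<open>(m,n)\<close>-shuffle is given by the set
  \<open>S \<subseteq> {..<m+n}\<close> of the \<open>m\<close> steps at which the first factor advances (the other factor being
  degenerate there); the \<open>t\<close>-th term of the degenerated pair of flags is
  \<open>(V\<^sub>i, W\<^sub>j)\<close> where \<open>i\<close> and \<open>j\<close> count the steps before \<open>t\<close> inside and outside \<open>S\<close>.
  The outer terms \<open>t = 0\<close> and \<open>t = m + n\<close> are the zero space and \<open>F\<^sup>m\<^sup>+\<^sup>n\<close>, and are omitted.
  The sign is that of the shuffle permutation, normalised so that the product of the
  apartment classes of \<open>L\<close> and \<open>L'\<close> is the apartment class of the concatenation of \<open>L\<close> and \<open>L'\<close>.
\<close>

definition shuffles_of_type :: "nat \<Rightarrow> nat \<Rightarrow> nat set set" where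
  "shuffles_of_type m n = {S. S \<subseteq> {..<m + n} \<and> card S = m}"

definition shuffle_sign :: "nat \<Rightarrow> nat \<Rightarrow> nat set \<Rightarrow> int" where
  "shuffle_sign m n S = (-1) ^ card {(i, j). i \<in> S \<and> j \<in> {..<m + n} - S \<and> j < i}"

definition shuffle_flag :: "nat \<Rightarrow> nat \<Rightarrow> nat set \<Rightarrow> 'f::field flag \<Rightarrow> 'f flag \<Rightarrow> 'f flag" where
  "shuffle_flag m n S xs ys =
     map (\<lambda>t. subspace_oplus (full_flag m xs ! card ({..<t} \<inter> S)) (full_flag n ys ! card ({..<t} - S)))
       [1..<m + n]"

definition steinberg_mult :: "nat \<Rightarrow> nat \<Rightarrow> 'f::field chain \<Rightarrow> 'f chain \<Rightarrow> 'f chain" where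
  "steinberg_mult m n a b =
     frag_extend (\<lambda>xs. frag_extend (\<lambda>ys. \<Sum>S\<in>shuffles_of_type m n.
       frag_cmul (shuffle_sign m n S) (frag_of (shuffle_flag m n S xs ys))) b) a"


section \<open>The module \<open>St\<^sup>2\<close> and its coinvariants\<close>

type_synonym 'f st2 = "('f chain, 'f chain) tensor"

definition St2 :: "nat \<Rightarrow> 'f::field st2 monoid" where
  "St2 n = tensor_group (steinberg n) (steinberg n)"

definition St2_act :: "nat \<Rightarrow> 'f::field mat \<Rightarrow> 'f st2 \<Rightarrow> 'f st2" where
  "St2_act n g = tensor_lift (St2 n)
     (\<lambda>a b. pure_tensor (steinberg n) (steinberg n) (steinberg_act g a) (steinberg_act g b))"

text \<open>\<open>(a \<otimes> b) \<cdot> (c \<otimes> d) = (-1)\<^sup>m\<^sup>n (a \<cdot> c) \<otimes> (b \<cdot> d)\<close>; the sign is an exponent in multiplicative notation.\<close>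

definition St2_mult :: "nat \<Rightarrow> nat \<Rightarrow> 'f::field st2 \<Rightarrow> 'f st2 \<Rightarrow> 'f st2" where
  "St2_mult m n Z W =
     tensor_lift (St2 (m + n)) (\<lambda>a b.
       tensor_lift (St2 (m + n)) (\<lambda>c d.
         pure_tensor (steinberg (m + n)) (steinberg (m + n))
           (steinberg_mult m n a c) (steinberg_mult m n b d)
           [^]\<^bsub>St2 (m + n)\<^esub> ((-1) ^ (m * n) :: int)) W) Z"

definition St2_coinv :: "nat \<Rightarrow> 'f::field st2 set monoid" where
  "St2_coinv n = coinvariants (St2 n) (St2_act n ` GL n)"

definition St2_class :: "nat \<Rightarrow> 'f::field st2 \<Rightarrow> 'f st2 set" where
  "St2_class n = coinvariant_class (St2 n) (St2_act n ` GL n)"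

definition St2_coinv_mult ::
  "nat \<Rightarrow> nat \<Rightarrow> 'f::field st2 set \<Rightarrow> 'f st2 set \<Rightarrow> 'f st2 set" where
  "St2_coinv_mult m n Z W = the_elem {St2_class (m + n) (St2_mult m n x y) | x y. x \<in> Z \<and> y \<in> W}"

text \<open>The homomorphism from the coinvariants to the integers induced by the pairing.\<close>

definition St2_coinv_pairing :: "'f::field st2 set \<Rightarrow> int" where
  "St2_coinv_pairing Z = the_elem (tensor_lift integer_group steinberg_pairing ` Z)"

text \<open>The element corresponding to \<open>(-1)\<^bsup>n(n-1)/2\<^esup>\<close> under the pairing isomorphism (used for \<open>n \<ge> 1\<close>).\<close>

definition gamma :: "nat \<Rightarrow> 'f::field st2 set" where
  "gamma n = inv_into (carrier (St2_coinv n)) St2_coinv_pairing ((-1) ^ (n * (n - 1) div 2))"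


section \<open>The same with coefficients in a commutative ring\<close>

type_synonym ('f, 'k) st2k = "('k, 'f st2) tensor"

definition St2k :: "('k, 'm) ring_scheme \<Rightarrow> nat \<Rightarrow> ('f::field, 'k) st2k monoid" where
  "St2k R n = tensor_group (add_monoid R) (St2 n)"

abbreviation St2k_pure ::
  "('k, 'm) ring_scheme \<Rightarrow> nat \<Rightarrow> 'k \<Rightarrow> 'f::field st2 \<Rightarrow> ('f, 'k) st2k" where
  "St2k_pure R n \<equiv> pure_tensor (add_monoid R) (St2 n)"

definition St2k_act ::
  "('k, 'm) ring_scheme \<Rightarrow> nat \<Rightarrow> 'f::field mat \<Rightarrow> ('f, 'k) st2k \<Rightarrow> ('f, 'k) st2k" where
  "St2k_act R n g = tensor_lift (St2k R n) (\<lambda>r x. St2k_pure R n r (St2_act n g x))"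

definition St2k_smult ::
  "('k, 'm) ring_scheme \<Rightarrow> nat \<Rightarrow> 'k \<Rightarrow> ('f::field, 'k) st2k \<Rightarrow> ('f, 'k) st2k" where
  "St2k_smult R n s = tensor_lift (St2k R n) (\<lambda>r x. St2k_pure R n (s \<otimes>\<^bsub>R\<^esub> r) x)"

definition St2k_mult ::
  "('k, 'm) ring_scheme \<Rightarrow> nat \<Rightarrow> nat \<Rightarrow>
   ('f::field, 'k) st2k \<Rightarrow> ('f, 'k) st2k \<Rightarrow> ('f, 'k) st2k" where
  "St2k_mult R m n Z W =
     tensor_lift (St2k R (m + n)) (\<lambda>r x.
       tensor_lift (St2k R (m + n)) (\<lambda>s y.
         St2k_pure R (m + n) (r \<otimes>\<^bsub>R\<^esub> s) (St2_mult m n x y)) W) Z"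

definition St2k_coinv :: "('k, 'm) ring_scheme \<Rightarrow> nat \<Rightarrow> ('f::field, 'k) st2k set monoid" where
  "St2k_coinv R n = coinvariants (St2k R n) (St2k_act R n ` GL n)"

definition St2k_class ::
  "('k, 'm) ring_scheme \<Rightarrow> nat \<Rightarrow> ('f::field, 'k) st2k \<Rightarrow> ('f, 'k) st2k set" where
  "St2k_class R n = coinvariant_class (St2k R n) (St2k_act R n ` GL n)"

definition St2k_coinv_smult ::
  "('k, 'm) ring_scheme \<Rightarrow> nat \<Rightarrow> 'k \<Rightarrow> ('f::field, 'k) st2k set \<Rightarrow> ('f, 'k) st2k set" where
  "St2k_coinv_smult R n s Z = the_elem {St2k_class R n (St2k_smult R n s x) | x. x \<in> Z}"

definition St2k_coinv_mult ::
  "('k, 'm) ring_scheme \<Rightarrow> nat \<Rightarrow> nat \<Rightarrow>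
   ('f::field, 'k) st2k set \<Rightarrow> ('f, 'k) st2k set \<Rightarrow> ('f, 'k) st2k set" where
  "St2k_coinv_mult R m n Z W =
     the_elem {St2k_class R (m + n) (St2k_mult R m n x y) | x y. x \<in> Z \<and> y \<in> W}"

text \<open>The image of \<open>gamma n\<close> under the map induced by \<open>x \<mapsto> 1 \<otimes> x\<close>.\<close>

definition gammak :: "('k, 'm) ring_scheme \<Rightarrow> nat \<Rightarrow> ('f::field, 'k) st2k set" where
  "gammak R n = the_elem {St2k_class R n (St2k_pure R n \<one>\<^bsub>R\<^esub> x) | x. x \<in> gamma n}"


section \<open>The graded algebras\<close>

text \<open>
  The algebra \<open>R 1 \<oplus> \<Oplus>\<^sub>n\<^sub>\<ge>\<^sub>1 C n\<close> with scalar multiplications \<open>act n\<close> and products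
  \<open>P m n\<close> from \<open>C m\<close> and \<open>C n\<close> to \<open>C (m + n)\<close>, for \<open>m, n \<ge> 1\<close>. The groups \<open>C n\<close> are written
  multiplicatively, so that \<open>\<otimes>\<^bsub>C n\<^esub>\<close> is the addition of the algebra.
\<close>

definition unital_graded_algebra ::
  "('k, 'm) ring_scheme \<Rightarrow> (nat \<Rightarrow> 'c monoid) \<Rightarrow> (nat \<Rightarrow> 'k \<Rightarrow> 'c \<Rightarrow> 'c) \<Rightarrow>
   (nat \<Rightarrow> nat \<Rightarrow> 'c \<Rightarrow> 'c \<Rightarrow> 'c) \<Rightarrow> ('k, 'k \<times> (nat \<Rightarrow> 'c)) module" where
  "unital_graded_algebra R C act P =
    \<lparr>carrier = carrier R \<times> carrier (sum_group {1..} C),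
     monoid.mult = (\<lambda>(r, f) (s, g). (r \<otimes>\<^bsub>R\<^esub> s,
       \<lambda>n\<in>{1..}. act n r (g n) \<otimes>\<^bsub>C n\<^esub> act n s (f n) \<otimes>\<^bsub>C n\<^esub>
         finprod (C n) (\<lambda>i. P i (n - i) (f i) (g (n - i))) {1..<n})),
     one = (\<one>\<^bsub>R\<^esub>, \<one>\<^bsub>sum_group {1..} C\<^esub>),
     ring.zero = (\<zero>\<^bsub>R\<^esub>, \<one>\<^bsub>sum_group {1..} C\<^esub>),
     add = (\<lambda>(r, f) (s, g). (r \<oplus>\<^bsub>R\<^esub> s, f \<otimes>\<^bsub>sum_group {1..} C\<^esub> g)),
     smult = (\<lambda>r (s, f). (r \<otimes>\<^bsub>R\<^esub> s, \<lambda>n\<in>{1..}. act n r (f n)))\<rparr>"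

definition steinberg_ring ::
  "'f::field itself \<Rightarrow> (int, int \<times> (nat \<Rightarrow> 'f st2 set)) module" where
  "steinberg_ring F =
     unital_graded_algebra int_ring St2_coinv (\<lambda>n r x. x [^]\<^bsub>St2_coinv n\<^esub> r) St2_coinv_mult"

definition steinberg_algebra ::
  "'f::field itself \<Rightarrow> ('k, 'm) ring_scheme \<Rightarrow> ('k, 'k \<times> (nat \<Rightarrow> ('f, 'k) st2k set)) module" where
  "steinberg_algebra F R =
     unital_graded_algebra R (St2k_coinv R) (St2k_coinv_smult R) (St2k_coinv_mult R)"

text \<open>
  The function \<open>f\<close> represents the finite sum of the \<open>f n \<gamma>\<^sub>n(x)\<close>; the product is determined by
  \<open>\<gamma>\<^sub>i(x) \<gamma>\<^sub>j(x) = (i + j choose i) \<gamma>\<^sub>i\<^sub>+\<^sub>j(x)\<close>.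
\<close>

definition divided_power_algebra :: "('k, 'm) ring_scheme \<Rightarrow> ('k, nat \<Rightarrow> 'k) module" where
  "divided_power_algebra R =
    \<lparr>carrier = {f. (\<forall>n. f n \<in> carrier R) \<and> finite {n. f n \<noteq> \<zero>\<^bsub>R\<^esub>}},
     monoid.mult = (\<lambda>f g n. finsum R (\<lambda>i. add_pow R (n choose i) (f i \<otimes>\<^bsub>R\<^esub> g (n - i))) {..n}),
     one = (\<lambda>n. if n = 0 then \<one>\<^bsub>R\<^esub> else \<zero>\<^bsub>R\<^esub>),
     ring.zero = (\<lambda>n. \<zero>\<^bsub>R\<^esub>),
     add = (\<lambda>f g n. f n \<oplus>\<^bsub>R\<^esub> g n),
     smult = (\<lambda>r f n. r \<otimes>\<^bsub>R\<^esub> f n)\<rparr>"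

text \<open>The additive maps with \<open>\<gamma>\<^sub>0(x) \<mapsto> 1\<close> and \<open>\<gamma>\<^sub>n(x) \<mapsto> gamma n\<close>, respectively \<open>gammak R n\<close>, for \<open>n \<ge> 1\<close>.\<close>

definition gamma_map ::
  "'f::field itself \<Rightarrow> (nat \<Rightarrow> int) \<Rightarrow> int \<times> (nat \<Rightarrow> 'f st2 set)" where
  "gamma_map F f = (f 0, \<lambda>n\<in>{1..}. gamma n [^]\<^bsub>St2_coinv n\<^esub> f n)"

definition gammak_map ::
  "'f::field itself \<Rightarrow> ('k, 'm) ring_scheme \<Rightarrow> (nat \<Rightarrow> 'k) \<Rightarrow>
   'k \<times> (nat \<Rightarrow> ('f, 'k) st2k set)" where
  "gammak_map F R f = (f 0, \<lambda>n\<in>{1..}. St2k_coinv_smult R n (f n) (gammak R n))"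

definition algebra_iso ::
  "('k, 'm) ring_scheme \<Rightarrow> ('k, 'a, 'p) module_scheme \<Rightarrow> ('k, 'b, 'q) module_scheme \<Rightarrow>
   ('a \<Rightarrow> 'b) set" where
  "algebra_iso R A B = {h \<in> ring_iso A B.
     \<forall>r\<in>carrier R. \<forall>x\<in>carrier A. h (r \<odot>\<^bsub>A\<^esub> x) = r \<odot>\<^bsub>B\<^esub> h x}"

end

theory Submission
  imports Defs "HOL-Library.Function_Algebras"
begin

text \<open>
  The pairing identifies the coinvariants of \<open>St\<^sup>2(V)\<close> with the integers, and it is compatible with products:
  different triples of a shuffle and two flags yield different flags, so
  \<open>\<langle>a \<cdot> c, b \<cdot> d\<rangle> = (m + n choose m) \<langle>a, b\<rangle> \<langle>c, d\<rangle>\<close>. Since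
  \<open>(m + n)(m + n - 1)/2 = m(m - 1)/2 + n(n - 1)/2 + mn\<close>, the Koszul sign is absorbed by the signs in the
  definition of \<open>\<gamma>\<^sub>n(x)\<close>, and these classes multiply like divided powers.

  For the identification of the coinvariants one classifies invariant biadditive forms on \<open>St(V)\<close>, by induction on
  \<open>dim V\<close> and simultaneously for two groups: forms invariant under \<open>GL(V)\<close> are multiples of the pairing, and forms
  invariant under the stabiliser of a vector \<open>v \<noteq> 0\<close> are combinations of the forms \<open>\<phi>\<^sub>p\<close>, where \<open>\<phi>\<^sub>p\<close> only pairs the
  flags that \<open>v\<close> enters at step \<open>p\<close>. For a complement \<open>H\<close> of \<open>v\<close>, the group \<open>St(V)\<close> is generated by the products of
  lines \<open>m\<close> outside \<open>H\<close> with \<open>St(H)\<close>, and also by the products of the line of \<open>v\<close> with \<open>St(H')\<close> for all complements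
  \<open>H'\<close> of \<open>v\<close>. Hence a form invariant under the stabiliser of \<open>v\<close> is determined by forms on \<open>St(H)\<close>, one for
  each \<open>m = v + h\<close>, which are invariant under the stabiliser of \<open>h\<close> in \<open>GL(H)\<close>. Conversely, a form invariant under
  \<open>GL(V)\<close> is a combination of the \<open>\<phi>\<^sub>p\<close> for every \<open>v\<close>, and its coefficients agree because there are two
  chains with exactly one common flag.
\<close>

section \<open>Tensor products and coinvariants\<close>

text \<open>Homomorphisms from the coinvariants to an abelian group are invariant forms with values
  in that group. Integer-valued forms alone would only describe the dual of the coinvariants and
  would miss torsion. The classification is therefore proved for values in an arbitrary quotient and
  applied to the universal form, whose values are the coinvariants themselves: they turn out to be
  cyclic. Two chains with a single common flag then give a pure tensor of pairing 1 that generates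
  them, so the pairing is bijective. The second family of groups enters because an automorphism of
  \<open>H\<close>, extended by the identity on \<open>v\<close>, preserves a pair of generators
  built from \<open>v\<close> and \<open>v + h\<close> only if it fixes \<open>h\<close>. On such
  generators the difference of two consecutive forms \<open>\<phi>\<^sub>p\<close> of
  \<open>v\<close> is a form \<open>\<phi>\<^sub>p\<close> of \<open>h\<close> on \<open>H\<close>,
  so the coefficients are found by Abel summation. Transitivity of linear groups and common
  complements replace any general position argument, so finite fields are included.\<close>

lemma (in comm_group) rcos_eq_iff:
  assumes N: "subgroup N G" and x: "x \<in> carrier G" "y \<in> carrier G"
  shows "N #> x = N #> y \<longleftrightarrow> x \<otimes> inv y \<in> N"
proof
  assume "N #> x = N #> y"
  then have "x \<in> N #> y" using rcos_self[OF x(1) N] by simp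
  then obtain h where "h \<in> N" "x = h \<otimes> y" unfolding r_coset_def by blast
  then show "x \<otimes> inv y \<in> N" using x subgroup.subset[OF N] by (auto simp: m_assoc)
next
  assume a: "x \<otimes> inv y \<in> N"
  have "(x \<otimes> inv y) \<otimes> y = x" using x by (simp add: m_assoc)
  then have "x \<in> N #> y" using a unfolding r_coset_def by force
  then show "N #> x = N #> y" using repr_independence[OF _ x(2) N] by simp
qed

lemma (in comm_group) rcos_mult:
  assumes "subgroup N G" "x \<in> carrier G" "y \<in> carrier G"
  shows "(N #> x) <#> (N #> y) = N #> (x \<otimes> y)"
  using normal.rcos_sum[OF subgroup_imp_normal[OF assms(1)] assms(2,3)] .

text \<open>Maps induced on quotients are encoded as \<open>the_elem\<close> of an image of a coset;
  they are evaluated by showing that the map is constant on the coset.\<close>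

lemma the_elem_const: "S \<noteq> {} \<Longrightarrow> (\<And>x. x \<in> S \<Longrightarrow> f x = c) \<Longrightarrow> the_elem (f ` S) = c"
  by (metis (no_types, lifting) image_cong image_constant_conv the_elem_eq)

section \<open>Biadditive maps and the universal property of the tensor product\<close>

definition bihom :: "('a, 'm) monoid_scheme \<Rightarrow> ('b, 'n) monoid_scheme \<Rightarrow> ('c, 'p) monoid_scheme \<Rightarrow>
    ('a \<Rightarrow> 'b \<Rightarrow> 'c) \<Rightarrow> bool" where
  "bihom G H K f \<longleftrightarrow> (\<forall>a\<in>carrier G. \<forall>b\<in>carrier H. f a b \<in> carrier K) \<and>
     (\<forall>a\<in>carrier G. \<forall>a'\<in>carrier G. \<forall>b\<in>carrier H. f (a \<otimes>\<^bsub>G\<^esub> a') b = f a b \<otimes>\<^bsub>K\<^esub> f a' b) \<and>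
     (\<forall>a\<in>carrier G. \<forall>b\<in>carrier H. \<forall>b'\<in>carrier H. f a (b \<otimes>\<^bsub>H\<^esub> b') = f a b \<otimes>\<^bsub>K\<^esub> f a b')"

lemma bihomD:
  assumes "bihom G H K f" "a \<in> carrier G" "b \<in> carrier H"
  shows "f a b \<in> carrier K"
    and "a' \<in> carrier G \<Longrightarrow> f (a \<otimes>\<^bsub>G\<^esub> a') b = f a b \<otimes>\<^bsub>K\<^esub> f a' b"
    and "b' \<in> carrier H \<Longrightarrow> f a (b \<otimes>\<^bsub>H\<^esub> b') = f a b \<otimes>\<^bsub>K\<^esub> f a b'"
  using assms unfolding bihom_def by auto

locale tensor_pair = G: comm_group G + H: comm_group H for G (structure) and H (structure)
begin

abbreviation FA where "FA \<equiv> free_Abelian_group (carrier G \<times> carrier H)"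
abbreviation TR where "TR \<equiv> tensor_relations G H"
abbreviation T where "T \<equiv> tensor_group G H"
abbreviation pt where "pt \<equiv> pure_tensor G H"

sublocale FA: comm_group FA by (rule abelian_free_Abelian_group)

lemma keys_diff3: "x \<in> S \<Longrightarrow> y \<in> S \<Longrightarrow> z \<in> S \<Longrightarrow> Poly_Mapping.keys (frag_of x - frag_of y - frag_of z) \<subseteq> S"
  using keys_diff[of "frag_of x - frag_of y" "frag_of z"] keys_diff[of "frag_of x" "frag_of y"] by auto

lemma relations_carrier:
  "{frag_of (a \<otimes>\<^bsub>G\<^esub> a', b) - frag_of (a, b) - frag_of (a', b) | a a' b.
           a \<in> carrier G \<and> a' \<in> carrier G \<and> b \<in> carrier H} \<union>
        {frag_of (a, b \<otimes>\<^bsub>H\<^esub> b') - frag_of (a, b) - frag_of (a, b') | a b b'.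
           a \<in> carrier G \<and> b \<in> carrier H \<and> b' \<in> carrier H} \<subseteq> carrier FA"
proof -
  have "frag_of (a \<otimes>\<^bsub>G\<^esub> a', b) - frag_of (a, b) - frag_of (a', b) \<in> carrier FA"
    if "a \<in> carrier G" "a' \<in> carrier G" "b \<in> carrier H" for a a' b
    unfolding carrier_free_Abelian_group_iff by (rule keys_diff3) (use that in auto)
  moreover have "frag_of (a, b \<otimes>\<^bsub>H\<^esub> b') - frag_of (a, b) - frag_of (a, b') \<in> carrier FA"
    if "a \<in> carrier G" "b \<in> carrier H" "b' \<in> carrier H" for a b b'
    unfolding carrier_free_Abelian_group_iff by (rule keys_diff3) (use that in auto)
  ultimately show ?thesis by blast
qed

lemma TR_subgroup: "subgroup TR FA"
  unfolding tensor_relations_def by (rule FA.generate_is_subgroup[OF relations_carrier])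

lemma TR_left: "a \<in> carrier G \<Longrightarrow> a' \<in> carrier G \<Longrightarrow> b \<in> carrier H \<Longrightarrow>
    frag_of (a \<otimes>\<^bsub>G\<^esub> a', b) - frag_of (a, b) - frag_of (a', b) \<in> TR"
  unfolding tensor_relations_def by (intro generate.incl) blast

lemma TR_right: "a \<in> carrier G \<Longrightarrow> b \<in> carrier H \<Longrightarrow> b' \<in> carrier H \<Longrightarrow>
    frag_of (a, b \<otimes>\<^bsub>H\<^esub> b') - frag_of (a, b) - frag_of (a, b') \<in> TR"
  unfolding tensor_relations_def by (intro generate.incl) blast

sublocale T: comm_group T
  unfolding tensor_group_def by (rule FA.abelian_FactGroup[OF TR_subgroup])

lemma carrier_T: "carrier T = (\<lambda>c. TR #>\<^bsub>FA\<^esub> c) ` carrier FA"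
  unfolding tensor_group_def by (rule carrier_FactGroup)

lemma mult_T: "c \<in> carrier FA \<Longrightarrow> d \<in> carrier FA \<Longrightarrow> (TR #>\<^bsub>FA\<^esub> c) \<otimes>\<^bsub>T\<^esub> (TR #>\<^bsub>FA\<^esub> d) = TR #>\<^bsub>FA\<^esub> (c + d)"
  unfolding tensor_group_def mult_FactGroup using FA.rcos_mult[OF TR_subgroup, of c d] by simp

lemma pt_closed: "a \<in> carrier G \<Longrightarrow> b \<in> carrier H \<Longrightarrow> pt a b \<in> carrier T"
  unfolding carrier_T pure_tensor_def by (rule imageI) simp

lemma coset_diff_eq:
  assumes "c \<in> carrier FA" "d \<in> carrier FA" "c - d \<in> TR"
  shows "TR #>\<^bsub>FA\<^esub> c = TR #>\<^bsub>FA\<^esub> d"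
  using FA.rcos_eq_iff[OF TR_subgroup assms(1,2)] assms by simp

lemma bihom_pt: "bihom G H T pt"
  unfolding bihom_def
proof (intro conjI ballI)
  have add: "frag_of x + frag_of y \<in> carrier FA" if "x \<in> carrier G \<times> carrier H" "y \<in> carrier G \<times> carrier H" for x y
    using that FA.m_closed[of "frag_of x" "frag_of y"] by simp
  fix a a' b assume *: "a \<in> carrier G" "a' \<in> carrier G" "b \<in> carrier H"
  have "TR #>\<^bsub>FA\<^esub> frag_of (a \<otimes>\<^bsub>G\<^esub> a', b) = TR #>\<^bsub>FA\<^esub> (frag_of (a, b) + frag_of (a', b))"
    by (rule coset_diff_eq) (use * add TR_left[OF *] in \<open>auto simp: diff_diff_eq simp del: carrier_free_Abelian_group_iff\<close>)
  then show "pt (a \<otimes>\<^bsub>G\<^esub> a') b = pt a b \<otimes>\<^bsub>T\<^esub> pt a' b"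
    unfolding pure_tensor_def using mult_T[of "frag_of (a, b)" "frag_of (a', b)"] * by simp
next
  have add: "frag_of x + frag_of y \<in> carrier FA" if "x \<in> carrier G \<times> carrier H" "y \<in> carrier G \<times> carrier H" for x y
    using that FA.m_closed[of "frag_of x" "frag_of y"] by simp
  fix a b b' assume *: "a \<in> carrier G" "b \<in> carrier H" "b' \<in> carrier H"
  have "TR #>\<^bsub>FA\<^esub> frag_of (a, b \<otimes>\<^bsub>H\<^esub> b') = TR #>\<^bsub>FA\<^esub> (frag_of (a, b) + frag_of (a, b'))"
    by (rule coset_diff_eq) (use * add TR_right[OF *] in \<open>auto simp: diff_diff_eq simp del: carrier_free_Abelian_group_iff\<close>)
  then show "pt a (b \<otimes>\<^bsub>H\<^esub> b') = pt a b \<otimes>\<^bsub>T\<^esub> pt a b'"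
    unfolding pure_tensor_def using mult_T[of "frag_of (a, b)" "frag_of (a, b')"] * by simp
qed (rule pt_closed)

text \<open>Cosets of formal sums are built from cosets of single pairs. The step takes quotients
  instead of products, because one such step yields negative coefficients as well as sums.\<close>

lemma tensor_induct [consumes 1, case_names one diff pure]:
  assumes z: "z \<in> carrier T" and 1: "P \<one>\<^bsub>T\<^esub>"
    and 2: "\<And>x y. x \<in> carrier T \<Longrightarrow> y \<in> carrier T \<Longrightarrow> P x \<Longrightarrow> P y \<Longrightarrow> P (x \<otimes>\<^bsub>T\<^esub> inv\<^bsub>T\<^esub> y)"
    and 3: "\<And>a b. a \<in> carrier G \<Longrightarrow> b \<in> carrier H \<Longrightarrow> P (pt a b)"
  shows "P z"
proof -
  obtain c where c: "Poly_Mapping.keys c \<subseteq> carrier G \<times> carrier H" "z = TR #>\<^bsub>FA\<^esub> c"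
    using z unfolding carrier_T by auto
  have "P (TR #>\<^bsub>FA\<^esub> c)"
  proof (rule free_Abelian_group_induct[OF c(1)])
    have "TR #>\<^bsub>FA\<^esub> 0 = TR" using FA.coset_mult_one[of TR] subgroup.subset[OF TR_subgroup] by simp
    moreover have "\<one>\<^bsub>T\<^esub> = TR" by (simp add: tensor_group_def)
    ultimately show "P (TR #>\<^bsub>FA\<^esub> 0)" using assms(2) by simp
  next
    fix x y assume 2: "Poly_Mapping.keys x \<subseteq> carrier G \<times> carrier H" "Poly_Mapping.keys y \<subseteq> carrier G \<times> carrier H"
      "P (TR #>\<^bsub>FA\<^esub> x)" "P (TR #>\<^bsub>FA\<^esub> y)"
    have xy: "x \<in> carrier FA" "y \<in> carrier FA" "- y \<in> carrier FA" using 2 by (auto simp: keys_minus)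
    have "TR #>\<^bsub>FA\<^esub> (x - y) = (TR #>\<^bsub>FA\<^esub> x) \<otimes>\<^bsub>T\<^esub> inv\<^bsub>T\<^esub> (TR #>\<^bsub>FA\<^esub> y)"
    proof -
      have "(TR #>\<^bsub>FA\<^esub> (x - y)) \<otimes>\<^bsub>T\<^esub> (TR #>\<^bsub>FA\<^esub> y) = TR #>\<^bsub>FA\<^esub> x"
        using mult_T[of "x - y" y] xy FA.m_closed[OF xy(1,3)] by simp
      moreover have "x - y \<in> carrier FA" using FA.m_closed[OF xy(1,3)] by simp
      ultimately show ?thesis using T.inv_solve_right[of "TR #>\<^bsub>FA\<^esub> (x - y)" "TR #>\<^bsub>FA\<^esub> x" "TR #>\<^bsub>FA\<^esub> y"] xy
        unfolding carrier_T by (metis imageI)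
    qed
    then show "P (TR #>\<^bsub>FA\<^esub> (x - y))" using assms(3) 2 xy unfolding carrier_T by simp
  next
    fix p assume "p \<in> carrier G \<times> carrier H"
    then show "P (TR #>\<^bsub>FA\<^esub> frag_of p)" using assms(4)[of "fst p" "snd p"] by (simp add: pure_tensor_def mem_Times_iff)
  qed
  then show ?thesis using c by simp
qed

text \<open>The uniqueness half of the universal property: identities between homomorphisms on
  tensors are reduced to pure tensors by it.\<close>

lemma hom_eq_on_T:
  assumes K: "group K" and f: "f \<in> hom T K" "g \<in> hom T K"
    and eq: "\<And>a b. a \<in> carrier G \<Longrightarrow> b \<in> carrier H \<Longrightarrow> f (pt a b) = g (pt a b)" and z: "z \<in> carrier T"
  shows "f z = g z"
  using z
proof (induction rule: tensor_induct)
  case one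
  then show ?case using f K by (simp add: hom_one T.is_group)
next
  case (diff x y)
  interpret f: group_hom T K f using f K T.is_group by (simp add: group_hom_def group_hom_axioms_def)
  interpret g: group_hom T K g using f K T.is_group by (simp add: group_hom_def group_hom_axioms_def)
  show ?case using diff by simp
qed (rule eq)

end

locale tensor_bihom = tensor_pair + K: comm_group K for K (structure) +
  fixes f assumes f: "bihom G H K f"
begin

text \<open>The expression whose image on a coset \<open>tensor_lift\<close> takes, isolated so that
  it can be shown to be a homomorphism on formal sums that kills the relations.\<close>

definition lin :: "(_ \<Rightarrow>\<^sub>0 int) \<Rightarrow> _" where
  "lin c = finprod K (\<lambda>p. f (fst p) (snd p) [^]\<^bsub>K\<^esub> Poly_Mapping.lookup c p) (Poly_Mapping.keys c)"

lemma lin_superset: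
  assumes S: "finite S" "Poly_Mapping.keys c \<subseteq> S" "S \<subseteq> carrier G \<times> carrier H"
  shows "lin c = finprod K (\<lambda>p. f (fst p) (snd p) [^]\<^bsub>K\<^esub> Poly_Mapping.lookup c p) S"
proof -
  have "f (fst p) (snd p) \<in> carrier K" if "p \<in> S" for p using bihomD(1)[OF f] that S by auto
  then show ?thesis unfolding lin_def
    by (intro K.finprod_mono_neutral_cong_left) (use S in \<open>auto simp: in_keys_iff\<close>)
qed

lemma lin_hom: "lin \<in> hom FA K"
proof (rule homI)
  fix c assume "c \<in> carrier FA"
  then have "f (fst p) (snd p) \<in> carrier K" if "p \<in> Poly_Mapping.keys c" for p using bihomD(1)[OF f] that by auto
  then show "lin c \<in> carrier K" unfolding lin_def by (intro K.finprod_closed) auto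
next
  fix c d assume cd: "c \<in> carrier FA" "d \<in> carrier FA"
  define S where "S = Poly_Mapping.keys c \<union> Poly_Mapping.keys d"
  have S: "finite S" "Poly_Mapping.keys c \<subseteq> S" "Poly_Mapping.keys d \<subseteq> S" "Poly_Mapping.keys (c + d) \<subseteq> S" "S \<subseteq> carrier G \<times> carrier H"
    using keys_add[of c d] cd by (auto simp: S_def)
  have fc: "f (fst p) (snd p) \<in> carrier K" if "p \<in> S" for p using bihomD(1)[OF f] that S by auto
  have "lin (c + d) = finprod K (\<lambda>p. f (fst p) (snd p) [^]\<^bsub>K\<^esub> Poly_Mapping.lookup c p \<otimes>\<^bsub>K\<^esub>
      f (fst p) (snd p) [^]\<^bsub>K\<^esub> Poly_Mapping.lookup d p) S"
    unfolding lin_superset[OF S(1,4,5)]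
    by (rule K.finprod_cong') (use fc in \<open>auto simp: lookup_add K.int_pow_mult\<close>)
  also have "\<dots> = lin c \<otimes>\<^bsub>K\<^esub> lin d"
    unfolding lin_superset[OF S(1,2,5)] lin_superset[OF S(1,3,5)]
    by (rule K.finprod_multf) (use fc in auto)
  finally show "lin (c \<otimes>\<^bsub>FA\<^esub> d) = lin c \<otimes>\<^bsub>K\<^esub> lin d" by simp
qed

lemma lin_frag_of: "a \<in> carrier G \<Longrightarrow> b \<in> carrier H \<Longrightarrow> lin (frag_of (a, b)) = f a b"
  unfolding lin_def using bihomD(1)[OF f, of a b] by simp

sublocale L: group_hom FA K lin
  using lin_hom by (simp add: group_hom_def group_hom_axioms_def FA.is_group K.is_group)

lemma lin_diff: "c \<in> carrier FA \<Longrightarrow> d \<in> carrier FA \<Longrightarrow> lin (c - d) = lin c \<otimes>\<^bsub>K\<^esub> inv\<^bsub>K\<^esub> lin d"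
  using L.hom_mult[of c "- d"] L.hom_inv[of d] by (simp add: keys_minus)

lemma lin_TR: "c \<in> TR \<Longrightarrow> lin c = \<one>\<^bsub>K\<^esub>"
proof -
  assume c: "c \<in> TR"
  have "TR \<subseteq> kernel FA K lin"
    unfolding tensor_relations_def
  \<comment> \<open>The kernel is a subgroup, so the two kinds of generating relations
    suffice.\<close>
  proof (rule FA.generate_subgroup_incl[OF _ L.subgroup_kernel])
    have 1: "x - y \<in> carrier FA" if "x \<in> carrier FA" "y \<in> carrier FA" for x y
      using FA.m_closed[of x "- y"] that by (simp add: keys_minus)
    have "frag_of (a \<otimes>\<^bsub>G\<^esub> a', b) - frag_of (a, b) - frag_of (a', b) \<in> kernel FA K lin"
      if *: "a \<in> carrier G" "a' \<in> carrier G" "b \<in> carrier H" for a a' b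
    proof -
      have mem: "frag_of (a \<otimes>\<^bsub>G\<^esub> a', b) \<in> carrier FA" "frag_of (a, b) \<in> carrier FA" "frag_of (a', b) \<in> carrier FA"
        using * by auto
      have "lin (frag_of (a \<otimes>\<^bsub>G\<^esub> a', b) - frag_of (a, b) - frag_of (a', b))
        = f a b \<otimes>\<^bsub>K\<^esub> f a' b \<otimes>\<^bsub>K\<^esub> inv\<^bsub>K\<^esub> f a b \<otimes>\<^bsub>K\<^esub> inv\<^bsub>K\<^esub> f a' b"
        using lin_diff[OF 1[OF mem(1,2)] mem(3)] lin_diff[OF mem(1,2)] * lin_frag_of bihomD(2)[OF f] by simp
      also have "\<dots> = \<one>\<^bsub>K\<^esub>" using bihomD(1)[OF f] * by (simp add: K.m_ac)
      finally show ?thesis unfolding kernel_def using 1 mem by simp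
    qed
    moreover have "frag_of (a, b \<otimes>\<^bsub>H\<^esub> b') - frag_of (a, b) - frag_of (a, b') \<in> kernel FA K lin"
      if *: "a \<in> carrier G" "b \<in> carrier H" "b' \<in> carrier H" for a b b'
    proof -
      have mem: "frag_of (a, b \<otimes>\<^bsub>H\<^esub> b') \<in> carrier FA" "frag_of (a, b) \<in> carrier FA" "frag_of (a, b') \<in> carrier FA"
        using * by auto
      have "lin (frag_of (a, b \<otimes>\<^bsub>H\<^esub> b') - frag_of (a, b) - frag_of (a, b'))
        = f a b \<otimes>\<^bsub>K\<^esub> f a b' \<otimes>\<^bsub>K\<^esub> inv\<^bsub>K\<^esub> f a b \<otimes>\<^bsub>K\<^esub> inv\<^bsub>K\<^esub> f a b'"
        using lin_diff[OF 1[OF mem(1,2)] mem(3)] lin_diff[OF mem(1,2)] * lin_frag_of bihomD(3)[OF f] by simp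
      also have "\<dots> = \<one>\<^bsub>K\<^esub>" using bihomD(1)[OF f] * by (simp add: K.m_ac)
      finally show ?thesis unfolding kernel_def using 1 mem by simp
    qed
    ultimately show "{frag_of (a \<otimes>\<^bsub>G\<^esub> a', b) - frag_of (a, b) - frag_of (a', b) | a a' b.
           a \<in> carrier G \<and> a' \<in> carrier G \<and> b \<in> carrier H} \<union>
        {frag_of (a, b \<otimes>\<^bsub>H\<^esub> b') - frag_of (a, b) - frag_of (a, b') | a b b'.
           a \<in> carrier G \<and> b \<in> carrier H \<and> b' \<in> carrier H} \<subseteq> kernel FA K lin" by blast
  qed
  then show ?thesis using c unfolding kernel_def by blast
qed

lemma tensor_lift_coset:
  assumes c: "c \<in> carrier FA"
  shows "tensor_lift K f (TR #>\<^bsub>FA\<^esub> c) = lin c"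
  unfolding tensor_lift_def lin_def[symmetric]
proof (rule the_elem_const)
  show "TR #>\<^bsub>FA\<^esub> c \<noteq> {}" using FA.rcos_self[OF c TR_subgroup] by blast
  fix d assume "d \<in> TR #>\<^bsub>FA\<^esub> c"
  then obtain r where r: "r \<in> TR" "d = r + c" unfolding r_coset_def by auto
  then have "r \<in> carrier FA" using subgroup.subset[OF TR_subgroup] by blast
  then have "lin (r + c) = lin r \<otimes>\<^bsub>K\<^esub> lin c" using L.hom_mult[of r c] c by simp
  then show "lin d = lin c" using r lin_TR L.hom_closed[OF c] by simp
qed

lemma tensor_lift_pure: "a \<in> carrier G \<Longrightarrow> b \<in> carrier H \<Longrightarrow> tensor_lift K f (pt a b) = f a b"
  unfolding pure_tensor_def using tensor_lift_coset lin_frag_of by simp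

lemma tensor_lift_hom: "tensor_lift K f \<in> hom T K"
proof (rule homI)
  fix x assume "x \<in> carrier T"
  then show "tensor_lift K f x \<in> carrier K" unfolding carrier_T using tensor_lift_coset L.hom_closed by auto
next
  fix x y assume "x \<in> carrier T" "y \<in> carrier T"
  then obtain c d where cd: "c \<in> carrier FA" "d \<in> carrier FA" and xy: "x = TR #>\<^bsub>FA\<^esub> c" "y = TR #>\<^bsub>FA\<^esub> d"
    unfolding carrier_T by blast
  have "c + d \<in> carrier FA" using FA.m_closed[OF cd] by simp
  then show "tensor_lift K f (x \<otimes>\<^bsub>T\<^esub> y) = tensor_lift K f x \<otimes>\<^bsub>K\<^esub> tensor_lift K f y"
    unfolding xy mult_T[OF cd] using tensor_lift_coset cd L.hom_mult[OF cd] by simp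
qed

end

lemma tensor_bihomI: "comm_group G \<Longrightarrow> comm_group H \<Longrightarrow> comm_group K \<Longrightarrow> bihom G H K f \<Longrightarrow> tensor_bihom G H K f"
  by (simp add: tensor_bihom_def tensor_pair_def tensor_bihom_axioms_def)

section \<open>Coinvariants cut out by an invariant homomorphism\<close>

locale coinvariant_kernel = M: comm_group M + K: comm_group K for M (structure) and K (structure) +
  fixes A and q
  assumes q_hom: "q \<in> hom M K"
    and A_closed: "\<And>\<alpha> x. \<alpha> \<in> A \<Longrightarrow> x \<in> carrier M \<Longrightarrow> \<alpha> x \<in> carrier M"
    and q_inv: "\<And>\<alpha> x. \<alpha> \<in> A \<Longrightarrow> x \<in> carrier M \<Longrightarrow> q (\<alpha> x) = q x"
    and q_kernel: "\<And>x. x \<in> carrier M \<Longrightarrow> q x = \<one>\<^bsub>K\<^esub> \<Longrightarrow> x \<in> coinvariant_relations M A"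
begin

abbreviation "CR \<equiv> coinvariant_relations M A"
abbreviation "C \<equiv> coinvariants M A"
abbreviation "cl \<equiv> coinvariant_class M A"

sublocale Q: group_hom M K q
  using q_hom by (simp add: group_hom_def group_hom_axioms_def M.is_group K.is_group)

text \<open>Invariance of \<open>q\<close> gives one inclusion, \<open>q_kernel\<close> the other.
  From here on, equality of classes means equality of values of \<open>q\<close>, and neither the
  group nor its action has to be mentioned again.\<close>

lemma CR_eq: "CR = kernel M K q"
proof
  show "CR \<subseteq> kernel M K q"
    unfolding coinvariant_relations_def
    by (rule M.generate_subgroup_incl[OF _ Q.subgroup_kernel]) (auto simp: kernel_def A_closed q_inv)
  show "kernel M K q \<subseteq> CR" using q_kernel unfolding kernel_def by blast
qed

lemma CR_subgroup: "subgroup CR M" unfolding CR_eq by (rule Q.subgroup_kernel)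

lemma C_comm_group: "comm_group C"
  unfolding coinvariants_def by (rule M.abelian_FactGroup[OF CR_subgroup])

lemma carrier_C: "carrier C = cl ` carrier M"
  unfolding coinvariants_def coinvariant_class_def by (rule carrier_FactGroup)

lemma mult_cl: "x \<in> carrier M \<Longrightarrow> y \<in> carrier M \<Longrightarrow> cl x \<otimes>\<^bsub>C\<^esub> cl y = cl (x \<otimes>\<^bsub>M\<^esub> y)"
  unfolding coinvariants_def coinvariant_class_def mult_FactGroup by (rule M.rcos_mult[OF CR_subgroup])

lemma cl_eq_iff: "x \<in> carrier M \<Longrightarrow> y \<in> carrier M \<Longrightarrow> cl x = cl y \<longleftrightarrow> q x = q y"
  unfolding coinvariant_class_def M.rcos_eq_iff[OF CR_subgroup]
  by (simp add: CR_eq kernel_def) (metis K.inv_equality K.inv_inv K.r_inv Q.hom_closed K.inv_closed)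

lemma mem_cl: "x \<in> carrier M \<Longrightarrow> y \<in> cl x \<longleftrightarrow> y \<in> carrier M \<and> q y = q x"
proof -
  assume x: "x \<in> carrier M"
  have "y \<in> carrier M" if "y \<in> cl x"
    using that M.r_coset_subset_G[OF subgroup.subset[OF CR_subgroup] x] unfolding coinvariant_class_def by blast
  moreover have "y \<in> cl x \<longleftrightarrow> cl y = cl x" if y: "y \<in> carrier M"
  proof
    assume "y \<in> cl x"
    then show "cl y = cl x"
      unfolding coinvariant_class_def using M.repr_independence[OF _ x CR_subgroup] by simp
  next
    assume "cl y = cl x"
    then show "y \<in> cl x" unfolding coinvariant_class_def using M.rcos_self[OF y CR_subgroup] by simp
  qed
  ultimately show ?thesis using cl_eq_iff[OF _ x] by blast
qed

lemma cl_nonempty: "x \<in> carrier M \<Longrightarrow> x \<in> cl x"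
  by (simp add: mem_cl)

end

context tensor_pair begin

lemma coset_hom: "(\<lambda>c. TR #>\<^bsub>FA\<^esub> c) \<in> hom FA T"
  by (rule homI) (auto simp: carrier_T mult_T simp del: carrier_free_Abelian_group_iff)

sublocale co: group_hom FA T "\<lambda>c. TR #>\<^bsub>FA\<^esub> c"
  using coset_hom by (simp add: group_hom_def group_hom_axioms_def FA.is_group T.is_group)

lemma coset_diff:
  assumes "c \<in> carrier FA" "d \<in> carrier FA"
  shows "TR #>\<^bsub>FA\<^esub> (c - d) = (TR #>\<^bsub>FA\<^esub> c) \<otimes>\<^bsub>T\<^esub> inv\<^bsub>T\<^esub> (TR #>\<^bsub>FA\<^esub> d)"
  using co.hom_mult[OF assms(1) FA.inv_closed[OF assms(2)]] co.hom_inv[OF assms(2)] assms by (simp add: keys_minus)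

lemma FA_diff_closed: "c \<in> carrier FA \<Longrightarrow> d \<in> carrier FA \<Longrightarrow> c - d \<in> carrier FA"
  using keys_diff[of c d] by auto

text \<open>Translates the integer coefficients of the form classification, which lives in formal
  sums, into powers in the multiplicatively written tensor group.\<close>

lemma coset_frag_cmul: "c \<in> carrier FA \<Longrightarrow> TR #>\<^bsub>FA\<^esub> (frag_cmul k c) = (TR #>\<^bsub>FA\<^esub> c) [^]\<^bsub>T\<^esub> k"
  using co.hom_int_pow[of c k] by simp

lemma coset_TR: "c \<in> TR \<Longrightarrow> TR #>\<^bsub>FA\<^esub> c = \<one>\<^bsub>T\<^esub>"
  using FA.rcos_eq_iff[OF TR_subgroup, of c 0] co.hom_one subgroup.subset[OF TR_subgroup] by auto

lemma pt_coset: "pt a b = TR #>\<^bsub>FA\<^esub> frag_of (a, b)"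
  by (simp add: pure_tensor_def)

end

section \<open>Biadditive maps between tensor products\<close>

lemma bihom_compose:
  assumes f: "bihom G H K f" and p: "p \<in> hom G' G" and q: "q \<in> hom H' H"
  shows "bihom G' H' K (\<lambda>a b. f (p a) (q b))"
  unfolding bihom_def
  by (auto simp: hom_mult[OF p] hom_mult[OF q] hom_in_carrier[OF p] hom_in_carrier[OF q] bihomD[OF f])

lemma id_hom: "(\<lambda>x. x) \<in> hom G G"
  by (rule homI) simp_all

lemma bihom_hom_compose: "bihom G H K f \<Longrightarrow> h \<in> hom K K' \<Longrightarrow> bihom G H K' (\<lambda>a b. h (f a b))"
  unfolding bihom_def by (auto simp: hom_mult hom_in_carrier)

lemma hom_pointwise_mult:
  assumes K: "comm_group K" and f: "f \<in> hom G K" and g: "g \<in> hom G K"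
  shows "(\<lambda>x. f x \<otimes>\<^bsub>K\<^esub> g x) \<in> hom G K"
proof -
  interpret K: comm_group K by fact
  show ?thesis using hom_in_carrier[OF f] hom_in_carrier[OF g]
    by (intro homI) (auto simp: hom_mult[OF f] hom_mult[OF g] K.m_ac)
qed

lemma hom_int_pow_comm: "comm_group K \<Longrightarrow> (\<lambda>x. x [^]\<^bsub>K\<^esub> (k :: int)) \<in> hom K K"
  by (rule homI) (auto simp: comm_group.int_pow_distrib group.int_pow_closed comm_group.axioms(2))

text \<open>The shape of the nested \<open>tensor_lift\<close> in the products of \<open>St2\<close>
  and \<open>St2k\<close>: a map of four variables, biadditive in the first pair and in the second
  pair, induces a biadditive map of two tensors.\<close>

locale tensor_quad = P: tensor_pair G H + Q: tensor_pair G' H' + K: comm_group K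
  for G :: "('a, 'm) monoid_scheme" and H :: "('b, 'n) monoid_scheme"
    and G' :: "('a', 'm') monoid_scheme" and H' :: "('b', 'n') monoid_scheme"
    and K :: "('k, 'p) monoid_scheme" +
  fixes F :: "'a \<Rightarrow> 'b \<Rightarrow> 'a' \<Rightarrow> 'b' \<Rightarrow> 'k"
  assumes left: "c \<in> carrier G' \<Longrightarrow> d \<in> carrier H' \<Longrightarrow> bihom G H K (\<lambda>a b. F a b c d)"
    and right: "a \<in> carrier G \<Longrightarrow> b \<in> carrier H \<Longrightarrow> bihom G' H' K (F a b)"
begin

definition lift2 where "lift2 Z W = tensor_lift K (\<lambda>a b. tensor_lift K (\<lambda>c d. F a b c d) W) Z"

lemma inner:
  assumes "a \<in> carrier G" "b \<in> carrier H"
  shows "tensor_lift K (F a b) \<in> hom Q.T K"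
    and "c \<in> carrier G' \<Longrightarrow> d \<in> carrier H' \<Longrightarrow> tensor_lift K (F a b) (Q.pt c d) = F a b c d"
proof -
  interpret I: tensor_bihom G' H' K "F a b"
    by (intro tensor_bihomI right assms Q.G.comm_group_axioms Q.H.comm_group_axioms K.comm_group_axioms)
  show "tensor_lift K (F a b) \<in> hom Q.T K" by (rule I.tensor_lift_hom)
  show "c \<in> carrier G' \<Longrightarrow> d \<in> carrier H' \<Longrightarrow> tensor_lift K (F a b) (Q.pt c d) = F a b c d"
    by (rule I.tensor_lift_pure)
qed

text \<open>For a fixed tensor \<open>W\<close> both sides of each additivity law are homomorphisms
  in \<open>W\<close>, so the law has to be checked only for pure \<open>W\<close>, where it is the
  assumption \<open>left\<close>.\<close>

lemma outer_bihom:
  assumes W: "W \<in> carrier Q.T"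
  shows "bihom G H K (\<lambda>a b. tensor_lift K (F a b) W)"
  unfolding bihom_def
proof (intro conjI ballI)
  show "tensor_lift K (F a b) W \<in> carrier K" if "a \<in> carrier G" "b \<in> carrier H" for a b
    using hom_in_carrier[OF inner(1)[OF that] W] .
next
  fix a a' b assume *: "a \<in> carrier G" "a' \<in> carrier G" "b \<in> carrier H"
  show "tensor_lift K (F (a \<otimes>\<^bsub>G\<^esub> a') b) W = tensor_lift K (F a b) W \<otimes>\<^bsub>K\<^esub> tensor_lift K (F a' b) W"
  proof (rule Q.hom_eq_on_T[OF K.is_group _ _ _ W])
    show "(\<lambda>W. tensor_lift K (F a b) W \<otimes>\<^bsub>K\<^esub> tensor_lift K (F a' b) W) \<in> hom Q.T K"
      using * by (intro hom_pointwise_mult K.comm_group_axioms inner(1))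
    show "tensor_lift K (F (a \<otimes>\<^bsub>G\<^esub> a') b) \<in> hom Q.T K" using * by (intro inner(1)) auto
    show "tensor_lift K (F (a \<otimes>\<^bsub>G\<^esub> a') b) (Q.pt c d)
      = tensor_lift K (F a b) (Q.pt c d) \<otimes>\<^bsub>K\<^esub> tensor_lift K (F a' b) (Q.pt c d)"
      if "c \<in> carrier G'" "d \<in> carrier H'" for c d
      using * that bihomD(2)[OF left[OF that] *(1,3,2)] by (simp add: inner(2))
  qed
next
  fix a b b' assume *: "a \<in> carrier G" "b \<in> carrier H" "b' \<in> carrier H"
  show "tensor_lift K (F a (b \<otimes>\<^bsub>H\<^esub> b')) W = tensor_lift K (F a b) W \<otimes>\<^bsub>K\<^esub> tensor_lift K (F a b') W"
  proof (rule Q.hom_eq_on_T[OF K.is_group _ _ _ W])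
    show "(\<lambda>W. tensor_lift K (F a b) W \<otimes>\<^bsub>K\<^esub> tensor_lift K (F a b') W) \<in> hom Q.T K"
      using * by (intro hom_pointwise_mult K.comm_group_axioms inner(1))
    show "tensor_lift K (F a (b \<otimes>\<^bsub>H\<^esub> b')) \<in> hom Q.T K" using * by (intro inner(1)) auto
    show "tensor_lift K (F a (b \<otimes>\<^bsub>H\<^esub> b')) (Q.pt c d)
      = tensor_lift K (F a b) (Q.pt c d) \<otimes>\<^bsub>K\<^esub> tensor_lift K (F a b') (Q.pt c d)"
      if "c \<in> carrier G'" "d \<in> carrier H'" for c d
      using * that bihomD(3)[OF left[OF that] *] by (simp add: inner(2))
  qed
qed

lemma
  assumes W: "W \<in> carrier Q.T"
  shows lift2_hom_left: "(\<lambda>Z. lift2 Z W) \<in> hom P.T K"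
    and lift2_pure_left: "a \<in> carrier G \<Longrightarrow> b \<in> carrier H \<Longrightarrow> lift2 (P.pt a b) W = tensor_lift K (F a b) W"
proof -
  interpret O: tensor_bihom G H K "\<lambda>a b. tensor_lift K (F a b) W"
    by (intro tensor_bihomI outer_bihom W P.G.comm_group_axioms P.H.comm_group_axioms K.comm_group_axioms)
  show "(\<lambda>Z. lift2 Z W) \<in> hom P.T K" unfolding lift2_def using O.tensor_lift_hom by (simp add: eta_contract_eq)
  show "a \<in> carrier G \<Longrightarrow> b \<in> carrier H \<Longrightarrow> lift2 (P.pt a b) W = tensor_lift K (F a b) W"
    unfolding lift2_def by (rule O.tensor_lift_pure)
qed

lemma lift2_pure: "a \<in> carrier G \<Longrightarrow> b \<in> carrier H \<Longrightarrow> c \<in> carrier G' \<Longrightarrow> d \<in> carrier H' \<Longrightarrow>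
    lift2 (P.pt a b) (Q.pt c d) = F a b c d"
  by (simp add: lift2_pure_left[OF Q.pt_closed] inner(2))

lemma lift2_bihom: "bihom P.T Q.T K lift2"
  unfolding bihom_def
proof (intro conjI ballI)
  show "lift2 Z W \<in> carrier K" if "Z \<in> carrier P.T" "W \<in> carrier Q.T" for Z W
    using hom_in_carrier[OF lift2_hom_left[OF that(2)] that(1)] .
  show "lift2 (Z \<otimes>\<^bsub>P.T\<^esub> Z') W = lift2 Z W \<otimes>\<^bsub>K\<^esub> lift2 Z' W"
    if "Z \<in> carrier P.T" "Z' \<in> carrier P.T" "W \<in> carrier Q.T" for Z Z' W
    using hom_mult[OF lift2_hom_left[OF that(3)] that(1,2)] .
  fix Z W W' assume Z: "Z \<in> carrier P.T" and W: "W \<in> carrier Q.T" "W' \<in> carrier Q.T"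
  have WW: "W \<otimes>\<^bsub>Q.T\<^esub> W' \<in> carrier Q.T" using W by (rule Q.T.m_closed)
  show "lift2 Z (W \<otimes>\<^bsub>Q.T\<^esub> W') = lift2 Z W \<otimes>\<^bsub>K\<^esub> lift2 Z W'"
  proof (rule P.hom_eq_on_T[OF K.is_group _ _ _ Z])
    show "(\<lambda>Z. lift2 Z W \<otimes>\<^bsub>K\<^esub> lift2 Z W') \<in> hom P.T K"
      by (intro hom_pointwise_mult K.comm_group_axioms lift2_hom_left W)
    show "(\<lambda>Z. lift2 Z (W \<otimes>\<^bsub>Q.T\<^esub> W')) \<in> hom P.T K" by (rule lift2_hom_left[OF WW])
    show "lift2 (P.pt a b) (W \<otimes>\<^bsub>Q.T\<^esub> W') = lift2 (P.pt a b) W \<otimes>\<^bsub>K\<^esub> lift2 (P.pt a b) W'"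
      if "a \<in> carrier G" "b \<in> carrier H" for a b
      using that hom_mult[OF inner(1)[OF that] W] by (simp add: lift2_pure_left W WW)
  qed
qed

end

lemma the_elem_Collect: "P x \<Longrightarrow> (\<And>x. P x \<Longrightarrow> f x = c) \<Longrightarrow> the_elem {f x | x. P x} = c"
  unfolding setcompr_eq_image by (rule the_elem_const) auto

lemma the_elem_Collect2: "P x y \<Longrightarrow> (\<And>x y. P x y \<Longrightarrow> f x y = c) \<Longrightarrow> the_elem {f x y | x y. P x y} = c"
proof -
  assume *: "P x y" "\<And>x y. P x y \<Longrightarrow> f x y = c"
  have "{f x y | x y. P x y} = case_prod f ` {p. case_prod P p}" by auto
  moreover have "the_elem (case_prod f ` {p. case_prod P p}) = c"
    using * by (intro the_elem_const) auto
  ultimately show ?thesis by simp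
qed

context coinvariant_kernel
begin

lemma val_cl: "x \<in> carrier M \<Longrightarrow> the_elem (q ` cl x) = q x"
  using cl_nonempty by (intro the_elem_const) (auto simp: mem_cl)

lemma val_hom: "(\<lambda>Z. the_elem (q ` Z)) \<in> hom C K"
proof (rule homI)
  fix X assume "X \<in> carrier C"
  then show "the_elem (q ` X) \<in> carrier K" by (auto simp: carrier_C val_cl)
next
  fix X Y assume "X \<in> carrier C" "Y \<in> carrier C"
  then obtain x y where "x \<in> carrier M" "X = cl x" "y \<in> carrier M" "Y = cl y" by (auto simp: carrier_C)
  then show "the_elem (q ` (X \<otimes>\<^bsub>C\<^esub> Y)) = the_elem (q ` X) \<otimes>\<^bsub>K\<^esub> the_elem (q ` Y)"
    by (simp add: mult_cl val_cl)
qed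

lemma val_eqI:
  assumes "X \<in> carrier C" "Y \<in> carrier C" "the_elem (q ` X) = the_elem (q ` Y)"
  shows "X = Y"
proof -
  obtain x y where "x \<in> carrier M" "X = cl x" "y \<in> carrier M" "Y = cl y" using assms(1,2) by (auto simp: carrier_C)
  then show ?thesis using assms(3) by (simp add: val_cl cl_eq_iff)
qed

end

section \<open>Invariant forms on the Steinberg module of a vector space\<close>

text \<open>Chains are finitely supported functions on an infinite type of flags. Summing over the
  support makes the sum over a predicate meaningful without naming a finite index set.\<close>

definition gsum :: "('a \<Rightarrow> 'b::comm_monoid_add) \<Rightarrow> ('a \<Rightarrow> bool) \<Rightarrow> 'b" where
  "gsum f P = sum f {x. f x \<noteq> 0 \<and> P x}"

lemma gsum_superset:
  assumes "finite A" "\<And>x. f x \<noteq> 0 \<Longrightarrow> P x \<Longrightarrow> x \<in> A"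
  shows "gsum f P = (\<Sum>x\<in>A. if P x then f x else 0)"
proof -
  have "gsum f P = sum f {x \<in> A. P x}"
    unfolding gsum_def by (rule sum.mono_neutral_left) (use assms in auto)
  then show ?thesis using assms by (simp add: sum.If_cases Int_def conj_commute)
qed

lemma gsum_cong: "(\<And>x. P x = Q x) \<Longrightarrow> (\<And>x. P x \<Longrightarrow> f x = g x) \<Longrightarrow> gsum f P = gsum g Q"
  unfolding gsum_def by (rule sum.cong) auto

lemma gsum_eq_0: "(\<And>x. P x \<Longrightarrow> f x = 0) \<Longrightarrow> gsum f P = 0"
  unfolding gsum_def by (auto intro: sum.neutral)

lemma gsum_add:
  assumes "finite {x. f x \<noteq> 0}" "finite {x. g x \<noteq> 0}"
  shows "gsum (\<lambda>x. f x + g x) P = gsum f P + gsum g P"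
proof -
  let ?A = "{x. f x \<noteq> 0} \<union> {x. g x \<noteq> 0}"
  have fin: "finite ?A" using assms by simp
  show ?thesis
    by (subst (1 2 3) gsum_superset[OF fin]) (auto simp: sum.distrib[symmetric] intro: sum.cong)
qed

lemma gsum_diff:
  fixes f :: "'a \<Rightarrow> 'b::ab_group_add"
  assumes "finite {x. f x \<noteq> 0}" "finite {x. g x \<noteq> 0}"
  shows "gsum (\<lambda>x. f x - g x) P = gsum f P - gsum g P"
proof -
  let ?A = "{x. f x \<noteq> 0} \<union> {x. g x \<noteq> 0}"
  have fin: "finite ?A" using assms by simp
  show ?thesis
    by (subst (1 2 3) gsum_superset[OF fin]) (auto simp: sum_subtractf[symmetric] intro: sum.cong)
qed

text \<open>The two maps need to be mutually inverse on the supports only; elsewhere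
  \<open>i\<close> and \<open>j\<close> may be arbitrary.\<close>

lemma gsum_reindex:
  assumes "\<And>x. f x \<noteq> 0 \<Longrightarrow> P x \<Longrightarrow> Q (i x) \<and> g (i x) = f x \<and> j (i x) = x"
    and "\<And>y. g y \<noteq> 0 \<Longrightarrow> Q y \<Longrightarrow> P (j y) \<and> f (j y) = g y \<and> i (j y) = y"
  shows "gsum f P = gsum g Q"
  unfolding gsum_def
  by (rule sum.reindex_bij_witness[where i = j and j = i]) (use assms in auto)

text \<open>
  A complete flag of an \<open>n\<close>-dimensional space is stored as a function on all natural numbers that is
  constant from \<open>n\<close> on, including the terms \<open>0\<close> and \<open>V\<close>.
\<close>

type_synonym 'v fullflag = "nat \<Rightarrow> 'v set"
type_synonym 'v fchain = "'v fullflag \<Rightarrow> int"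

section \<open>Covering pairs of subspaces and complete flags\<close>

locale vspace = vector_space scale for scale :: "'f::field \<Rightarrow> 'b::ab_group_add \<Rightarrow> 'b"
begin

text \<open>An increase of the dimension by one, expressed by a vector so that no dimension theory
  is involved and infinite-dimensional ambient spaces cause no trouble.\<close>

definition covers :: "'b set \<Rightarrow> 'b set \<Rightarrow> bool" where
  "covers X Y \<longleftrightarrow> subspace X \<and> (\<exists>v. v \<notin> X \<and> Y = span (insert v X))"

lemma covers_subspace: "covers X Y \<Longrightarrow> subspace X" "covers X Y \<Longrightarrow> subspace Y"
  unfolding covers_def by auto

lemma span_subspace_eq: "subspace X \<Longrightarrow> span X = X"
  by (simp add: span_eq_iff)

lemma span_insert_mem:
  "subspace X \<Longrightarrow> x \<in> span (insert v X) \<longleftrightarrow> (\<exists>k. x - scale k v \<in> X)"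
  by (simp add: span_breakdown_eq span_subspace_eq)

lemma covers_psubset: "covers X Y \<Longrightarrow> X \<subset> Y"
  unfolding covers_def by (metis insert_subset psubsetI span_superset)

lemma covers_subset: "covers X Y \<Longrightarrow> X \<subseteq> Y"
  using covers_psubset by blast

lemma covers_span: "subspace X \<Longrightarrow> v \<notin> X \<Longrightarrow> covers X (span (insert v X))"
  unfolding covers_def by blast

text \<open>The exchange property: the new vector may be replaced by any vector of \<open>Y\<close>
  outside \<open>X\<close>.\<close>

lemma covers_eq_span:
  assumes "covers X Y" "w \<in> Y" "w \<notin> X"
  shows "Y = span (insert w X)"
proof -
  obtain v where v: "subspace X" "v \<notin> X" "Y = span (insert v X)"
    using assms(1) unfolding covers_def by blast
  have "v \<in> span (insert w X)"
    using in_span_insert[of w v X] assms v by (simp add: span_subspace_eq)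
  then have "Y \<subseteq> span (insert w X)"
    unfolding v by (intro span_minimal) (auto intro: span_base)
  moreover have "span (insert w X) \<subseteq> Y"
    by (intro span_minimal) (use assms v covers_subset covers_subspace in auto)
  ultimately show ?thesis by blast
qed

lemma covers_between:
  assumes "covers X Y" "subspace Z" "X \<subseteq> Z" "Z \<subseteq> Y"
  shows "Z = X \<or> Z = Y"
proof (rule ccontr)
  assume a: "\<not> ?thesis"
  then obtain w where "w \<in> Z" "w \<notin> X" using assms by blast
  then have "Y = span (insert w X)" using assms by (intro covers_eq_span) auto
  also have "\<dots> \<subseteq> Z" using assms \<open>w \<in> Z\<close> by (intro span_minimal) auto
  finally show False using a assms by blast
qed

text \<open>\<open>B \<inter> H\<close> lies between \<open>A\<close> and \<open>B\<close> and
  differs from \<open>B\<close>, so it can only be \<open>A\<close>.\<close>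

lemma hyperplane_inter_eq:
  assumes "covers A B" "A \<subseteq> H" "\<not> B \<subseteq> H" "subspace H"
  shows "B \<inter> H = A"
  using covers_between[OF assms(1), of "B \<inter> H"] assms covers_subset covers_subspace subspace_inter
  by (metis Int_subset_iff inf.absorb_iff2 inf_commute inf_le1)

text \<open>A vector of \<open>B\<close> outside \<open>A\<close> is moved into \<open>H\<close> by
  subtracting a multiple of a vector of \<open>A\<close> that lies outside \<open>H\<close>. The
  result is still outside \<open>A\<close>, and it generates \<open>B \<inter> H\<close> over
  \<open>A \<inter> H\<close>.\<close>

lemma hyperplane_inter_covers:
  assumes V: "covers H V" and AB: "covers A B" "B \<subseteq> V" "\<not> A \<subseteq> H"
  shows "covers (A \<inter> H) (B \<inter> H)"
proof -
  obtain a where a: "a \<in> A" "a \<notin> H" using AB by blast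
  obtain w where w: "w \<in> B" "w \<notin> A" using covers_psubset[OF AB(1)] by blast
  have sH: "subspace H" "subspace A" "subspace B" using V AB covers_subspace by auto
  have "a \<in> V" "w \<in> V" using a w AB covers_subset by auto
  then have "w \<in> span (insert a H)" using covers_eq_span[OF V _ a(2)] by simp
  then obtain c where c: "w - scale c a \<in> H" using span_insert_mem sH by blast
  define h where "h = w - scale c a"
  have aB: "a \<in> B" using a AB covers_subset by blast
  have hB: "h \<in> B" "h \<in> H" unfolding h_def using c w aB sH
    by (auto intro: subspace_diff subspace_scale)
  have "w = h + scale c a" unfolding h_def by simp
  then have hA: "h \<notin> A" using w a sH by (metis subspace_add subspace_scale)
  have Beq: "B = span (insert h A)" using covers_eq_span[OF AB(1) hB(1) hA] .
  have "B \<inter> H = span (insert h (A \<inter> H))"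
  proof
    show "B \<inter> H \<subseteq> span (insert h (A \<inter> H))"
    proof
      fix x assume x: "x \<in> B \<inter> H"
      then obtain k where "x - scale k h \<in> A" using Beq span_insert_mem sH by blast
      moreover have "x - scale k h \<in> H" using x hB sH by (auto intro: subspace_diff subspace_scale)
      ultimately show "x \<in> span (insert h (A \<inter> H))"
        using span_insert_mem[OF subspace_inter[OF sH(2,1)]] by blast
    qed
    show "span (insert h (A \<inter> H)) \<subseteq> B \<inter> H"
      by (intro span_minimal) (use hB sH AB(1) covers_subset subspace_inter in auto)
  qed
  then show ?thesis unfolding covers_def using hA subspace_inter sH by auto
qed

text \<open>The modular law for a line that meets \<open>H\<close> trivially.\<close>

lemma span_insert_inter:
  assumes "subspace H" "subspace Y" "Y \<subseteq> H" "a \<notin> H"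
  shows "span (insert a Y) \<inter> H = Y"
proof
  show "span (insert a Y) \<inter> H \<subseteq> Y"
  proof
    fix x assume x: "x \<in> span (insert a Y) \<inter> H"
    then obtain k where k: "x - scale k a \<in> Y" using span_insert_mem assms by blast
    then have "x - (x - scale k a) \<in> H" using x assms subspace_diff by blast
    then have "scale k a \<in> H" by simp
    then have "k = 0" using assms subspace_scale[of H "scale k a" "inverse k"] by (cases "k = 0") auto
    then show "x \<in> Y" using k by simp
  qed
  show "Y \<subseteq> span (insert a Y) \<inter> H" using assms span_superset by blast
qed

lemma covers_insert_lift:
  assumes "covers A B" "B \<subseteq> H" "subspace H" "v \<notin> H"
  shows "covers (span (insert v A)) (span (insert v B))" "covers A (span (insert v A))"
proof -
  obtain w where w: "w \<in> B" "w \<notin> A" using covers_psubset[OF assms(1)] by blast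
  have B: "B = span (insert w A)" using covers_eq_span[OF assms(1) w] .
  have s: "subspace A" "subspace B" using assms covers_subspace by auto
  show "covers A (span (insert v A))" using s assms covers_subset by (intro covers_span) auto
  have AH: "A \<subseteq> H" using assms covers_subset by blast
  have "w \<notin> span (insert v A)" using span_insert_inter[OF assms(3) s(1) AH assms(4)] w assms by blast
  moreover have "span (insert v B) = span (insert w (span (insert v A)))"
  proof
    show "span (insert v B) \<subseteq> span (insert w (span (insert v A)))"
      unfolding B
    proof (intro span_minimal, clarsimp, intro conjI)
      show "v \<in> span (insert w (span (insert v A)))" by (intro span_base) (auto intro: span_base)
      show "span (insert w A) \<subseteq> span (insert w (span (insert v A)))"
        by (intro span_mono) (use span_superset in blast)
    qed auto
    show "span (insert w (span (insert v A))) \<subseteq> span (insert v B)"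
    proof (intro span_minimal, clarsimp, intro conjI)
      show "w \<in> span (insert v B)" using w by (auto intro: span_base)
      show "span (insert v A) \<subseteq> span (insert v B)"
        by (intro span_mono) (use assms covers_subset in blast)
    qed auto
  qed
  ultimately show "covers (span (insert v A)) (span (insert v B))" unfolding covers_def by auto
qed

definition flags :: "nat \<Rightarrow> 'b set \<Rightarrow> 'b fullflag set" where
  "flags n V = {F. F 0 = {0} \<and> (\<forall>i<n. covers (F i) (F (Suc i))) \<and> (\<forall>i\<ge>n. F i = V)}"

lemma flagsD:
  assumes "F \<in> flags n V"
  shows "F 0 = {0}" "i < n \<Longrightarrow> covers (F i) (F (Suc i))" "n \<le> i \<Longrightarrow> F i = V"
  using assms unfolding flags_def by auto

lemma flags_subspace: assumes "F \<in> flags n V" shows "subspace (F i)"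
proof (cases "i < n")
  case True
  then show ?thesis using flagsD(2)[OF assms] covers_subspace by blast
next
  case False
  then have i: "F i = V" using flagsD(3)[OF assms] by simp
  show ?thesis
  proof (cases n)
    case 0
    then have "V = {0}" using flagsD(1,3)[OF assms] by (metis le0)
    then show ?thesis using i by (simp add: subspace_0)
  next
    case (Suc m)
    then show ?thesis using flagsD(2)[OF assms, of m] flagsD(3)[OF assms, of n] i covers_subspace by auto
  qed
qed

lemma flags_mono: assumes "F \<in> flags n V" "i \<le> j" shows "F i \<subseteq> F j"
proof -
  have "F i \<subseteq> F (Suc i)" for i
    using flagsD[OF assms(1)] covers_subset
    by (cases "i < n") (metis, metis leD le_SucI not_less order_refl)
  then show ?thesis using lift_Suc_mono_le[of F] assms(2) by blast
qed

lemma flags_le: assumes "F \<in> flags n V" shows "F i \<subseteq> V"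
proof -
  have "F i \<subseteq> F (max i n)" using flags_mono[OF assms] by simp
  then show ?thesis using flagsD(3)[OF assms, of "max i n"] by simp
qed

lemma flags_V_subspace: "F \<in> flags n V \<Longrightarrow> subspace V"
  using flags_subspace[of F n V n] flagsD(3)[of F n V n] by simp

text \<open>
  For a hyperplane \<open>H\<close>, a flag \<open>F\<close> of \<open>V\<close> amounts to a flag of \<open>H\<close>, the level at which \<open>F\<close> leaves \<open>H\<close>,
  and a vector outside \<open>H\<close> in the term at that level.
\<close>

definition lv :: "'b set \<Rightarrow> 'b fullflag \<Rightarrow> nat" where
  "lv H F = (LEAST i. \<not> F i \<subseteq> H)"

definition res :: "'b set \<Rightarrow> 'b fullflag \<Rightarrow> 'b fullflag" where
  "res H F = (\<lambda>i. if i < lv H F then F i else F (Suc i) \<inter> H)"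

definition ins :: "'b \<Rightarrow> 'b fullflag \<Rightarrow> nat \<Rightarrow> 'b fullflag" where
  "ins v E k = (\<lambda>i. if i < k then E i else span (insert v (E (i - 1))))"

lemma lv_eqI:
  assumes "F \<in> flags n V" "\<not> F k \<subseteq> H" "F (k - 1) \<subseteq> H" "0 < k"
  shows "lv H F = k"
  unfolding lv_def
proof (rule Least_equality)
  fix y assume "\<not> F y \<subseteq> H"
  then have "\<not> y \<le> k - 1" using flags_mono[OF assms(1), of y "k-1"] assms by blast
  then show "k \<le> y" using assms by linarith
qed (fact assms)

lemma lv_props:
  assumes F: "F \<in> flags n V" and H: "covers H V"
  shows "0 < lv H F" "lv H F \<le> n" "F i \<subseteq> H \<longleftrightarrow> i < lv H F"
proof -
  have V: "\<not> F n \<subseteq> H" using flagsD(3)[OF F] covers_psubset[OF H] by auto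
  have 1: "\<not> F (lv H F) \<subseteq> H" unfolding lv_def by (rule LeastI[of _ n]) (fact V)
  have 2: "F i \<subseteq> H" if "i < lv H F" for i using not_less_Least that unfolding lv_def by blast
  have "0 \<in> H" using covers_subspace[OF H] subspace_0 by blast
  then show "0 < lv H F" using 1 flagsD(1)[OF F] by (cases "lv H F") auto
  show "lv H F \<le> n" unfolding lv_def by (rule Least_le) (fact V)
  show "F i \<subseteq> H \<longleftrightarrow> i < lv H F" using 1 2 flags_mono[OF F, of "lv H F" i] by (meson not_less order_trans)
qed

text \<open>Intersecting with \<open>H\<close> lowers the dimension exactly from the level
  \<open>k\<close> of leaving \<open>H\<close> on. There \<open>F k \<inter> H = F (k - 1)\<close>,
  so omitting this repeated term joins the two branches of \<open>res\<close> without a gap.\<close>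

lemma res_flags:
  assumes F: "F \<in> flags (Suc n) V" and H: "covers H V"
  shows "res H F \<in> flags n H"
proof -
  note lv = lv_props[OF F H]
  let ?k = "lv H F"
  have sH: "subspace H" using H covers_subspace by blast
  show ?thesis unfolding flags_def
  proof (intro CollectI conjI allI impI)
    show "res H F 0 = {0}" using lv flagsD(1)[OF F] by (simp add: res_def)
  next
    fix i assume i: "i < n"
    consider "Suc i < ?k" | "Suc i = ?k" | "?k \<le> i" by linarith
    then show "covers (res H F i) (res H F (Suc i))"
    proof cases
      case 1
      then show ?thesis using flagsD(2)[OF F, of i] i by (simp add: res_def)
    next
      case 2
      have "F (Suc i) \<inter> H = F i"
        using flagsD(2)[OF F, of i] i lv 2 sH by (intro hyperplane_inter_eq) auto
      moreover have "covers (F (Suc i) \<inter> H) (F (Suc (Suc i)) \<inter> H)"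
        using flagsD(2)[OF F, of "Suc i"] i lv 2 flags_le[OF F] by (intro hyperplane_inter_covers[OF H]) auto
      ultimately show ?thesis using 2 by (simp add: res_def)
    next
      case 3
      then show ?thesis using flagsD(2)[OF F, of "Suc i"] i lv flags_le[OF F]
        by (auto simp: res_def intro!: hyperplane_inter_covers[OF H])
    qed
  next
    fix i assume i: "n \<le> i"
    have HV: "H \<subseteq> V" using H covers_subset by blast
    show "res H F i = H"
    \<comment> \<open>If the first branch of \<open>res\<close> still applies at index
      \<open>n\<close>, then the flag leaves \<open>H\<close> only at the very last step, and its
      term \<open>n\<close> is already \<open>H\<close>.\<close>
    proof (cases "i < ?k")
      case True
      then have "i = n" "?k = Suc n" using i lv by auto
      then have "F (Suc n) \<inter> H = F n"
        using flagsD(2)[OF F, of n] lv sH by (intro hyperplane_inter_eq) auto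
      then show ?thesis using flagsD(3)[OF F, of "Suc n"] HV True \<open>i = n\<close> by (auto simp: res_def)
    next
      case False
      then show ?thesis using i flagsD(3)[OF F, of "Suc i"] HV by (auto simp: res_def)
    qed
  qed
qed

lemma ins_flags:
  assumes E: "E \<in> flags n H" and v: "v \<notin> H" and k: "0 < k" "k \<le> Suc n"
  shows "ins v E k \<in> flags (Suc n) (span (insert v H))"
proof -
  have sH: "subspace H" using flags_V_subspace[OF E] .
  show ?thesis unfolding flags_def
  proof (intro CollectI conjI allI impI)
    show "ins v E k 0 = {0}" using k flagsD(1)[OF E] by (simp add: ins_def)
  next
    fix i assume i: "i < Suc n"
    consider "Suc i < k" | "Suc i = k" | "k \<le> i" by linarith
    then show "covers (ins v E k i) (ins v E k (Suc i))"
    proof cases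
      case 1
      then show ?thesis using flagsD(2)[OF E, of i] i k by (simp add: ins_def)
    next
      case 2
      have "v \<notin> E i" using v flags_le[OF E] by blast
      then have "covers (E i) (span (insert v (E i)))" using flags_subspace[OF E, of i] by (intro covers_span)
      then show ?thesis unfolding ins_def using 2 by auto
    next
      case 3
      then obtain i' where i': "i = Suc i'" using k by (cases i) auto
      then show ?thesis using 3 flagsD(2)[OF E, of i'] i flags_le[OF E]
        by (auto simp: ins_def intro!: covers_insert_lift(1)[OF _ _ sH v])
    qed
  next
    fix i assume "Suc n \<le> i"
    then show "ins v E k i = span (insert v H)" using k flagsD(3)[OF E] by (auto simp: ins_def)
  qed
qed

lemma
  assumes E: "E \<in> flags n H" and v: "v \<notin> H" and k: "0 < k" "k \<le> Suc n"
  shows lv_ins: "lv H (ins v E k) = k" and res_ins: "res H (ins v E k) = E"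
    and mem_ins: "v \<in> ins v E k k"
proof -
  have sH: "subspace H" using flags_V_subspace[OF E] .
  show m: "v \<in> ins v E k k" by (auto simp: ins_def intro: span_base)
  show l: "lv H (ins v E k) = k"
    by (rule lv_eqI[OF ins_flags[OF E v k]]) (use m v flags_le[OF E] k in \<open>auto simp: ins_def\<close>)
  show "res H (ins v E k) = E"
    unfolding res_def l using k span_insert_inter[OF sH flags_subspace[OF E] flags_le[OF E] v]
    by (auto simp: ins_def fun_eq_iff)
qed

text \<open>From its level on the flag contains \<open>v\<close>, so each such term is spanned by
  \<open>v\<close> and its intersection with \<open>H\<close>; below the level nothing was
  changed.\<close>

lemma ins_res:
  assumes F: "F \<in> flags (Suc n) V" and H: "covers H V" and v: "v \<in> F (lv H F)" "v \<notin> H"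
  shows "ins v (res H F) (lv H F) = F"
proof
  fix i
  note lv = lv_props[OF F H]
  show "ins v (res H F) (lv H F) i = F i"
  proof (cases "i < lv H F")
    case True
    then show ?thesis by (simp add: ins_def res_def)
  next
    case False
    then obtain i' where i': "i = Suc i'" using lv by (cases i) auto
    have vi: "v \<in> F i" using v flags_mono[OF F, of "lv H F" i] False by auto
    have "res H F i' = F i \<inter> H"
    proof (cases "i' < lv H F")
      case True
      then have i'': "lv H F = i" using False i' by simp
      then have "F i \<inter> H = F i'"
        using flagsD(2)[OF F, of i'] lv i' covers_subspace[OF H] by (intro hyperplane_inter_eq) auto
      then show ?thesis using True by (simp add: res_def)
    next
      case f: False
      then show ?thesis by (simp add: res_def i')
    qed
    moreover have "span (insert v (F i \<inter> H)) = F i"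
    proof
      show "span (insert v (F i \<inter> H)) \<subseteq> F i"
        using vi flags_subspace[OF F] by (intro span_minimal) auto
      show "F i \<subseteq> span (insert v (F i \<inter> H))"
      proof
        fix x assume x: "x \<in> F i"
        have "V = span (insert v H)" using covers_eq_span[OF H] v flags_le[OF F] by blast
        then obtain c where c: "x - scale c v \<in> H"
          using x flags_le[OF F] span_insert_mem covers_subspace(1)[OF H] by blast
        have "x - scale c v \<in> F i" using x vi flags_subspace[OF F] by (auto intro: subspace_diff subspace_scale)
        then show "x \<in> span (insert v (F i \<inter> H))"
          using c span_insert_mem subspace_inter flags_subspace[OF F] covers_subspace(1)[OF H] by blast
      qed
    qed
    ultimately show ?thesis using False i' by (simp add: ins_def)
  qed
qed

end

lemma gsum_cmult:
  fixes f :: "'a \<Rightarrow> int"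
  shows "gsum (\<lambda>x. c * f x) P = c * gsum f P"
proof (cases "c = 0")
  case False
  then show ?thesis unfolding gsum_def by (simp add: sum_distrib_left)
qed (simp add: gsum_def)

section \<open>Top-dimensional cycles and the product with a line\<close>

context vspace begin

text \<open>The flags that share with \<open>F\<close> the face omitting its term \<open>i\<close>,
  including \<open>F\<close> itself.\<close>

definition adj :: "nat \<Rightarrow> 'b fullflag \<Rightarrow> 'b fullflag \<Rightarrow> bool" where
  "adj i F G \<longleftrightarrow> (\<forall>p. p \<noteq> i \<longrightarrow> G p = F p)"

text \<open>The top-dimensional cycles. Faces that omit different levels are different simplices, so
  the boundary vanishes level by level and its alternating signs drop out. In degree 0, where the
  induction on \<open>n\<close> starts, only finiteness and the support condition remain.\<close>

definition St :: "nat \<Rightarrow> 'b set \<Rightarrow> 'b fchain set" where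
  "St n V = {c. finite {F. c F \<noteq> 0} \<and> (\<forall>F. c F \<noteq> 0 \<longrightarrow> F \<in> flags n V) \<and>
     (\<forall>F\<in>flags n V. \<forall>i. 0 < i \<longrightarrow> i < n \<longrightarrow> gsum c (adj i F) = 0)}"

lemma St_finite: "c \<in> St n V \<Longrightarrow> finite {F. c F \<noteq> 0}"
  and St_flags: "c \<in> St n V \<Longrightarrow> c F \<noteq> 0 \<Longrightarrow> F \<in> flags n V"
  and St_cycle: "c \<in> St n V \<Longrightarrow> F \<in> flags n V \<Longrightarrow> 0 < i \<Longrightarrow> i < n \<Longrightarrow> gsum c (adj i F) = 0"
  unfolding St_def by auto

lemma St_add: assumes "a \<in> St n V" "b \<in> St n V" shows "a + b \<in> St n V"
proof -
  have "finite {F. (a + b) F \<noteq> 0}"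
    by (rule finite_subset[OF _ finite_UnI[OF St_finite[OF assms(1)] St_finite[OF assms(2)]]]) auto
  moreover have "F \<in> flags n V" if "(a + b) F \<noteq> 0" for F
    using that St_flags[OF assms(1), of F] St_flags[OF assms(2), of F] by (cases "a F = 0") auto
  ultimately show ?thesis
    using gsum_add[OF St_finite[OF assms(1)] St_finite[OF assms(2)]] St_cycle[OF assms(1)] St_cycle[OF assms(2)]
    unfolding St_def plus_fun_def by simp
qed

lemma St_diff: assumes "a \<in> St n V" "b \<in> St n V" shows "a - b \<in> St n V"
proof -
  have "finite {F. (a - b) F \<noteq> 0}"
    by (rule finite_subset[OF _ finite_UnI[OF St_finite[OF assms(1)] St_finite[OF assms(2)]]]) auto
  moreover have "F \<in> flags n V" if "(a - b) F \<noteq> 0" for F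
    using that St_flags[OF assms(1), of F] St_flags[OF assms(2), of F] by (cases "a F = 0") auto
  ultimately show ?thesis
    using gsum_diff[OF St_finite[OF assms(1)] St_finite[OF assms(2)]] St_cycle[OF assms(1)] St_cycle[OF assms(2)]
    unfolding St_def fun_diff_def by simp
qed

lemma St_zero: "0 \<in> St n V"
  unfolding St_def by (auto simp: gsum_def)

text \<open>
  The product of the class of the line of \<open>v\<close> with \<open>b \<in> St(H)\<close> in \<open>St(V)\<close>, where \<open>V\<close> is the direct sum of
  that line and \<open>H\<close>: a shuffle is determined by the level at which \<open>v\<close> enters.
\<close>

definition join :: "nat \<Rightarrow> 'b set \<Rightarrow> 'b \<Rightarrow> 'b set \<Rightarrow> 'b fchain \<Rightarrow> 'b fchain" where
  "join n V v H b = (\<lambda>F. if F \<in> flags (Suc n) V \<and> v \<in> F (lv H F)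
     then (-1) ^ lv H F * b (res H F) else 0)"

lemma join_add: "join n V v H (a + b) = join n V v H a + join n V v H b"
  by (auto simp: join_def fun_eq_iff algebra_simps)

lemma join_nonzero:
  assumes v: "v \<notin> H" "covers H V" and c: "join n V v H b F \<noteq> 0"
  shows "F \<in> flags (Suc n) V" "res H F \<in> flags n H" "b (res H F) \<noteq> 0"
    "0 < lv H F" "lv H F \<le> Suc n" "F = ins v (res H F) (lv H F)"
    "join n V v H b F = (-1) ^ lv H F * b (res H F)"
proof -
  show F: "F \<in> flags (Suc n) V" using c by (auto simp: join_def split: if_splits)
  show "0 < lv H F" "lv H F \<le> Suc n" using lv_props[OF F v(2)] by auto
  show "res H F \<in> flags n H" by (rule res_flags[OF F v(2)])
  show "b (res H F) \<noteq> 0" "join n V v H b F = (-1) ^ lv H F * b (res H F)"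
    using c by (auto simp: join_def split: if_splits)
  show "F = ins v (res H F) (lv H F)"
    using ins_res[OF F v(2) _ v(1)] c by (auto simp: join_def split: if_splits)
qed

lemma join_ins:
  assumes "v \<notin> H" "E \<in> flags n H" "0 < k" "k \<le> Suc n" "V = span (insert v H)"
  shows "join n V v H b (ins v E k) = (-1) ^ k * b E"
  using ins_flags[OF assms(2,1,3,4)] lv_ins[OF assms(2,1,3,4)] res_ins[OF assms(2,1,3,4)]
    mem_ins[OF assms(2,1,3,4)] assms(5) by (simp add: join_def)

lemma adj_ins_Suc: "adj k (ins v E k) (ins v E (Suc k))" if "0 < k"
  using that by (auto simp: adj_def ins_def less_Suc_eq)

lemma adj_cong: "adj i F G \<Longrightarrow> adj i F = adj i G"
  by (auto simp: adj_def fun_eq_iff)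

text \<open>Terms of \<open>E\<close> from \<open>k\<close> on move up by one under the insertion.
  Away from the two indices \<open>k - 1\<close> and \<open>k\<close> a change of one term of
  \<open>E\<close> thus remains a change of one term.\<close>

lemma adj_ins:
  assumes k: "0 < k" and i: "i \<noteq> k" "Suc i \<noteq> k" and a: "adj (if i < k then i else i - 1) E E'"
  shows "adj i (ins v E k) (ins v E' k)"
  unfolding adj_def ins_def
proof (intro allI impI)
  fix p assume p: "p \<noteq> i"
  show "(if p < k then E' p else span (insert v (E' (p - 1)))) = (if p < k then E p else span (insert v (E (p - 1))))"
  proof (cases "p < k")
    case True
    then have "p \<noteq> (if i < k then i else i - 1)" using p i k by auto
    then show ?thesis using a True by (simp add: adj_def)
  next
    case False
    then have "p - 1 \<noteq> (if i < k then i else i - 1)" using p i k by auto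
    then show ?thesis using a False by (simp add: adj_def)
  qed
qed

text \<open>The terms \<open>k - 1\<close> and \<open>k\<close> are untouched by the adjacency, so
  the other flag leaves \<open>H\<close> at the same level and through the same vector
  \<open>v\<close>; hence it is an insertion of \<open>v\<close> as well.\<close>

lemma adj_ins_res:
  assumes V: "V = span (insert v H)" "v \<notin> H" and E: "E \<in> flags n H" and k: "0 < k" "k \<le> Suc n"
    and G: "G \<in> flags (Suc n) V" and i: "i \<noteq> k" "Suc i \<noteq> k" and a: "adj i (ins v E k) G"
  shows "adj (if i < k then i else i - 1) E (res H G)" "lv H G = k" "ins v (res H G) k = G"
proof -
  let ?F = "ins v E k"
  have H: "covers H V" using V covers_span[OF flags_V_subspace[OF E] V(2)] by simp
  note F = ins_flags[OF E V(2) k, folded V(1)] and lF = lv_ins[OF E V(2) k] and mF = mem_ins[OF E V(2) k]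
  have "\<not> ?F k \<subseteq> H" "?F (k - 1) \<subseteq> H" using lv_props[OF F H] lF k by auto
  moreover have Gk: "G k = ?F k" "G (k - 1) = ?F (k - 1)" using a i k by (auto simp: adj_def)
  ultimately show l: "lv H G = k" using k by (intro lv_eqI[OF G]) auto
  then show "ins v (res H G) k = G" using ins_res[OF G H _ V(2)] Gk mF by simp
  have "adj (if i < k then i else i - 1) (res H ?F) (res H G)"
    using a i unfolding adj_def res_def l lF by auto
  then show "adj (if i < k then i else i - 1) E (res H G)" using res_ins[OF E V(2) k] by simp
qed

text \<open>The only flags of this class that can carry the chain insert \<open>v\<close> into the
  same \<open>E\<close> at the adjacent levels \<open>k\<close> and \<open>k + 1\<close>. They
  cancel because the sign of \<open>join\<close> alternates with the level.\<close>

lemma join_cycle_swap: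
  assumes V: "V = span (insert v H)" "v \<notin> H" and E: "E \<in> flags n H" and k: "0 < k" "k \<le> n"
  shows "gsum (join n V v H b) (adj k (ins v E k)) = 0"
proof -
  let ?c = "join n V v H b"
  have sH: "subspace H" using flags_V_subspace[OF E] .
  have H: "covers H V" using V covers_span[OF sH V(2)] by simp
  have k': "k \<le> Suc n" "0 < Suc k" "Suc k \<le> Suc n" using k by auto
  let ?F = "ins v E k" let ?G = "ins v E (Suc k)"
  note F = ins_flags[OF E V(2) k(1) k'(1), folded V(1)]
  note lF = lv_ins[OF E V(2) k(1) k'(1)] and lG = lv_ins[OF E V(2) k'(2,3)]
  have ne: "?F \<noteq> ?G" using lF lG by (metis n_not_Suc_n)
  have "gsum ?c (adj k ?F) = (\<Sum>x\<in>{?F, ?G}. if adj k ?F x then ?c x else 0)"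
  proof (rule gsum_superset)
    fix G assume c: "?c G \<noteq> 0" and a: "adj k ?F G"
    note J = join_nonzero[OF V(2) H c]
    have 1: "G (k - 1) \<subseteq> H" using a k flags_le[OF E] by (auto simp: adj_def ins_def)
    have "v \<in> ?F (Suc k)" by (auto simp: ins_def intro: span_base)
    then have 2: "\<not> G (Suc k) \<subseteq> H" using a V by (auto simp: adj_def)
    note lvG = lv_props(3)[OF J(1) H]
    \<comment> \<open>The terms \<open>k - 1\<close> and \<open>k + 1\<close> are prescribed: the
      first lies in \<open>H\<close>, the second does not.\<close>
    have "lv H G \<le> Suc k" "k - 1 < lv H G" using 1 2 lvG by auto
    then consider "lv H G = k" | "lv H G = Suc k" by linarith
    then show "G \<in> {?F, ?G}"
    proof cases
      case 1
      have "res H G (k - 1) = E (k - 1)" using 1 a k by (simp add: res_def adj_def ins_def)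
      then have "G k = ?F k" using J(6) 1 by (simp add: ins_def fun_eq_iff)
      then have "G = ?F" using a unfolding adj_def by (intro ext) metis
      then show ?thesis by simp
    next
      case 2
      have "res H G p = E p" for p
      proof -
        have Fp: "p \<ge> k \<Longrightarrow> ?F (Suc p) \<inter> H = E p" for p
          using span_insert_inter[OF sH flags_subspace[OF E] flags_le[OF E] V(2)] by (simp add: ins_def)
        have Gk: "G (Suc k) \<inter> H = G k"
          using flagsD(2)[OF J(1), of k] k lvG[of k] lvG[of "Suc k"] 2 sH by (intro hyperplane_inter_eq) auto
        show ?thesis
          using Fp[of p] Gk a 2 by (cases "p = k") (auto simp: res_def adj_def ins_def less_Suc_eq)
      qed
      then have "res H G = E" by blast
      then show ?thesis using J(6) 2 by simp
    qed
  qed auto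
  also have "\<dots> = ?c ?F + ?c ?G"
    using ne adj_ins_Suc[OF k(1)] by (simp add: adj_def)
  also have "\<dots> = 0"
    using join_ins[OF V(2) E k(1) k'(1) V(1)] join_ins[OF V(2) E k'(2,3) V(1)] by simp
  finally show ?thesis .
qed

lemma join_St:
  assumes V: "V = span (insert v H)" "v \<notin> H" "subspace H" and b: "b \<in> St n H"
  shows "join n V v H b \<in> St (Suc n) V"
proof -
  let ?c = "join n V v H b"
  have H: "covers H V" using V covers_span by simp
  have "finite {F. ?c F \<noteq> 0}"
  proof (rule finite_subset)
    show "{F. ?c F \<noteq> 0} \<subseteq> (\<lambda>(E, k). ins v E k) ` ({E. b E \<noteq> 0} \<times> {..Suc n})"
    proof
      fix F assume "F \<in> {F. ?c F \<noteq> 0}"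
      then have c: "?c F \<noteq> 0" by simp
      have "(res H F, lv H F) \<in> {E. b E \<noteq> 0} \<times> {..Suc n}" using join_nonzero(3,5)[OF V(2) H c] by simp
      from imageI[OF this, of "\<lambda>(E, k). ins v E k"]
      show "F \<in> (\<lambda>(E, k). ins v E k) ` ({E. b E \<noteq> 0} \<times> {..Suc n})"
        using join_nonzero(6)[OF V(2) H c] by simp
    qed
    show "finite ((\<lambda>(E, k). ins v E k) ` ({E. b E \<noteq> 0} \<times> {..Suc n}))"
      using St_finite[OF b] by simp
  qed
  moreover have "gsum ?c (adj i F) = 0" if F: "F \<in> flags (Suc n) V" and i: "0 < i" "i < Suc n" for F i
  proof (cases "\<exists>G. ?c G \<noteq> 0 \<and> adj i F G")
    case False
    then show ?thesis by (intro gsum_eq_0) blast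
  next
    case True
    then obtain G where cG: "?c G \<noteq> 0" and FG: "adj i F G" by blast
    note J = join_nonzero[OF V(2) H cG]
    \<comment> \<open>A class on which the chain is not identically zero has a representative of the
      form \<open>ins v E k\<close>.\<close>
    define E where "E = res H G" define k where "k = lv H G"
    have E: "E \<in> flags n H" and k: "0 < k" "k \<le> Suc n" and G: "G = ins v E k"
      using J by (auto simp: E_def k_def)
    have "gsum ?c (adj i G) = 0"
    proof -
      \<comment> \<open>The omitted term sits just after or just before the step where
        \<open>v\<close> enters, and the two positions of \<open>v\<close> cancel; otherwise the
        class corresponds to a class of flags of \<open>H\<close>, and \<open>b\<close> is a
        cycle.\<close>
      consider "i = k" | "Suc i = k" | "i \<noteq> k" "Suc i \<noteq> k" by blast
      then show ?thesis
      proof cases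
        case 1
        then show ?thesis using join_cycle_swap[OF V(1,2) E] i G by auto
      next
        case 2
        then show ?thesis using join_cycle_swap[OF V(1,2) E, of i] i G adj_cong[OF adj_ins_Suc[OF i(1), of v E]] by simp
      next
        case 3
        define i' where "i' = (if i < k then i else i - 1)"
        have i': "0 < i'" "i' < n" using i k 3 by (auto simp: i'_def)
        have iff: "adj i' E (res H G') \<and> lv H G' = k" if "?c G' \<noteq> 0" "adj i G G'" for G'
          using adj_ins_res[OF V(1,2) E k join_nonzero(1)[OF V(2) H that(1)] 3, folded G i'_def] that(2) by blast
        have 2: "adj i G (ins v E' k)" if "adj i' E E'" for E'
          using adj_ins[OF k(1) 3, folded i'_def] that unfolding G .
        have "gsum ?c (adj i G) = gsum (\<lambda>E'. (-1) ^ k * b E') (adj i' E)"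
        proof (rule gsum_reindex[where i = "res H" and j = "\<lambda>E'. ins v E' k"])
          fix G' assume a: "?c G' \<noteq> 0" "adj i G G'"
          show "adj i' E (res H G') \<and> (-1) ^ k * b (res H G') = ?c G' \<and> ins v (res H G') k = G'"
            using join_nonzero[OF V(2) H a(1)] iff[OF a] by simp
        next
          fix E' assume a: "(-1) ^ k * b E' \<noteq> 0" "adj i' E E'"
          then have "E' \<in> flags n H" using St_flags[OF b] by simp
          then show "adj i G (ins v E' k) \<and> ?c (ins v E' k) = (-1) ^ k * b E' \<and> res H (ins v E' k) = E'"
            using join_ins[OF V(2) _ k V(1)] res_ins[OF _ V(2) k] 2[OF a(2)] by simp
        qed
        also have "\<dots> = 0" using St_cycle[OF b E i'] by (simp add: gsum_cmult)
        finally show ?thesis .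
      qed
    qed
    then show ?thesis using adj_cong[OF FG] by simp
  qed
  ultimately show ?thesis unfolding St_def using join_nonzero(1)[OF V(2) H] by blast
qed

end

lemma psubset_removeI: "A \<subseteq> B - {x} \<Longrightarrow> x \<in> B \<Longrightarrow> A \<subset> B"
  by blast

section \<open>Vanishing criteria and generators\<close>

context vspace begin

lemma gsum_singleton:
  assumes "P F" "\<And>G. c G \<noteq> 0 \<Longrightarrow> P G \<Longrightarrow> G = F"
  shows "gsum c P = c F"
  using gsum_superset[of "{F}" c P] assms by auto

text \<open>Downward induction on the term that avoids \<open>v\<close>. If \<open>v\<close> lies in
  \<open>F i\<close> but not in \<open>F (i - 1)\<close>, the adjacent flags carrying
  \<open>c\<close> also contain \<open>v\<close> in term \<open>i\<close> by induction. That term is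
  then spanned by \<open>v\<close> and \<open>F (i - 1)\<close>, so the cycle condition has the
  single summand \<open>c F\<close>.\<close>

lemma St_eq_0_line:
  assumes c: "c \<in> St (Suc n) V" and v: "v \<noteq> 0" "v \<in> V"
    and 0: "\<And>F. F \<in> flags (Suc n) V \<Longrightarrow> v \<notin> F n \<Longrightarrow> c F = 0"
  shows "c = 0"
proof -
  have *: "c F = 0" if "F \<in> flags (Suc n) V" "v \<notin> F (n - d)" "d \<le> n" for F d
    using that
  proof (induction d arbitrary: F)
    case 0
    then show ?case using assms(4) by simp
  next
    case (Suc d)
    let ?i = "n - d"
    note F = Suc.prems(1)
    show ?case
    proof (cases "v \<in> F ?i")
      case False
      then show ?thesis using Suc by simp
    next
      case True
      have i: "0 < ?i" "?i < Suc n" "n - Suc d = ?i - 1" using Suc.prems by auto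
      have "gsum c (adj ?i F) = c F"
      proof (rule gsum_singleton)
        fix G assume G: "c G \<noteq> 0" "adj ?i F G"
        have Gf: "G \<in> flags (Suc n) V" using St_flags[OF c G(1)] .
        have vG: "v \<in> G ?i" using Suc.IH[OF Gf] G(1) Suc.prems by auto
        have eq: "K ?i = span (insert v (K (?i - 1)))" if "K \<in> flags (Suc n) V" "v \<in> K ?i" "v \<notin> K (?i - 1)" for K
        proof (rule covers_eq_span[OF _ that(2,3)])
          show "covers (K (?i - 1)) (K ?i)" using flagsD(2)[OF that(1), of "?i - 1"] i(1,2) by (metis Suc_pred' less_imp_diff_less)
        qed
        have *: "G (?i - 1) = F (?i - 1)" using G(2) i by (auto simp: adj_def)
        have "v \<notin> F (?i - 1)" using Suc.prems i(3) by metis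
        then have "G ?i = F ?i" using eq[OF Gf vG] eq[OF F True] * by metis
        then show "G = F" using G(2) unfolding adj_def by (intro ext) metis
      qed (simp add: adj_def)
      then show ?thesis using St_cycle[OF c F i(1,2)] by simp
    qed
  qed
  have "c F = 0" for F
    using *[of F n] flagsD(1)[of F "Suc n" V] v St_flags[OF c, of F] by auto
  then show ?thesis by (simp add: fun_eq_iff)
qed

text \<open>The dual argument, upwards: if \<open>F i\<close> lies in \<open>H\<close> and
  \<open>F (i + 1)\<close> does not, then \<open>F i\<close> is the intersection of
  \<open>F (i + 1)\<close> with \<open>H\<close> and cannot be varied.\<close>

lemma St_eq_0_hyperplane:
  assumes c: "c \<in> St (Suc n) V" and H: "covers H V"
    and 0: "\<And>F. F \<in> flags (Suc n) V \<Longrightarrow> \<not> F 1 \<subseteq> H \<Longrightarrow> c F = 0"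
  shows "c = 0"
proof -
  have *: "c F = 0" if "F \<in> flags (Suc n) V" "\<not> F (Suc k) \<subseteq> H" for F k
    using that
  proof (induction k arbitrary: F)
    case 0
    then show ?case using assms(3) by simp
  next
    case (Suc k)
    let ?i = "Suc k"
    note F = Suc.prems(1)
    show ?case
    proof (cases "F ?i \<subseteq> H")
      case False
      then show ?thesis using Suc by simp
    next
      case True
      have i: "0 < ?i" "?i < Suc n"
        using True flagsD(3)[OF F, of ?i] covers_psubset[OF H] by (force simp: not_less[symmetric])+
      have eq: "G (Suc ?i) \<inter> H = G ?i" if "G \<in> flags (Suc n) V" "G ?i \<subseteq> H" "\<not> G (Suc ?i) \<subseteq> H" for G
        using flagsD(2)[OF that(1), of ?i] i that covers_subspace[OF H] by (intro hyperplane_inter_eq) auto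
      have "gsum c (adj ?i F) = c F"
      proof (rule gsum_singleton)
        fix G assume G: "c G \<noteq> 0" "adj ?i F G"
        have Gf: "G \<in> flags (Suc n) V" using St_flags[OF c G(1)] .
        have GF: "G (Suc ?i) = F (Suc ?i)" using G(2) by (simp add: adj_def)
        have "G ?i \<subseteq> H" using Suc.IH[OF Gf] G(1) by auto
        then have "G ?i = F ?i" using eq[OF Gf] eq[OF F True] Suc.prems GF by auto
        then show "G = F" using G(2) unfolding adj_def by (intro ext) metis
      qed (simp add: adj_def)
      then show ?thesis using St_cycle[OF c F i(1,2)] by simp
    qed
  qed
  have "c F = 0" for F
    using *[of F n] flagsD(3)[of F "Suc n" V "Suc n"] covers_psubset[OF H] St_flags[OF c, of F] by auto
  then show ?thesis by (simp add: fun_eq_iff)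
qed

text \<open>The candidate for the factor \<open>b\<close> of a chain that agrees with a product
  \<open>join n V v H b\<close> on the flags which \<open>v\<close> enters at level
  \<open>k\<close>; the sign undoes the sign of \<open>join\<close>.\<close>

definition restr :: "nat \<Rightarrow> nat \<Rightarrow> 'b \<Rightarrow> 'b set \<Rightarrow> 'b fchain \<Rightarrow> 'b fchain" where
  "restr n k v H a = (\<lambda>E. if E \<in> flags n H then (-1) ^ k * a (ins v E k) else 0)"

text \<open>For an intermediate \<open>k\<close>, varying the term \<open>k - 1\<close> of
  \<open>E\<close> would change two terms of \<open>ins v E k\<close>. For the two extreme values
  this term is \<open>{0}\<close> or \<open>H\<close> and never varies, so cycle conditions
  correspond.\<close>

lemma restr_St:
  assumes V: "V = span (insert v H)" "v \<notin> H" and k: "k = 1 \<or> k = Suc n" and a: "a \<in> St (Suc n) V"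
  shows "restr n k v H a \<in> St n H"
proof -
  let ?r = "restr n k v H a"
  have k0: "0 < k" "k \<le> Suc n" using k by auto
  have "finite {E. ?r E \<noteq> 0}"
  proof (rule finite_subset)
    show "{E. ?r E \<noteq> 0} \<subseteq> res H ` {F. a F \<noteq> 0}"
    proof
      fix E assume "E \<in> {E. ?r E \<noteq> 0}"
      then have E: "E \<in> flags n H" "a (ins v E k) \<noteq> 0" by (auto simp: restr_def split: if_splits)
      then show "E \<in> res H ` {F. a F \<noteq> 0}"
        using res_ins[OF E(1) V(2) k0] by (intro image_eqI[where x = "ins v E k"]) auto
    qed
  qed (use St_finite[OF a] in simp)
  moreover have "E \<in> flags n H" if "?r E \<noteq> 0" for E using that by (auto simp: restr_def split: if_splits)
  moreover have "gsum ?r (adj i E) = 0" if E: "E \<in> flags n H" and i: "0 < i" "i < n" for E i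
  proof -
    define i' where "i' = (if k = 1 then Suc i else i)"
    have i': "i' \<noteq> k" "Suc i' \<noteq> k" "(if i' < k then i' else i' - 1) = i" "0 < i'" "i' < Suc n"
      using k i by (auto simp: i'_def)
    have "gsum ?r (adj i E) = gsum (\<lambda>F. (-1) ^ k * a F) (adj i' (ins v E k))"
    proof (rule gsum_reindex[where j = "res H" and i = "\<lambda>E'. ins v E' k"])
      fix E' assume E': "?r E' \<noteq> 0" "adj i E E'"
      then have f: "E' \<in> flags n H" by (auto simp: restr_def split: if_splits)
      show "adj i' (ins v E k) (ins v E' k) \<and> (-1) ^ k * a (ins v E' k) = ?r E' \<and> res H (ins v E' k) = E'"
        using adj_ins[OF k0(1) i'(1,2), of E E' v] E'(2) f res_ins[OF f V(2) k0] i'(3) by (simp add: restr_def)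
    next
      fix G assume G: "(-1) ^ k * a G \<noteq> 0" "adj i' (ins v E k) G"
      then have Gf: "G \<in> flags (Suc n) V" using St_flags[OF a] by simp
      have H: "covers H V" using V covers_span[OF flags_V_subspace[OF E] V(2)] by simp
      show "adj i E (res H G) \<and> ?r (res H G) = (-1) ^ k * a G \<and> ins v (res H G) k = G"
        using adj_ins_res[OF V E k0 Gf i'(1,2) G(2)] i'(3) res_flags[OF Gf H] by (simp add: restr_def)
    qed
    also have "\<dots> = 0"
      using St_cycle[OF a ins_flags[OF E V(2) k0, folded V(1)] i'(4,5)] by (simp add: gsum_cmult)
    finally show ?thesis .
  qed
  ultimately show ?thesis unfolding St_def by blast
qed

lemma join_restr:
  assumes V: "V = span (insert v H)" "v \<notin> H" "subspace H" and F: "F \<in> flags (Suc n) V"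
    and k: "lv H F = k" "v \<in> F k"
  shows "join n V v H (restr n k v H a) F = a F"
proof -
  have H: "covers H V" using V covers_span by simp
  show ?thesis
    using F k res_flags[OF F H] ins_res[OF F H _ V(2)] by (simp add: join_def restr_def)
qed

text \<open>The hyperplanes \<open>F n\<close> of the support that miss \<open>v\<close> are removed
  one at a time. A product with one of them agrees with \<open>a\<close> on the flags ending in it
  and vanishes on all other flags whose hyperplane misses \<open>v\<close>. When none is left,
  \<open>St_eq_0_line\<close> applies.\<close>

lemma St_induct_line [consumes 3, case_names zero add join]:
  assumes a: "a \<in> St (Suc n) V" and v: "v \<noteq> 0" "v \<in> V"
    and P0: "P 0" and Padd: "\<And>a b. a \<in> St (Suc n) V \<Longrightarrow> b \<in> St (Suc n) V \<Longrightarrow> P a \<Longrightarrow> P b \<Longrightarrow> P (a + b)"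
    and Pj: "\<And>H b. V = span (insert v H) \<Longrightarrow> v \<notin> H \<Longrightarrow> subspace H \<Longrightarrow> b \<in> St n H \<Longrightarrow> P (join n V v H b)"
  shows "P a"
  using a
proof (induction "card ((\<lambda>F. F n) ` {F. a F \<noteq> 0 \<and> v \<notin> F n})" arbitrary: a rule: less_induct)
  case less
  note a = less.prems
  let ?S = "\<lambda>a. (\<lambda>F. F n) ` {F. a F \<noteq> 0 \<and> v \<notin> F n}"
  show ?case
  proof (cases "?S a = {}")
    case True
    have "a F = 0" if "v \<notin> F n" for F using True that by auto
    then have "a = 0" using St_eq_0_line[OF a v] by blast
    then show ?thesis using P0 by simp
  next
    case False
    then obtain F where F: "a F \<noteq> 0" "v \<notin> F n" by blast
    define H where "H = F n"
    have Ff: "F \<in> flags (Suc n) V" using St_flags[OF a F(1)] .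
    have H: "covers H V" using flagsD(2)[OF Ff, of n] flagsD(3)[OF Ff, of "Suc n"] by (simp add: H_def)
    have vH: "v \<notin> H" using F by (simp add: H_def)
    have V: "V = span (insert v H)" using covers_eq_span[OF H v(2) vH] .
    have sH: "subspace H" using covers_subspace[OF H] by simp
    \<comment> \<open>Level \<open>Suc n\<close> means that \<open>v\<close> enters last, so these
      are the flags whose term \<open>n\<close> is \<open>H\<close>.\<close>
    define b where "b = restr n (Suc n) v H a"
    have b: "b \<in> St n H" unfolding b_def using restr_St[OF V vH _ a] by simp
    define J where "J = join n V v H b"
    have J: "J \<in> St (Suc n) V" unfolding J_def by (rule join_St[OF V vH sH b])
    have aJ: "a - J \<in> St (Suc n) V" using St_diff[OF a J] .
    have sub: "?S (a - J) \<subseteq> ?S a - {H}"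
    proof
      fix X assume "X \<in> ?S (a - J)"
      then obtain G where G: "a G \<noteq> J G" "v \<notin> G n" "X = G n" by auto
      show "X \<in> ?S a - {H}"
      \<comment> \<open>Where \<open>J\<close> vanishes, \<open>a\<close> does not, and the
        hyperplane cannot be \<open>H\<close>, since there \<open>J\<close> agrees with
        \<open>a\<close>. Where \<open>J\<close> does not vanish, \<open>v\<close> must enter last,
        so \<open>J\<close> and \<open>a\<close> agree again, a contradiction.\<close>
      proof (cases "J G = 0")
        case True
        have "G n \<noteq> H"
        proof
          assume GH: "G n = H"
          have aG: "a G \<noteq> 0" using G True by simp
          have Gf: "G \<in> flags (Suc n) V" using St_flags[OF a aG] .
          have "lv H G = Suc n"
            using lv_props[OF Gf H] GH by (intro le_antisym Suc_leI) auto
          then have "J G = a G"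
            unfolding J_def b_def using v flagsD(3)[OF Gf, of "Suc n"] by (intro join_restr[OF V vH sH Gf]) auto
          then show False using G by simp
        qed
        then show ?thesis using G True by auto
      next
        case False
        note jn = join_nonzero[OF vH H False[unfolded J_def]]
        have vG: "v \<in> G (lv H G)" using False by (auto simp: J_def join_def split: if_splits)
        have "\<not> lv H G \<le> n" using flags_mono[OF jn(1), of "lv H G" n] vG G by auto
        then have l: "lv H G = Suc n" using jn(5) by simp
        then have "J G = a G" unfolding J_def b_def using vG by (intro join_restr[OF V vH sH jn(1)]) auto
        then show ?thesis using G by simp
      qed
    qed
    have "card (?S (a - J)) < card (?S a)"
    proof (rule psubset_card_mono)
      show "finite (?S a)" using St_finite[OF a] by simp
      have "H \<in> ?S a" using F by (auto simp: H_def)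
      then show "?S (a - J) \<subset> ?S a" by (rule psubset_removeI[OF sub])
    qed
    then have "P (a - J)" using less.hyps aJ by blast
    moreover have "P J" unfolding J_def by (rule Pj[OF V vH sH b])
    ultimately have "P (a - J + J)" using Padd aJ J by blast
    then show ?thesis by simp
  qed
qed

text \<open>The dual of \<open>St_induct_line\<close>: the lines \<open>F 1\<close> outside
  \<open>H\<close> are removed one at a time, with \<open>m\<close> entering at level 1, and
  \<open>St_eq_0_hyperplane\<close> ends the recursion.\<close>

lemma St_induct_hyperplane [consumes 2, case_names zero add join]:
  assumes a: "a \<in> St (Suc n) V" and H: "covers H V"
    and P0: "P 0" and Padd: "\<And>a b. a \<in> St (Suc n) V \<Longrightarrow> b \<in> St (Suc n) V \<Longrightarrow> P a \<Longrightarrow> P b \<Longrightarrow> P (a + b)"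
    and Pj: "\<And>m b. V = span (insert m H) \<Longrightarrow> m \<notin> H \<Longrightarrow> b \<in> St n H \<Longrightarrow> P (join n V m H b)"
  shows "P a"
  using a
proof (induction "card ((\<lambda>F. F 1) ` {F. a F \<noteq> 0 \<and> \<not> F 1 \<subseteq> H})" arbitrary: a rule: less_induct)
  case less
  note a = less.prems
  let ?S = "\<lambda>a. (\<lambda>F. F 1) ` {F. a F \<noteq> 0 \<and> \<not> F 1 \<subseteq> H}"
  show ?case
  proof (cases "?S a = {}")
    case True
    have "a F = 0" if "\<not> F 1 \<subseteq> H" for F using True that by auto
    then have "a = 0" using St_eq_0_hyperplane[OF a H] by blast
    then show ?thesis using P0 by simp
  next
    case False
    then obtain F m where F: "a F \<noteq> 0" "m \<in> F 1" and mH: "m \<notin> H" by blast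
    have Ff: "F \<in> flags (Suc n) V" using St_flags[OF a F(1)] .
    have V: "V = span (insert m H)" using covers_eq_span[OF H _ mH] F(2) flags_le[OF Ff] by blast
    have sH: "subspace H" using covers_subspace[OF H] by simp
    define b where "b = restr n 1 m H a"
    have b: "b \<in> St n H" unfolding b_def using restr_St[OF V mH _ a] by simp
    define J where "J = join n V m H b"
    have J: "J \<in> St (Suc n) V" unfolding J_def by (rule join_St[OF V mH sH b])
    have aJ: "a - J \<in> St (Suc n) V" using St_diff[OF a J] .
    have sub: "?S (a - J) \<subseteq> ?S a - {F 1}"
    proof
      fix X assume "X \<in> ?S (a - J)"
      then obtain G where G: "a G \<noteq> J G" "\<not> G 1 \<subseteq> H" "X = G 1" by auto
      have Gf: "G \<in> flags (Suc n) V" using G(1) St_flags[OF a] St_flags[OF J] by metis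
      have l: "lv H G = 1"
        using lv_props[OF Gf H] G(2) by (metis One_nat_def Suc_leI le_antisym not_less)
      have "m \<notin> G 1"
      proof
        assume "m \<in> G 1"
        then have "J G = a G" unfolding J_def b_def by (intro join_restr[OF V mH sH Gf l])
        then show False using G by simp
      qed
      then show "X \<in> ?S a - {F 1}" using G l F(2) by (auto simp: J_def join_def)
    qed
    have "card (?S (a - J)) < card (?S a)"
    proof (rule psubset_card_mono)
      show "finite (?S a)" using St_finite[OF a] by simp
      have "F 1 \<in> ?S a" using F mH by auto
      then show "?S (a - J) \<subset> ?S a" by (rule psubset_removeI[OF sub])
    qed
    then have "P (a - J)" using less.hyps aJ by blast
    moreover have "P J" unfolding J_def by (rule Pj[OF V mH b])
    ultimately have "P (a - J + J)" using Padd aJ J by blast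
    then show ?thesis by simp
  qed
qed

section \<open>Linear isomorphisms and pulled back chains\<close>

definition lin_iso :: "'b set \<Rightarrow> 'b set \<Rightarrow> ('b \<Rightarrow> 'b) \<Rightarrow> bool" where
  "lin_iso V W h \<longleftrightarrow> subspace V \<and> bij_betw h V W \<and>
     (\<forall>x\<in>V. \<forall>y\<in>V. h (x + y) = h x + h y) \<and> (\<forall>c. \<forall>x\<in>V. h (scale c x) = scale c (h x))"

lemma lin_iso_zero: assumes "lin_iso V W h" shows "h 0 = 0"
proof -
  have "h (scale 0 0) = scale 0 (h 0)" using assms subspace_0 unfolding lin_iso_def by blast
  then show ?thesis by simp
qed

lemma lin_iso_subspace:
  assumes h: "lin_iso V W h" and X: "subspace X" "X \<subseteq> V"
  shows "subspace (h ` X)"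
proof (rule subspaceI)
  show "0 \<in> h ` X" using lin_iso_zero[OF h] subspace_0[OF X(1)] by (metis image_eqI)
next
  fix x y assume "x \<in> h ` X" "y \<in> h ` X"
  then obtain a b where ab: "a \<in> X" "b \<in> X" "x = h a" "y = h b" by blast
  then have "x + y = h (a + b)" using h X(2) unfolding lin_iso_def by (simp add: subset_iff)
  then show "x + y \<in> h ` X" using ab subspace_add[OF X(1)] by blast
next
  fix c x assume "x \<in> h ` X"
  then obtain a where a: "a \<in> X" "x = h a" by blast
  then have "scale c x = h (scale c a)" using h X(2) unfolding lin_iso_def by (simp add: subset_iff)
  then show "scale c x \<in> h ` X" using a subspace_scale[OF X(1)] by blast
qed

lemma lin_iso_inv:
  assumes h: "lin_iso V W h"
  shows "lin_iso W V (inv_into V h)"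
proof -
  let ?g = "inv_into V h"
  have V: "subspace V" and b: "bij_betw h V W" using h unfolding lin_iso_def by auto
  have hV: "h ` V = W" using b by (simp add: bij_betw_def)
  have g: "?g y \<in> V" "h (?g y) = y" if "y \<in> W" for y
    using that b by (auto simp: bij_betw_def inv_into_into f_inv_into_f)
  have inj: "x = y" if "x \<in> V" "y \<in> V" "h x = h y" for x y
    using b that by (auto simp: bij_betw_def dest: inj_onD)
  have sW: "subspace W" using lin_iso_subspace[OF h V] hV by simp
  have "?g (x + y) = ?g x + ?g y" if "x \<in> W" "y \<in> W" for x y
  proof (rule inj)
    show "h (?g (x + y)) = h (?g x + ?g y)"
      using g that h subspace_add[OF sW] unfolding lin_iso_def by auto
  qed (use g that subspace_add[OF sW] subspace_add[OF V] in auto)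
  moreover have "?g (scale c x) = scale c (?g x)" if "x \<in> W" for x c
  proof (rule inj)
    show "h (?g (scale c x)) = h (scale c (?g x))"
      using g that h subspace_scale[OF sW] unfolding lin_iso_def by auto
  qed (use g that subspace_scale[OF sW] subspace_scale[OF V] in auto)
  ultimately show ?thesis unfolding lin_iso_def using sW bij_betw_inv_into[OF b] by auto
qed

lemma lin_iso_restrict:
  assumes h: "lin_iso V W h" and X: "subspace X" "X \<subseteq> V"
  shows "lin_iso X (h ` X) h"
proof -
  have "inj_on h X" using h X(2) unfolding lin_iso_def bij_betw_def by (meson inj_on_subset)
  then show ?thesis using h X unfolding lin_iso_def bij_betw_def by (simp add: subset_iff)
qed

lemma lin_iso_span_insert:
  assumes h: "lin_iso V W h" and X: "subspace X" "X \<subseteq> V" and v: "v \<in> V"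
  shows "h ` span (insert v X) = span (insert (h v) (h ` X))"
proof -
  have V: "subspace V" and add: "\<And>x y. x \<in> V \<Longrightarrow> y \<in> V \<Longrightarrow> h (x + y) = h x + h y"
    and sc: "\<And>c x. x \<in> V \<Longrightarrow> h (scale c x) = scale c (h x)"
    using h unfolding lin_iso_def by auto
  note hX = lin_iso_subspace[OF h X]
  show ?thesis
  proof
    show "h ` span (insert v X) \<subseteq> span (insert (h v) (h ` X))"
    proof
      fix y assume "y \<in> h ` span (insert v X)"
      then obtain x k where x: "y = h x" "x - scale k v \<in> X" using span_insert_mem[OF X(1)] by blast
      then have "h x = h (x - scale k v) + scale k (h v)"
        using add[of "x - scale k v" "scale k v"] sc v X subspace_scale[OF V] by auto
      then have "y - scale k (h v) \<in> h ` X" using x by auto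
      then show "y \<in> span (insert (h v) (h ` X))" using span_insert_mem[OF hX] by blast
    qed
    have sub: "span (insert v X) \<subseteq> V" using X v V by (intro span_minimal) auto
    show "span (insert (h v) (h ` X)) \<subseteq> h ` span (insert v X)"
      by (intro span_minimal lin_iso_subspace[OF h _ sub]) (auto intro: span_base)
  qed
qed

lemma lin_iso_covers:
  assumes h: "lin_iso V W h" and XY: "covers X Y" "Y \<subseteq> V"
  shows "covers (h ` X) (h ` Y)"
proof -
  obtain v where v: "subspace X" "v \<notin> X" "Y = span (insert v X)" using XY unfolding covers_def by blast
  have "v \<in> V" "X \<subseteq> V" using XY v covers_subset by (auto intro: span_base)
  moreover have "h v \<notin> h ` X" using calculation v(2) h unfolding lin_iso_def bij_betw_def
    by (auto dest: inj_onD)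
  ultimately show ?thesis unfolding covers_def using lin_iso_subspace[OF h] lin_iso_span_insert[OF h] v by blast
qed

definition fimg :: "('b \<Rightarrow> 'b) \<Rightarrow> 'b fullflag \<Rightarrow> 'b fullflag" where
  "fimg h F = (\<lambda>i. h ` F i)"

lemma fimg_flags:
  assumes h: "lin_iso V W h" and F: "F \<in> flags n V"
  shows "fimg h F \<in> flags n W"
  using flagsD[OF F] lin_iso_covers[OF h _ flags_le[OF F]] lin_iso_zero[OF h] h
  unfolding flags_def fimg_def lin_iso_def bij_betw_def by auto

lemma fimg_inv:
  assumes h: "lin_iso V W h" and F: "F \<in> flags n V"
  shows "fimg (inv_into V h) (fimg h F) = F"
  using flags_le[OF F] h unfolding fimg_def lin_iso_def bij_betw_def by (auto simp: fun_eq_iff)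

lemma fimg_inv':
  assumes h: "lin_iso V W h" and F: "F \<in> flags n W"
  shows "fimg h (fimg (inv_into V h) F) = F"
  using flags_le[OF F] h unfolding fimg_def lin_iso_def bij_betw_def
  by (intro ext) (simp add: image_inv_into_cancel)

text \<open>A pullback is evaluated without a sum over preimages. It reverses composition, which is
  harmless for invariance under a group.\<close>

definition pb :: "nat \<Rightarrow> 'b set \<Rightarrow> ('b \<Rightarrow> 'b) \<Rightarrow> 'b fchain \<Rightarrow> 'b fchain" where
  "pb n V h c = (\<lambda>F. if F \<in> flags n V then c (fimg h F) else 0)"

text \<open>Values outside \<open>V\<close> are irrelevant; this lets an extension of an isomorphism
  of \<open>H\<close> be replaced by that isomorphism on chains of \<open>H\<close>.\<close>

lemma pb_cong:
  assumes "\<And>x. x \<in> V \<Longrightarrow> h x = g x"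
  shows "pb n V h = pb n V g"
proof -
  have *: "fimg h F = fimg g F" if F: "F \<in> flags n V" for F
    using assms flags_le[OF F] unfolding fimg_def by (auto simp: fun_eq_iff intro!: image_cong)
  show ?thesis unfolding pb_def by (intro ext) (simp add: *)
qed

lemma gsum_pb:
  assumes h: "lin_iso V W h" and f: "\<And>F. f F \<noteq> 0 \<Longrightarrow> F \<in> flags n W"
    and PQ: "\<And>F. F \<in> flags n V \<Longrightarrow> P F = Q (fimg h F)"
  shows "gsum (\<lambda>F. if F \<in> flags n V then f (fimg h F) else 0) P = gsum f Q"
proof (rule gsum_reindex[where i = "fimg h" and j = "fimg (inv_into V h)"])
  fix F assume F: "(if F \<in> flags n V then f (fimg h F) else 0) \<noteq> 0" "P F"
  then have "F \<in> flags n V" by (auto split: if_splits)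
  then show "Q (fimg h F) \<and> f (fimg h F) = (if F \<in> flags n V then f (fimg h F) else 0) \<and>
     fimg (inv_into V h) (fimg h F) = F"
    using PQ fimg_inv[OF h] F by auto
next
  fix F assume F: "f F \<noteq> 0" "Q F"
  note Ff = f[OF F(1)]
  have "fimg (inv_into V h) F \<in> flags n V" using fimg_flags[OF lin_iso_inv[OF h] Ff] .
  then show "P (fimg (inv_into V h) F) \<and>
       (if fimg (inv_into V h) F \<in> flags n V then f (fimg h (fimg (inv_into V h) F)) else 0) = f F \<and>
       fimg h (fimg (inv_into V h) F) = F"
    using PQ fimg_inv'[OF h Ff] F by auto
qed

lemma pb_St:
  assumes h: "lin_iso V W h" and c: "c \<in> St n W"
  shows "pb n V h c \<in> St n V"
proof -
  have "finite {F. pb n V h c F \<noteq> 0}"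
  proof (rule finite_subset)
    show "{F. pb n V h c F \<noteq> 0} \<subseteq> fimg (inv_into V h) ` {F. c F \<noteq> 0}"
    proof
      fix F assume "F \<in> {F. pb n V h c F \<noteq> 0}"
      then have F: "F \<in> flags n V" "c (fimg h F) \<noteq> 0" by (auto simp: pb_def split: if_splits)
      show "F \<in> fimg (inv_into V h) ` {F. c F \<noteq> 0}"
        using fimg_inv[OF h F(1)] F(2) by (intro image_eqI[where x = "fimg h F"]) auto
    qed
  qed (use St_finite[OF c] in simp)
  moreover have "gsum (pb n V h c) (adj i F) = 0" if F: "F \<in> flags n V" and i: "0 < i" "i < n" for F i
  proof -
    have inj: "fimg h G p = fimg h F p \<Longrightarrow> G p = F p" if "G \<in> flags n V" for G p
      using fimg_inv[OF h F] fimg_inv[OF h that] by (metis fimg_def)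
    have "gsum (pb n V h c) (adj i F) = gsum c (adj i (fimg h F))"
      unfolding pb_def
    proof (rule gsum_pb[OF h St_flags[OF c]])
      fix G assume G: "G \<in> flags n V"
      show "adj i F G = adj i (fimg h F) (fimg h G)"
        using inj[OF G] unfolding adj_def by (metis fimg_def)
    qed
    then show ?thesis using St_cycle[OF c fimg_flags[OF h F] i] by simp
  qed
  ultimately show ?thesis unfolding St_def pb_def by auto
qed

lemma pb_join:
  assumes h: "lin_iso V' V h" and H': "subspace H'" "v' \<notin> H'" "V' = span (insert v' H')"
  shows "pb (Suc n) V' h (join n V (h v') (h ` H') b) = join n V' v' H' (pb n H' h b)"
proof
  fix F
  show "pb (Suc n) V' h (join n V (h v') (h ` H') b) F = join n V' v' H' (pb n H' h b) F"
  proof (cases "F \<in> flags (Suc n) V'")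
    case False
    then show ?thesis by (simp add: pb_def join_def)
  next
    case F: True
    have H'V: "H' \<subseteq> V'" "v' \<in> V'" using H' span_superset[of "insert v' H'"] by auto
    have cov: "covers H' V'" using H' covers_span by simp
    have inj: "inj_on h V'" using h by (simp add: lin_iso_def bij_betw_def)
    have sub: "h ` F i \<subseteq> h ` H' \<longleftrightarrow> F i \<subseteq> H'" for i
      using inj_on_image_mem_iff[OF inj _ H'V(1)] flags_le[OF F, of i] unfolding image_subset_iff by blast
    have l: "lv (h ` H') (fimg h F) = lv H' F" unfolding lv_def fimg_def sub ..
    have m: "h v' \<in> h ` F i \<longleftrightarrow> v' \<in> F i" for i
      using inj_on_image_mem_iff[OF inj H'V(2) flags_le[OF F]] .
    have r: "res (h ` H') (fimg h F) = fimg h (res H' F)"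
      unfolding res_def l using inj_on_image_Int[OF inj flags_le[OF F] H'V(1)]
      by (auto simp: fimg_def fun_eq_iff)
    show ?thesis using F fimg_flags[OF h F] res_flags[OF F cov] m
      by (simp add: pb_def join_def l r) (simp add: fimg_def)
  qed
qed

lemma coeff_unique:
  assumes H: "subspace H" "v \<notin> H" and "x - scale c v \<in> H" "x - scale d v \<in> H"
  shows "c = d"
proof (rule ccontr)
  assume "c \<noteq> d"
  have "(x - scale c v) - (x - scale d v) \<in> H" by (rule subspace_diff[OF H(1) assms(3,4)])
  then have "scale (d - c) v \<in> H" by (simp add: scale_left_diff_distrib)
  then have "scale (inverse (d - c)) (scale (d - c) v) \<in> H" using H subspace_scale by blast
  then show False using \<open>c \<noteq> d\<close> H by simp
qed

lemma lin_iso_extend: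
  assumes g: "lin_iso H' H g" and v: "v' \<notin> H'" "v \<notin> H"
  obtains h where "lin_iso (span (insert v' H')) (span (insert v H)) h"
    "\<And>x. x \<in> H' \<Longrightarrow> h x = g x" "h v' = v"
proof -
  have H': "subspace H'" and gb: "bij_betw g H' H" 
    and g_add: "\<And>x y. x \<in> H' \<Longrightarrow> y \<in> H' \<Longrightarrow> g (x + y) = g x + g y"
    and g_scale: "\<And>c x. x \<in> H' \<Longrightarrow> g (scale c x) = scale c (g x)" using g unfolding lin_iso_def by auto
  have H: "subspace H" using lin_iso_subspace[OF g H'] gb by (simp add: bij_betw_def)
  have gH: "x \<in> H' \<Longrightarrow> g x \<in> H" for x using gb by (auto simp: bij_betw_def)
  \<comment> \<open>The coordinate of \<open>x\<close> along \<open>v'\<close> modulo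
    \<open>H'\<close>, unique by \<open>coeff_unique\<close>.\<close>
  define cf where "cf x = (SOME c. x - scale c v' \<in> H')" for x
  define h where "h x = g (x - scale (cf x) v') + scale (cf x) v" for x
  have h: "h (y + scale c v') = g y + scale c v" if y: "y \<in> H'" for y c
  proof -
    have "(y + scale c v') - scale c v' \<in> H'" using y by simp
    moreover from this have "(y + scale c v') - scale (cf (y + scale c v')) v' \<in> H'"
      unfolding cf_def by (rule someI)
    ultimately have "cf (y + scale c v') = c" using coeff_unique[OF H' v(1)] by blast
    then show ?thesis by (simp add: h_def)
  qed
  have dec: "\<exists>y\<in>H'. \<exists>c. x = y + scale c v'" if "x \<in> span (insert v' H')" for x
    using that unfolding span_insert_mem[OF H'] by (metis diff_add_cancel)
  have dec': "\<exists>y\<in>H. \<exists>c. x = y + scale c v" if "x \<in> span (insert v H)" for x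
    using that unfolding span_insert_mem[OF H] by (metis diff_add_cancel)
  have mem': "y + scale c v \<in> span (insert v H)" if "y \<in> H" for y c
    using that span_insert_mem[OF H] by (metis add_diff_cancel)
  have mem: "y + scale c v' \<in> span (insert v' H')" if "y \<in> H'" for y c
    using that span_insert_mem[OF H'] by (metis add_diff_cancel)
  have "lin_iso (span (insert v' H')) (span (insert v H)) h"
    unfolding lin_iso_def
  proof (intro conjI ballI allI)
    show "bij_betw h (span (insert v' H')) (span (insert v H))"
      unfolding bij_betw_def
    proof
      show "inj_on h (span (insert v' H'))"
      proof (rule inj_onI)
        fix x y assume "x \<in> span (insert v' H')" "y \<in> span (insert v' H')" and e: "h x = h y"
        then obtain a b c d where *: "a \<in> H'" "b \<in> H'" "x = a + scale c v'" "y = b + scale d v'"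
          using dec by meson
        then have eq: "g a + scale c v = g b + scale d v" using e h by simp
        have "c = d"
        proof (rule coeff_unique[OF H v(2)])
          show "(g a + scale c v) - scale c v \<in> H" using gH * by simp
          show "(g a + scale c v) - scale d v \<in> H" unfolding eq using gH * by simp
        qed
        then have "g a = g b" using eq by simp
        then have "a = b" using gb * by (auto simp: bij_betw_def dest: inj_onD)
        then show "x = y" using * \<open>c = d\<close> by simp
      qed
      show "h ` span (insert v' H') = span (insert v H)"
      proof safe
        fix x assume "x \<in> span (insert v' H')"
        then obtain a c where "a \<in> H'" "x = a + scale c v'" using dec by blast
        then show "h x \<in> span (insert v H)" using h mem' gH by simp
      next
        fix x assume "x \<in> span (insert v H)"
        then obtain y c where y: "y \<in> H" "x = y + scale c v" using dec' by blast
        then obtain a where a: "a \<in> H'" "y = g a" using gb unfolding bij_betw_def by blast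
        then have "x = h (a + scale c v')" using y h by simp
        then show "x \<in> h ` span (insert v' H')" using mem[OF a(1)] by blast
      qed
    qed
  next
    fix x y assume "x \<in> span (insert v' H')" "y \<in> span (insert v' H')"
    then obtain a b c d where *: "a \<in> H'" "b \<in> H'" "x = a + scale c v'" "y = b + scale d v'"
      using dec by meson
    have "x + y = (a + b) + scale (c + d) v'" using * by (simp add: scale_left_distrib)
    then have "h (x + y) = g (a + b) + scale (c + d) v" using h[of "a + b" "c + d"] * subspace_add[OF H'] by metis
    also have "\<dots> = h x + h y" using * h g_add by (simp add: scale_left_distrib)
    finally show "h (x + y) = h x + h y" .
  next
    fix k x assume "x \<in> span (insert v' H')"
    then obtain a c where *: "a \<in> H'" "x = a + scale c v'" using dec by blast
    have "scale k x = scale k a + scale (k * c) v'" using * by (simp add: scale_right_distrib)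
    then have "h (scale k x) = g (scale k a) + scale (k * c) v" using h[of "scale k a" "k * c"] * subspace_scale[OF H'] by metis
    also have "\<dots> = scale k (h x)" using * h g_scale by (simp add: scale_right_distrib)
    finally show "h (scale k x) = scale k (h x)" .
  qed auto
  moreover have "h x = g x" if "x \<in> H'" for x using h[OF that, of 0] by simp
  moreover have "h v' = v"
    using h[OF subspace_0[OF H'], of 1] lin_iso_zero[OF g] by simp
  ultimately show thesis using that by blast
qed

lemma lin_iso_id: "subspace V \<Longrightarrow> lin_iso V V (\<lambda>x. x)"
  unfolding lin_iso_def by (auto simp: bij_betw_def)

text \<open>If \<open>w\<close> is not a multiple of \<open>v\<close>, a basis containing
  \<open>v\<close> and \<open>w - v\<close> is chosen and \<open>v\<close> is dropped: the rest
  misses \<open>v\<close>, and it misses \<open>w\<close> because it contains \<open>w - v\<close>.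
  If \<open>w\<close> is a multiple of \<open>v\<close>, every complement of \<open>v\<close> will
  do.\<close>

lemma complement_exists:
  assumes V: "subspace V" "v \<in> V" "w \<in> V" "v \<noteq> 0" "w \<noteq> 0"
  obtains K where "subspace K" "v \<notin> K" "w \<notin> K" "V = span (insert v K)" "V = span (insert w K)"
proof -
  have ind: "\<exists>B. S \<subseteq> B \<and> B \<subseteq> V \<and> independent B \<and> V = span B" if S: "S \<subseteq> V" "independent S" for S
  proof -
    obtain B where B: "S \<subseteq> B" "B \<subseteq> V" "independent B" "V \<subseteq> span B"
      using maximal_independent_subset_extend[OF S] by metis
    then show ?thesis using span_minimal[OF B(2) V(1)] by blast
  qed
  define u where "u = (if w \<in> span {v} then {} else {w - v})"
  have vu: "insert v u \<subseteq> V" "independent (insert v u)" "v \<notin> u"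
  proof -
    show "insert v u \<subseteq> V" using V by (auto simp: u_def intro: subspace_diff)
    have "w - v \<in> span {v} \<Longrightarrow> w \<in> span {v}"
      using span_add[of "w - v" "{v}" v] by (simp add: span_base)
    then have *: "w - v \<notin> span {v}" if "w \<notin> span {v}" using that by blast
    show "independent (insert v u)"
      using V * independent_insertI[of "w - v" "{v}"] by (auto simp: u_def insert_commute)
    show "v \<notin> u"
    proof
      assume "v \<in> u"
      then have "w - v = v" "w \<notin> span {v}" by (auto simp: u_def split: if_splits)
      then have "w - v \<in> span {v}" "w \<notin> span {v}" by (auto intro: span_base)
      then show False using * by blast
    qed
  qed
  obtain B where B: "insert v u \<subseteq> B" "independent B" "V = span B" using ind[OF vu(1,2)] by blast
  define K where "K = span (B - {v})"
  have vK: "v \<notin> K" using B unfolding K_def dependent_def by blast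
  have VK: "V = span (insert v K)"
  proof -
    have "span (insert v K) \<subseteq> V"
      unfolding K_def using B by (intro span_minimal) (auto intro: span_base intro!: span_mono)
    moreover have "V \<subseteq> span (insert v K)"
      unfolding B(3) K_def
    proof (intro span_minimal subsetI)
      fix x assume "x \<in> B"
      then show "x \<in> span (insert v (span (B - {v})))"
        by (cases "x = v") (auto intro: span_base)
    qed auto
    ultimately show ?thesis by blast
  qed
  have wK: "w \<notin> K"
  proof
    assume w: "w \<in> K"
    show False
    proof (cases "w \<in> span {v}")
      case True
      then obtain k where k: "w = scale k v" by (auto simp: span_singleton)
      then have "k \<noteq> 0" using V by auto
      then have "v = scale (inverse k) w" using k by simp
      then show False using w vK unfolding K_def by (metis span_scale)
    next
      case False
      then have "w - v \<in> B - {v}" using B vu by (auto simp: u_def)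
      then have "w - v \<in> K" unfolding K_def by (rule span_base)
      then have "w - (w - v) \<in> K" using w unfolding K_def using span_diff by blast
      then show False using vK by simp
    qed
  qed
  have sK: "subspace K" by (simp add: K_def)
  have "covers K V" using covers_span[OF sK vK] VK by simp
  then have "V = span (insert w K)" using covers_eq_span V(3) wK by blast
  then show thesis using that[OF sK vK wK VK] by blast
qed

text \<open>The identity of a common complement extends to a map with \<open>v\<close> going to
  \<open>w\<close>.\<close>

lemma lin_iso_transitive:
  assumes V: "subspace V" "v \<in> V" "w \<in> V" "v \<noteq> 0" "w \<noteq> 0"
  obtains h where "lin_iso V V h" "h v = w"
proof -
  obtain K where K: "subspace K" "v \<notin> K" "w \<notin> K" "V = span (insert v K)" "V = span (insert w K)"
    using complement_exists[OF V] .
  show thesis using lin_iso_extend[OF lin_iso_id[OF K(1)] K(2,3)] that K(4,5) by metis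
qed

text \<open>The projection to \<open>H'\<close> along \<open>v\<close> restricts to an isomorphism
  from \<open>H\<close> onto \<open>H'\<close>, which is then extended by fixing
  \<open>v\<close>.\<close>

lemma lin_iso_complements:
  assumes H: "subspace H" "v \<notin> H" "V = span (insert v H)"
    and H': "subspace H'" "v \<notin> H'" "V = span (insert v H')"
  obtains h where "lin_iso V V h" "h v = v" "h ` H = H'"
proof -
  define cf where "cf x = (SOME c. x - scale c v \<in> H')" for x
  have cf: "x - scale (cf x) v \<in> H'" if "x \<in> V" for x
    using that span_insert_mem[OF H'(1)] H'(3) unfolding cf_def by (metis someI_ex)
  have sV: "subspace V" unfolding H(3) by simp
  have HV: "H \<subseteq> V" "H' \<subseteq> V" "v \<in> V" using H(3) H'(3) span_superset by blast+
  have cfI: "cf x = c" if "x \<in> V" "x - scale c v \<in> H'" for x c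
    using coeff_unique[OF H'(1,2) cf[OF that(1)] that(2)] .
  define g where "g x = x - scale (cf x) v" for x
  have cf_add: "cf (x + y) = cf x + cf y" if "x \<in> V" "y \<in> V" for x y
  proof (rule cfI)
    have "(x - scale (cf x) v) + (y - scale (cf y) v) \<in> H'" using cf that H' by (intro subspace_add)
    then show "x + y - scale (cf x + cf y) v \<in> H'" by (simp add: algebra_simps scale_left_distrib)
  qed (use that sV subspace_add in blast)
  have cf_scale: "cf (scale k x) = k * cf x" if "x \<in> V" for x k
  proof (rule cfI)
    have "scale k (x - scale (cf x) v) \<in> H'" using cf that H' by (intro subspace_scale)
    then show "scale k x - scale (k * cf x) v \<in> H'" by (simp add: scale_right_diff_distrib)
  qed (use that sV subspace_scale in blast)
  have g: "lin_iso H H' g"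
    unfolding lin_iso_def
  proof (intro conjI ballI allI H(1))
    show "bij_betw g H H'"
      unfolding bij_betw_def
    proof
      show "inj_on g H"
      proof (rule inj_onI)
        fix x y assume xy: "x \<in> H" "y \<in> H" "g x = g y"
        \<comment> \<open>The common projection differs from \<open>x\<close> and from
          \<open>y\<close>, both in \<open>H\<close>, by multiples of \<open>v\<close>; these
          multiples must coincide.\<close>
        have "- cf x = - cf y"
        proof (rule coeff_unique[OF H(1,2)])
          show "(x - scale (cf x) v) - scale (- cf x) v \<in> H" using xy by simp
          have "x - scale (cf x) v = y - scale (cf y) v" using xy by (simp add: g_def)
          then show "(x - scale (cf x) v) - scale (- cf y) v \<in> H"
            using xy by simp
        qed
        then have "cf x = cf y" by simp
        then show "x = y" using xy by (simp add: g_def)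
      qed
      show "g ` H = H'"
      proof safe
        fix x assume "x \<in> H" then show "g x \<in> H'" using cf HV by (auto simp: g_def)
      next
        fix y assume y: "y \<in> H'"
        then obtain c where c: "y - scale c v \<in> H" using HV H(3) span_insert_mem[OF H(1)] by blast
        have "cf (y - scale c v) = - c" using y HV c by (intro cfI) auto
        then have "g (y - scale c v) = y" by (simp add: g_def)
        then show "y \<in> g ` H" using c by (metis image_eqI)
      qed
    qed
  next
    fix x y assume "x \<in> H" "y \<in> H"
    then have "cf (x + y) = cf x + cf y" using cf_add HV by blast
    then show "g (x + y) = g x + g y" by (simp add: g_def algebra_simps scale_left_distrib)
  next
    fix k x assume "x \<in> H"
    then show "g (scale k x) = scale k (g x)" using cf_scale HV by (auto simp: g_def scale_right_diff_distrib)
  qed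
  obtain h where h: "lin_iso V V h" "\<And>x. x \<in> H \<Longrightarrow> h x = g x" "h v = v"
    using lin_iso_extend[OF g H(2) H'(2)] H(3) H'(3) by metis
  moreover have "h ` H = H'"
    using h(2) g unfolding lin_iso_def bij_betw_def by (metis image_cong)
  ultimately show thesis using that by blast
qed

end

section \<open>Calculations modulo a subgroup\<close>

definition add_subgroup :: "'a::ab_group_add set \<Rightarrow> bool" where
  "add_subgroup N \<longleftrightarrow> 0 \<in> N \<and> (\<forall>x\<in>N. \<forall>y\<in>N. x - y \<in> N)"

lemma add_subgroup_0: "add_subgroup N \<Longrightarrow> 0 \<in> N"
  and add_subgroup_diff: "add_subgroup N \<Longrightarrow> x \<in> N \<Longrightarrow> y \<in> N \<Longrightarrow> x - y \<in> N"
  unfolding add_subgroup_def by auto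

lemma add_subgroup_minus: "add_subgroup N \<Longrightarrow> x \<in> N \<Longrightarrow> - x \<in> N"
  using add_subgroup_diff[of N 0 x] add_subgroup_0[of N] by simp

lemma add_subgroup_add: "add_subgroup N \<Longrightarrow> x \<in> N \<Longrightarrow> y \<in> N \<Longrightarrow> x + y \<in> N"
  using add_subgroup_diff[of N x "- y"] add_subgroup_minus[of N y] by simp

lemma add_subgroup_sum: "add_subgroup N \<Longrightarrow> (\<And>i. i \<in> I \<Longrightarrow> f i \<in> N) \<Longrightarrow> sum f I \<in> N"
  by (induction I rule: infinite_finite_induct) (auto simp: add_subgroup_0 add_subgroup_add)

lemma add_subgroup_frag_cmul:
  assumes N: "add_subgroup N" and x: "x \<in> N"
  shows "frag_cmul k x \<in> N"
proof -
  have nat: "frag_cmul (int n) x \<in> N" for n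
  proof (induction n)
    case (Suc n)
    then show ?case using add_subgroup_add[OF N x Suc] by (simp add: frag_cmul_distrib)
  qed (simp add: add_subgroup_0[OF N])
  show ?thesis
  proof (cases "0 \<le> k")
    case True
    then show ?thesis using nat[of "nat k"] by simp
  next
    case False
    then have "frag_cmul k x = - frag_cmul (int (nat (- k))) x" by (simp flip: minus_frag_cmul)
    then show ?thesis using add_subgroup_minus[OF N nat] by metis
  qed
qed

lemma frag_cmul_sum_left: "frag_cmul (sum f I) x = (\<Sum>i\<in>I. frag_cmul (f i) x)"
  by (induction I rule: infinite_finite_induct) (auto simp: frag_cmul_distrib)

lemma frag_cmul_diff_right: "frag_cmul k (x - y) = frag_cmul k x - frag_cmul k y"
  by (rule poly_mapping_eqI) (simp add: lookup_minus algebra_simps)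

lemma frag_cmul_diff_left: "frag_cmul (k - l) x = frag_cmul k x - frag_cmul l x"
  by (rule poly_mapping_eqI) (simp add: lookup_minus algebra_simps)

text \<open>For coefficients written as differences of \<open>s\<close> the sum depends on the
  increments of \<open>\<phi>\<close> only, up to the two boundary terms. Those increments are what
  \<open>phi_join_step\<close> computes.\<close>

lemma frag_abel_summation:
  "(\<Sum>p=1..Suc n. frag_cmul (\<phi> p) (s (p - 1) - s p)) =
     frag_cmul (\<phi> 1) (s 0) + (\<Sum>p=1..n. frag_cmul (\<phi> (Suc p) - \<phi> p) (s p)) - frag_cmul (\<phi> (Suc n)) (s (Suc n))"
  by (induction n) (simp_all add: frag_cmul_diff_right frag_cmul_diff_left algebra_simps)

section \<open>Pairings refined by the position of a vector\<close>

context vspace begin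

definition pr :: "'b fchain \<Rightarrow> 'b fchain \<Rightarrow> ('b fullflag \<Rightarrow> bool) \<Rightarrow> int" where
  "pr a b Q = gsum (\<lambda>F. a F * b F) Q"

text \<open>
  Every flag meets the condition in \<open>phi v p\<close> for exactly one \<open>p\<close>, so these forms refine the pairing
  \<open>pr\<close> according to the position of \<open>v\<close>.
\<close>

definition phi :: "'b \<Rightarrow> nat \<Rightarrow> 'b fchain \<Rightarrow> 'b fchain \<Rightarrow> int" where
  "phi v p a b = pr a b (\<lambda>F. v \<in> F p \<and> v \<notin> F (p - 1))"

lemma finite_mult_St: "a \<in> St n V \<Longrightarrow> finite {F. a F * b F \<noteq> 0}"
  using finite_subset[of "{F. a F * b F \<noteq> 0}" "{F. a F \<noteq> 0}"] St_finite by auto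

lemma pr_add_left: "a \<in> St n V \<Longrightarrow> a' \<in> St n V \<Longrightarrow> pr (a + a') b Q = pr a b Q + pr a' b Q"
  unfolding pr_def using gsum_add[OF finite_mult_St finite_mult_St, of a n V a' n V b b Q] by (simp add: distrib_right)

lemma pr_add_right: "a \<in> St n V \<Longrightarrow> pr a (b + b') Q = pr a b Q + pr a b' Q"
  unfolding pr_def using gsum_add[OF finite_mult_St finite_mult_St, of a n V a n V b b' Q] by (simp add: distrib_left)

lemma pr_cong:
  assumes "a \<in> St n V" "\<And>F. F \<in> flags n V \<Longrightarrow> P F = Q F"
  shows "pr a b P = pr a b Q"
proof -
  have "{F. a F * b F \<noteq> 0 \<and> P F} = {F. a F * b F \<noteq> 0 \<and> Q F}"
    using St_flags[OF assms(1)] assms(2) by auto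
  then show ?thesis unfolding pr_def gsum_def by simp
qed

lemma phi_add_left: "a \<in> St n V \<Longrightarrow> a' \<in> St n V \<Longrightarrow> phi v p (a + a') b = phi v p a b + phi v p a' b"
  and phi_add_right: "a \<in> St n V \<Longrightarrow> phi v p a (b + b') = phi v p a b + phi v p a b'"
  unfolding phi_def by (auto intro: pr_add_left pr_add_right)

lemma pr_pb:
  assumes h: "lin_iso V W h" and a: "a \<in> St n W"
    and PQ: "\<And>F. F \<in> flags n V \<Longrightarrow> P F = Q (fimg h F)"
  shows "pr (pb n V h a) (pb n V h b) P = pr a b Q"
proof -
  have "pr (pb n V h a) (pb n V h b) P
      = gsum (\<lambda>F. if F \<in> flags n V then a (fimg h F) * b (fimg h F) else 0) P"
    unfolding pr_def pb_def by (rule gsum_cong) auto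
  also have "\<dots> = gsum (\<lambda>F. a F * b F) Q"
    using St_flags[OF a] PQ by (intro gsum_pb[OF h, where f = "\<lambda>F. a F * b F"]) auto
  finally show ?thesis by (simp add: pr_def)
qed

lemma phi_pb:
  assumes h: "lin_iso V W h" and a: "a \<in> St n W" and v: "v \<in> V"
  shows "phi v p (pb n V h a) (pb n V h b) = phi (h v) p a b"
  unfolding phi_def
proof (rule pr_pb[OF h a])
  fix F assume F: "F \<in> flags n V"
  have inj: "inj_on h V" using h by (simp add: lin_iso_def bij_betw_def)
  show "(v \<in> F p \<and> v \<notin> F (p - 1)) = (h v \<in> fimg h F p \<and> h v \<notin> fimg h F (p - 1))"
    using inj_on_image_mem_iff[OF inj v flags_le[OF F]] by (simp add: fimg_def)
qed

lemma sum_phi: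
  assumes a: "a \<in> St n V" and v: "v \<in> V" "v \<noteq> 0"
  shows "(\<Sum>p=1..n. phi v p a b) = pr a b (\<lambda>_. True)"
proof -
  let ?A = "{F. a F \<noteq> 0}"
  note fin = St_finite[OF a]
  have one: "(\<Sum>p=1..n. if v \<in> F p \<and> v \<notin> F (p - 1) then x else 0) = x" if F: "F \<in> flags n V" for F and x :: int
  proof -
    define e where "e = (LEAST i. v \<in> F i)"
    have vn: "v \<in> F n" using flagsD(3)[OF F] v by simp
    have e: "v \<in> F e" "e \<le> n" unfolding e_def using vn by (auto intro: LeastI Least_le)
    have e0: "0 < e" using flagsD(1)[OF F] e(1) v by (cases e) auto
    have l: "v \<in> F i \<longleftrightarrow> e \<le> i" for i
      using flags_mono[OF F, of e i] e(1) Least_le[of "\<lambda>i. v \<in> F i" i] unfolding e_def by blast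
    have "(v \<in> F p \<and> v \<notin> F (p - 1)) = (p = e)" if "p \<in> {1..n}" for p using that unfolding l by auto
    then have "(\<Sum>p=1..n. if v \<in> F p \<and> v \<notin> F (p - 1) then x else 0) = (\<Sum>p=1..n. if p = e then x else 0)"
      by (intro sum.cong) auto
    then show ?thesis using e e0 by simp
  qed
  have "(\<Sum>p=1..n. phi v p a b)
      = (\<Sum>p=1..n. \<Sum>F\<in>?A. if v \<in> F p \<and> v \<notin> F (p - 1) then a F * b F else 0)"
    unfolding phi_def pr_def by (intro sum.cong refl gsum_superset[OF fin]) auto
  also have "\<dots> = (\<Sum>F\<in>?A. \<Sum>p=1..n. if v \<in> F p \<and> v \<notin> F (p - 1) then a F * b F else 0)"
    by (rule sum.swap)
  also have "\<dots> = (\<Sum>F\<in>?A. a F * b F)" using one St_flags[OF a] by (intro sum.cong) auto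
  also have "\<dots> = pr a b (\<lambda>_. True)"
    unfolding pr_def by (subst gsum_superset[OF fin]) auto
  finally show ?thesis .
qed

text \<open>A common flag of the two products contains \<open>v\<close> and \<open>v + h\<close> at
  the level where it leaves \<open>H\<close>, hence also \<open>h\<close>; as \<open>h\<close> lies
  in \<open>H\<close>, it already lies in the term before. The two equal signs multiply to
  1.\<close>

lemma join_mult_iff:
  assumes v: "v \<notin> H" "subspace H" "V = span (insert v H)" and h: "h \<in> H"
    and F: "join n V v H a F * join n V (v + h) H b F \<noteq> 0"
  shows "F \<in> flags (Suc n) V" "res H F \<in> flags n H" "F = ins v (res H F) (lv H F)" "0 < lv H F" "lv H F \<le> Suc n"
    "v \<in> F (lv H F)" "h \<in> res H F (lv H F - 1)"
    "join n V v H a F * join n V (v + h) H b F = a (res H F) * b (res H F)"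
proof -
  have H: "covers H V" using v covers_span by simp
  have nz: "join n V v H a F \<noteq> 0" "join n V (v + h) H b F \<noteq> 0" using F by auto
  note J = join_nonzero[OF v(1) H nz(1)]
  show "F \<in> flags (Suc n) V" "res H F \<in> flags n H" "F = ins v (res H F) (lv H F)" "0 < lv H F" "lv H F \<le> Suc n"
    using J by blast+
  have vF: "v \<in> F (lv H F)" "v + h \<in> F (lv H F)"
    using nz by (auto simp: join_def split: if_splits)
  show "v \<in> F (lv H F)" by fact
  have "(v + h) - v \<in> F (lv H F)" using vF flags_subspace[OF J(1)] by (intro subspace_diff)
  then have hF: "h \<in> F (lv H F) \<inter> H" using h by simp
  have "F (lv H F) \<inter> H = F (lv H F - 1)"
    using flagsD(2)[OF J(1), of "lv H F - 1"] J(4,5) lv_props(3)[OF J(1) H] v(2) by (intro hyperplane_inter_eq) auto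
  then show "h \<in> res H F (lv H F - 1)" using hF J(4) by (simp add: res_def)
  show "join n V v H a F * join n V (v + h) H b F = a (res H F) * b (res H F)"
    using nz by (auto simp: join_def power_add[symmetric] split: if_splits)
qed

lemma join_mult_ins:
  assumes v: "v \<notin> H" "V = span (insert v H)" and h: "h \<in> E (p - 1)" and E: "E \<in> flags n H"
    and p: "0 < p" "p \<le> Suc n"
  shows "join n V v H a (ins v E p) * join n V (v + h) H b (ins v E p) = a E * b E"
proof -
  note F = ins_flags[OF E v(1) p, folded v(2)]
  have "h \<in> ins v E p p" using h p by (auto simp: ins_def intro: span_base)
  then have "v + h \<in> ins v E p p" using mem_ins[OF E v(1) p] flags_subspace[OF F] by (intro subspace_add)
  then show ?thesis
    using F mem_ins[OF E v(1) p] lv_ins[OF E v(1) p] res_ins[OF E v(1) p]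
    by (simp add: join_def power_add[symmetric])
qed

text \<open>A flag carrying the products contains \<open>v\<close> exactly from the level where it
  leaves \<open>H\<close>, so the condition of \<open>phi\<close> prescribes this level. What
  remains is a flag \<open>E\<close> of \<open>H\<close> with \<open>h\<close> in its term
  \<open>p - 1\<close>.\<close>

lemma phi_join:
  assumes v: "v \<notin> H" "subspace H" "V = span (insert v H)" and h: "h \<in> H" and a: "a \<in> St n H"
    and p: "0 < p" "p \<le> Suc n"
  shows "phi v p (join n V v H a) (join n V (v + h) H b) = pr a b (\<lambda>E. h \<in> E (p - 1))"
  unfolding phi_def pr_def
proof (rule gsum_reindex[where i = "res H" and j = "\<lambda>E. ins v E p"])
  have H: "covers H V" using v covers_span by simp
  fix F assume F: "join n V v H a F * join n V (v + h) H b F \<noteq> 0" "v \<in> F p \<and> v \<notin> F (p - 1)"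
  note J = join_mult_iff[OF v h F(1)]
  have "\<not> lv H F \<le> p - 1" using F(2) J(6) flags_mono[OF J(1), of "lv H F" "p - 1"] by blast
  moreover have "lv H F \<le> p" using F(2) v(1) lv_props(3)[OF J(1) H, of p] by (meson not_less subsetD)
  ultimately have "lv H F = p" by linarith
  then show "h \<in> res H F (p - 1) \<and> a (res H F) * b (res H F) = join n V v H a F * join n V (v + h) H b F \<and>
      ins v (res H F) p = F" using J by auto
next
  fix E assume E: "a E * b E \<noteq> 0" "h \<in> E (p - 1)"
  then have Ef: "E \<in> flags n H" using St_flags[OF a] by auto
  have "v \<notin> ins v E p (p - 1)" using p v(1) flags_le[OF Ef] by (auto simp: ins_def)
  then show "(v \<in> ins v E p p \<and> v \<notin> ins v E p (p - 1)) \<and>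
         join n V v H a (ins v E p) * join n V (v + h) H b (ins v E p) = a E * b E \<and> res H (ins v E p) = E"
    using mem_ins[OF Ef v(1) p] res_ins[OF Ef v(1) p] join_mult_ins[OF v(1,3) E(2) Ef p] by simp
qed

text \<open>By \<open>phi_join\<close> the difference retains the flags of \<open>H\<close> that
  have \<open>h\<close> in term \<open>p\<close> but not in term \<open>p - 1\<close>.\<close>

lemma phi_join_step:
  assumes v: "v \<notin> H" "subspace H" "V = span (insert v H)" and h: "h \<in> H" and a: "a \<in> St n H"
    and p: "0 < p" "p \<le> n"
  shows "phi v (Suc p) (join n V v H a) (join n V (v + h) H b) - phi v p (join n V v H a) (join n V (v + h) H b)
     = phi h p a b"
proof -
  note fin = St_finite[OF a]
  have "pr a b (\<lambda>E. h \<in> E p) - pr a b (\<lambda>E. h \<in> E (p - 1)) = phi h p a b"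
    unfolding phi_def pr_def
  proof (subst (1 2 3) gsum_superset[OF fin])
    show "(\<Sum>x | a x \<noteq> 0. if h \<in> x p then a x * b x else 0) - (\<Sum>x | a x \<noteq> 0. if h \<in> x (p - 1) then a x * b x else 0)
      = (\<Sum>x | a x \<noteq> 0. if h \<in> x p \<and> h \<notin> x (p - 1) then a x * b x else 0)"
      unfolding sum_subtractf[symmetric]
    proof (rule sum.cong[OF refl])
      fix E assume "E \<in> {E. a E \<noteq> 0}"
      then have "E \<in> flags n H" using St_flags[OF a] by simp
      then have "E (p - 1) \<subseteq> E p" using flags_mono by simp
      then show "(if h \<in> E p then a E * b E else 0) - (if h \<in> E (p - 1) then a E * b E else 0) =
         (if h \<in> E p \<and> h \<notin> E (p - 1) then a E * b E else 0)" by auto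
    qed
  qed auto
  then show ?thesis using phi_join[OF v h a, of "Suc p"] phi_join[OF v h a, of p] p by simp
qed

text \<open>By induction: chains of a hyperplane with the single common flag \<open>E\<close> are
  multiplied by the lines of \<open>v\<close> and \<open>v + h\<close>. Common flags insert
  \<open>v\<close> into \<open>E\<close> at a level after \<open>h\<close> has appeared, and
  \<open>h\<close> is chosen to appear as late as possible.\<close>

lemma exists_single_common_flag:
  assumes "flags n V \<noteq> {}"
  shows "\<exists>a\<in>St n V. \<exists>b\<in>St n V. \<exists>F\<in>flags n V. \<forall>G. a G * b G = (if G = F then 1 else 0)"
  using assms
proof (induction n arbitrary: V)
  case 0
  then obtain F where F: "F \<in> flags 0 V" by blast
  have eq: "G = F" if "G \<in> flags 0 V" for G
    using flagsD(3)[OF that] flagsD(3)[OF F] by (auto simp: fun_eq_iff)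
  let ?a = "\<lambda>G. if G = F then 1 else 0"
  have "?a \<in> St 0 V" unfolding St_def using F by auto
  then show ?case using F by (intro bexI[of _ ?a] bexI[of _ F]) auto
next
  case (Suc n)
  then obtain F where F: "F \<in> flags (Suc n) V" by blast
  define H where "H = F n"
  have H: "covers H V" using flagsD(2)[OF F, of n] flagsD(3)[OF F, of "Suc n"] by (simp add: H_def)
  have sH: "subspace H" using covers_subspace[OF H] by simp
  have "res H F \<in> flags n H" by (rule res_flags[OF F H])
  then obtain a b E where ab: "a \<in> St n H" "b \<in> St n H" "E \<in> flags n H"
    and one: "\<And>G. a G * b G = (if G = E then 1 else 0)" using Suc.IH[of H] by blast
  obtain v where v: "v \<in> V" "v \<notin> H" using covers_psubset[OF H] by blast
  have V: "V = span (insert v H)" by (rule covers_eq_span[OF H v])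
  \<comment> \<open>Such an \<open>h\<close> leaves only the last level \<open>Suc n\<close> for
    inserting \<open>v\<close>. For \<open>n = 0\<close> the vector 0 serves.\<close>
  obtain h where h: "h \<in> H" "\<And>p. p < n \<Longrightarrow> h \<notin> E p"
  proof (cases n)
    case 0
    then show thesis using that[of 0] subspace_0[OF sH] by simp
  next
    case (Suc k)
    then obtain h where "h \<in> E n" "h \<notin> E k" using covers_psubset[OF flagsD(2)[OF ab(3), of k]] by auto
    then show thesis using that[of h] flagsD(3)[OF ab(3)] flags_mono[OF ab(3)] Suc
      by (metis less_Suc_eq_le order_refl subsetD)
  qed
  have vh: "v + h \<notin> H" using subspace_diff[OF sH, of "v + h" h] h v by auto
  have Vm: "V = span (insert (v + h) H)"
  proof (rule covers_eq_span[OF H _ vh])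
    have "h \<in> V" using h(1) covers_subset[OF H] by blast
    then show "v + h \<in> V" using v covers_subspace[OF H] subspace_add by blast
  qed
  let ?a = "join n V v H a" let ?b = "join n V (v + h) H b" let ?F = "ins v E (Suc n)"
  have "?a G * ?b G = (if G = ?F then 1 else 0)" for G
  proof (cases "?a G * ?b G = 0")
    case True
    moreover have "?a ?F * ?b ?F = 1"
      using join_mult_ins[OF v(2) V, of h E "Suc n" n a b] ab(3) h(1) flagsD(3)[OF ab(3), of n] one by simp
    ultimately show ?thesis by auto
  next
    case False
    note J = join_mult_iff[OF v(2) sH V h(1) False]
    have "a (res H G) * b (res H G) \<noteq> 0" using False J(8) by simp
    then have r: "res H G = E" using one by (metis (full_types))
    then have "h \<in> E (lv H G - 1)" using J(7) by simp
    then have "\<not> lv H G - 1 < n" using h(2) by blast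
    then have l: "lv H G = Suc n" using J(4,5) by linarith
    have "G = ?F" using J(3) unfolding r l .
    then show ?thesis unfolding J(8) r by (simp add: one)
  qed
  moreover have "?F \<in> flags (Suc n) V" using ins_flags[OF ab(3) v(2), of "Suc n"] V by simp
  moreover have "?a \<in> St (Suc n) V" "?b \<in> St (Suc n) V"
    using join_St[OF V v(2) sH ab(1)] join_St[OF Vm vh sH ab(2)] by auto
  ultimately show ?case by blast
qed

section \<open>Classification of invariant forms\<close>

text \<open>
  Forms with values in a quotient \<open>A/N\<close> are represented by maps into \<open>A\<close> that are biadditive, respectively
  invariant, modulo \<open>N\<close>.
\<close>

definition biadditive :: "nat \<Rightarrow> 'b set \<Rightarrow> 'z::ab_group_add set \<Rightarrow> ('b fchain \<Rightarrow> 'b fchain \<Rightarrow> 'z) \<Rightarrow> bool" where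
  "biadditive n V N \<beta> \<longleftrightarrow>
     (\<forall>a\<in>St n V. \<forall>a'\<in>St n V. \<forall>b\<in>St n V. \<beta> (a + a') b - \<beta> a b - \<beta> a' b \<in> N) \<and>
     (\<forall>a\<in>St n V. \<forall>b\<in>St n V. \<forall>b'\<in>St n V. \<beta> a (b + b') - \<beta> a b - \<beta> a b' \<in> N)"

definition invariant :: "nat \<Rightarrow> 'b set \<Rightarrow> (('b \<Rightarrow> 'b) \<Rightarrow> bool) \<Rightarrow> 'z::ab_group_add set \<Rightarrow> ('b fchain \<Rightarrow> 'b fchain \<Rightarrow> 'z) \<Rightarrow> bool" where
  "invariant n V \<Gamma> N \<beta> \<longleftrightarrow> (\<forall>h a b. lin_iso V V h \<longrightarrow> \<Gamma> h \<longrightarrow> a \<in> St n V \<longrightarrow> b \<in> St n V \<longrightarrow>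
     \<beta> (pb n V h a) (pb n V h b) - \<beta> a b \<in> N)"

lemma biadditiveD:
  assumes "biadditive n V N \<beta>" "a \<in> St n V" "b \<in> St n V"
  shows "a' \<in> St n V \<Longrightarrow> \<beta> (a + a') b - \<beta> a b - \<beta> a' b \<in> N"
    and "b' \<in> St n V \<Longrightarrow> \<beta> a (b + b') - \<beta> a b - \<beta> a b' \<in> N"
  using assms unfolding biadditive_def by auto

lemma invariantD:
  "invariant n V \<Gamma> N \<beta> \<Longrightarrow> lin_iso V V h \<Longrightarrow> \<Gamma> h \<Longrightarrow> a \<in> St n V \<Longrightarrow> b \<in> St n V \<Longrightarrow>
     \<beta> (pb n V h a) (pb n V h b) - \<beta> a b \<in> N"
  unfolding invariant_def by blast

lemma biadditive_zero:
  assumes "biadditive n V N \<beta>" "add_subgroup N" "b \<in> St n V"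
  shows "\<beta> 0 b \<in> N" "\<beta> b 0 \<in> N"
proof -
  show "\<beta> 0 b \<in> N"
    using add_subgroup_minus[OF assms(2) biadditiveD(1)[OF assms(1) St_zero assms(3) St_zero]] by simp
  show "\<beta> b 0 \<in> N"
    using add_subgroup_minus[OF assms(2) biadditiveD(2)[OF assms(1) assms(3) St_zero St_zero]] by simp
qed

lemma biadditive_add_mem:
  assumes "biadditive n V N \<beta>" "add_subgroup N" "a \<in> St n V" "b \<in> St n V" "c \<in> St n V"
  shows "\<beta> a c \<in> N \<Longrightarrow> \<beta> b c \<in> N \<Longrightarrow> \<beta> (a + b) c \<in> N" "\<beta> c a \<in> N \<Longrightarrow> \<beta> c b \<in> N \<Longrightarrow> \<beta> c (a + b) \<in> N"
proof -
  assume "\<beta> a c \<in> N" "\<beta> b c \<in> N"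
  then have "(\<beta> (a + b) c - \<beta> a c - \<beta> b c) + (\<beta> a c + \<beta> b c) \<in> N"
    using assms biadditiveD(1) by (intro add_subgroup_add) auto
  then show "\<beta> (a + b) c \<in> N" by simp
next
  assume "\<beta> c a \<in> N" "\<beta> c b \<in> N"
  then have "(\<beta> c (a + b) - \<beta> c a - \<beta> c b) + (\<beta> c a + \<beta> c b) \<in> N"
    using assms biadditiveD(2) by (intro add_subgroup_add) auto
  then show "\<beta> c (a + b) \<in> N" by simp
qed

lemma join_scale: "c \<noteq> 0 \<Longrightarrow> join n V (scale c m) H b = join n V m H b"
proof -
  assume c: "c \<noteq> 0"
  have "scale c m \<in> F i \<longleftrightarrow> m \<in> F i" if "F \<in> flags (Suc n) V" for F i
    using subspace_scale[OF flags_subspace[OF that], of m i c]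
      subspace_scale[OF flags_subspace[OF that], of "scale c m" i "inverse c"] c by auto
  then show ?thesis by (auto simp: join_def fun_eq_iff)
qed

text \<open>The automorphism \<open>g\<close> of \<open>H\<close> is extended by fixing
  \<open>v\<close>, so that it carries \<open>v + h0\<close> to \<open>v + h\<close>. Symmetries of
  \<open>V\<close> fixing \<open>v\<close> thereby act on forms on \<open>St(H)\<close>.\<close>

lemma pb_join_extend:
  assumes v: "v \<notin> H" "V = span (insert v H)" and g: "lin_iso H H g" and h: "h0 \<in> H" "g h0 = h"
  obtains k where "lin_iso V V k" "k v = v"
    "\<And>a. pb (Suc n) V k (join n V v H a) = join n V v H (pb n H g a)"
    "\<And>b. pb (Suc n) V k (join n V (v + h) H b) = join n V (v + h0) H (pb n H g b)"
proof -
  have H: "subspace H" using g by (simp add: lin_iso_def)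
  obtain k where k: "lin_iso V V k" "\<And>x. x \<in> H \<Longrightarrow> k x = g x" "k v = v"
    using lin_iso_extend[OF g v(1) v(1)] v(2) by metis
  have kH: "k ` H = H" using k(2) g unfolding lin_iso_def bij_betw_def by (metis image_cong)
  have pbk: "pb n H k = pb n H g" by (rule pb_cong) (fact k(2))
  have HV: "H \<subseteq> V" "v \<in> V" using v span_superset[of "insert v H"] by auto
  have vh0: "v + h0 \<notin> H" using subspace_diff[OF H, of "v + h0" h0] h v by auto
  have "v + h0 \<in> V" using HV h subspace_add[of V v h0] v by auto
  then have V0: "V = span (insert (v + h0) H)"
    using covers_eq_span[OF covers_span[OF H v(1)], of "v + h0"] vh0 v by auto
  have "k (v + h0) = v + h" using k h HV unfolding lin_iso_def by (metis subsetD)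
  then have "pb (Suc n) V k (join n V (v + h) H b) = join n V (v + h0) H (pb n H g b)" for b
    using pb_join[OF k(1) H vh0 V0, of n b] kH pbk by simp
  moreover have "pb (Suc n) V k (join n V v H a) = join n V v H (pb n H g a)" for a
    using pb_join[OF k(1) H v, of n a] kH pbk k(3) by simp
  ultimately show thesis using that k by blast
qed

text \<open>An automorphism of \<open>H\<close> that fixes \<open>h\<close> extends to one of
  \<open>V\<close> that fixes \<open>v\<close> and \<open>v + h\<close>, hence preserves both
  families of products; so the induced form inherits invariance under the stabiliser of
  \<open>h\<close>.\<close>

lemma join_form:
  assumes v: "v \<notin> H" "V = span (insert v H)" "subspace H" and h: "h \<in> H"
    and \<beta>: "biadditive (Suc n) V N \<beta>" "invariant (Suc n) V (\<lambda>k. k v = v) N \<beta>"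
  defines "\<beta>' \<equiv> \<lambda>a b. \<beta> (join n V v H a) (join n V (v + h) H b)"
  shows "biadditive n H N \<beta>'" "invariant n H (\<lambda>k. k h = h) N \<beta>'"
    "a \<in> St n H \<Longrightarrow> join n V v H a \<in> St (Suc n) V" "b \<in> St n H \<Longrightarrow> join n V (v + h) H b \<in> St (Suc n) V"
proof -
  have vh: "v + h \<notin> H" using subspace_diff[OF v(3), of "v + h" h] h v by auto
  have HV: "H \<subseteq> V" "v \<in> V" using v span_superset[of "insert v H"] by auto
  then have "v + h \<in> V" using h subspace_add[of V v h] v by auto
  then have Vh: "V = span (insert (v + h) H)"
    using covers_eq_span[OF covers_span[OF v(3,1)], of "v + h"] vh v by auto
  show J: "a \<in> St n H \<Longrightarrow> join n V v H a \<in> St (Suc n) V" "b \<in> St n H \<Longrightarrow> join n V (v + h) H b \<in> St (Suc n) V" for a b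
    using join_St[OF v(2,1,3)] join_St[OF Vh vh v(3)] by auto
  show "biadditive n H N \<beta>'"
    unfolding biadditive_def \<beta>'_def join_add
    by (intro conjI ballI biadditiveD[OF \<beta>(1)] J)
  show "invariant n H (\<lambda>k. k h = h) N \<beta>'"
    unfolding invariant_def
  proof (intro allI impI)
    fix g a b assume g: "lin_iso H H g" "g h = h" and ab: "a \<in> St n H" "b \<in> St n H"
    obtain k where k: "lin_iso V V k" "k v = v"
      "\<And>a. pb (Suc n) V k (join n V v H a) = join n V v H (pb n H g a)"
      "\<And>b. pb (Suc n) V k (join n V (v + h) H b) = join n V (v + h) H (pb n H g b)"
      using pb_join_extend[OF v(1,2) g(1) h g(2), where n = n] by metis
    show "\<beta>' (pb n H g a) (pb n H g b) - \<beta>' a b \<in> N"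
      using invariantD[OF \<beta>(2) k(1,2) J(1)[OF ab(1)] J(2)[OF ab(2)]] k(3,4) by (simp add: \<beta>'_def)
  qed
qed

text \<open>
  The stabiliser of \<open>v\<close> permutes the complements of \<open>v\<close> transitively, so on the left it suffices to consider
  \<open>join n V v H a\<close> for one \<open>H\<close>; on the right \<open>join n V m H b\<close> with \<open>m = v + h\<close>, \<open>h \<in> H\<close>, suffices after scaling
  \<open>m\<close>. The case \<open>h = 0\<close> is governed by \<open>A\<close>, the case \<open>h \<noteq> 0\<close> by \<open>B\<close>.
\<close>

lemma line_forms_step:
  fixes \<beta> :: "'b fchain \<Rightarrow> 'b fchain \<Rightarrow> 'z \<Rightarrow>\<^sub>0 int"
  assumes A: "\<And>H (\<beta> :: 'b fchain \<Rightarrow> 'b fchain \<Rightarrow> 'z \<Rightarrow>\<^sub>0 int). subspace H \<Longrightarrow> biadditive n H N \<beta> \<Longrightarrow> invariant n H (\<lambda>_. True) N \<beta> \<Longrightarrow>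
      \<exists>t. \<forall>a\<in>St n H. \<forall>b\<in>St n H. \<beta> a b - frag_cmul (pr a b (\<lambda>_. True)) t \<in> N"
    and B: "\<And>H v (\<beta> :: 'b fchain \<Rightarrow> 'b fchain \<Rightarrow> 'z \<Rightarrow>\<^sub>0 int). subspace H \<Longrightarrow> v \<in> H \<Longrightarrow> v \<noteq> 0 \<Longrightarrow> biadditive n H N \<beta> \<Longrightarrow>
      invariant n H (\<lambda>k. k v = v) N \<beta> \<Longrightarrow>
      \<exists>t. \<forall>a\<in>St n H. \<forall>b\<in>St n H. \<beta> a b - (\<Sum>p=1..n. frag_cmul (phi v p a b) (t p)) \<in> N"
    and N: "add_subgroup N" and V: "subspace V" "v \<in> V" "v \<noteq> 0"
    and \<beta>: "biadditive (Suc n) V N \<beta>" "invariant (Suc n) V (\<lambda>k. k v = v) N \<beta>"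
  shows "\<exists>t. \<forall>a\<in>St (Suc n) V. \<forall>b\<in>St (Suc n) V. \<beta> a b - (\<Sum>p=1..Suc n. frag_cmul (phi v p a b) (t p)) \<in> N"
proof -
  obtain H where H: "subspace H" "v \<notin> H" "V = span (insert v H)"
    using complement_exists[OF V(1,2,2,3,3)] by metis
  have cov: "covers H V" using H covers_span by simp
  note jf = join_form[OF H(2,3,1) _ \<beta>]
  \<comment> \<open>Every automorphism fixes 0, so for \<open>h = 0\<close> the stabiliser is the
    whole linear group of \<open>H\<close>.\<close>
  have "invariant n H (\<lambda>_. True) N (\<lambda>a b. \<beta> (join n V v H a) (join n V (v + 0) H b))"
    using jf(2)[OF subspace_0[OF H(1)]] unfolding invariant_def by (metis lin_iso_zero)
  then obtain t0 where t0: "\<And>a b. a \<in> St n H \<Longrightarrow> b \<in> St n H \<Longrightarrow>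
      \<beta> (join n V v H a) (join n V (v + 0) H b) - frag_cmul (pr a b (\<lambda>_. True)) t0 \<in> N"
    using A[OF H(1) jf(1)[OF subspace_0[OF H(1)]]] by blast
  \<comment> \<open>One family of coefficients serves all non-zero \<open>h\<close>, since these are
    permuted transitively by automorphisms of \<open>H\<close>, which extend to symmetries of the
    form.\<close>
  obtain s where s: "\<And>h a b. h \<in> H \<Longrightarrow> h \<noteq> 0 \<Longrightarrow> a \<in> St n H \<Longrightarrow> b \<in> St n H \<Longrightarrow>
      \<beta> (join n V v H a) (join n V (v + h) H b) - (\<Sum>p=1..n. frag_cmul (phi h p a b) (s p)) \<in> N"
  proof (cases "\<exists>h0\<in>H. h0 \<noteq> 0")
    case True
    then obtain h0 where h0: "h0 \<in> H" "h0 \<noteq> 0" by blast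
    obtain s where s: "\<And>a b. a \<in> St n H \<Longrightarrow> b \<in> St n H \<Longrightarrow>
        \<beta> (join n V v H a) (join n V (v + h0) H b) - (\<Sum>p=1..n. frag_cmul (phi h0 p a b) (s p)) \<in> N"
      using B[OF H(1) h0 jf(1,2)[OF h0(1)]] by blast
    show thesis
    proof (rule that[of s])
      fix h a b assume h: "h \<in> H" "h \<noteq> 0" and ab: "a \<in> St n H" "b \<in> St n H"
      obtain g where g: "lin_iso H H g" "g h0 = h" using lin_iso_transitive[OF H(1) h0(1) h(1) h0(2) h(2)] .
      obtain k where k: "lin_iso V V k" "k v = v"
        "\<And>a. pb (Suc n) V k (join n V v H a) = join n V v H (pb n H g a)"
        "\<And>b. pb (Suc n) V k (join n V (v + h) H b) = join n V (v + h0) H (pb n H g b)"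
        using pb_join_extend[OF H(2,3) g(1) h0(1) g(2), where n = n] by metis
      let ?a = "pb n H g a" let ?b = "pb n H g b"
      let ?S = "\<Sum>p=1..n. frag_cmul (phi h p a b) (s p)"
      have "\<beta> (join n V v H ?a) (join n V (v + h0) H ?b) - \<beta> (join n V v H a) (join n V (v + h) H b) \<in> N"
        using invariantD[OF \<beta>(2) k(1,2) jf(3)[OF h(1) ab(1)] jf(4)[OF h(1) ab(2)]] k(3,4) by simp
      moreover have "\<beta> (join n V v H ?a) (join n V (v + h0) H ?b) - ?S \<in> N"
        using s[OF pb_St[OF g(1) ab(1)] pb_St[OF g(1) ab(2)]] phi_pb[OF g(1) ab(1) h0(1)] g(2) by simp
      ultimately show "\<beta> (join n V v H a) (join n V (v + h) H b) - ?S \<in> N"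
        using add_subgroup_diff[OF N] by fastforce
    qed
  next
    case False
    then show thesis using that[of "\<lambda>_. 0"] by blast
  qed
  \<comment> \<open>The values that the restrictions prescribe: \<open>t0\<close> from
    \<open>h = 0\<close> at index 0, \<open>s\<close> from \<open>h \<noteq> 0\<close> at the
    indices up to \<open>n\<close>. The value 0 at \<open>Suc n\<close> removes the last boundary
    term of the Abel summation, and \<open>t\<close> consists of the successive differences.\<close>
  define s' where "s' p = (if p = 0 then t0 else if p \<le> n then s p else 0)" for p
  define t where "t p = s' (p - 1) - s' p" for p
  define \<rho> where "\<rho> a b = (\<Sum>p=1..Suc n. frag_cmul (phi v p a b) (t p))" for a b
  define \<delta> where "\<delta> a b = \<beta> a b - \<rho> a b" for a b
  have bi: "biadditive (Suc n) V N \<delta>"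
    unfolding biadditive_def
  proof (intro conjI ballI)
    fix a a' b assume a: "a \<in> St (Suc n) V" "a' \<in> St (Suc n) V" "b \<in> St (Suc n) V"
    have "\<rho> (a + a') b = \<rho> a b + \<rho> a' b"
      unfolding \<rho>_def phi_add_left[OF a(1,2)] frag_cmul_distrib sum.distrib ..
    then show "\<delta> (a + a') b - \<delta> a b - \<delta> a' b \<in> N"
      using biadditiveD(1)[OF \<beta>(1) a(1,3,2)] by (simp add: \<delta>_def algebra_simps)
  next
    fix a b b' assume a: "a \<in> St (Suc n) V" "b \<in> St (Suc n) V" "b' \<in> St (Suc n) V"
    have "\<rho> a (b + b') = \<rho> a b + \<rho> a b'"
      unfolding \<rho>_def phi_add_right[OF a(1)] frag_cmul_distrib sum.distrib ..
    then show "\<delta> a (b + b') - \<delta> a b - \<delta> a b' \<in> N"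
      using biadditiveD(2)[OF \<beta>(1) a(1,2,3)] by (simp add: \<delta>_def algebra_simps)
  qed
  have inv: "\<delta> (pb (Suc n) V h a) (pb (Suc n) V h b) - \<delta> a b \<in> N"
    if h: "lin_iso V V h" "h v = v" and ab: "a \<in> St (Suc n) V" "b \<in> St (Suc n) V" for h a b
  proof -
    have "\<rho> (pb (Suc n) V h a) (pb (Suc n) V h b) = \<rho> a b"
      unfolding \<rho>_def using phi_pb[OF h(1) ab(1) V(2)] h(2) by simp
    then show ?thesis using invariantD[OF \<beta>(2) h ab] by (simp add: \<delta>_def)
  qed
  have gen: "\<delta> (join n V v H a) (join n V m H b) \<in> N"
    if ab: "a \<in> St n H" "b \<in> St n H" and m: "V = span (insert m H)" "m \<notin> H" for a b m
  proof -
    have "m \<in> span (insert v H)" using m(1) H(3) span_superset by blast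
    then obtain c where c: "m - scale c v \<in> H" using span_insert_mem[OF H(1)] by blast
    then have c0: "c \<noteq> 0" using m(2) by auto
    \<comment> \<open>Only the line of \<open>m\<close> matters, and its coordinate \<open>c\<close>
      along \<open>v\<close> is non-zero; dividing by \<open>c\<close> brings it into the form
      \<open>v + h\<close>.\<close>
    define h where "h = scale (inverse c) (m - scale c v)"
    have h: "h \<in> H" unfolding h_def using c H(1) by (intro subspace_scale)
    have "scale c h = m - scale c v" unfolding h_def using c0 by simp
    then have "m = scale c (v + h)" by (simp add: scale_right_distrib)
    then have jm: "join n V m H b = join n V (v + h) H b" using join_scale[OF c0] by simp
    let ?\<phi> = "\<lambda>p. phi v p (join n V v H a) (join n V (v + h) H b)"
    have "\<rho> (join n V v H a) (join n V (v + h) H b)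
        = frag_cmul (?\<phi> 1) (s' 0) + (\<Sum>p=1..n. frag_cmul (?\<phi> (Suc p) - ?\<phi> p) (s' p)) - frag_cmul (?\<phi> (Suc n)) (s' (Suc n))"
      unfolding \<rho>_def t_def by (rule frag_abel_summation)
    also have "\<dots> = frag_cmul (?\<phi> 1) t0 + (\<Sum>p=1..n. frag_cmul (phi h p a b) (s p))"
    proof -
      have "(\<Sum>p=1..n. frag_cmul (?\<phi> (Suc p) - ?\<phi> p) (s' p)) = (\<Sum>p=1..n. frag_cmul (phi h p a b) (s p))"
        using phi_join_step[OF H(2,1,3) h ab(1)] by (intro sum.cong) (auto simp: s'_def)
      then show ?thesis by (simp add: s'_def)
    qed
    also have "?\<phi> 1 = pr a b (\<lambda>E. h \<in> E 0)" using phi_join[OF H(2,1,3) h ab(1), of 1] by simp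
    finally have \<rho>: "\<rho> (join n V v H a) (join n V (v + h) H b)
      = frag_cmul (pr a b (\<lambda>E. h \<in> E 0)) t0 + (\<Sum>p=1..n. frag_cmul (phi h p a b) (s p))" .
    show ?thesis
    \<comment> \<open>The first term survives only for \<open>h = 0\<close>, since term 0 of a flag
      is \<open>{0}\<close>; the others survive only for \<open>h \<noteq> 0\<close>, since 0 never
      newly enters a flag. So \<open>t0\<close> and \<open>s\<close> do not interfere.\<close>
    proof (cases "h = 0")
      case True
      have z: "0 \<in> E i" if "E \<in> flags n H" for E i using subspace_0[OF flags_subspace[OF that]] .
      have "pr a b (\<lambda>E. h \<in> E 0) = pr a b (\<lambda>_. True)" using True z by (intro pr_cong[OF ab(1)]) auto
      moreover have "phi h p a b = 0" for p
      proof -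
        have "phi h p a b = pr a b (\<lambda>_. False)" unfolding phi_def using True z by (intro pr_cong[OF ab(1)]) auto
        then show ?thesis by (simp add: pr_def gsum_def)
      qed
      ultimately show ?thesis using t0[OF ab] \<rho> True by (simp add: jm \<delta>_def)
    next
      case False
      have "pr a b (\<lambda>E. h \<in> E 0) = pr a b (\<lambda>_. False)"
        using False flagsD(1) by (intro pr_cong[OF ab(1)]) auto
      then have "pr a b (\<lambda>E. h \<in> E 0) = 0" by (simp add: pr_def gsum_def)
      then show ?thesis using s[OF h False ab] \<rho> by (simp add: jm \<delta>_def)
    qed
  qed
  have gen2: "\<delta> (join n V v H a) b \<in> N" if a: "a \<in> St n H" and b: "b \<in> St (Suc n) V" for a b
  proof -
    note ja = jf(3)[OF subspace_0[OF H(1)] a]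
    show ?thesis
      using b cov
    proof (induction rule: St_induct_hyperplane)
      case zero
      then show ?case using biadditive_zero(2)[OF bi N ja] .
    next
      case (add a' b')
      then show ?case using biadditive_add_mem(2)[OF bi N _ _ ja] by blast
    next
      case (join m b')
      then show ?case using gen[OF a] by blast
    qed
  qed
  have gen3: "\<delta> a b \<in> N" if a: "a \<in> St (Suc n) V" and b: "b \<in> St (Suc n) V" for a b
    using a V(3,2)
  proof (induction rule: St_induct_line)
    case zero
    then show ?case using biadditive_zero(1)[OF bi N b] .
  next
    case (add a' b')
    then show ?case using biadditive_add_mem(1)[OF bi N _ _ b] by blast
  next
    case (join H' a')
    obtain h where h: "lin_iso V V h" "h v = v" "h ` H = H'"
      using lin_iso_complements[OF H join(3,2,1)] .
    have "lin_iso H H' h" using lin_iso_restrict[OF h(1) H(1)] h(3) H(3) span_superset by blast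
    then have "pb n H h a' \<in> St n H" using pb_St join(4) by blast
    moreover have "pb (Suc n) V h (join n V v H' a') = join n V v H (pb n H h a')"
      using pb_join[OF h(1) H, of n a'] h by simp
    ultimately have "\<delta> (pb (Suc n) V h (join n V v H' a')) (pb (Suc n) V h b) \<in> N"
      using gen2 pb_St[OF h(1) b] by simp
    moreover have "join n V v H' a' \<in> St (Suc n) V" using join_St[OF join(1,2,3,4)] .
    ultimately show ?case using inv[OF h(1,2) _ b] add_subgroup_diff[OF N]
      by (metis add_diff_cancel_left' diff_add_cancel)
  qed
  then show ?thesis unfolding \<delta>_def \<rho>_def by blast
qed

text \<open>
  Evaluating the form on two chains with a single common flag, and letting \<open>v\<close> run through vectors that enter
  that flag at the different levels, shows that the coefficients \<open>t p\<close> agree modulo \<open>N\<close>.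
\<close>

lemma GL_forms_step:
  fixes \<beta> :: "'b fchain \<Rightarrow> 'b fchain \<Rightarrow> 'z \<Rightarrow>\<^sub>0 int"
  assumes B: "\<And>v. v \<in> V \<Longrightarrow> v \<noteq> 0 \<Longrightarrow>
      \<exists>t. \<forall>a\<in>St n V. \<forall>b\<in>St n V. \<beta> a b - (\<Sum>p=1..n. frag_cmul (phi v p a b) (t p)) \<in> N"
    and N: "add_subgroup N" and V: "subspace V" "0 < n"
    and \<beta>: "biadditive n V N \<beta>" "invariant n V (\<lambda>_. True) N \<beta>"
  shows "\<exists>t. \<forall>a\<in>St n V. \<forall>b\<in>St n V. \<beta> a b - frag_cmul (pr a b (\<lambda>_. True)) t \<in> N"
proof (cases "flags n V = {}")
  \<comment> \<open>Without complete flags of length \<open>n\<close>, for instance if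
    \<open>V\<close> has another dimension, the group of cycles is zero.\<close>
  case True
  then have "a = 0" if "a \<in> St n V" for a
    using St_flags[OF that] by (auto simp: fun_eq_iff)
  moreover have "\<beta> 0 0 \<in> N" by (rule biadditive_zero(1)[OF \<beta>(1) N St_zero])
  ultimately show ?thesis by (intro exI[of _ 0]) auto
next
  case False
  obtain a0 b0 F where ab0: "a0 \<in> St n V" "b0 \<in> St n V" and F: "F \<in> flags n V"
    and one: "\<And>G. a0 G * b0 G = (if G = F then 1 else 0)"
    using exists_single_common_flag[OF False] by blast
  have ex: "\<exists>w. w \<in> F p \<and> w \<notin> F (p - 1)" if "p \<in> {1..n}" for p
  proof -
    have "covers (F (p - 1)) (F p)" using flagsD(2)[OF F, of "p - 1"] that by fastforce
    then show ?thesis using covers_psubset by blast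
  qed
  have w0: "w \<in> V" "w \<noteq> 0" if "w \<in> F p" "w \<notin> F (p - 1)" for w p
    using that flags_le[OF F] subspace_0[OF flags_subspace[OF F]] by auto
  obtain v where v: "v \<in> V" "v \<noteq> 0" using ex[of 1] w0 V(2) by (metis One_nat_def Suc_leI atLeastAtMost_iff order_refl)
  obtain t where t: "\<And>a b. a \<in> St n V \<Longrightarrow> b \<in> St n V \<Longrightarrow> \<beta> a b - (\<Sum>p=1..n. frag_cmul (phi v p a b) (t p)) \<in> N"
    using B[OF v] by blast
  define t0 where "t0 = \<beta> a0 b0"
  have tt: "t p - t0 \<in> N" if p: "p \<in> {1..n}" for p
  proof -
    obtain w where w: "w \<in> F p" "w \<notin> F (p - 1)" using ex[OF p] by blast
    obtain h where h: "lin_iso V V h" "h v = w" using lin_iso_transitive[OF V(1) v(1) w0(1)[OF w] v(2) w0(2)[OF w]] .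
    have "phi w k a0 b0 = (if k = p then 1 else 0)" if "k \<in> {1..n}" for k
    proof -
      have "phi w k a0 b0 = (if w \<in> F k \<and> w \<notin> F (k - 1) then 1 else 0)"
        unfolding phi_def pr_def by (subst gsum_superset[of "{F}"]) (auto simp: one split: if_splits)
      moreover have "w \<in> F k \<and> w \<notin> F (k - 1) \<longleftrightarrow> k = p"
      proof
        assume k: "w \<in> F k \<and> w \<notin> F (k - 1)"
        have "\<not> k \<le> p - 1" "\<not> p \<le> k - 1" using k w flags_mono[OF F] by blast+
        then show "k = p" by linarith
      qed (use w in simp)
      ultimately show ?thesis by simp
    qed
    then have "phi v k (pb n V h a0) (pb n V h b0) = (if k = p then 1 else 0)" if "k \<in> {1..n}" for k
      using phi_pb[OF h(1) ab0(1) v(1)] h(2) that by simp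
    then have "(\<Sum>k=1..n. frag_cmul (phi v k (pb n V h a0) (pb n V h b0)) (t k)) = (\<Sum>k=1..n. if k = p then t p else 0)"
      by (intro sum.cong) auto
    also have "\<dots> = t p" using p by simp
    finally have *: "\<beta> (pb n V h a0) (pb n V h b0) - t p \<in> N"
      using t[OF pb_St[OF h(1) ab0(1)] pb_St[OF h(1) ab0(2)]] by simp
    have "\<beta> (pb n V h a0) (pb n V h b0) - t0 \<in> N"
      unfolding t0_def by (rule invariantD[OF \<beta>(2) h(1) TrueI ab0])
    from add_subgroup_diff[OF N this *] show ?thesis by simp
  qed
  have "\<beta> a b - frag_cmul (pr a b (\<lambda>_. True)) t0 \<in> N" if ab: "a \<in> St n V" "b \<in> St n V" for a b
  proof -
    have "frag_cmul (pr a b (\<lambda>_. True)) t0 = (\<Sum>p=1..n. frag_cmul (phi v p a b) t0)"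
      using sum_phi[OF ab(1) v] frag_cmul_sum_left by metis
    then have "\<beta> a b - frag_cmul (pr a b (\<lambda>_. True)) t0
      = (\<beta> a b - (\<Sum>p=1..n. frag_cmul (phi v p a b) (t p))) + (\<Sum>p=1..n. frag_cmul (phi v p a b) (t p - t0))"
      by (simp add: frag_cmul_diff_right sum_subtractf)
    also have "\<dots> \<in> N"
      using tt by (intro add_subgroup_add[OF N] t[OF ab] add_subgroup_sum[OF N] add_subgroup_frag_cmul[OF N]) auto
    finally show ?thesis .
  qed
  then show ?thesis by blast
qed

text \<open>\<open>St 0 V\<close> is generated by \<open>E 1\<close>, so the value of a form on this
  generator determines it modulo \<open>N\<close>.\<close>

lemma GL_forms_0:
  fixes \<beta> :: "'b fchain \<Rightarrow> 'b fchain \<Rightarrow> 'z \<Rightarrow>\<^sub>0 int"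
  assumes N: "add_subgroup N" and \<beta>: "biadditive 0 V N \<beta>"
  shows "\<exists>t. \<forall>a\<in>St 0 V. \<forall>b\<in>St 0 V. \<beta> a b - frag_cmul (pr a b (\<lambda>_. True)) t \<in> N"
proof -
  define E :: "int \<Rightarrow> 'b fchain" where "E k = (\<lambda>F. if F \<in> flags 0 V then k else 0)" for k
  have uniq: "F = (\<lambda>_. V)" if "F \<in> flags 0 V" for F using flagsD(3)[OF that] by (simp add: fun_eq_iff)
  have E: "E k \<in> St 0 V" for k
    unfolding St_def E_def
    by (auto intro: finite_subset[of _ "{\<lambda>_. V}"] dest!: uniq split: if_splits)
  have Ea: "a = E (a (\<lambda>_. V))" if "a \<in> St 0 V" for a
  proof
    fix F show "a F = E (a (\<lambda>_. V)) F"
      using St_flags[OF that, of F] uniq[of F] by (auto simp: E_def)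
  qed
  have E_add: "E k + E l = E (k + l)" for k l by (auto simp: E_def fun_eq_iff)
  define t where "t = \<beta> (E 1) (E 1)"
  define \<delta> where "\<delta> a b = \<beta> a b - frag_cmul (pr a b (\<lambda>_. True)) t" for a b
  have bi: "biadditive 0 V N \<delta>"
    unfolding biadditive_def
  proof (intro conjI ballI)
    fix a a' b assume a: "a \<in> St 0 V" "a' \<in> St 0 V" "b \<in> St 0 V"
    show "\<delta> (a + a') b - \<delta> a b - \<delta> a' b \<in> N"
      using biadditiveD(1)[OF \<beta> a(1,3,2)] unfolding \<delta>_def pr_add_left[OF a(1,2)] frag_cmul_distrib
      by (simp add: algebra_simps)
  next
    fix a b b' assume a: "a \<in> St 0 V" "b \<in> St 0 V" "b' \<in> St 0 V"
    show "\<delta> a (b + b') - \<delta> a b - \<delta> a b' \<in> N"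
      using biadditiveD(2)[OF \<beta> a(1,2,3)] unfolding \<delta>_def pr_add_right[OF a(1)] frag_cmul_distrib
      by (simp add: algebra_simps)
  qed
  \<comment> \<open>Additivity holds only modulo \<open>N\<close>, so an integer is reached from 0
    and 1 by adding and by cancelling.\<close>
  have ind: "P k" if "P 0" "P 1" "\<And>k l. P k \<Longrightarrow> P l \<Longrightarrow> P (k + l)" "\<And>k l. P (k + l) \<Longrightarrow> P l \<Longrightarrow> P k" for P and k :: int
  proof (induction k rule: int_induct[of _ 0])
    case base
    show ?case by (rule that(1))
  next
    case (step1 i)
    show ?case by (rule that(3)[OF step1(2) that(2)])
  next
    case (step2 i)
    then show ?case using that(4)[of "i - 1" 1] that(2) by simp
  qed
  have \<delta>1: "\<delta> (E 1) (E 1) \<in> N"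
  proof (cases "flags 0 V = {}")
    case True
    then have "E 1 = 0" by (simp add: E_def fun_eq_iff)
    then show ?thesis using biadditive_zero(1)[OF bi N St_zero] by metis
  next
    case False
    then have V: "(\<lambda>_. V) \<in> flags 0 V" using uniq by auto
    have "pr (E 1) (E 1) (\<lambda>_. True) = 1"
      unfolding pr_def by (subst gsum_superset[of "{\<lambda>_. V}"]) (use V in \<open>auto simp: E_def dest: uniq split: if_splits\<close>)
    then show ?thesis by (simp add: \<delta>_def t_def add_subgroup_0[OF N])
  qed
  have cancel: "x \<in> N" if "x + y \<in> N" "y \<in> N" for x y :: "'z \<Rightarrow>\<^sub>0 int"
    using add_subgroup_diff[OF N that] by simp
  have 1: "\<delta> (E k) (E 1) \<in> N" for k
  proof (rule ind[of "\<lambda>k. \<delta> (E k) (E 1) \<in> N"])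
    show "\<delta> (E 0) (E 1) \<in> N" using biadditive_zero(1)[OF bi N E] by (simp add: E_def zero_fun_def)
  next
    fix k l assume "\<delta> (E k) (E 1) \<in> N" "\<delta> (E l) (E 1) \<in> N"
    then show "\<delta> (E (k + l)) (E 1) \<in> N" using biadditive_add_mem(1)[OF bi N E E E, of k 1 l] by (simp add: E_add)
  next
    fix k l assume *: "\<delta> (E (k + l)) (E 1) \<in> N" "\<delta> (E l) (E 1) \<in> N"
    have "\<delta> (E (k + l)) (E 1) - \<delta> (E k) (E 1) - \<delta> (E l) (E 1) \<in> N"
      using biadditiveD(1)[OF bi E E E, of k l 1] by (simp add: E_add)
    from add_subgroup_diff[OF N *(1) this] have "\<delta> (E k) (E 1) + \<delta> (E l) (E 1) \<in> N" by (simp add: algebra_simps)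
    then show "\<delta> (E k) (E 1) \<in> N" using cancel *(2) by blast
  qed (fact \<delta>1)
  have 2: "\<delta> (E k) (E l) \<in> N" for k l
  proof (rule ind[of "\<lambda>l. \<delta> (E k) (E l) \<in> N" l])
    show "\<delta> (E k) (E 0) \<in> N" using biadditive_zero(2)[OF bi N E] by (simp add: E_def zero_fun_def)
  next
    fix m l assume "\<delta> (E k) (E m) \<in> N" "\<delta> (E k) (E l) \<in> N"
    then show "\<delta> (E k) (E (m + l)) \<in> N" using biadditive_add_mem(2)[OF bi N E E E, of k m l] by (simp add: E_add)
  next
    fix m l assume *: "\<delta> (E k) (E (m + l)) \<in> N" "\<delta> (E k) (E l) \<in> N"
    have "\<delta> (E k) (E (m + l)) - \<delta> (E k) (E m) - \<delta> (E k) (E l) \<in> N"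
      using biadditiveD(2)[OF bi E E E, of k m l] by (simp add: E_add)
    from add_subgroup_diff[OF N *(1) this] have "\<delta> (E k) (E m) + \<delta> (E k) (E l) \<in> N" by (simp add: algebra_simps)
    then show "\<delta> (E k) (E m) \<in> N" using cancel *(2) by blast
  qed (fact 1)
  show ?thesis
  proof (intro exI ballI)
    fix a b assume "a \<in> St 0 V" "b \<in> St 0 V"
    then show "\<beta> a b - frag_cmul (pr a b (\<lambda>_. True)) t \<in> N" using 2 Ea unfolding \<delta>_def by metis
  qed
qed

text \<open>The two statements carry each other: in degree \<open>Suc n\<close> the second follows
  from both in degree \<open>n\<close>, and the first from the second in degree
  \<open>Suc n\<close>, applied to every non-zero vector.\<close>

theorem GL_forms:
  fixes \<beta> :: "'b fchain \<Rightarrow> 'b fchain \<Rightarrow> 'z \<Rightarrow>\<^sub>0 int"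
  assumes N: "add_subgroup N"
  shows "subspace V \<Longrightarrow> biadditive n V N \<beta> \<Longrightarrow> invariant n V (\<lambda>_. True) N \<beta> \<Longrightarrow>
      \<exists>t. \<forall>a\<in>St n V. \<forall>b\<in>St n V. \<beta> a b - frag_cmul (pr a b (\<lambda>_. True)) t \<in> N" (is "_ \<Longrightarrow> _ \<Longrightarrow> _ \<Longrightarrow> ?A n V \<beta>")
    and "subspace V \<Longrightarrow> v \<in> V \<Longrightarrow> v \<noteq> 0 \<Longrightarrow> biadditive n V N \<beta> \<Longrightarrow> invariant n V (\<lambda>k. k v = v) N \<beta> \<Longrightarrow>
      \<exists>t. \<forall>a\<in>St n V. \<forall>b\<in>St n V. \<beta> a b - (\<Sum>p=1..n. frag_cmul (phi v p a b) (t p)) \<in> N"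
proof (induction n arbitrary: V v \<beta>)
  case 0
  {
    case 1
    show ?case by (rule GL_forms_0[OF N 1(2)])
  next
    case 2
    have "flags 0 V = {}"
    proof (rule ccontr)
      assume "flags 0 V \<noteq> {}"
      then obtain F where F: "F \<in> flags 0 V" by blast
      then show False using flagsD(1)[OF F] flagsD(3)[OF F, of 0] 2 by auto
    qed
    then have "a = 0" if "a \<in> St 0 V" for a using St_flags[OF that] by (auto simp: fun_eq_iff)
    moreover have "\<beta> 0 0 \<in> N" by (rule biadditive_zero(1)[OF 2(4) N St_zero])
    ultimately show ?case by auto
  }
next
  case (Suc n)
  {
    case 1
    show ?case
    proof (rule GL_forms_step[OF _ N 1(1) _ 1(2,3)])
      fix v assume v: "v \<in> V" "v \<noteq> 0"
      show "\<exists>t. \<forall>a\<in>St (Suc n) V. \<forall>b\<in>St (Suc n) V. \<beta> a b - (\<Sum>p = 1..Suc n. frag_cmul (phi v p a b) (t p)) \<in> N"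
        using 1(3) by (intro line_forms_step[OF Suc.IH N 1(1) v 1(2)]) (auto simp: invariant_def)
    qed simp
  next
    case 2
    show ?case by (rule line_forms_step[OF Suc.IH N 2])
  }
qed

section \<open>Dimensions of the terms of a flag\<close>

lemma flags_basis:
  assumes F: "F \<in> flags n V" "i \<le> n"
  shows "\<exists>B. finite B \<and> independent B \<and> card B = i \<and> span B = F i"
  using F(2)
proof (induction i)
  case 0
  then show ?case using flagsD(1)[OF F(1)] by (intro exI[of _ "{}"]) (auto simp: independent_empty)
next
  case (Suc i)
  then obtain B where B: "finite B" "independent B" "card B = i" "span B = F i" by auto
  have cov: "covers (F i) (F (Suc i))" using flagsD(2)[OF F(1)] Suc.prems by simp
  then obtain v where v: "v \<in> F (Suc i)" "v \<notin> F i" using covers_psubset by blast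
  then have vB: "v \<notin> span B" "v \<notin> B" using B by (auto intro: span_base)
  have "span (insert v B) = F (Suc i)"
  proof
    show "span (insert v B) \<subseteq> F (Suc i)"
      using v B(4) span_superset[of B] covers_subset[OF cov] covers_subspace(2)[OF cov] by (intro span_minimal) auto
    have "F (Suc i) = span (insert v (span B))" using covers_eq_span[OF cov v] B(4) by simp
    also have "\<dots> \<subseteq> span (insert v B)"
      by (intro span_minimal) (auto intro: span_base subsetD[OF span_mono])
    finally show "F (Suc i) \<subseteq> span (insert v B)" .
  qed
  then show ?case using B vB independent_insertI[OF vB(1) B(2)] by (intro exI[of _ "insert v B"]) auto
qed

lemma flags_dim: "F \<in> flags n V \<Longrightarrow> i \<le> n \<Longrightarrow> dim (F i) = i"
  using flags_basis[of F n V i] dim_span_eq_card_independent by metis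

lemma dim_psubset:
  assumes XY: "subspace X" "X \<subset> Y" and T: "Y \<subseteq> span T" "finite T"
  shows "dim X < dim Y"
proof -
  obtain B where B: "B \<subseteq> X" "independent B" "X \<subseteq> span B" "card B = dim X"
    using basis_exists by metis
  have sB: "span B = X" using B XY span_minimal by blast
  obtain v where v: "v \<in> Y" "v \<notin> X" using XY by blast
  have "independent (insert v B)" using independent_insertI[of v B] v B sB by auto
  moreover have "insert v B \<subseteq> Y" using v B XY by blast
  ultimately obtain D where D: "insert v B \<subseteq> D" "D \<subseteq> Y" "independent D" "Y \<subseteq> span D"
    using maximal_independent_subset_extend by metis
  have fD: "finite D" using independent_span_bound[OF T(2) D(3)] D(2) T(1) by auto
  have "v \<notin> B" using v B by blast
  then have "card B < card (insert v B)" using fD D(1) finite_subset by fastforce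
  also have "\<dots> \<le> card D" using fD D(1) card_mono by blast
  also have "\<dots> = dim Y" using basis_card_eq_dim[OF D(2,4,3)] .
  finally show ?thesis using B by simp
qed

text \<open>The \<open>i\<close> strict inclusions up to \<open>G i\<close> bound its dimension from
  below, and the \<open>n - i\<close> inclusions above it bound it from above.\<close>

lemma strict_chain_dim:
  assumes F: "F \<in> flags n V" and s: "\<And>i. i \<le> n \<Longrightarrow> subspace (G i)" "\<And>i. i < n \<Longrightarrow> G i \<subset> G (Suc i)"
    and G: "G n = V" and i: "i \<le> n"
  shows "dim (G i) = i"
proof -
  obtain T where T: "finite T" "span T = V" using flags_basis[OF F order_refl] flagsD(3)[OF F] by auto
  have GV: "G i \<subseteq> V" if "i \<le> n" for i
    using that
  proof (induction rule: inc_induct)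
    case base then show ?case using G by simp
  next
    case (step j) then show ?case using s(2)[of j] by auto
  qed
  have lt: "dim (G i) < dim (G (Suc i))" if "i < n" for i
    using that GV[of "Suc i"] by (intro dim_psubset[OF s(1) s(2) _ T(1)]) (auto simp: T(2))
  have lo: "i \<le> dim (G i)" if "i \<le> n" for i
    using that
  proof (induction i)
    case (Suc j) then show ?case using lt[of j] by linarith
  qed simp
  have hi: "dim (G i) + (n - i) \<le> n" if "i \<le> n" for i
    using that
  proof (induction rule: inc_induct)
    case base then show ?case using flags_dim[OF F order_refl] flagsD(3)[OF F] G by simp
  next
    case (step j) then show ?case using lt[of j] by simp
  qed
  show ?thesis using lo[OF i] hi[OF i] i by simp
qed

text \<open>The simplices of the building are only strict chains. In maximal length the dimensions
  leave no room between consecutive terms, so these are covering pairs.\<close>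

lemma strict_chain_flags:
  assumes F: "F \<in> flags n V" and s: "\<And>i. i \<le> n \<Longrightarrow> subspace (G i)" "\<And>i. i < n \<Longrightarrow> G i \<subset> G (Suc i)"
    and G: "G 0 = {0}" "\<And>i. n \<le> i \<Longrightarrow> G i = V"
  shows "G \<in> flags n V"
proof -
  have Gn: "G n = V" using G(2) by simp
  note d = strict_chain_dim[OF F s Gn]
  obtain T where T: "finite T" "span T = V" using flags_basis[OF F order_refl] flagsD(3)[OF F] by auto
  have GV: "G i \<subseteq> V" if "i \<le> n" for i
    using that
  proof (induction rule: inc_induct)
    case base then show ?case using Gn by simp
  next
    case (step j) then show ?case using s(2)[of j] by auto
  qed
  have "covers (G i) (G (Suc i))" if i: "i < n" for i
  proof -
    obtain v where v: "v \<in> G (Suc i)" "v \<notin> G i" using s(2)[OF i] by blast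
    have sub: "span (insert v (G i)) \<subseteq> G (Suc i)" using v s(1)[of "Suc i"] s(2)[OF i] i by (intro span_minimal) auto
    have "G i \<subset> span (insert v (G i))" using v span_superset[of "insert v (G i)"] by auto
    then have "dim (G i) < dim (span (insert v (G i)))"
      using s(1)[of i] i sub GV[of "Suc i"] by (intro dim_psubset[OF _ _ _ T(1)]) (auto simp: T(2))
    moreover have "dim (span (insert v (G i))) < dim (G (Suc i))" if "span (insert v (G i)) \<noteq> G (Suc i)"
      using that sub GV[of "Suc i"] i by (intro dim_psubset[OF subspace_span _ _ T(1)]) (auto simp: T(2))
    ultimately have "span (insert v (G i)) = G (Suc i)" using d[of i] d[of "Suc i"] i by fastforce
    then show ?thesis unfolding covers_def using s(1)[of i] i v by auto
  qed
  then show ?thesis using G unfolding flags_def by auto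
qed

end

section \<open>Complete flags of \<open>F\<^sup>n\<close> as functions\<close>

definition fscale :: "'f::field \<Rightarrow> (nat \<Rightarrow> 'f) \<Rightarrow> nat \<Rightarrow> 'f" where
  "fscale c v = (\<lambda>i. c * v i)"

interpretation vs: vspace fscale
  by (unfold vspace_def vector_space_def) (auto simp: fscale_def fun_eq_iff algebra_simps)

text \<open>Vectors of all lengths share one type, which is not an abelian group. Extension by zero
  places every \<open>carrier_vec n\<close> as \<open>EE n\<close> in the vector space of functions,
  where the locale \<open>vspace\<close> applies.\<close>

definition emb :: "'f::field vec \<Rightarrow> nat \<Rightarrow> 'f" where
  "emb v = (\<lambda>i. if i < dim_vec v then v $ i else 0)"

abbreviation unemb :: "nat \<Rightarrow> (nat \<Rightarrow> 'f) \<Rightarrow> 'f vec" where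
  "unemb n f \<equiv> vec n f"

definition EE :: "nat \<Rightarrow> (nat \<Rightarrow> 'f::field) set" where
  "EE n = {f. \<forall>i\<ge>n. f i = 0}"

lemma emb_EE: "v \<in> carrier_vec n \<Longrightarrow> emb v \<in> EE n"
  by (auto simp: emb_def EE_def)

lemma unemb_emb: "v \<in> carrier_vec n \<Longrightarrow> unemb n (emb v) = v"
  by (auto simp: emb_def)

lemma emb_unemb: "f \<in> EE n \<Longrightarrow> emb (unemb n f) = f"
  by (auto simp: emb_def EE_def fun_eq_iff)

lemma emb_add: "u \<in> carrier_vec n \<Longrightarrow> v \<in> carrier_vec n \<Longrightarrow> emb (u + v) = emb u + emb v"
  by (auto simp: emb_def fun_eq_iff)

lemma emb_smult: "emb (c \<cdot>\<^sub>v v) = fscale c (emb v)"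
  by (auto simp: emb_def fscale_def fun_eq_iff)

lemma emb_zero: "emb (0\<^sub>v n) = 0"
  by (auto simp: emb_def fun_eq_iff)

lemma inj_on_emb: "inj_on emb (carrier_vec n)"
  using unemb_emb by (metis inj_onI)

lemma emb_carrier: "emb ` carrier_vec n = (EE n :: (nat \<Rightarrow> 'f::field) set)"
proof
  show "(EE n :: (nat \<Rightarrow> 'f) set) \<subseteq> emb ` carrier_vec n"
  proof (rule subsetI)
    fix f :: "nat \<Rightarrow> 'f" assume "f \<in> EE n"
    then have "f = emb (unemb n f)" by (simp add: emb_unemb)
    then show "f \<in> emb ` carrier_vec n" by (rule image_eqI[where x = "unemb n f"]) simp
  qed
qed (auto intro: emb_EE)

lemma unemb_image: "U \<subseteq> carrier_vec n \<Longrightarrow> unemb n ` emb ` U = U"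
proof -
  assume "U \<subseteq> carrier_vec n"
  then have "(\<lambda>v. unemb n (emb v)) ` U = (\<lambda>v. v) ` U" by (intro image_cong refl unemb_emb) blast
  then show ?thesis by (simp add: image_image)
qed

lemma emb_image: "X \<subseteq> EE n \<Longrightarrow> emb ` unemb n ` X = X"
proof -
  assume "X \<subseteq> EE n"
  then have "(\<lambda>f. emb (unemb n f)) ` X = (\<lambda>f. f) ` X" by (intro image_cong refl emb_unemb) blast
  then show ?thesis by (simp add: image_image)
qed

lemma subspace_EE: "vs.subspace (EE n)"
  by (rule vs.subspaceI) (auto simp: EE_def fscale_def)

lemma subspace_vec_iff:
  "subspace (class_ring :: 'f::field ring) U (module_vec TYPE('f) n) \<longleftrightarrow>
     U \<subseteq> carrier_vec n \<and> vs.subspace (emb ` U)" (is "?L \<longleftrightarrow> ?R")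
proof
  assume ?L
  then have sm: "submodule (class_ring :: 'f ring) U (module_vec TYPE('f) n)" by (simp add: VectorSpace.subspace_def)
  note s = submodule.subset[OF sm] submodule.m_closed[OF sm] submodule.zero_closed[OF sm] submodule.smult_closed[OF sm]
  have U: "U \<subseteq> carrier_vec n" using s(1) by (simp add: module_vec_simps)
  show ?R
  proof (intro conjI U vs.subspaceI)
    show "0 \<in> emb ` U" using s(3) emb_zero[of n] by (metis image_eqI module_vec_simps(2))
  next
    fix x y assume "x \<in> emb ` U" "y \<in> emb ` U"
    then obtain u v where uv: "u \<in> U" "v \<in> U" "x = emb u" "y = emb v" by blast
    have "u + v \<in> U" using s(2)[OF uv(1,2)] by (simp add: module_vec_simps)
    moreover have "x + y = emb (u + v)" using emb_add[of u n v] U uv by (metis subsetD)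
    ultimately show "x + y \<in> emb ` U" by blast
  next
    fix c x assume "x \<in> emb ` U"
    then obtain u where u: "u \<in> U" "x = emb u" by blast
    have "c \<cdot>\<^sub>v u \<in> U" using s(4)[OF _ u(1), of c] by (simp add: module_vec_simps class_ring_simps)
    then show "fscale c x \<in> emb ` U" using u emb_smult by (metis image_eqI)
  qed
next
  assume R: ?R
  have mem: "u \<in> U" if "u \<in> carrier_vec n" "emb u \<in> emb ` U" for u
    using that R inj_on_emb[of n] by (auto dest: inj_onD)
  show ?L
    unfolding VectorSpace.subspace_def submodule_def
  proof (intro conjI vec_vs vec_module allI impI)
    show "U \<subseteq> carrier (module_vec TYPE('f) n)" using R by (simp add: module_vec_simps)
    show "\<zero>\<^bsub>module_vec TYPE('f) n\<^esub> \<in> U"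
    proof -
      have "0 \<in> emb ` U" using R vs.subspace_0 by blast
      then have "0\<^sub>v n \<in> U" by (intro mem) (simp_all add: emb_zero)
      then show ?thesis by (simp add: module_vec_simps)
    qed
  next
    fix u v assume uv: "u \<in> U" "v \<in> U"
    have "emb u + emb v \<in> emb ` U" using R uv by (intro vs.subspace_add) auto
    then show "u \<oplus>\<^bsub>module_vec TYPE('f) n\<^esub> v \<in> U"
      using R uv emb_add[of u n v, symmetric] by (intro mem) (simp_all add: module_vec_simps subset_iff)
  next
    fix c u assume u: "u \<in> U"
    have "fscale c (emb u) \<in> emb ` U" using R u by (intro vs.subspace_scale) auto
    then show "c \<odot>\<^bsub>module_vec TYPE('f) n\<^esub> u \<in> U"
      using R u emb_smult[of c u, symmetric] by (intro mem) (simp_all add: module_vec_simps subset_iff)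
  qed
qed

text \<open>Witness that \<open>EE n\<close> has dimension \<open>n\<close>; the dimension counts
  for simplices and the class of pairing 1 rest on it.\<close>

lemma standard_flag: "(\<lambda>i. EE (min i n)) \<in> vs.flags n (EE n :: (nat \<Rightarrow> 'f::field) set)"
  unfolding vs.flags_def
proof (intro CollectI conjI allI impI)
  show "EE (min 0 n) = ({0} :: (nat \<Rightarrow> 'f) set)" by (auto simp: EE_def fun_eq_iff)
next
  fix i assume i: "i < n"
  define e :: "nat \<Rightarrow> 'f" where "e = (\<lambda>j. if j = i then 1 else 0)"
  have "EE (Suc i) = vs.span (insert e (EE i))"
  proof
    show "vs.span (insert e (EE i)) \<subseteq> EE (Suc i)"
      by (intro vs.span_minimal subspace_EE) (auto simp: e_def EE_def)
    show "EE (Suc i) \<subseteq> vs.span (insert e (EE i))"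
    proof
      fix x :: "nat \<Rightarrow> 'f" assume "x \<in> EE (Suc i)"
      then have "x - fscale (x i) e \<in> EE i" by (auto simp: EE_def e_def fscale_def)
      then show "x \<in> vs.span (insert e (EE i))" using vs.span_insert_mem[OF subspace_EE] by blast
    qed
  qed
  moreover have "e \<notin> EE i" by (auto simp: EE_def e_def)
  ultimately have "vs.covers (EE i) (EE (Suc i) :: (nat \<Rightarrow> 'f) set)"
    unfolding vs.covers_def using subspace_EE by blast
  then show "vs.covers (EE (min i n)) (EE (min (Suc i) n) :: (nat \<Rightarrow> 'f) set)" using i by (simp add: min_def)
qed (simp add: min_def)

section \<open>Lists of subspaces and flags as functions\<close>

definition toF :: "nat \<Rightarrow> 'f::field flag \<Rightarrow> (nat \<Rightarrow> 'f) fullflag" where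
  "toF n xs = (\<lambda>i. emb ` (full_flag n xs ! min i n))"

definition fromF :: "nat \<Rightarrow> (nat \<Rightarrow> 'f::field) fullflag \<Rightarrow> 'f flag" where
  "fromF n F = map (\<lambda>i. unemb n ` F i) [1..<n]"

lemma proper_subspaces_iff:
  "U \<in> proper_subspaces n \<longleftrightarrow> U \<subseteq> carrier_vec n \<and> vs.subspace (emb ` U) \<and> U \<noteq> {0\<^sub>v n} \<and> U \<noteq> carrier_vec n"
  unfolding proper_subspaces_def subspace_vec_iff by auto

text \<open>For positive \<open>n\<close> a unit vector separates \<open>{0}\<close> from the whole
  space, so adding the outer terms keeps the chain strict.\<close>

lemma full_flag_sorted:
  fixes xs :: "'f::field flag"
  assumes "xs \<in> tits_simplices n k" "0 < n"
  shows "sorted_wrt (\<subset>) (full_flag n xs)" "\<forall>U \<in> set (full_flag n xs). U \<subseteq> carrier_vec n \<and> vs.subspace (emb ` U)"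
proof -
  have xs: "set xs \<subseteq> proper_subspaces n" "sorted_wrt (\<subset>) xs" using assms by (auto simp: tits_simplices_def)
  have z: "{0\<^sub>v n} \<subset> U" if "U \<in> proper_subspaces n" for U
  proof -
    have U: "U \<subseteq> carrier_vec n" "vs.subspace (emb ` U)" "U \<noteq> {0\<^sub>v n}" using that by (auto simp: proper_subspaces_iff)
    have "emb (0\<^sub>v n) \<in> emb ` U" using vs.subspace_0[OF U(2)] emb_zero by metis
    then have "0\<^sub>v n \<in> U" using inj_on_emb[of n] U(1) by (auto dest: inj_onD)
    then show ?thesis using U by blast
  qed
  have "0\<^sub>v n \<noteq> (unit_vec n 0 :: 'f vec)" using assms(2) by (metis index_unit_vec(1) index_zero_vec(1) zero_neq_one)
  then have "{0\<^sub>v n} \<subset> (carrier_vec n :: 'f vec set)" using unit_vec_carrier[of n 0] zero_carrier_vec[of n]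
    by (metis empty_subsetI insert_subset psubsetI singletonD)
  moreover have "U \<subset> carrier_vec n" if "U \<in> proper_subspaces n" for U using that by (auto simp: proper_subspaces_iff)
  ultimately show "sorted_wrt (\<subset>) (full_flag n xs)"
    using xs z unfolding full_flag_def by (auto simp: sorted_wrt_append)
  show "\<forall>U \<in> set (full_flag n xs). U \<subseteq> carrier_vec n \<and> vs.subspace (emb ` U)"
    using xs unfolding full_flag_def
    by (auto simp: proper_subspaces_iff subset_iff emb_zero emb_carrier subspace_EE vs.subspace_single_0)
qed

lemma full_flag_length: "xs \<in> tits_simplices n (n - 1) \<Longrightarrow> 0 < n \<Longrightarrow> length (full_flag n xs) = Suc n"
  by (auto simp: full_flag_def tits_simplices_def)

text \<open>Strictness is enough by \<open>strict_chain_flags\<close>. The \<open>min\<close> in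
  \<open>toF\<close> makes the flag constant from \<open>n\<close> on, as \<open>flags\<close>
  demands.\<close>

lemma toF_flags:
  assumes xs: "xs \<in> tits_simplices n (n - 1)" "0 < n"
  shows "toF n xs \<in> vs.flags n (EE n)"
proof (rule vs.strict_chain_flags[OF standard_flag])
  note ff = full_flag_sorted[OF xs] and len = full_flag_length[OF xs]
  have nth: "full_flag n xs ! i \<in> set (full_flag n xs)" if "i \<le> n" for i using that len by simp
  show "vs.subspace (toF n xs i)" if "i \<le> n" for i using that ff(2) nth by (simp add: toF_def min_def)
  show "toF n xs i \<subset> toF n xs (Suc i)" if "i < n" for i
  proof -
    have "full_flag n xs ! i \<subset> full_flag n xs ! Suc i" using sorted_wrt_nth_less[OF ff(1), of i "Suc i"] len that by simp
    moreover have "full_flag n xs ! Suc i \<subseteq> carrier_vec n" using nth[of "Suc i"] ff(2) that by auto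
    ultimately show ?thesis using that image_strict_mono[OF inj_on_subset[OF inj_on_emb]]
      by (simp add: toF_def min_def)
  qed
  show "toF n xs 0 = {0}" by (simp add: toF_def full_flag_def emb_zero)
  show "toF n xs i = EE n" if "n \<le> i" for i
  proof -
    have "full_flag n xs ! n = carrier_vec n"
      using xs by (auto simp: full_flag_def nth_append tits_simplices_def nth_Cons' )
    then show ?thesis using that emb_carrier[of n] by (simp add: toF_def min_def)
  qed
qed

lemma fromF_nth: "i < n - 1 \<Longrightarrow> fromF n F ! i = unemb n ` F (Suc i)"
  by (simp add: fromF_def)

lemma fromF_length: "length (fromF n F) = n - 1"
  by (simp add: fromF_def)

lemma toF_fromF:
  fixes F :: "(nat \<Rightarrow> 'f::field) fullflag"
  assumes F: "F \<in> vs.flags n (EE n)" "0 < n"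
  shows "toF n (fromF n F) = F"
proof
  fix i
  have full: "full_flag n (fromF n F) ! j = unemb n ` F j" if "j \<le> n" for j
  proof -
    consider "j = 0" | "j = n" "0 < j" | "0 < j" "j < n" using \<open>j \<le> n\<close> by linarith
    then show ?thesis
    proof cases
      case 1
      then show ?thesis using vs.flagsD(1)[OF F(1)] by (auto simp: full_flag_def)
    next
      case 2
      have "unemb n ` EE n = (carrier_vec n :: 'f vec set)" using unemb_image[of "carrier_vec n" n] emb_carrier[of n] by auto
      then show ?thesis using vs.flagsD(3)[OF F(1), of n] 2 by (simp add: full_flag_def nth_append fromF_length nth_Cons')
    next
      case 3
      then have "j - 1 < n - 1" by linarith
      then show ?thesis using 3 fromF_nth[of "j - 1" n F] by (simp add: full_flag_def nth_append fromF_length nth_Cons')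
    qed
  qed
  have "emb ` unemb n ` F (min i n) = F (min i n)" using vs.flags_le[OF F(1)] by (rule emb_image)
  moreover have "F (min i n) = F i" using vs.flagsD(3)[OF F(1), of i] vs.flagsD(3)[OF F(1), of n] by (auto simp: min_def)
  ultimately show "toF n (fromF n F) i = F i" using full[of "min i n"] by (simp add: toF_def)
qed

lemma fromF_tits:
  assumes F: "F \<in> vs.flags n (EE n)"
  shows "fromF n F \<in> tits_simplices n (n - 1)"
proof -
  have im: "emb ` unemb n ` F i = F i" for i using vs.flags_le[OF F] by (rule emb_image)
  have lt: "F i \<subset> F j" if "i < j" "j \<le> n" for i j
    using vs.covers_psubset[OF vs.flagsD(2)[OF F, of i]] vs.flags_mono[OF F, of "Suc i" j] that by auto
  have ilt: "unemb n ` F i \<subset> unemb n ` F j" if "i < j" "j \<le> n" for i j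
    using lt[OF that] im[of i] im[of j] by (metis image_mono psubset_eq)
  have "unemb n ` F i \<in> proper_subspaces n" if i: "1 \<le> i" "i < n" for i
    unfolding proper_subspaces_iff im
  proof (intro conjI)
    show "vs.subspace (F i)" by (rule vs.flags_subspace[OF F])
    have "F 0 \<subset> F i" "F i \<subset> F n" using lt i by auto
    then show "unemb n ` F i \<noteq> {0\<^sub>v n}" "unemb n ` F i \<noteq> carrier_vec n"
      using im[of i] vs.flagsD(1)[OF F] vs.flagsD(3)[OF F, of n]
      by (metis emb_zero image_insert image_empty order_less_irrefl, metis emb_carrier order_less_irrefl order_refl)
  qed auto
  moreover have "sorted_wrt (\<subset>) (fromF n F)"
    unfolding sorted_wrt_iff_nth_less fromF_length
  proof (intro allI impI)
    fix i j assume ij: "i < j" "j < n - 1"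
    then have "i < n - 1" "Suc i < Suc j" "Suc j \<le> n" by auto
    then show "fromF n F ! i \<subset> fromF n F ! j" using ilt ij fromF_nth by metis
  qed
  ultimately show ?thesis unfolding tits_simplices_def by (auto simp: fromF_length fromF_def)
qed

lemma fromF_toF:
  assumes xs: "xs \<in> tits_simplices n (n - 1)" "0 < n"
  shows "fromF n (toF n xs) = xs"
proof (rule nth_equalityI)
  have len: "length xs = n - 1" using xs by (simp add: tits_simplices_def)
  then show "length (fromF n (toF n xs)) = length xs" by (simp add: fromF_length)
  fix i assume "i < length (fromF n (toF n xs))"
  then have i: "i < n - 1" by (simp add: fromF_length)
  have "xs ! i \<in> set xs" using i len by simp
  then have "xs ! i \<in> proper_subspaces n" using xs(1) unfolding tits_simplices_def by blast
  then have "xs ! i \<subseteq> carrier_vec n" unfolding proper_subspaces_iff by blast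
  then show "fromF n (toF n xs) ! i = xs ! i"
    using fromF_nth[OF i, of "toF n xs"] unemb_image[of "xs ! i" n] i len by (simp add: toF_def full_flag_def nth_append)
qed

section \<open>Faces and the cycle condition\<close>

definition del :: "nat \<Rightarrow> 'a list \<Rightarrow> 'a list" where
  "del i xs = take i xs @ drop (Suc i) xs"

lemma length_del: "i < length xs \<Longrightarrow> length (del i xs) = length xs - 1"
  by (simp add: del_def)

lemma nth_del: "i < length xs \<Longrightarrow> j < length xs - 1 \<Longrightarrow> del i xs ! j = (if j < i then xs ! j else xs ! Suc j)"
  by (auto simp: del_def nth_append min_def)

text \<open>Position \<open>i\<close> of the list is term \<open>Suc i\<close> of the flag, because
  the term 0 is not stored in the list.\<close>

lemma del_eq_iff:
  assumes F: "F \<in> vs.flags n (EE n)" and G: "G \<in> vs.flags n (EE n)" and i: "i < n - 1"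
  shows "del i (fromF n G) = del i (fromF n F) \<longleftrightarrow> vs.adj (Suc i) F G"
proof
  assume "vs.adj (Suc i) F G"
  then have GF: "G p = F p" if "p \<noteq> Suc i" for p using that by (simp add: vs.adj_def)
  show "del i (fromF n G) = del i (fromF n F)"
  proof (rule nth_equalityI)
    fix j assume "j < length (del i (fromF n G))"
    then have "j < n - 1 - 1" using i by (simp add: length_del fromF_length)
    then show "del i (fromF n G) ! j = del i (fromF n F) ! j"
      using i GF[of "Suc j"] GF[of "Suc (Suc j)"] by (simp add: nth_del fromF_length fromF_nth)
  qed (use i in \<open>simp add: length_del fromF_length\<close>)
next
  assume eq: "del i (fromF n G) = del i (fromF n F)"
  have im: "emb ` unemb n ` F p = F p" "emb ` unemb n ` G p = G p" for p
    using vs.flags_le[OF F] vs.flags_le[OF G] by (auto intro!: emb_image)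
  show "vs.adj (Suc i) F G"
    unfolding vs.adj_def
  proof (intro allI impI)
    fix p assume p: "p \<noteq> Suc i"
    consider "p = 0" | "n \<le> p" | "0 < p" "p \<le> i" | "Suc i < p" "p < n" using p by linarith
    then show "G p = F p"
    proof cases
      case 3
      then have "p - 1 < i" by linarith
      then have "del i (fromF n G) ! (p - 1) = unemb n ` G p" "del i (fromF n F) ! (p - 1) = unemb n ` F p"
        using i 3 by (simp_all add: nth_del fromF_length fromF_nth)
      then show ?thesis using eq im by metis
    next
      case 4
      then have "\<not> p - 2 < i" "p - 2 < n - 1 - 1" by linarith+
      then have "del i (fromF n G) ! (p - 2) = unemb n ` G p" "del i (fromF n F) ! (p - 2) = unemb n ` F p"
        using i 4 by (simp_all add: nth_del fromF_length fromF_nth Suc_diff_Suc numeral_2_eq_2)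
      then show ?thesis using eq im by metis
    qed (use vs.flagsD[OF F] vs.flagsD[OF G] in auto)
  qed
qed

text \<open>For \<open>i < k\<close> the entry at position \<open>i\<close> has dimension
  \<open>i + 1\<close> after omitting position \<open>k\<close>, but \<open>i + 2\<close> after
  omitting position \<open>i\<close>.\<close>

lemma del_index_unique:
  fixes F G :: "(nat \<Rightarrow> 'f::field) fullflag"
  assumes F: "F \<in> vs.flags n (EE n)" and G: "G \<in> vs.flags n (EE n)" and i: "i < n - 1" "k < n - 1"
    and eq: "del k (fromF n G) = del i (fromF n F)"
  shows "k = i"
proof -
  have *: False if F: "F \<in> vs.flags n (EE n)" and G: "G \<in> vs.flags n (EE n)" and i: "i < k" "k < n - 1"
    and eq: "del k (fromF n G) = del i (fromF n F)" for i k and F G :: "(nat \<Rightarrow> 'f) fullflag"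
  proof -
    have "del k (fromF n G) ! i = unemb n ` G (Suc i)" "del i (fromF n F) ! i = unemb n ` F (Suc (Suc i))"
      using i by (simp_all add: nth_del fromF_length fromF_nth)
    then have "G (Suc i) = F (Suc (Suc i))"
      using eq emb_image[OF vs.flags_le[OF F]] emb_image[OF vs.flags_le[OF G]] by metis
    moreover have "vs.dim (G (Suc i)) = Suc i" using i by (intro vs.flags_dim[OF G]) linarith
    moreover have "vs.dim (F (Suc (Suc i))) = Suc (Suc i)" using i by (intro vs.flags_dim[OF F]) linarith
    ultimately show False by simp
  qed
  show ?thesis using *[OF F G _ i(2) eq] *[OF G F _ i(1) eq[symmetric]] by (meson linorder_neqE_nat)
qed

text \<open>The coefficient of \<open>ys\<close> in the part of the boundary that omits position
  \<open>i\<close>, without its sign.\<close>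

definition face_sum :: "'f::field chain \<Rightarrow> nat \<Rightarrow> 'f flag \<Rightarrow> int" where
  "face_sum c i ys = (\<Sum>xs | xs \<in> Poly_Mapping.keys c \<and> del i xs = ys. Poly_Mapping.lookup c xs)"

lemma lookup_frag_extend:
  "Poly_Mapping.lookup (frag_extend f c) y = (\<Sum>x\<in>Poly_Mapping.keys c. Poly_Mapping.lookup c x * Poly_Mapping.lookup (f x) y)"
  by (simp add: frag_extend_def lookup_sum)

lemma lookup_boundary:
  assumes c: "Poly_Mapping.keys c \<subseteq> tits_simplices n k"
  shows "Poly_Mapping.lookup (tits_boundary c) ys = (\<Sum>i<k. (-1) ^ i * face_sum c i ys)"
proof -
  let ?K = "Poly_Mapping.keys c" let ?l = "Poly_Mapping.lookup c"
  have "Poly_Mapping.lookup (tits_boundary c) ys =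
      (\<Sum>xs\<in>?K. \<Sum>i<k. if del i xs = ys then (-1) ^ i * ?l xs else 0)"
    unfolding tits_boundary_def lookup_frag_extend
  proof (rule sum.cong[OF refl])
    fix xs assume "xs \<in> ?K"
    then have "length xs = k" using c by (auto simp: tits_simplices_def)
    then show "?l xs * Poly_Mapping.lookup (\<Sum>i<length xs. frag_cmul ((-1) ^ i) (frag_of (take i xs @ drop (Suc i) xs))) ys
      = (\<Sum>i<k. if del i xs = ys then (-1) ^ i * ?l xs else 0)"
      by (simp add: lookup_sum sum_distrib_left del_def[symmetric]) (intro sum.cong, auto simp: lookup_frag_of)
  qed
  also have "\<dots> = (\<Sum>i<k. \<Sum>xs\<in>?K. if del i xs = ys then (-1) ^ i * ?l xs else 0)" by (rule sum.swap)
  also have "\<dots> = (\<Sum>i<k. (-1) ^ i * face_sum c i ys)"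
    unfolding face_sum_def sum_distrib_left
    by (intro sum.cong[OF refl]) (simp add: sum.If_cases Int_def)
  finally show ?thesis .
qed

lemma face_sum_eq_0: "(\<And>xs. xs \<in> Poly_Mapping.keys c \<Longrightarrow> del i xs \<noteq> ys) \<Longrightarrow> face_sum c i ys = 0"
  unfolding face_sum_def by (rule sum.neutral) blast

text \<open>
  The faces with different omitted positions are distinct simplices because they miss different dimensions,
  hence the boundary vanishes iff each of its \<open>n - 1\<close> parts does.
\<close>

lemma boundary_eq_0_iff:
  assumes c: "Poly_Mapping.keys c \<subseteq> tits_simplices n (n - 1)"
  shows "tits_boundary c = 0 \<longleftrightarrow> (\<forall>i<n - 1. \<forall>ys. face_sum c i ys = 0)"
proof
  assume "\<forall>i<n - 1. \<forall>ys. face_sum c i ys = 0"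
  then show "tits_boundary c = 0" by (intro poly_mapping_eqI) (simp add: lookup_boundary[OF c])
next
  assume 0: "tits_boundary c = 0"
  show "\<forall>i<n - 1. \<forall>ys. face_sum c i ys = 0"
  proof (intro allI impI, rule ccontr)
    fix i ys assume i: "i < n - 1" and nz: "face_sum c i ys \<noteq> 0"
    then have n: "0 < n" by simp
    have ex: "\<exists>F. F \<in> vs.flags n (EE n) \<and> del k (fromF n F) = ys" if "face_sum c k ys \<noteq> 0" for k
    proof -
      obtain xs where xs: "xs \<in> Poly_Mapping.keys c" "del k xs = ys"
        using \<open>face_sum c k ys \<noteq> 0\<close> face_sum_eq_0 by blast
      then have t: "xs \<in> tits_simplices n (n - 1)" using c by blast
      show ?thesis using toF_flags[OF t n] fromF_toF[OF t n] xs(2) by (intro exI[of _ "toF n xs"]) simp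
    qed
    obtain F where F: "F \<in> vs.flags n (EE n)" "del i (fromF n F) = ys" using ex[OF nz] by blast
    have "face_sum c k ys = 0" if k: "k < n - 1" "k \<noteq> i" for k
    proof (rule ccontr)
      assume "face_sum c k ys \<noteq> 0"
      then obtain G where G: "G \<in> vs.flags n (EE n)" "del k (fromF n G) = ys" using ex by blast
      from del_index_unique[OF F(1) G(1) i k(1)] F(2) G(2) k(2) show False by simp
    qed
    then have "(\<Sum>k<n - 1. (-1) ^ k * face_sum c k ys) = (\<Sum>k<n - 1. if k = i then (-1) ^ i * face_sum c i ys else 0)"
      by (intro sum.cong) auto
    also have "\<dots> = (-1) ^ i * face_sum c i ys" using i by simp
    finally show False using lookup_boundary[OF c, of ys] 0 nz by simp
  qed
qed

lemma carrier_steinberg: "c \<in> carrier (steinberg n) \<longleftrightarrow> Poly_Mapping.keys c \<subseteq> tits_simplices n (n - 1) \<and> tits_boundary c = 0"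
  by (simp add: steinberg_def)

section \<open>Chains as functions on flags\<close>

definition toSt :: "nat \<Rightarrow> 'f::field chain \<Rightarrow> (nat \<Rightarrow> 'f) fchain" where
  "toSt n c = (\<lambda>F. if F \<in> vs.flags n (EE n) then Poly_Mapping.lookup c (fromF n F) else 0)"

definition fromSt :: "nat \<Rightarrow> (nat \<Rightarrow> 'f::field) fchain \<Rightarrow> 'f chain" where
  "fromSt n d = Abs_poly_mapping (\<lambda>xs. if xs \<in> tits_simplices n (n - 1) then d (toF n xs) else 0)"

lemma toSt_add: "toSt n (c + d) = toSt n c + toSt n d"
  by (auto simp: toSt_def fun_eq_iff lookup_add)

text \<open>The link between the two descriptions of cycles: the list position \<open>i\<close>
  becomes the flag index \<open>Suc i\<close>, and sharing a face becomes
  \<open>adj\<close>.\<close>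

lemma face_sum_toSt:
  assumes c: "Poly_Mapping.keys c \<subseteq> tits_simplices n (n - 1)" and F: "F \<in> vs.flags n (EE n)" and i: "i < n - 1"
  shows "face_sum c i (del i (fromF n F)) = gsum (toSt n c) (vs.adj (Suc i) F)"
  unfolding face_sum_def gsum_def
proof (rule sum.reindex_bij_witness[where i = "fromF n" and j = "toF n"])
  have n: "0 < n" using i by simp
  fix xs assume "xs \<in> {xs. xs \<in> Poly_Mapping.keys c \<and> del i xs = del i (fromF n F)}"
  then have xs: "xs \<in> Poly_Mapping.keys c" "del i xs = del i (fromF n F)" by auto
  then have t: "xs \<in> tits_simplices n (n - 1)" using c by blast
  note tF = toF_flags[OF t n] and ft = fromF_toF[OF t n]
  show "fromF n (toF n xs) = xs" by (rule ft)
  show eq: "toSt n c (toF n xs) = Poly_Mapping.lookup c xs" using tF ft by (simp add: toSt_def)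
  show "toF n xs \<in> {x. toSt n c x \<noteq> 0 \<and> vs.adj (Suc i) F x}"
    using del_eq_iff[OF F tF i] xs ft eq by (simp add: in_keys_iff)
next
  have n: "0 < n" using i by simp
  fix G assume "G \<in> {x. toSt n c x \<noteq> 0 \<and> vs.adj (Suc i) F x}"
  then have G: "toSt n c G \<noteq> 0" "vs.adj (Suc i) F G" by auto
  then have Gf: "G \<in> vs.flags n (EE n)" by (auto simp: toSt_def split: if_splits)
  show "toF n (fromF n G) = G" by (rule toF_fromF[OF Gf n])
  show "fromF n G \<in> {xs. xs \<in> Poly_Mapping.keys c \<and> del i xs = del i (fromF n F)}"
    using del_eq_iff[OF F Gf i] G Gf by (simp add: toSt_def in_keys_iff)
qed

lemma finite_toSt:
  assumes n: "0 < n"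
  shows "finite {F. toSt n c F \<noteq> 0}"
proof (rule finite_subset)
  show "{F. toSt n c F \<noteq> 0} \<subseteq> toF n ` Poly_Mapping.keys c"
  proof
    fix F assume "F \<in> {F. toSt n c F \<noteq> 0}"
    then have F: "F \<in> vs.flags n (EE n)" "Poly_Mapping.lookup c (fromF n F) \<noteq> 0"
      by (auto simp: toSt_def split: if_splits)
    then show "F \<in> toF n ` Poly_Mapping.keys c"
      using toF_fromF[OF F(1) n] by (intro image_eqI[where x = "fromF n F"]) (auto simp: in_keys_iff)
  qed
qed simp

lemma toSt_in_iff:
  assumes c: "Poly_Mapping.keys c \<subseteq> tits_simplices n (n - 1)" and n: "0 < n"
  shows "toSt n c \<in> vs.St n (EE n) \<longleftrightarrow> c \<in> carrier (steinberg n)"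
proof
  assume St: "toSt n c \<in> vs.St n (EE n)"
  have "face_sum c i ys = 0" if i: "i < n - 1" for i ys
  proof (cases "\<exists>xs\<in>Poly_Mapping.keys c. del i xs = ys")
    case True
    then obtain xs where xs: "xs \<in> Poly_Mapping.keys c" "del i xs = ys" by blast
    then have t: "xs \<in> tits_simplices n (n - 1)" using c by blast
    have "face_sum c i (del i (fromF n (toF n xs))) = 0"
      using face_sum_toSt[OF c toF_flags[OF t n] i] vs.St_cycle[OF St toF_flags[OF t n], of "Suc i"] i by simp
    then show ?thesis using fromF_toF[OF t n] xs by simp
  next
    case False
    then show ?thesis by (intro face_sum_eq_0) blast
  qed
  then show "c \<in> carrier (steinberg n)" using boundary_eq_0_iff[OF c] c by (simp add: carrier_steinberg)
next
  assume "c \<in> carrier (steinberg n)"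
  then have z: "face_sum c i ys = 0" if "i < n - 1" for i ys
    using boundary_eq_0_iff[OF c] that by (simp add: carrier_steinberg)
  have "gsum (toSt n c) (vs.adj i F) = 0" if F: "F \<in> vs.flags n (EE n)" and i: "0 < i" "i < n" for F i
    using face_sum_toSt[OF c F, of "i - 1"] z[of "i - 1"] i by simp
  then show "toSt n c \<in> vs.St n (EE n)"
    unfolding vs.St_def using finite_toSt[OF n, of c] by (auto simp: toSt_def split: if_splits)
qed

lemma toSt_steinberg: "c \<in> carrier (steinberg n) \<Longrightarrow> 0 < n \<Longrightarrow> toSt n c \<in> vs.St n (EE n)"
  using toSt_in_iff[of c n] by (simp add: carrier_steinberg)

lemma lookup_fromSt:
  assumes d: "finite {F. d F \<noteq> 0}" and n: "0 < n"
  shows "Poly_Mapping.lookup (fromSt n d) = (\<lambda>xs. if xs \<in> tits_simplices n (n - 1) then d (toF n xs) else 0)"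
proof -
  have "finite {xs. (if xs \<in> tits_simplices n (n - 1) then d (toF n xs) else 0) \<noteq> 0}"
  proof (rule finite_subset)
    show "{xs. (if xs \<in> tits_simplices n (n - 1) then d (toF n xs) else 0) \<noteq> 0} \<subseteq> fromF n ` {F. d F \<noteq> 0}"
    proof
      fix xs assume "xs \<in> {xs. (if xs \<in> tits_simplices n (n - 1) then d (toF n xs) else 0) \<noteq> 0}"
      then have xs: "xs \<in> tits_simplices n (n - 1)" "d (toF n xs) \<noteq> 0" by (auto split: if_splits)
      then show "xs \<in> fromF n ` {F. d F \<noteq> 0}"
        using fromF_toF[OF xs(1) n] by (intro image_eqI[where x = "toF n xs"]) auto
    qed
  qed (use d in simp)
  then show ?thesis unfolding fromSt_def by (rule lookup_Abs_poly_mapping)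
qed

lemma toSt_fromSt:
  assumes d: "d \<in> vs.St n (EE n)" and n: "0 < n"
  shows "toSt n (fromSt n d) = d"
proof
  fix F
  show "toSt n (fromSt n d) F = d F"
    using lookup_fromSt[OF vs.St_finite[OF d] n] fromF_tits[of F n] toF_fromF[of F n] vs.St_flags[OF d, of F] n
    by (auto simp: toSt_def)
qed

lemma fromSt_steinberg:
  assumes d: "d \<in> vs.St n (EE n)" and n: "0 < n"
  shows "fromSt n d \<in> carrier (steinberg n)"
proof -
  have "Poly_Mapping.keys (fromSt n d) \<subseteq> tits_simplices n (n - 1)"
    using lookup_fromSt[OF vs.St_finite[OF d] n] by (auto simp: in_keys_iff split: if_splits)
  then show ?thesis using toSt_in_iff[OF _ n] toSt_fromSt[OF d n] d by metis
qed

lemma fromSt_toSt: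
  assumes c: "c \<in> carrier (steinberg n)" and n: "0 < n"
  shows "fromSt n (toSt n c) = c"
proof (rule poly_mapping_eqI)
  fix xs
  have k: "Poly_Mapping.keys c \<subseteq> tits_simplices n (n - 1)" using c by (simp add: carrier_steinberg)
  show "Poly_Mapping.lookup (fromSt n (toSt n c)) xs = Poly_Mapping.lookup c xs"
  proof (cases "xs \<in> tits_simplices n (n - 1)")
    case True
    then have "Poly_Mapping.lookup (fromSt n (toSt n c)) xs = toSt n c (toF n xs)"
      using lookup_fromSt[OF finite_toSt[OF n] n, of c] by simp
    then show ?thesis using toF_flags[OF True n] fromF_toF[OF True n] by (simp add: toSt_def)
  next
    case False
    then show ?thesis using lookup_fromSt[OF finite_toSt[OF n] n, of c] k
      by (auto simp: in_keys_iff)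
  qed
qed

lemma fromSt_add:
  assumes d: "d \<in> vs.St n (EE n)" "e \<in> vs.St n (EE n)" and n: "0 < n"
  shows "fromSt n (d + e) = fromSt n d + fromSt n e"
proof (rule poly_mapping_eqI)
  fix xs
  note l = lookup_fromSt[OF vs.St_finite n]
  show "Poly_Mapping.lookup (fromSt n (d + e)) xs = Poly_Mapping.lookup (fromSt n d + fromSt n e) xs"
    unfolding lookup_add l[OF vs.St_add[OF d]] l[OF d(1)] l[OF d(2)] by simp
qed

lemma steinberg_pairing_toSt:
  assumes a: "Poly_Mapping.keys a \<subseteq> tits_simplices n (n - 1)" and n: "0 < n"
  shows "steinberg_pairing a b = vs.pr (toSt n a) (toSt n b) (\<lambda>_. True)"
proof -
  let ?f = "\<lambda>F. toSt n a F * toSt n b F"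
  have "steinberg_pairing a b = (\<Sum>x | x \<in> Poly_Mapping.keys a \<and> Poly_Mapping.lookup b x \<noteq> 0. Poly_Mapping.lookup a x * Poly_Mapping.lookup b x)"
    unfolding steinberg_pairing_def by (rule sum.mono_neutral_right) auto
  also have "\<dots> = sum ?f {F. ?f F \<noteq> 0 \<and> True}"
  proof (rule sum.reindex_bij_witness[where i = "fromF n" and j = "toF n"])
    fix x assume "x \<in> {x. x \<in> Poly_Mapping.keys a \<and> Poly_Mapping.lookup b x \<noteq> 0}"
    then have x: "x \<in> Poly_Mapping.keys a" "Poly_Mapping.lookup b x \<noteq> 0" and t: "x \<in> tits_simplices n (n - 1)"
      using a by auto
    note tF = toF_flags[OF t n] and ft = fromF_toF[OF t n]
    show "fromF n (toF n x) = x" by (rule ft)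
    show "?f (toF n x) = Poly_Mapping.lookup a x * Poly_Mapping.lookup b x" using tF ft by (simp add: toSt_def)
    show "toF n x \<in> {F. ?f F \<noteq> 0 \<and> True}" using x tF ft by (simp add: toSt_def in_keys_iff)
  next
    fix F assume "F \<in> {F. ?f F \<noteq> 0 \<and> True}"
    then have F: "toSt n a F \<noteq> 0" "toSt n b F \<noteq> 0" by auto
    then have Ff: "F \<in> vs.flags n (EE n)" by (auto simp: toSt_def split: if_splits)
    show "toF n (fromF n F) = F" by (rule toF_fromF[OF Ff n])
    show "fromF n F \<in> {x. x \<in> Poly_Mapping.keys a \<and> Poly_Mapping.lookup b x \<noteq> 0}"
      using F Ff by (simp add: toSt_def in_keys_iff)
  qed
  finally show ?thesis by (simp add: vs.pr_def gsum_def)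
qed

lemma tits_boundary_add: "tits_boundary (c + d) = tits_boundary c + tits_boundary d"
  and tits_boundary_minus: "tits_boundary (- c) = - tits_boundary c"
  and tits_boundary_0: "tits_boundary 0 = 0"
  by (simp_all add: tits_boundary_def frag_extend_add frag_extend_minus)

lemma mult_steinberg [simp]: "x \<otimes>\<^bsub>steinberg n\<^esub> y = x + y"
  and one_steinberg [simp]: "\<one>\<^bsub>steinberg n\<^esub> = 0"
  by (simp_all add: steinberg_def)

lemma steinberg_add_closed:
  "a \<in> carrier (steinberg n) \<Longrightarrow> b \<in> carrier (steinberg n) \<Longrightarrow> a + b \<in> carrier (steinberg n)"
  using keys_add[of a b] by (auto simp: carrier_steinberg tits_boundary_add)

lemma steinberg_0_closed: "0 \<in> carrier (steinberg n)"
  by (simp add: carrier_steinberg tits_boundary_0)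

lemma comm_group_steinberg: "comm_group (steinberg n)"
proof (rule comm_groupI)
  show "\<exists>y\<in>carrier (steinberg n). y \<otimes>\<^bsub>steinberg n\<^esub> x = \<one>\<^bsub>steinberg n\<^esub>" if "x \<in> carrier (steinberg n)" for x
    using that by (intro bexI[of _ "- x"]) (auto simp: carrier_steinberg keys_minus tits_boundary_minus)
qed (simp_all add: steinberg_add_closed steinberg_0_closed algebra_simps)

section \<open>Matrices and linear isomorphisms\<close>

lemma lin_iso_sum:
  assumes h: "vs.lin_iso V W h" and f: "\<And>i. i \<in> I \<Longrightarrow> f i \<in> V" and I: "finite I"
  shows "h (\<Sum>i\<in>I. f i) = (\<Sum>i\<in>I. h (f i))"
  using I f
proof (induction I)
  case empty
  then show ?case using vs.lin_iso_zero[OF h] by (simp add: zero_fun_def)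
next
  case (insert x I)
  have "sum f I \<in> V" using insert.prems h unfolding vs.lin_iso_def by (intro vs.subspace_sum) auto
  then have "h (f x + sum f I) = h (f x) + h (sum f I)" using insert.prems h unfolding vs.lin_iso_def by blast
  moreover have "h (sum f I) = (\<Sum>i\<in>I. h (f i))" using insert by blast
  ultimately show ?case by (simp only: sum.insert[OF insert.hyps])
qed

lemma matrix_of_lin_iso:
  assumes h: "vs.lin_iso (EE n) (EE n) (h :: (nat \<Rightarrow> 'f::field) \<Rightarrow> _)"
  obtains A where "A \<in> carrier_mat n n" "\<And>v. v \<in> carrier_vec n \<Longrightarrow> emb (A *\<^sub>v v) = h (emb v)"
proof
  define A where "A = mat n n (\<lambda>(i, j). h (emb (unit_vec n j)) i)"
  show A: "A \<in> carrier_mat n n" by (simp add: A_def)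
  fix v :: "'f vec" assume v: "v \<in> carrier_vec n"
  have hE: "h x \<in> EE n" if "x \<in> EE n" for x using h that unfolding vs.lin_iso_def bij_betw_def by blast
  have u: "emb (unit_vec n j) \<in> (EE n :: (nat \<Rightarrow> 'f) set)" for j by (rule emb_EE) simp
  have sum_app: "(\<Sum>j<k. fscale (v $ j) (g j)) i = (\<Sum>j<k. v $ j * g j i)" for g :: "nat \<Rightarrow> nat \<Rightarrow> 'f" and i k
    by (induction k) (simp_all add: fscale_def zero_fun_def plus_fun_def)
  have "emb v = (\<Sum>j<n. fscale (v $ j) (emb (unit_vec n j)))"
  proof
    fix i
    have "(\<Sum>j<n. fscale (v $ j) (emb (unit_vec n j))) i = (\<Sum>j<n. v $ j * emb (unit_vec n j) i)"
      by (rule sum_app)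
    also have "\<dots> = (\<Sum>j<n. if j = i then v $ j else 0)"
      by (intro sum.cong) (auto simp: emb_def)
    also have "\<dots> = emb v i" using v by (simp add: emb_def)
    finally show "emb v i = (\<Sum>j<n. fscale (v $ j) (emb (unit_vec n j))) i" by simp
  qed
  then have "h (emb v) = (\<Sum>j<n. h (fscale (v $ j) (emb (unit_vec n j))))"
    using lin_iso_sum[OF h vs.subspace_scale[OF subspace_EE u] finite_lessThan] by simp
  also have "\<dots> = (\<Sum>j<n. fscale (v $ j) (h (emb (unit_vec n j))))"
    using h u unfolding vs.lin_iso_def by (intro sum.cong) auto
  finally have hv: "h (emb v) = (\<Sum>j<n. fscale (v $ j) (h (emb (unit_vec n j))))" .
  show "emb (A *\<^sub>v v) = h (emb v)"
  proof
    fix i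
    show "emb (A *\<^sub>v v) i = h (emb v) i"
    proof (cases "i < n")
      case True
      then have "emb (A *\<^sub>v v) i = (\<Sum>j<n. h (emb (unit_vec n j)) i * v $ j)"
        using v by (simp add: emb_def A_def scalar_prod_def lessThan_atLeast0)
      then show ?thesis unfolding hv sum_app by (simp add: mult.commute)
    next
      case False
      then show ?thesis using hE[OF emb_EE[OF v]] by (simp add: emb_def EE_def A_def)
    qed
  qed
qed

lemma mat_eq_one:
  assumes A: "A \<in> carrier_mat n n" and eq: "\<And>v. v \<in> carrier_vec n \<Longrightarrow> A *\<^sub>v v = (v :: 'f::field vec)"
  shows "A = 1\<^sub>m n"
proof (rule eq_matI)
  fix i j assume ij: "i < dim_row (1\<^sub>m n :: 'f mat)" "j < dim_col (1\<^sub>m n :: 'f mat)"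
  have "(A *\<^sub>v unit_vec n j) $ i = unit_vec n j $ i" using eq[of "unit_vec n j"] by simp
  then show "A $$ (i, j) = 1\<^sub>m n $$ (i, j)" using A ij by simp
qed (use A in auto)

text \<open>
  Chains on the function side are pulled back along \<open>h\<close>, which corresponds to the action of the inverse of \<open>h\<close>.
\<close>

lemma GL_of_lin_iso:
  assumes h: "vs.lin_iso (EE n) (EE n) (h :: (nat \<Rightarrow> 'f::field) \<Rightarrow> _)"
  shows "\<exists>g\<in>GL n. \<forall>v\<in>carrier_vec n. h (emb (g *\<^sub>v v)) = emb v"
proof -
  let ?k = "inv_into (EE n) h"
  have b: "bij_betw h (EE n) (EE n)" using h by (simp add: vs.lin_iso_def)
  have hk: "h (?k x) = x" "?k (h x) = x" if "x \<in> EE n" for x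
    using b that by (auto simp: bij_betw_def f_inv_into_f)
  obtain B where B: "B \<in> carrier_mat n n" "\<And>v. v \<in> carrier_vec n \<Longrightarrow> emb (B *\<^sub>v v) = h (emb v)"
    using matrix_of_lin_iso[OF h] by metis
  obtain g where g: "g \<in> carrier_mat n n" "\<And>v. v \<in> carrier_vec n \<Longrightarrow> emb (g *\<^sub>v v) = ?k (emb v)"
    using matrix_of_lin_iso[OF vs.lin_iso_inv[OF h]] by metis
  have eq: "C *\<^sub>v v = v" if "C \<in> carrier_mat n n" "v \<in> carrier_vec n" "emb (C *\<^sub>v v) = emb v" for C v
    using that inj_on_emb[of n] by (auto dest!: inj_onD)
  have 1: "g * B = 1\<^sub>m n"
  proof (rule mat_eq_one)
    fix v :: "'f vec" assume v: "v \<in> carrier_vec n"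
    then have "emb ((g * B) *\<^sub>v v) = emb v" using g B hk emb_EE[OF v] by simp
    then show "(g * B) *\<^sub>v v = v" using eq[of "g * B" v] v g(1) B(1) by simp
  qed (use g(1) B(1) in simp)
  have 2: "B * g = 1\<^sub>m n"
  proof (rule mat_eq_one)
    fix v :: "'f vec" assume v: "v \<in> carrier_vec n"
    then have "emb ((B * g) *\<^sub>v v) = emb v" using g B hk emb_EE[OF v] by simp
    then show "(B * g) *\<^sub>v v = v" using eq[of "B * g" v] v g(1) B(1) by simp
  qed (use g(1) B(1) in simp)
  have "invertible_mat g"
    unfolding invertible_mat_def inverts_mat_def using g(1) B(1) 1 2 by (intro conjI exI[of _ B]) auto
  then have "g \<in> GL n" using g(1) by (simp add: GL_def)
  moreover have "h (emb (g *\<^sub>v v)) = emb v" if "v \<in> carrier_vec n" for v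
    using g(2)[OF that] hk(1)[OF emb_EE[OF that]] by simp
  ultimately show ?thesis by blast
qed

lemma lin_iso_of_GL:
  assumes g: "g \<in> GL n"
  shows "\<exists>h. vs.lin_iso (EE n) (EE n) (h :: (nat \<Rightarrow> 'f::field) \<Rightarrow> _) \<and> (\<forall>v\<in>carrier_vec n. h (emb (g *\<^sub>v v)) = emb v)"
proof -
  have gc: "g \<in> carrier_mat n n" using g by (simp add: GL_def)
  obtain B where "g * B = 1\<^sub>m (dim_row g)" "B * g = 1\<^sub>m (dim_row B)"
    using g unfolding GL_def invertible_mat_def inverts_mat_def by blast
  then have gB: "g * B = 1\<^sub>m n" "B * g = 1\<^sub>m (dim_row B)" using gc by auto
  \<comment> \<open>\<open>invertible_mat\<close> leaves the shape of the inverse open; it is found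
    by comparing column numbers in both identities.\<close>
  have "dim_col B = n" using arg_cong[OF gB(1), of dim_col] by simp
  moreover have "dim_row B = n" using arg_cong[OF gB(2), of dim_col] gc by simp
  ultimately have Bc: "B \<in> carrier_mat n n" by blast
  have Bg: "B * g = 1\<^sub>m n" using gB(2) Bc by simp
  define h :: "(nat \<Rightarrow> 'f) \<Rightarrow> nat \<Rightarrow> 'f" where "h f = emb (B *\<^sub>v unemb n f)" for f
  have hg: "h (emb (g *\<^sub>v v)) = emb v" if v: "v \<in> carrier_vec n" for v
  proof -
    have "B *\<^sub>v (g *\<^sub>v v) = v" using assoc_mult_mat_vec[OF Bc gc v] Bg v by simp
    moreover have "unemb n (emb (g *\<^sub>v v)) = g *\<^sub>v v" using gc v by (intro unemb_emb) simp
    ultimately show ?thesis by (simp add: h_def)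
  qed
  have "vs.lin_iso (EE n) (EE n) h"
    unfolding vs.lin_iso_def
  proof (intro conjI subspace_EE ballI allI)
    show "bij_betw h (EE n) (EE n)"
    proof (rule bij_betw_byWitness[where f' = "\<lambda>f. emb (g *\<^sub>v unemb n f)"])
      show "\<forall>a\<in>EE n. emb (g *\<^sub>v unemb n (h a)) = a"
      proof
        fix a :: "nat \<Rightarrow> 'f" assume a: "a \<in> EE n"
        have "unemb n (h a) = B *\<^sub>v unemb n a" unfolding h_def using Bc by (intro unemb_emb) simp
        moreover have "g *\<^sub>v (B *\<^sub>v unemb n a) = unemb n a"
          using assoc_mult_mat_vec[OF gc Bc, of "unemb n a"] gB by simp
        ultimately show "emb (g *\<^sub>v unemb n (h a)) = a" using emb_unemb[OF a] by simp
      qed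
      show "\<forall>a\<in>EE n. h (emb (g *\<^sub>v unemb n a)) = a" by (simp add: hg emb_unemb Ball_def)
      show "h ` EE n \<subseteq> EE n" using Bc by (auto simp: h_def intro!: emb_EE)
      show "(\<lambda>f. emb (g *\<^sub>v unemb n f)) ` EE n \<subseteq> EE n" using gc by (auto intro!: emb_EE)
    qed
    fix x y :: "nat \<Rightarrow> 'f"
    have "unemb n (x + y) = unemb n x + unemb n y" by auto
    then show "h (x + y) = h x + h y"
      unfolding h_def using mult_add_distrib_mat_vec[OF Bc, of "unemb n x" "unemb n y"] Bc
      by (simp add: emb_add[of _ n])
  next
    fix c and x :: "nat \<Rightarrow> 'f"
    have "unemb n (fscale c x) = c \<cdot>\<^sub>v unemb n x" by (auto simp: fscale_def)
    then show "h (fscale c x) = fscale c (h x)"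
      unfolding h_def using mult_mat_vec[OF Bc, of "unemb n x" c] by (simp add: emb_smult)
  qed
  then show ?thesis using hg by blast
qed

context
  fixes n g h
  assumes g: "g \<in> GL n" and h: "vs.lin_iso (EE n) (EE n) (h :: (nat \<Rightarrow> 'f::field) \<Rightarrow> _)"
    and gh: "\<And>v. v \<in> carrier_vec n \<Longrightarrow> h (emb (g *\<^sub>v v)) = emb v" and n: "0 < n"
begin

text \<open>On vectors \<open>g\<close> undoes \<open>h\<close>. So the coefficient at
  \<open>F\<close> of the chain moved by \<open>g\<close> is the coefficient of the chain at the
  image of \<open>F\<close> under \<open>h\<close>, which is a pullback.\<close>

lemma act_flag:
  assumes F: "F \<in> vs.flags n (EE n)"
  shows "map (\<lambda>U. (\<lambda>v. g *\<^sub>v v) ` U) (fromF n (vs.fimg h F)) = fromF n F"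
proof (rule nth_equalityI)
  have gc: "g \<in> carrier_mat n n" using g by (simp add: GL_def)
  have hE: "h x \<in> EE n" if "x \<in> EE n" for x using h that unfolding vs.lin_iso_def bij_betw_def by blast
  have inj: "inj_on h (EE n)" using h by (simp add: vs.lin_iso_def bij_betw_def)
  have *: "g *\<^sub>v unemb n (h f) = unemb n f" if f: "f \<in> EE n" for f
  proof -
    let ?v = "unemb n (h f)"
    have "h (emb (g *\<^sub>v ?v)) = h f" using gh[of ?v] emb_unemb[OF hE[OF f]] by simp
    moreover have "emb (g *\<^sub>v ?v) \<in> EE n" using gc by (intro emb_EE) simp
    ultimately have "emb (g *\<^sub>v ?v) = f" using inj f by (auto dest: inj_onD)
    moreover have "unemb n (emb (g *\<^sub>v ?v)) = g *\<^sub>v ?v" using gc by (intro unemb_emb) simp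
    ultimately show ?thesis by simp
  qed
  show "length (map (\<lambda>U. (\<lambda>v. g *\<^sub>v v) ` U) (fromF n (vs.fimg h F))) = length (fromF n F)"
    by (simp add: fromF_length)
  fix i assume "i < length (map (\<lambda>U. (\<lambda>v. g *\<^sub>v v) ` U) (fromF n (vs.fimg h F)))"
  then have i: "i < n - 1" by (simp add: fromF_length)
  have "(\<lambda>v. g *\<^sub>v v) ` unemb n ` h ` F (Suc i) = unemb n ` F (Suc i)"
    unfolding image_image using * vs.flags_le[OF F] by (intro image_cong refl) blast
  then show "map (\<lambda>U. (\<lambda>v. g *\<^sub>v v) ` U) (fromF n (vs.fimg h F)) ! i = fromF n F ! i"
    using i by (simp add: fromF_length vs.fimg_def fromF_nth[OF i])
qed

lemma toSt_act:
  assumes c: "Poly_Mapping.keys c \<subseteq> tits_simplices n (n - 1)"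
  shows "toSt n (steinberg_act g c) = vs.pb n (EE n) h (toSt n c)"
    "Poly_Mapping.keys (steinberg_act g c) \<subseteq> tits_simplices n (n - 1)"
proof -
  let ?m = "map (\<lambda>U. (\<lambda>v. g *\<^sub>v v) ` U)"
  have ex: "\<exists>G. G \<in> vs.flags n (EE n) \<and> xs = fromF n (vs.fimg h G)" if "xs \<in> Poly_Mapping.keys c" for xs
  proof -
    have t: "xs \<in> tits_simplices n (n - 1)" using that c by blast
    note tF = toF_flags[OF t n]
    show ?thesis
      using vs.fimg_flags[OF vs.lin_iso_inv[OF h] tF] vs.fimg_inv'[OF h tF] fromF_toF[OF t n] by metis
  qed
  show "Poly_Mapping.keys (steinberg_act g c) \<subseteq> tits_simplices n (n - 1)"
  proof -
    have "Poly_Mapping.keys (steinberg_act g c) \<subseteq> (\<Union>xs\<in>Poly_Mapping.keys c. Poly_Mapping.keys (frag_of (?m xs)))"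
      unfolding steinberg_act_def by (rule keys_frag_extend)
    also have "\<dots> \<subseteq> tits_simplices n (n - 1)"
    proof
      fix y assume "y \<in> (\<Union>xs\<in>Poly_Mapping.keys c. Poly_Mapping.keys (frag_of (?m xs)))"
      then obtain xs where xs: "xs \<in> Poly_Mapping.keys c" "y = ?m xs" by auto
      obtain G where G: "G \<in> vs.flags n (EE n)" "xs = fromF n (vs.fimg h G)" using ex[OF xs(1)] by blast
      show "y \<in> tits_simplices n (n - 1)" using act_flag[OF G(1)] fromF_tits[OF G(1)] xs(2) G(2) by simp
    qed
    finally show ?thesis .
  qed
  show "toSt n (steinberg_act g c) = vs.pb n (EE n) h (toSt n c)"
  proof
    fix F
    show "toSt n (steinberg_act g c) F = vs.pb n (EE n) h (toSt n c) F"
    proof (cases "F \<in> vs.flags n (EE n)")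
      case True
      have iff: "?m xs = fromF n F \<longleftrightarrow> xs = fromF n (vs.fimg h F)" if xs: "xs \<in> Poly_Mapping.keys c" for xs
      proof
        assume eq: "?m xs = fromF n F"
        obtain G where G: "G \<in> vs.flags n (EE n)" "xs = fromF n (vs.fimg h G)" using ex[OF xs] by blast
        have "fromF n G = fromF n F" using eq act_flag[OF G(1)] G(2) by simp
        then have "G = F" using toF_fromF[OF G(1) n] toF_fromF[OF True n] by metis
        then show "xs = fromF n (vs.fimg h F)" using G(2) by simp
      qed (use act_flag[OF True] in simp)
      have "Poly_Mapping.lookup (steinberg_act g c) (fromF n F)
          = (\<Sum>xs\<in>Poly_Mapping.keys c. if xs = fromF n (vs.fimg h F) then Poly_Mapping.lookup c xs else 0)"
        unfolding steinberg_act_def lookup_frag_extend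
      proof (rule sum.cong[OF refl])
        fix xs assume xs: "xs \<in> Poly_Mapping.keys c"
        show "Poly_Mapping.lookup c xs * Poly_Mapping.lookup (frag_of (?m xs)) (fromF n F)
          = (if xs = fromF n (vs.fimg h F) then Poly_Mapping.lookup c xs else 0)"
          unfolding iff[OF xs, symmetric] lookup_frag_of by (simp add: eq_commute)
      qed
      also have "\<dots> = Poly_Mapping.lookup c (fromF n (vs.fimg h F))" by (simp add: in_keys_iff)
      finally show ?thesis using True vs.fimg_flags[OF h True] by (simp add: toSt_def vs.pb_def)
    qed (simp add: toSt_def vs.pb_def)
  qed
qed

end

lemma steinberg_act_closed:
  assumes g: "g \<in> GL n" and n: "0 < n" and c: "c \<in> carrier (steinberg n)"
  shows "steinberg_act g c \<in> carrier (steinberg n)"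
proof -
  obtain h where h: "vs.lin_iso (EE n) (EE n) h" "\<And>v. v \<in> carrier_vec n \<Longrightarrow> h (emb (g *\<^sub>v v)) = emb v"
    using lin_iso_of_GL[OF g] by blast
  have k: "Poly_Mapping.keys c \<subseteq> tits_simplices n (n - 1)" using c by (simp add: carrier_steinberg)
  show ?thesis
    using toSt_act[OF g h n k] vs.pb_St[OF h(1) toSt_steinberg[OF c n]] toSt_in_iff[OF _ n] by metis
qed

lemma steinberg_act_add: "steinberg_act g (c + d) = steinberg_act g c + steinberg_act g d"
  by (simp add: steinberg_act_def frag_extend_add)

lemma steinberg_pairing_act:
  assumes g: "g \<in> GL n" and n: "0 < n" and c: "c \<in> carrier (steinberg n)" "d \<in> carrier (steinberg n)"
  shows "steinberg_pairing (steinberg_act g c) (steinberg_act g d) = steinberg_pairing c d"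
proof -
  obtain h where h: "vs.lin_iso (EE n) (EE n) h" "\<And>v. v \<in> carrier_vec n \<Longrightarrow> h (emb (g *\<^sub>v v)) = emb v"
    using lin_iso_of_GL[OF g] by blast
  have k: "Poly_Mapping.keys c \<subseteq> tits_simplices n (n - 1)" "Poly_Mapping.keys d \<subseteq> tits_simplices n (n - 1)"
    using c by (simp_all add: carrier_steinberg)
  have "steinberg_pairing (steinberg_act g c) (steinberg_act g d)
      = vs.pr (toSt n (steinberg_act g c)) (toSt n (steinberg_act g d)) (\<lambda>_. True)"
    by (rule steinberg_pairing_toSt[OF toSt_act(2)[OF g h n k(1)] n])
  also have "\<dots> = vs.pr (vs.pb n (EE n) h (toSt n c)) (vs.pb n (EE n) h (toSt n d)) (\<lambda>_. True)"
    by (simp only: toSt_act(1)[OF g h n k(1)] toSt_act(1)[OF g h n k(2)])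
  also have "\<dots> = vs.pr (toSt n c) (toSt n d) (\<lambda>_. True)"
    by (rule vs.pr_pb[OF h(1) toSt_steinberg[OF c(1) n]]) simp
  also have "\<dots> = steinberg_pairing c d" by (rule steinberg_pairing_toSt[OF k(1) n, symmetric])
  finally show ?thesis .
qed

section \<open>The pairing on the coinvariants of \<open>St\<^sup>2\<close>\<close>

interpretation StSt: tensor_pair "steinberg n :: 'f::field chain monoid" "steinberg n :: 'f chain monoid" for n
  by (simp add: tensor_pair_def comm_group_steinberg)

lemma comm_group_St2: "comm_group (St2 n)"
  unfolding St2_def by (rule StSt.T.comm_group_axioms)

lemma steinberg_pairing_bihom: assumes "0 < n"
  shows "bihom (steinberg n :: 'f::field chain monoid) (steinberg n) integer_group steinberg_pairing"
proof -
  have eq: "steinberg_pairing a b = vs.pr (toSt n a) (toSt n b) (\<lambda>_. True)" if "a \<in> carrier (steinberg n)" for a b :: "'f chain"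
    using that assms by (intro steinberg_pairing_toSt) (simp_all add: carrier_steinberg)
  show ?thesis
    unfolding bihom_def
  proof (intro conjI ballI)
    fix a a' b :: "'f chain" assume *: "a \<in> carrier (steinberg n)" "a' \<in> carrier (steinberg n)" "b \<in> carrier (steinberg n)"
    show "steinberg_pairing (a \<otimes>\<^bsub>steinberg n\<^esub> a') b = steinberg_pairing a b \<otimes>\<^bsub>integer_group\<^esub> steinberg_pairing a' b"
      using * eq steinberg_add_closed[OF *(1,2)] vs.pr_add_left[OF toSt_steinberg[OF *(1) assms] toSt_steinberg[OF *(2) assms]]
      by (simp add: toSt_add)
  next
    fix a b b' :: "'f chain" assume *: "a \<in> carrier (steinberg n)" "b \<in> carrier (steinberg n)" "b' \<in> carrier (steinberg n)"
    show "steinberg_pairing a (b \<otimes>\<^bsub>steinberg n\<^esub> b') = steinberg_pairing a b \<otimes>\<^bsub>integer_group\<^esub> steinberg_pairing a b'"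
      using * eq vs.pr_add_right[OF toSt_steinberg[OF *(1) assms]] by (simp add: toSt_add)
  qed simp
qed

definition St2_pairing :: "'f::field st2 \<Rightarrow> int" where
  "St2_pairing = tensor_lift integer_group steinberg_pairing"

lemma
  assumes n: "0 < n"
  shows St2_pairing_hom: "St2_pairing \<in> hom (St2 n) integer_group"
    and St2_pairing_pure: "a \<in> carrier (steinberg n) \<Longrightarrow> b \<in> carrier (steinberg n) \<Longrightarrow>
      St2_pairing (pure_tensor (steinberg n) (steinberg n) a b) = steinberg_pairing a b"
proof -
  interpret tensor_bihom "steinberg n" "steinberg n" integer_group steinberg_pairing
    using steinberg_pairing_bihom[OF n] by (intro tensor_bihomI comm_group_steinberg abelian_integer_group)
  show "St2_pairing \<in> hom (St2 n) integer_group" unfolding St2_pairing_def St2_def by (rule tensor_lift_hom)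
  show "a \<in> carrier (steinberg n) \<Longrightarrow> b \<in> carrier (steinberg n) \<Longrightarrow>
      St2_pairing (pure_tensor (steinberg n) (steinberg n) a b) = steinberg_pairing a b"
    unfolding St2_pairing_def by (rule tensor_lift_pure)
qed

lemma St2_act_bihom:
  assumes g: "g \<in> GL n" and n: "0 < n"
  shows "bihom (steinberg n) (steinberg n) (St2 n)
    (\<lambda>a b. pure_tensor (steinberg n) (steinberg n) (steinberg_act g a) (steinberg_act g b))"
proof -
  have "steinberg_act g \<in> hom (steinberg n) (steinberg n)"
    by (rule homI) (simp_all add: steinberg_act_closed[OF g n] steinberg_act_add)
  then show ?thesis unfolding St2_def by (intro bihom_compose[OF StSt.bihom_pt])
qed

lemma
  assumes g: "g \<in> GL n" and n: "0 < n"
  shows St2_act_hom: "St2_act n g \<in> hom (St2 n) (St2 n)"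
    and St2_act_pure: "a \<in> carrier (steinberg n) \<Longrightarrow> b \<in> carrier (steinberg n) \<Longrightarrow>
      St2_act n g (pure_tensor (steinberg n) (steinberg n) a b) =
        pure_tensor (steinberg n) (steinberg n) (steinberg_act g a) (steinberg_act g b)"
proof -
  interpret tensor_bihom "steinberg n" "steinberg n" "St2 n"
    "\<lambda>a b. pure_tensor (steinberg n) (steinberg n) (steinberg_act g a) (steinberg_act g b)"
    using St2_act_bihom[OF g n] by (intro tensor_bihomI comm_group_steinberg comm_group_St2)
  show "St2_act n g \<in> hom (St2 n) (St2 n)" unfolding St2_act_def St2_def[of n, symmetric]
    using tensor_lift_hom by (simp add: St2_def)
  show "a \<in> carrier (steinberg n) \<Longrightarrow> b \<in> carrier (steinberg n) \<Longrightarrow>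
      St2_act n g (pure_tensor (steinberg n) (steinberg n) a b) =
        pure_tensor (steinberg n) (steinberg n) (steinberg_act g a) (steinberg_act g b)"
    unfolding St2_act_def by (rule tensor_lift_pure)
qed

lemma St2_pairing_act:
  fixes g :: "'f::field mat"
  assumes g: "g \<in> GL n" and n: "0 < n" and z: "z \<in> carrier (St2 n)"
  shows "St2_pairing (St2_act n g z) = St2_pairing z"
proof -
  have 1: "(\<lambda>z. St2_pairing (St2_act n g z)) \<in> hom (StSt.T n) integer_group"
    using hom_compose[OF St2_act_hom[OF g n] St2_pairing_hom[OF n]] by (simp add: St2_def comp_def)
  have 2: "St2_pairing \<in> hom (StSt.T n) integer_group" using St2_pairing_hom[OF n] by (simp add: St2_def)
  show ?thesis
  proof (rule StSt.hom_eq_on_T[OF group_integer_group 1 2])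
    fix a b :: "'f chain" assume ab: "a \<in> carrier (steinberg n)" "b \<in> carrier (steinberg n)"
    show "St2_pairing (St2_act n g (pure_tensor (steinberg n) (steinberg n) a b)) = St2_pairing (pure_tensor (steinberg n) (steinberg n) a b)"
      unfolding St2_act_pure[OF g n ab] St2_pairing_pure[OF n ab]
        St2_pairing_pure[OF n steinberg_act_closed[OF g n ab(1)] steinberg_act_closed[OF g n ab(2)]]
      by (rule steinberg_pairing_act[OF g n ab])
  qed (use z in \<open>simp add: St2_def\<close>)
qed

abbreviation "CRel n \<equiv> coinvariant_relations (St2 n) (St2_act n ` GL n)"

lemma CRel_subgroup: assumes n: "0 < n" shows "subgroup (CRel n) (St2 n)"
proof -
  interpret M: comm_group "St2 n" by (rule comm_group_St2)
  show ?thesis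
    unfolding coinvariant_relations_def
    by (rule M.generate_is_subgroup) (auto intro!: M.m_closed M.inv_closed hom_in_carrier[OF St2_act_hom[OF _ n]])
qed

lemma CRel_act: "g \<in> GL n \<Longrightarrow> z \<in> carrier (St2 n) \<Longrightarrow> St2_act n g z \<otimes>\<^bsub>St2 n\<^esub> inv\<^bsub>St2 n\<^esub> z \<in> CRel n"
  unfolding coinvariant_relations_def by (rule generate.incl) blast

text \<open>The classification of the universal form makes every pure tensor a multiple of one
  unknown element modulo the relations; the chains with a single common flag replace that element by
  a pure tensor of pairing 1.\<close>

lemma St2_generator:
  assumes n: "0 < n"
  obtains \<tau> where "\<tau> \<in> carrier (St2 n :: 'f::field st2 monoid)" "St2_pairing \<tau> = 1"
    "\<And>z. z \<in> carrier (St2 n) \<Longrightarrow> z \<otimes>\<^bsub>St2 n\<^esub> inv\<^bsub>St2 n\<^esub> (\<tau> [^]\<^bsub>St2 n\<^esub> St2_pairing z) \<in> CRel n"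
proof -
  interpret M: comm_group "St2 n :: 'f st2 monoid" by (rule comm_group_St2)
  note CR = CRel_subgroup[OF n, where 'a = 'f]
  let ?S = "steinberg n :: 'f chain monoid"
  let ?FA = "free_Abelian_group (carrier ?S \<times> carrier ?S)"
  let ?co = "\<lambda>c. tensor_relations ?S ?S #>\<^bsub>?FA\<^esub> c"
  let ?pt = "pure_tensor ?S ?S"
  \<comment> \<open>Formal sums modulo \<open>N\<close> are the coinvariants, so
    \<open>\<beta>\<close> below is the universal invariant form, transported to chains on function
    flags.\<close>
  define N where "N = {c \<in> carrier ?FA. ?co c \<in> CRel n}"
  define \<beta> where "\<beta> d e = frag_of (fromSt n d :: 'f chain, fromSt n e :: 'f chain)" for d e
  have \<beta>FA: "\<beta> d e \<in> carrier ?FA" if "d \<in> vs.St n (EE n)" "e \<in> vs.St n (EE n)" for d e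
    using fromSt_steinberg[OF that(1) n] fromSt_steinberg[OF that(2) n] by (simp add: \<beta>_def)
  have N: "add_subgroup N"
    unfolding add_subgroup_def
  proof (intro conjI ballI)
    have "?co 0 = \<one>\<^bsub>St2 n\<^esub>" using StSt.co.hom_one[of n] by (simp add: St2_def)
    then show "0 \<in> N" using subgroup.one_closed[OF CR] by (simp add: N_def)
    fix x y assume "x \<in> N" "y \<in> N"
    then have xy: "x \<in> carrier ?FA" "y \<in> carrier ?FA" "?co x \<in> CRel n" "?co y \<in> CRel n" by (auto simp: N_def)
    have "?co (x - y) = ?co x \<otimes>\<^bsub>St2 n\<^esub> inv\<^bsub>St2 n\<^esub> (?co y)"
      using StSt.coset_diff[OF xy(1,2)] by (simp add: St2_def)
    also have "\<dots> \<in> CRel n" using xy subgroup.m_closed[OF CR] subgroup.m_inv_closed[OF CR] by blast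
    finally show "x - y \<in> N" using StSt.FA_diff_closed[OF xy(1,2)] unfolding N_def by blast
  qed
  have TRN: "c \<in> N" if c: "c \<in> tensor_relations ?S ?S" for c
  proof -
    have "c \<in> carrier ?FA" using c subgroup.subset[OF StSt.TR_subgroup] by blast
    moreover have "?co c = \<one>\<^bsub>St2 n\<^esub>" using StSt.coset_TR[OF c] by (simp add: St2_def)
    ultimately show ?thesis using subgroup.one_closed[OF CR] by (simp add: N_def)
  qed
  have bi: "vs.biadditive n (EE n) N \<beta>"
    unfolding vs.biadditive_def
  proof (intro conjI ballI)
    fix a a' b :: "(nat \<Rightarrow> 'f) fchain" assume *: "a \<in> vs.St n (EE n)" "a' \<in> vs.St n (EE n)" "b \<in> vs.St n (EE n)"
    show "\<beta> (a + a') b - \<beta> a b - \<beta> a' b \<in> N"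
      using TRN[OF StSt.TR_left[OF fromSt_steinberg[OF *(1) n] fromSt_steinberg[OF *(2) n] fromSt_steinberg[OF *(3) n]]]
      by (simp add: \<beta>_def fromSt_add[OF *(1,2) n])
  next
    fix a b b' :: "(nat \<Rightarrow> 'f) fchain" assume *: "a \<in> vs.St n (EE n)" "b \<in> vs.St n (EE n)" "b' \<in> vs.St n (EE n)"
    show "\<beta> a (b + b') - \<beta> a b - \<beta> a b' \<in> N"
      using TRN[OF StSt.TR_right[OF fromSt_steinberg[OF *(1) n] fromSt_steinberg[OF *(2) n] fromSt_steinberg[OF *(3) n]]]
      by (simp add: \<beta>_def fromSt_add[OF *(2,3) n])
  qed
  have inv: "vs.invariant n (EE n) (\<lambda>_. True) N \<beta>"
    unfolding vs.invariant_def
  proof (intro allI impI)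
    fix h :: "(nat \<Rightarrow> 'f) \<Rightarrow> nat \<Rightarrow> 'f" and a b :: "(nat \<Rightarrow> 'f) fchain"
    assume h: "vs.lin_iso (EE n) (EE n) h" and ab: "a \<in> vs.St n (EE n)" "b \<in> vs.St n (EE n)"
    obtain g where g: "g \<in> GL n" "\<And>v. v \<in> carrier_vec n \<Longrightarrow> h (emb (g *\<^sub>v v)) = emb v"
      using GL_of_lin_iso[OF h] by blast
    have pb: "fromSt n (vs.pb n (EE n) h d) = steinberg_act g (fromSt n d)" if d: "d \<in> vs.St n (EE n)" for d
    proof -
      let ?c = "fromSt n d"
      have c: "?c \<in> carrier ?S" using fromSt_steinberg[OF d n] .
      then have k: "Poly_Mapping.keys ?c \<subseteq> tits_simplices n (n - 1)" by (simp add: carrier_steinberg)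
      have "toSt n (steinberg_act g ?c) = vs.pb n (EE n) h d"
        using toSt_act(1)[OF g(1) h g(2) n k] toSt_fromSt[OF d n] by simp
      then show ?thesis using fromSt_toSt[OF steinberg_act_closed[OF g(1) n c] n] by simp
    qed
    let ?a = "fromSt n a" and ?b = "fromSt n b"
    note c = fromSt_steinberg[OF ab(1) n] fromSt_steinberg[OF ab(2) n]
    have "?co (\<beta> (vs.pb n (EE n) h a) (vs.pb n (EE n) h b) - \<beta> a b)
        = ?pt (steinberg_act g ?a) (steinberg_act g ?b) \<otimes>\<^bsub>St2 n\<^esub> inv\<^bsub>St2 n\<^esub> (?pt ?a ?b)"
      using StSt.coset_diff[OF \<beta>FA[OF vs.pb_St[OF h ab(1)] vs.pb_St[OF h ab(2)]] \<beta>FA[OF ab]]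
      by (simp add: St2_def StSt.pt_coset \<beta>_def pb[OF ab(1)] pb[OF ab(2)])
    also have "\<dots> = St2_act n g (?pt ?a ?b) \<otimes>\<^bsub>St2 n\<^esub> inv\<^bsub>St2 n\<^esub> (?pt ?a ?b)"
      using St2_act_pure[OF g(1) n c] by simp
    also have "\<dots> \<in> CRel n" using CRel_act[OF g(1)] StSt.pt_closed[OF c] by (simp add: St2_def)
    finally show "\<beta> (vs.pb n (EE n) h a) (vs.pb n (EE n) h b) - \<beta> a b \<in> N"
      using StSt.FA_diff_closed[OF \<beta>FA[OF vs.pb_St[OF h ab(1)] vs.pb_St[OF h ab(2)]] \<beta>FA[OF ab]] unfolding N_def by blast
  qed
  obtain t where t: "\<And>a b. a \<in> vs.St n (EE n) \<Longrightarrow> b \<in> vs.St n (EE n) \<Longrightarrow>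
      \<beta> a b - frag_cmul (vs.pr a b (\<lambda>_. True)) t \<in> N"
    using vs.GL_forms(1)[OF N subspace_EE bi inv] by blast
  obtain a0 b0 F where ab0: "a0 \<in> vs.St n (EE n :: (nat \<Rightarrow> 'f) set)" "b0 \<in> vs.St n (EE n)"
    and one: "\<And>G. a0 G * b0 G = (if G = F then 1 else 0)"
    using vs.exists_single_common_flag[of n "EE n"] standard_flag by blast
  have pr1: "vs.pr a0 b0 (\<lambda>_. True) = 1"
    unfolding vs.pr_def by (subst gsum_superset[of "{F}"]) (auto simp: one split: if_splits)
  let ?a0 = "fromSt n a0" and ?b0 = "fromSt n b0"
  note c0 = fromSt_steinberg[OF ab0(1) n] fromSt_steinberg[OF ab0(2) n]
  define \<tau> where "\<tau> = ?pt ?a0 ?b0"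
  have \<tau>: "\<tau> \<in> carrier (St2 n)" unfolding \<tau>_def St2_def by (rule StSt.pt_closed[OF c0])
  have pair: "steinberg_pairing a b = vs.pr (toSt n a) (toSt n b) (\<lambda>_. True)" if "a \<in> carrier ?S" for a b
    using that n by (intro steinberg_pairing_toSt) (simp_all add: carrier_steinberg)
  have P\<tau>: "St2_pairing \<tau> = 1"
    unfolding \<tau>_def St2_pairing_pure[OF n c0] pair[OF c0(1)] toSt_fromSt[OF ab0(1) n] toSt_fromSt[OF ab0(2) n] by (rule pr1)
  have pt_mem: "?pt a b \<otimes>\<^bsub>St2 n\<^esub> inv\<^bsub>St2 n\<^esub> (\<tau> [^]\<^bsub>St2 n\<^esub> St2_pairing (?pt a b)) \<in> CRel n"
    if ab: "a \<in> carrier ?S" "b \<in> carrier ?S" for a b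
  proof -
    let ?k = "steinberg_pairing a b"
    note sa = toSt_steinberg[OF ab(1) n] and sb = toSt_steinberg[OF ab(2) n]
    have \<beta>ab: "\<beta> (toSt n a) (toSt n b) = frag_of (a, b)" by (simp add: \<beta>_def fromSt_toSt[OF ab(1) n] fromSt_toSt[OF ab(2) n])
    \<comment> \<open>The unknown \<open>t\<close> is eliminated: the relation for \<open>a0\<close>
      and \<open>b0\<close>, whose pairing is 1, says that \<open>t\<close> agrees with
      \<open>\<beta> a0 b0\<close> modulo \<open>N\<close>; a multiple of it is subtracted.\<close>
    have "(frag_of (a, b) - frag_cmul ?k t) - frag_cmul ?k (\<beta> a0 b0 - frag_cmul 1 t) \<in> N"
      using add_subgroup_diff[OF N t[OF sa sb] add_subgroup_frag_cmul[OF N t[OF ab0], of ?k]]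
      by (simp only: \<beta>ab pair[OF ab(1)] pr1)
    then have "frag_of (a, b) - frag_cmul ?k (\<beta> a0 b0) \<in> N"
      by (simp add: frag_cmul_diff_right)
    then have "?co (frag_of (a, b) - frag_cmul ?k (\<beta> a0 b0)) \<in> CRel n" by (simp add: N_def)
    moreover have mem: "frag_of (a, b) \<in> carrier ?FA" "frag_cmul ?k (\<beta> a0 b0) \<in> carrier ?FA"
      using ab \<beta>FA[OF ab0] keys_cmul by auto
    have "?co (frag_of (a, b) - frag_cmul ?k (\<beta> a0 b0)) = ?pt a b \<otimes>\<^bsub>St2 n\<^esub> inv\<^bsub>St2 n\<^esub> (\<tau> [^]\<^bsub>St2 n\<^esub> ?k)"
      using StSt.coset_diff[OF mem] StSt.coset_frag_cmul[OF \<beta>FA[OF ab0]] by (simp add: St2_def StSt.pt_coset \<beta>_def \<tau>_def)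
    ultimately show ?thesis using St2_pairing_pure[OF n ab] by simp
  qed
  have all: "z \<otimes>\<^bsub>St2 n\<^esub> inv\<^bsub>St2 n\<^esub> (\<tau> [^]\<^bsub>St2 n\<^esub> St2_pairing z) \<in> CRel n" if z: "z \<in> carrier (St2 n)" for z
  proof -
    interpret P: group_hom "St2 n :: 'f st2 monoid" integer_group St2_pairing
      using St2_pairing_hom[OF n, where 'a = 'f] by (simp add: group_hom_def group_hom_axioms_def M.is_group)
    show ?thesis
      using z unfolding St2_def
    proof (induction rule: StSt.tensor_induct)
      case one
      then show ?case unfolding St2_def[symmetric] using P.hom_one subgroup.one_closed[OF CR] by simp
    next
      case (diff x y)
      note d = diff[folded St2_def]
      let ?u = "\<lambda>x. x \<otimes>\<^bsub>St2 n\<^esub> inv\<^bsub>St2 n\<^esub> (\<tau> [^]\<^bsub>St2 n\<^esub> St2_pairing x)"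
      have "St2_pairing (x \<otimes>\<^bsub>St2 n\<^esub> inv\<^bsub>St2 n\<^esub> y) = St2_pairing x - St2_pairing y"
        using d by simp
      then have "?u (x \<otimes>\<^bsub>St2 n\<^esub> inv\<^bsub>St2 n\<^esub> y) = ?u x \<otimes>\<^bsub>St2 n\<^esub> inv\<^bsub>St2 n\<^esub> (?u y)"
        using d \<tau> by (simp add: M.int_pow_diff M.inv_mult M.m_ac)
      also have "\<dots> \<in> CRel n" using d subgroup.m_closed[OF CR] subgroup.m_inv_closed[OF CR] by blast
      finally show ?case unfolding St2_def[symmetric] .
    next
      case (pure a b)
      show ?case unfolding St2_def[symmetric] by (rule pt_mem[OF pure])
    qed
  qed
  show thesis using that[OF \<tau> P\<tau> all] .
qed

lemma coinvariant_kernel_St2: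
  assumes n: "0 < n"
  shows "coinvariant_kernel (St2 n) integer_group (St2_act n ` GL n) St2_pairing"
proof -
  interpret M: comm_group "St2 n" by (rule comm_group_St2)
  have "x \<in> CRel n" if x: "x \<in> carrier (St2 n)" "St2_pairing x = 0" for x
  proof -
    obtain \<tau> where \<tau>: "\<tau> \<in> carrier (St2 n)"
      "x \<otimes>\<^bsub>St2 n\<^esub> inv\<^bsub>St2 n\<^esub> (\<tau> [^]\<^bsub>St2 n\<^esub> St2_pairing x) \<in> CRel n"
      using St2_generator[OF n] x(1) by metis
    then show ?thesis using x by simp
  qed
  then show ?thesis
    using St2_pairing_hom[OF n] hom_in_carrier[OF St2_act_hom[OF _ n]] St2_pairing_act[OF _ n]
    by (auto simp: coinvariant_kernel_def coinvariant_kernel_axioms_def comm_group_St2 abelian_integer_group)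
qed

section \<open>The shuffle product\<close>

definition sumspace :: "nat \<Rightarrow> nat \<Rightarrow> 'f::field vec set \<Rightarrow> 'f vec set \<Rightarrow> bool" where
  "sumspace m n U W \<longleftrightarrow> U \<subseteq> carrier_vec m \<and> W \<subseteq> carrier_vec n \<and> 0\<^sub>v m \<in> U \<and> 0\<^sub>v n \<in> W"

text \<open>A direct sum determines its summands: 0 in the other summand extends each vector of one
  summand to a vector of the sum.\<close>

lemma subspace_oplus_mono_iff:
  assumes s: "sumspace m n U W" and s': "sumspace m n U' W'"
  shows "subspace_oplus U W \<subseteq> subspace_oplus U' W' \<longleftrightarrow> U \<subseteq> U' \<and> W \<subseteq> W'"
proof
  assume sub: "subspace_oplus U W \<subseteq> subspace_oplus U' W'"
  have mem: "u \<in> U' \<and> w \<in> W'" if "u \<in> U" "w \<in> W" for u w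
  proof -
    have "u @\<^sub>v w \<in> subspace_oplus U W" using that unfolding subspace_oplus_def by blast
    then have "u @\<^sub>v w \<in> subspace_oplus U' W'" using sub by blast
    then obtain u' w' where uw: "u' \<in> U'" "w' \<in> W'" "u @\<^sub>v w = u' @\<^sub>v w'" by (auto simp: subspace_oplus_def)
    have "u \<in> carrier_vec m" "u' \<in> carrier_vec m" using that uw s s' by (auto simp: sumspace_def)
    then have "u = u' \<and> w = w'" using append_vec_eq uw(3) by blast
    then show ?thesis using uw by simp
  qed
  then show "U \<subseteq> U' \<and> W \<subseteq> W'" using s unfolding sumspace_def by blast
qed (auto simp: subspace_oplus_def)

lemma subspace_oplus_eq_iff:
  assumes s: "sumspace m n U W" and s': "sumspace m n U' W'"
  shows "subspace_oplus U W = subspace_oplus U' W' \<longleftrightarrow> U = U' \<and> W = W'"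
  using subspace_oplus_mono_iff[OF s s'] subspace_oplus_mono_iff[OF s' s] by blast

definition shift :: "nat \<Rightarrow> (nat \<Rightarrow> 'f::field) \<Rightarrow> nat \<Rightarrow> 'f" where
  "shift m f = (\<lambda>i. if i < m then 0 else f (i - m))"

lemma emb_append: "u \<in> carrier_vec m \<Longrightarrow> emb (u @\<^sub>v w) = emb u + shift m (emb w)"
  by (auto simp: emb_def shift_def fun_eq_iff)

text \<open>After embedding, concatenation is addition of the first vector and the shifted second
  one, so the image is a sum of two subspaces.\<close>

lemma subspace_emb_oplus:
  assumes U: "U \<subseteq> carrier_vec m" "vs.subspace (emb ` U)" and W: "vs.subspace (emb ` W)"
  shows "vs.subspace (emb ` subspace_oplus U W)"
proof -
  have "vs.subspace (shift m ` emb ` W)"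
  proof (rule vs.subspaceI)
    have "shift m 0 = 0" by (auto simp: shift_def fun_eq_iff)
    then show "0 \<in> shift m ` emb ` W" using vs.subspace_0[OF W] by (metis image_eqI)
  next
    fix x y assume "x \<in> shift m ` emb ` W" "y \<in> shift m ` emb ` W"
    then obtain f g where fg: "f \<in> emb ` W" "g \<in> emb ` W" "x = shift m f" "y = shift m g" by blast
    have "x + y = shift m (f + g)" unfolding fg by (auto simp: shift_def fun_eq_iff)
    then show "x + y \<in> shift m ` emb ` W" using vs.subspace_add[OF W fg(1,2)] by blast
  next
    fix c x assume "x \<in> shift m ` emb ` W"
    then obtain f where f: "f \<in> emb ` W" "x = shift m f" by blast
    have "fscale c x = shift m (fscale c f)" unfolding f by (auto simp: shift_def fun_eq_iff fscale_def)
    then show "fscale c x \<in> shift m ` emb ` W" using vs.subspace_scale[OF W f(1)] by blast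
  qed
  then have "vs.subspace {x + y | x y. x \<in> emb ` U \<and> y \<in> shift m ` emb ` W}"
    using U(2) by (intro vs.subspace_sums)
  moreover have "emb ` subspace_oplus U W = {x + y | x y. x \<in> emb ` U \<and> y \<in> shift m ` emb ` W}"
  proof
    show "emb ` subspace_oplus U W \<subseteq> {x + y | x y. x \<in> emb ` U \<and> y \<in> shift m ` emb ` W}"
    proof
      fix z assume "z \<in> emb ` subspace_oplus U W"
      then obtain u w where uw: "u \<in> U" "w \<in> W" "z = emb (u @\<^sub>v w)" by (auto simp: subspace_oplus_def)
      then have "z = emb u + shift m (emb w)" using emb_append[of u m w] U(1) by (metis subsetD)
      then show "z \<in> {x + y | x y. x \<in> emb ` U \<and> y \<in> shift m ` emb ` W}" using uw by blast
    qed
    show "{x + y | x y. x \<in> emb ` U \<and> y \<in> shift m ` emb ` W} \<subseteq> emb ` subspace_oplus U W"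
    proof
      fix z assume "z \<in> {x + y | x y. x \<in> emb ` U \<and> y \<in> shift m ` emb ` W}"
      then obtain u w where uw: "u \<in> U" "w \<in> W" "z = emb u + shift m (emb w)" by blast
      then have "z = emb (u @\<^sub>v w)" using emb_append[of u m w] U(1) by (metis subsetD)
      moreover have "u @\<^sub>v w \<in> subspace_oplus U W" using uw by (auto simp: subspace_oplus_def)
      ultimately show "z \<in> emb ` subspace_oplus U W" by blast
    qed
  qed
  ultimately show ?thesis by simp
qed

section \<open>Shuffles of two flags\<close>

abbreviation cin :: "nat set \<Rightarrow> nat \<Rightarrow> nat" where "cin S t \<equiv> card ({..<t} \<inter> S)"
abbreviation cout :: "nat set \<Rightarrow> nat \<Rightarrow> nat" where "cout S t \<equiv> card ({..<t} - S)"

lemma cin_Suc: "cin S (Suc t) = (if t \<in> S then Suc (cin S t) else cin S t)"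
  by (simp add: lessThan_Suc)

lemma cout_Suc: "cout S (Suc t) = (if t \<in> S then cout S t else Suc (cout S t))"
  by (simp add: lessThan_Suc insert_Diff_if)

lemma cin_mono: "s \<le> t \<Longrightarrow> cin S s \<le> cin S t"
  by (intro card_mono) auto

lemma cout_mono: "s \<le> t \<Longrightarrow> cout S s \<le> cout S t"
  by (intro card_mono) auto

lemma shuffle_counts:
  assumes S: "S \<in> shuffles_of_type m n"
  shows "cin S (m + n) = m" "cout S (m + n) = n"
    "t \<le> m + n \<Longrightarrow> cin S t \<le> m" "t \<le> m + n \<Longrightarrow> cout S t \<le> n"
proof -
  have S': "S \<subseteq> {..<m + n}" "card S = m" using S by (auto simp: shuffles_of_type_def)
  then have "{..<m + n} \<inter> S = S" by blast
  then show 1: "cin S (m + n) = m" using S' by simp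
  show 2: "cout S (m + n) = n" using S' by (subst card_Diff_subset) (auto intro: finite_subset)
  show "t \<le> m + n \<Longrightarrow> cin S t \<le> m" "t \<le> m + n \<Longrightarrow> cout S t \<le> n"
    using cin_mono[of t "m + n" S] cout_mono[of t "m + n" S] 1 2 by auto
qed

text \<open>Includes the outer terms at 0 and \<open>m + n\<close> that \<open>shuffle_flag\<close>
  omits, so that properness of the inner terms follows from strictness of the whole chain.\<close>

definition shuffle_term :: "nat \<Rightarrow> nat \<Rightarrow> nat set \<Rightarrow> 'f::field flag \<Rightarrow> 'f flag \<Rightarrow> nat \<Rightarrow> 'f vec set" where
  "shuffle_term m n S xs ys t = subspace_oplus (full_flag m xs ! cin S t) (full_flag n ys ! cout S t)"

lemma shuffle_flag_nth: "k < m + n - 1 \<Longrightarrow> shuffle_flag m n S xs ys ! k = shuffle_term m n S xs ys (Suc k)"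
  by (simp add: shuffle_flag_def shuffle_term_def)

lemma length_shuffle_flag: "length (shuffle_flag m n S xs ys) = m + n - 1"
  by (simp add: shuffle_flag_def)

lemma full_flag_nth_props:
  assumes xs: "xs \<in> tits_simplices m (m - 1)" "0 < m" and i: "i \<le> m"
  shows "full_flag m xs ! i \<subseteq> carrier_vec m" "vs.subspace (emb ` (full_flag m xs ! i))" "0\<^sub>v m \<in> full_flag m xs ! i"
    "vs.dim (emb ` (full_flag m xs ! i)) = i"
proof -
  have mem: "full_flag m xs ! i \<in> set (full_flag m xs)" using i full_flag_length[OF xs] by simp
  show c: "full_flag m xs ! i \<subseteq> carrier_vec m" and s: "vs.subspace (emb ` (full_flag m xs ! i))"
    using full_flag_sorted(2)[OF xs] mem by auto
  have "0 \<in> emb ` (full_flag m xs ! i)" using vs.subspace_0[OF s] .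
  then obtain u where u: "u \<in> full_flag m xs ! i" "emb u = 0" by auto
  then have "emb u = emb (0\<^sub>v m)" by (simp add: emb_zero)
  then have "u = 0\<^sub>v m" using inj_on_emb[of m] u c by (meson inj_onD subsetD zero_carrier_vec)
  then show "0\<^sub>v m \<in> full_flag m xs ! i" using u by simp
  show "vs.dim (emb ` (full_flag m xs ! i)) = i"
    using vs.flags_dim[OF toF_flags[OF xs] i] i by (simp add: toF_def min_def)
qed

lemma full_flag_nth_eq_iff:
  assumes xs: "xs \<in> tits_simplices m (m - 1)" "xs' \<in> tits_simplices m (m - 1)" "0 < m"
    and i: "i \<le> m" "i' \<le> m" "full_flag m xs ! i = full_flag m xs' ! i'"
  shows "i = i'"
  using full_flag_nth_props(4)[OF xs(1,3) i(1)] full_flag_nth_props(4)[OF xs(2,3) i(2)] i(3) by simp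

lemma full_flag_strict:
  assumes xs: "xs \<in> tits_simplices m (m - 1)" "0 < m" and i: "i < m"
  shows "full_flag m xs ! i \<subset> full_flag m xs ! Suc i"
  using sorted_wrt_nth_less[OF full_flag_sorted(1)[OF xs], of i "Suc i"] full_flag_length[OF xs] i by simp

lemma full_flag_0: "full_flag n xs ! 0 = {0\<^sub>v n}"
  by (simp add: full_flag_def)

lemma full_flag_last:
  assumes "xs \<in> tits_simplices m (m - 1)" "0 < m"
  shows "full_flag m xs ! m = carrier_vec m"
  using assms by (auto simp: full_flag_def nth_append tits_simplices_def nth_Cons')

context
  fixes m n :: nat
  assumes m: "0 < m" and n: "0 < n"
begin

lemma sumspace_full_flag:
  assumes "xs \<in> tits_simplices m (m - 1)" "ys \<in> tits_simplices n (n - 1)" "i \<le> m" "j \<le> n"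
  shows "sumspace m n (full_flag m xs ! i) (full_flag n ys ! j)"
  using full_flag_nth_props[OF assms(1) m assms(3)] full_flag_nth_props[OF assms(2) n assms(4)]
  unfolding sumspace_def by blast

text \<open>At each step exactly one of the two counters advances, and the corresponding flag is
  strict.\<close>

lemma shuffle_term_strict:
  assumes x: "xs \<in> tits_simplices m (m - 1)" and y: "ys \<in> tits_simplices n (n - 1)"
    and S: "S \<in> shuffles_of_type m n" and t: "t < m + n"
  shows "shuffle_term m n S xs ys t \<subset> shuffle_term m n S xs ys (Suc t)"
proof -
  have c: "cin S t \<le> m" "cin S (Suc t) \<le> m" "cout S t \<le> n" "cout S (Suc t) \<le> n"
    using shuffle_counts(3,4)[OF S] t by auto
  note s = sumspace_full_flag[OF x y c(1,3)] and s' = sumspace_full_flag[OF x y c(2,4)]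
  have "full_flag m xs ! cin S t \<subseteq> full_flag m xs ! cin S (Suc t) \<and> full_flag n ys ! cout S t \<subseteq> full_flag n ys ! cout S (Suc t)
     \<and> \<not> (full_flag m xs ! cin S t = full_flag m xs ! cin S (Suc t) \<and> full_flag n ys ! cout S t = full_flag n ys ! cout S (Suc t))"
  proof (cases "t \<in> S")
    case True
    then have "cin S (Suc t) = Suc (cin S t)" "cout S (Suc t) = cout S t" by (simp_all only: cin_Suc cout_Suc if_True)
    then show ?thesis using full_flag_strict[OF x m, of "cin S t"] c(2) by auto
  next
    case False
    then have "cin S (Suc t) = cin S t" "cout S (Suc t) = Suc (cout S t)" by (simp_all only: cin_Suc cout_Suc if_False)
    then show ?thesis using full_flag_strict[OF y n, of "cout S t"] c(4) by auto
  qed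
  then show ?thesis
    unfolding shuffle_term_def psubset_eq subspace_oplus_mono_iff[OF s s'] subspace_oplus_eq_iff[OF s s'] by blast
qed

lemma shuffle_term_strict_less:
  assumes x: "xs \<in> tits_simplices m (m - 1)" and y: "ys \<in> tits_simplices n (n - 1)"
    and S: "S \<in> shuffles_of_type m n" and t: "s < t" "t \<le> m + n"
  shows "shuffle_term m n S xs ys s \<subset> shuffle_term m n S xs ys t"
  using t
proof (induction t)
  case (Suc t)
  then show ?case using shuffle_term_strict[OF x y S, of t] by (cases "s = t") auto
qed simp

lemma append_carrier: "subspace_oplus (carrier_vec m) (carrier_vec n) = (carrier_vec (m + n) :: 'f::field vec set)"
proof
  show "subspace_oplus (carrier_vec m) (carrier_vec n) \<subseteq> (carrier_vec (m + n) :: 'f vec set)"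
    by (auto simp: subspace_oplus_def)
  show "(carrier_vec (m + n) :: 'f vec set) \<subseteq> subspace_oplus (carrier_vec m) (carrier_vec n)"
  proof (rule subsetI)
    fix v :: "'f vec" assume "v \<in> carrier_vec (m + n)"
    then have "v = vec_first v m @\<^sub>v vec_last v n" by simp
    then show "v \<in> subspace_oplus (carrier_vec m) (carrier_vec n)"
      unfolding subspace_oplus_def by (intro CollectI exI[of _ "vec_first v m"] exI[of _ "vec_last v n"]) simp
  qed
qed

lemma shuffle_flag_tits:
  assumes x: "xs \<in> tits_simplices m (m - 1)" and y: "ys \<in> tits_simplices n (n - 1)"
    and S: "S \<in> shuffles_of_type m n"
  shows "shuffle_flag m n S xs ys \<in> tits_simplices (m + n) (m + n - 1)"
proof -
  let ?t = "shuffle_term m n S xs ys"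
  have t0: "?t 0 = {0\<^sub>v (m + n)}"
    by (auto simp: shuffle_term_def full_flag_0 subspace_oplus_def)
  have tl: "?t (m + n) = carrier_vec (m + n)"
    unfolding shuffle_term_def shuffle_counts(1,2)[OF S] full_flag_last[OF x m] full_flag_last[OF y n] by (rule append_carrier)
  have "?t t \<in> proper_subspaces (m + n)" if t: "0 < t" "t < m + n" for t
    unfolding proper_subspaces_iff
  proof (intro conjI)
    have c: "cin S t \<le> m" "cout S t \<le> n" using shuffle_counts(3,4)[OF S, of t] t by auto
    show "vs.subspace (emb ` ?t t)"
      unfolding shuffle_term_def
      using full_flag_nth_props(1,2)[OF x m c(1)] full_flag_nth_props(2)[OF y n c(2)] by (rule subspace_emb_oplus)
    show "?t t \<subseteq> carrier_vec (m + n)" "?t t \<noteq> {0\<^sub>v (m + n)}" "?t t \<noteq> carrier_vec (m + n)"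
      using shuffle_term_strict_less[OF x y S, of 0 t] shuffle_term_strict_less[OF x y S, of t "m + n"] t t0 tl by auto
  qed
  then have "set (shuffle_flag m n S xs ys) \<subseteq> proper_subspaces (m + n)"
    by (auto simp: shuffle_flag_def shuffle_term_def)
  moreover have "sorted_wrt (\<subset>) (shuffle_flag m n S xs ys)"
    unfolding sorted_wrt_iff_nth_less length_shuffle_flag
  proof (intro allI impI)
    fix i j assume "i < j" "j < m + n - 1"
    then show "shuffle_flag m n S xs ys ! i \<subset> shuffle_flag m n S xs ys ! j"
      using shuffle_term_strict_less[OF x y S, of "Suc i" "Suc j"] by (simp add: shuffle_flag_nth)
  qed
  ultimately show ?thesis by (simp add: tits_simplices_def length_shuffle_flag)
qed

text \<open>A discrete intermediate value theorem; applied to the counters it shows that every term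
  of either factor occurs in the shuffle.\<close>

lemma step_surj:
  fixes f :: "nat \<Rightarrow> nat"
  assumes "\<And>t. f (Suc t) \<le> Suc (f t)" "f 0 = 0" "i \<le> f N"
  shows "\<exists>t\<le>N. f t = i"
  using assms(3)
proof (induction N)
  case 0
  then show ?case using assms(2) by auto
next
  case (Suc N)
  then show ?case
  proof (cases "i \<le> f N")
    case False
    then have "f (Suc N) = i" using assms(1)[of N] Suc.prems by simp
    then show ?thesis by blast
  qed (use Suc.IH le_SucI in blast)
qed

lemma flag_eqI:
  assumes x: "xs \<in> tits_simplices k (k - 1)" "xs' \<in> tits_simplices k (k - 1)"
    and eq: "\<And>i. 0 < i \<Longrightarrow> i < k \<Longrightarrow> full_flag k xs ! i = full_flag k xs' ! i"
  shows "xs = xs'"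
proof (rule nth_equalityI)
  have l: "length xs = k - 1" "length xs' = k - 1" using x by (auto simp: tits_simplices_def)
  then show "length xs = length xs'" by simp
  fix i assume "i < length xs"
  then show "xs ! i = xs' ! i" using eq[of "Suc i"] l by (simp add: full_flag_def nth_append)
qed

text \<open>Each term determines its two summands, and the dimension of the first summand determines
  the counter. The counters recover \<open>S\<close>; as they pass through all values, both flags
  are recovered too.\<close>

lemma shuffle_flag_inj:
  assumes x: "xs \<in> tits_simplices m (m - 1)" "xs' \<in> tits_simplices m (m - 1)"
    and y: "ys \<in> tits_simplices n (n - 1)" "ys' \<in> tits_simplices n (n - 1)"
    and S: "S \<in> shuffles_of_type m n" "S' \<in> shuffles_of_type m n"
    and eq: "shuffle_flag m n S xs ys = shuffle_flag m n S' xs' ys'"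
  shows "S = S' \<and> xs = xs' \<and> ys = ys'"
proof -
  have *: "full_flag m xs ! cin S t = full_flag m xs' ! cin S' t \<and> full_flag n ys ! cout S t = full_flag n ys' ! cout S' t"
    if t: "0 < t" "t < m + n" for t
  proof -
    have c: "cin S t \<le> m" "cout S t \<le> n" "cin S' t \<le> m" "cout S' t \<le> n"
      using shuffle_counts(3,4)[OF S(1), of t] shuffle_counts(3,4)[OF S(2), of t] t by auto
    have "shuffle_flag m n S xs ys ! (t - 1) = shuffle_flag m n S' xs' ys' ! (t - 1)" using eq by simp
    then have "shuffle_term m n S xs ys t = shuffle_term m n S' xs' ys' t" using t by (simp add: shuffle_flag_nth)
    then show ?thesis
      unfolding shuffle_term_def
      using subspace_oplus_eq_iff[OF sumspace_full_flag[OF x(1) y(1) c(1,2)] sumspace_full_flag[OF x(2) y(2) c(3,4)]] by blast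
  qed
  have ci: "cin S t = cin S' t" if t: "t \<le> m + n" for t
  proof -
    consider "t = 0" | "t = m + n" | "0 < t" "t < m + n" using t by linarith
    then show ?thesis
    proof cases
      case 2
      then show ?thesis using shuffle_counts(1)[OF S(1)] shuffle_counts(1)[OF S(2)] by simp
    next
      case 3
      then show ?thesis
        using *[OF 3] full_flag_nth_eq_iff[OF x m] shuffle_counts(3)[OF S(1), of t] shuffle_counts(3)[OF S(2), of t] by auto
    qed simp
  qed
  have "t \<in> S \<longleftrightarrow> t \<in> S'" for t
  proof (cases "t < m + n")
    case True
    then show ?thesis using ci[of t] ci[of "Suc t"] cin_Suc[of t S] cin_Suc[of t S'] by (metis Suc_leI less_imp_le n_not_Suc_n)
  next
    case False
    then show ?thesis using S by (auto simp: shuffles_of_type_def)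
  qed
  then have SS: "S = S'" by blast
  have "xs = xs'"
  proof (rule flag_eqI[OF x])
    fix i assume i: "0 < i" "i < m"
    have "\<exists>t\<le>m + n. cin S t = i"
      by (rule step_surj) (use i shuffle_counts(1)[OF S(1)] cin_Suc[of _ S] in auto)
    then obtain t where t: "t \<le> m + n" "cin S t = i" by blast
    then have "t \<noteq> m + n" using i shuffle_counts(1)[OF S(1)] by auto
    moreover have "t \<noteq> 0" using t(2) i(1) by (cases t) simp_all
    ultimately show "full_flag m xs ! i = full_flag m xs' ! i" using *[of t] t SS by auto
  qed
  moreover have "ys = ys'"
  proof (rule flag_eqI[OF y])
    fix i assume i: "0 < i" "i < n"
    have "\<exists>t\<le>m + n. cout S t = i"
      by (rule step_surj) (use i shuffle_counts(2)[OF S(1)] cout_Suc[of _ S] in auto)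
    then obtain t where t: "t \<le> m + n" "cout S t = i" by blast
    then have "t \<noteq> m + n" using i shuffle_counts(2)[OF S(1)] by auto
    moreover have "t \<noteq> 0" using t(2) i(1) by (cases t) simp_all
    ultimately show "full_flag n ys ! i = full_flag n ys' ! i" using *[of t] t SS by auto
  qed
  ultimately show ?thesis using SS by blast
qed

end

section \<open>Transposition of adjacent steps\<close>

definition swap2 :: "nat \<Rightarrow> nat \<Rightarrow> nat" where
  "swap2 k x = (if x = k then Suc k else if x = Suc k then k else x)"

lemma swap2_swap2 [simp]: "swap2 k (swap2 k x) = x"
  by (auto simp: swap2_def)

lemma swap2_image_iff: "x \<in> swap2 k ` S \<longleftrightarrow> swap2 k x \<in> S"
  by (metis image_iff swap2_swap2)

lemma finite_shuffles: "finite (shuffles_of_type m n)"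
  unfolding shuffles_of_type_def by (rule finite_subset[of _ "Pow {..<m + n}"]) auto

lemma card_shuffles: "card (shuffles_of_type m n) = (m + n) choose m"
  using n_subsets[of "{..<m + n}" m] by (simp add: shuffles_of_type_def)

lemma shuffle_sign_square: "shuffle_sign m n S * shuffle_sign m n S = 1"
  by (simp add: shuffle_sign_def power_add[symmetric])

lemma swap2_shuffle:
  assumes S: "S \<in> shuffles_of_type m n" and k: "Suc k < m + n"
  shows "swap2 k ` S \<in> shuffles_of_type m n"
proof -
  have "inj_on (swap2 k) S" by (metis inj_onI swap2_swap2)
  moreover have "swap2 k x < m + n" if "x < m + n" for x using that k by (auto simp: swap2_def)
  ultimately show ?thesis using S by (auto simp: shuffles_of_type_def card_image subset_iff)
qed

text \<open>The inversions are carried along by the transposition, and exactly one new inversion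
  arises, between the two transposed steps.\<close>

lemma shuffle_sign_swap2:
  assumes S: "S \<in> shuffles_of_type m n" and k: "Suc k < m + n" "k \<in> S" "Suc k \<notin> S"
  shows "shuffle_sign m n (swap2 k ` S) = - shuffle_sign m n S"
proof -
  define I where "I S = {(i, j). i \<in> S \<and> j \<in> {..<m + n} - S \<and> j < i}" for S :: "nat set"
  let ?p = "\<lambda>(i, j). (swap2 k i, swap2 k j)"
  have "I (swap2 k ` S) = insert (Suc k, k) (?p ` I S)"
  proof (rule Set.set_eqI)
    fix p :: "nat \<times> nat"
    obtain i j where p: "p = (i, j)" by (cases p)
    have "(i, j) \<in> ?p ` I S \<longleftrightarrow> (swap2 k i, swap2 k j) \<in> I S"
    proof
      assume "(i, j) \<in> ?p ` I S"
      then show "(swap2 k i, swap2 k j) \<in> I S" by auto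
    next
      assume "(swap2 k i, swap2 k j) \<in> I S"
      then show "(i, j) \<in> ?p ` I S" by (intro image_eqI[where x = "(swap2 k i, swap2 k j)"]) auto
    qed
    then show "p \<in> I (swap2 k ` S) \<longleftrightarrow> p \<in> insert (Suc k, k) (?p ` I S)"
      using k unfolding p by (simp add: I_def swap2_image_iff) (auto simp: swap2_def split: if_splits)
  qed
  moreover have "(Suc k, k) \<notin> ?p ` I S" by (auto simp: I_def swap2_def split: if_splits)
  moreover have "finite (I S)"
  proof (rule finite_subset)
    show "I S \<subseteq> {..<m + n} \<times> {..<m + n}" using S by (auto simp: I_def shuffles_of_type_def)
  qed simp
  moreover have "inj_on ?p (I S)" by (rule inj_onI) (auto dest: arg_cong[where f = "swap2 k"])
  ultimately have "card (I (swap2 k ` S)) = Suc (card (I S))" by (simp add: card_image)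
  then show ?thesis by (simp add: shuffle_sign_def I_def)
qed

lemma cin_cout: "cin S t + cout S t = t"
  using card_Int_Diff[of "{..<t}" S] by simp

text \<open>The counters change only between the two transposed steps, that is, in the one term
  which the face omits.\<close>

lemma cin_swap2:
  assumes "t \<noteq> Suc k"
  shows "cin (swap2 k ` S) t = cin S t" "cout (swap2 k ` S) t = cout S t"
proof -
  show c: "cin (swap2 k ` S) t = cin S t"
  proof (cases "t \<le> k")
    case True
    then have "{..<t} \<inter> swap2 k ` S = {..<t} \<inter> S" by (auto simp: swap2_image_iff) (auto simp: swap2_def)
    then show ?thesis by simp
  next
    case False
    then have "swap2 k x < t \<longleftrightarrow> x < t" for x using assms by (auto simp: swap2_def)
    then have "{..<t} \<inter> swap2 k ` S = swap2 k ` ({..<t} \<inter> S)" by (auto simp: swap2_image_iff)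
    moreover have "inj_on (swap2 k) ({..<t} \<inter> S)" by (metis inj_onI swap2_swap2)
    ultimately show ?thesis by (simp add: card_image)
  qed
  show "cout (swap2 k ` S) t = cout S t"
    using cin_cout[of t S] cin_cout[of t "swap2 k ` S"] c by simp
qed

section \<open>The boundary of a product\<close>

lemma frag_extend_superset:
  "finite A \<Longrightarrow> Poly_Mapping.keys c \<subseteq> A \<Longrightarrow> frag_extend f c = (\<Sum>x\<in>A. frag_cmul (Poly_Mapping.lookup c x) (f x))"
  unfolding frag_extend_def by (rule sum.mono_neutral_left) (auto simp: in_keys_iff)

lemma lookup_frag_extend_del: "Poly_Mapping.lookup (frag_extend (frag_of \<circ> del i) c) ys = face_sum c i ys"
proof -
  have "Poly_Mapping.lookup (frag_extend (frag_of \<circ> del i) c) ys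
    = (\<Sum>xs\<in>Poly_Mapping.keys c. if del i xs = ys then Poly_Mapping.lookup c xs else 0)"
    unfolding lookup_frag_extend by (intro sum.cong refl) (auto simp: lookup_frag_of)
  then show ?thesis unfolding face_sum_def by (simp add: sum.If_cases Int_def)
qed

lemma steinberg_iff_faces:
  assumes c: "Poly_Mapping.keys c \<subseteq> tits_simplices n (n - 1)"
  shows "c \<in> carrier (steinberg n) \<longleftrightarrow> (\<forall>i<n - 1. frag_extend (frag_of \<circ> del i) c = 0)"
proof -
  have "frag_extend (frag_of \<circ> del i) c = 0 \<longleftrightarrow> (\<forall>ys. face_sum c i ys = 0)" for i
    unfolding lookup_frag_extend_del[symmetric] by (auto intro: poly_mapping_eqI)
  then show ?thesis using boundary_eq_0_iff[OF c] c by (simp add: carrier_steinberg)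
qed

text \<open>A map that depends only on the face factors through the face map, so it kills every
  chain whose face vanishes.\<close>

lemma frag_extend_factor:
  assumes 0: "frag_extend (frag_of \<circ> d) c = 0"
    and h: "\<And>x x'. x \<in> Poly_Mapping.keys c \<Longrightarrow> x' \<in> Poly_Mapping.keys c \<Longrightarrow> d x = d x' \<Longrightarrow> h x = h x'"
  shows "frag_extend (frag_of \<circ> h) c = 0"
proof -
  define h' where "h' z = h (SOME x. x \<in> Poly_Mapping.keys c \<and> d x = z)" for z
  have h': "h' (d x) = h x" if "x \<in> Poly_Mapping.keys c" for x
  proof -
    let ?x = "SOME y. y \<in> Poly_Mapping.keys c \<and> d y = d x"
    have "?x \<in> Poly_Mapping.keys c \<and> d ?x = d x" by (rule someI[of _ x]) (simp add: that)
    then show ?thesis unfolding h'_def by (intro h) (simp_all add: that)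
  qed
  have "frag_extend (frag_of \<circ> h) c = frag_extend ((frag_of \<circ> h') \<circ> d) c"
    unfolding frag_extend_def by (intro sum.cong refl) (simp add: h')
  also have "\<dots> = frag_extend (frag_of \<circ> h') (frag_extend (frag_of \<circ> d) c)"
    by (rule frag_extend_compose[symmetric])
  also have "\<dots> = 0" unfolding 0 by simp
  finally show ?thesis .
qed

lemma full_flag_del:
  assumes l: "length xs = m - 1" "length xs' = m - 1" and i: "0 < i" "i < m"
    and eq: "del (i - 1) xs = del (i - 1) xs'" and j: "j \<noteq> i" "j \<le> m"
  shows "full_flag m xs ! j = full_flag m xs' ! j"
proof -
  consider "j = 0" | "j = m" | "0 < j" "j < i" | "i < j" "j < m" using j by linarith
  then show ?thesis
  proof cases
    case 1
    then show ?thesis by (simp add: full_flag_def)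
  next
    case 2
    then show ?thesis using l i by (simp add: full_flag_def nth_append nth_Cons')
  next
    case 3
    then have "del (i - 1) xs ! (j - 1) = xs ! (j - 1)" "del (i - 1) xs' ! (j - 1) = xs' ! (j - 1)"
      using l i by (auto simp: nth_del)
    then show ?thesis using 3 l i eq by (simp add: full_flag_def nth_append nth_Cons')
  next
    case 4
    then have "del (i - 1) xs ! (j - 2) = xs ! (j - 1)" "del (i - 1) xs' ! (j - 2) = xs' ! (j - 1)"
      using l i nth_del[of "i - 1" xs "j - 2"] nth_del[of "i - 1" xs' "j - 2"] by (auto simp: Suc_diff_Suc numeral_2_eq_2)
    then show ?thesis using 4 l i eq by (simp add: full_flag_def nth_append nth_Cons')
  qed
qed

lemma del_shuffle_eqI:
  assumes k: "k < m + n - 1"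
    and eq: "\<And>t. 0 < t \<Longrightarrow> t < m + n \<Longrightarrow> t \<noteq> Suc k \<Longrightarrow> shuffle_term m n S xs ys t = shuffle_term m n S' xs' ys' t"
  shows "del k (shuffle_flag m n S xs ys) = del k (shuffle_flag m n S' xs' ys')"
proof (rule nth_equalityI)
  fix j assume "j < length (del k (shuffle_flag m n S xs ys))"
  then have j: "j < m + n - 1 - 1" using k by (simp add: length_del length_shuffle_flag)
  have nth: "del k (shuffle_flag m n S xs ys) ! j = shuffle_term m n S xs ys (if j < k then Suc j else Suc (Suc j))" for S xs ys
    using j k by (simp add: nth_del length_shuffle_flag shuffle_flag_nth)
  show "del k (shuffle_flag m n S xs ys) ! j = del k (shuffle_flag m n S' xs' ys') ! j"
    unfolding nth by (rule eq) (use j k in auto)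
qed (use k in \<open>simp add: length_del length_shuffle_flag\<close>)

text \<open>The transposition matches the shuffles containing only \<open>k\<close> with those
  containing only \<open>k + 1\<close>, and matched summands are opposite.\<close>

lemma sum_shuffles_cancel:
  assumes k: "Suc k < m + n" and f: "\<And>S. S \<in> shuffles_of_type m n \<Longrightarrow> k \<in> S \<Longrightarrow> Suc k \<notin> S \<Longrightarrow> f (swap2 k ` S) = - f S"
  shows "(\<Sum>S\<in>shuffles_of_type m n. f S) = (\<Sum>S | S \<in> shuffles_of_type m n \<and> (k \<in> S \<longleftrightarrow> Suc k \<in> S). f S :: 'a::ab_group_add)"
proof -
  let ?Sh = "shuffles_of_type m n"
  let ?A = "{S \<in> ?Sh. k \<in> S \<longleftrightarrow> Suc k \<in> S}" and ?B = "{S \<in> ?Sh. k \<in> S \<and> Suc k \<notin> S}" and ?C = "{S \<in> ?Sh. k \<notin> S \<and> Suc k \<in> S}"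
  have fin: "finite ?A" "finite ?B" "finite ?C" using finite_shuffles by auto
  have sw: "swap2 k ` swap2 k ` S = S" for S by (simp add: image_image)
  have "(\<Sum>S\<in>?C. f S) = (\<Sum>S\<in>?B. - f S)"
  proof (rule sum.reindex_bij_witness[where i = "image (swap2 k)" and j = "image (swap2 k)"])
    fix S assume S: "S \<in> ?C"
    then show m: "swap2 k ` S \<in> ?B" using swap2_shuffle[OF _ k] by (auto simp: swap2_image_iff) (auto simp: swap2_def)
    show "swap2 k ` swap2 k ` S = S" by (rule sw)
    show "- f (swap2 k ` S) = f S" using f[of "swap2 k ` S"] m sw[of S] by simp
  next
    fix S assume S: "S \<in> ?B"
    then show "swap2 k ` S \<in> ?C" using swap2_shuffle[OF _ k] by (auto simp: swap2_image_iff) (auto simp: swap2_def)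
    show "swap2 k ` swap2 k ` S = S" by (rule sw)
  qed
  then have BC: "(\<Sum>S\<in>?B. f S) + (\<Sum>S\<in>?C. f S) = 0" by (simp add: sum_negf)
  have "?Sh = ?A \<union> (?B \<union> ?C)" by blast
  then have "(\<Sum>S\<in>?Sh. f S) = (\<Sum>S\<in>?A \<union> (?B \<union> ?C). f S)" by simp
  also have "\<dots> = (\<Sum>S\<in>?A. f S) + ((\<Sum>S\<in>?B. f S) + (\<Sum>S\<in>?C. f S))"
    using fin by (subst sum.union_disjoint, auto)+
  finally show ?thesis using BC by simp
qed

lemma frag_extend_frag_extend: "frag_extend f (frag_extend g c) = frag_extend (\<lambda>x. frag_extend f (g x)) c"
proof -
  have "frag_extend f (frag_extend g c) = frag_extend f (\<Sum>x\<in>Poly_Mapping.keys c. frag_cmul (Poly_Mapping.lookup c x) (g x))"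
    by (simp add: frag_extend_def)
  also have "\<dots> = frag_extend (\<lambda>x. frag_extend f (g x)) c"
    unfolding frag_extend_sum[OF finite_keys] by (simp add: frag_extend_def[of "\<lambda>x. frag_extend f (g x)"] frag_extend_cmul comp_def)
  finally show ?thesis .
qed

lemma keys_steinberg_mult:
  assumes "0 < m" "0 < n" and a: "Poly_Mapping.keys a \<subseteq> tits_simplices m (m - 1)" and c: "Poly_Mapping.keys c \<subseteq> tits_simplices n (n - 1)"
  shows "Poly_Mapping.keys (steinberg_mult m n a c) \<subseteq> tits_simplices (m + n) (m + n - 1)"
proof
  fix z assume z: "z \<in> Poly_Mapping.keys (steinberg_mult m n a c)"
  from subsetD[OF keys_frag_extend z[unfolded steinberg_mult_def]]
  obtain x where x: "x \<in> Poly_Mapping.keys a" and z: "z \<in> Poly_Mapping.keys (frag_extend (\<lambda>ys. \<Sum>S\<in>shuffles_of_type m n.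
       frag_cmul (shuffle_sign m n S) (frag_of (shuffle_flag m n S x ys))) c)"
    by (rule UN_E)
  from subsetD[OF keys_frag_extend z]
  obtain y where y: "y \<in> Poly_Mapping.keys c" and z: "z \<in> Poly_Mapping.keys (\<Sum>S\<in>shuffles_of_type m n.
       frag_cmul (shuffle_sign m n S) (frag_of (shuffle_flag m n S x y)))"
    by (rule UN_E)
  from subsetD[OF keys_sum z]
  obtain S where S: "S \<in> shuffles_of_type m n" and z: "z \<in> Poly_Mapping.keys (frag_cmul (shuffle_sign m n S) (frag_of (shuffle_flag m n S x y)))"
    by (rule UN_E)
  from subsetD[OF keys_cmul z] have "z = shuffle_flag m n S x y" by simp
  then show "z \<in> tits_simplices (m + n) (m + n - 1)"
    using shuffle_flag_tits[OF assms(1,2) subsetD[OF a x] subsetD[OF c y] S] by simp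
qed

text \<open>
  The terms of the boundary where steps \<open>k\<close> and \<open>k + 1\<close> belong to different factors cancel in pairs under the
  transposition of these steps; the others contain a part of the boundary of one factor.
\<close>

lemma steinberg_mult_closed:
  assumes mn: "0 < m" "0 < n" and a: "a \<in> carrier (steinberg m)" and c: "c \<in> carrier (steinberg n)"
  shows "steinberg_mult m n a c \<in> carrier (steinberg (m + n))"
proof -
  have ka: "Poly_Mapping.keys a \<subseteq> tits_simplices m (m - 1)" and kc: "Poly_Mapping.keys c \<subseteq> tits_simplices n (n - 1)"
    using a c by (auto simp: carrier_steinberg)
  note fa = steinberg_iff_faces[OF ka, THEN iffD1, OF a, rule_format]
    and fc = steinberg_iff_faces[OF kc, THEN iffD1, OF c, rule_format]
  have lx: "length x = m - 1" if "x \<in> Poly_Mapping.keys a" for x using that ka by (auto simp: tits_simplices_def)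
  have ly: "length y = n - 1" if "y \<in> Poly_Mapping.keys c" for y using that kc by (auto simp: tits_simplices_def)
  have "frag_extend (frag_of \<circ> del k) (steinberg_mult m n a c) = 0" if k: "k < m + n - 1" for k
  proof -
    let ?sh = "shuffle_flag m n" and ?s = "shuffle_sign m n"
    let ?D = "\<lambda>S x y. frag_of (del k (?sh S x y))"
    let ?E = "{S. S \<in> shuffles_of_type m n \<and> (k \<in> S \<longleftrightarrow> Suc k \<in> S)}"
    have fin: "finite ?E" using finite_shuffles[of m n] by simp
    have k': "Suc k < m + n" using k by linarith
    have inner: "frag_extend (frag_of \<circ> del k) (\<Sum>S\<in>shuffles_of_type m n. frag_cmul (?s S) (frag_of (?sh S x y)))
       = (\<Sum>S\<in>?E. frag_cmul (?s S) (?D S x y))" for x y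
    proof -
      have "frag_extend (frag_of \<circ> del k) (\<Sum>S\<in>shuffles_of_type m n. frag_cmul (?s S) (frag_of (?sh S x y)))
        = (\<Sum>S\<in>shuffles_of_type m n. frag_cmul (?s S) (?D S x y))"
        unfolding frag_extend_sum[OF finite_shuffles] by (simp add: frag_extend_cmul)
      also have "\<dots> = (\<Sum>S\<in>?E. frag_cmul (?s S) (?D S x y))"
      proof (rule sum_shuffles_cancel[OF k'])
        fix S assume S: "S \<in> shuffles_of_type m n" "k \<in> S" "Suc k \<notin> S"
        have "del k (?sh (swap2 k ` S) x y) = del k (?sh S x y)"
          by (rule del_shuffle_eqI[OF k]) (simp add: shuffle_term_def cin_swap2)
        then show "frag_cmul (?s (swap2 k ` S)) (?D (swap2 k ` S) x y) = - frag_cmul (?s S) (?D S x y)"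
          using shuffle_sign_swap2[OF S(1) k' S(2,3)] by simp
      qed
      finally show ?thesis .
    qed
    have "frag_extend (frag_of \<circ> del k) (steinberg_mult m n a c)
        = frag_extend (\<lambda>x. frag_extend (\<lambda>y. \<Sum>S\<in>?E. frag_cmul (?s S) (?D S x y)) c) a"
      unfolding steinberg_mult_def frag_extend_frag_extend inner ..
    also have "\<dots> = (\<Sum>x\<in>Poly_Mapping.keys a. \<Sum>y\<in>Poly_Mapping.keys c. \<Sum>S\<in>?E.
        frag_cmul (Poly_Mapping.lookup a x * Poly_Mapping.lookup c y * ?s S) (?D S x y))"
      by (simp add: frag_extend_def frag_cmul_sum mult.assoc)
    also have "\<dots> = (\<Sum>S\<in>?E. \<Sum>x\<in>Poly_Mapping.keys a. \<Sum>y\<in>Poly_Mapping.keys c.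
        frag_cmul (Poly_Mapping.lookup a x * Poly_Mapping.lookup c y * ?s S) (?D S x y))"
      by (subst sum.swap[of _ ?E], subst sum.swap[of _ ?E]) simp
    also have "\<dots> = 0"
    proof (rule sum.neutral, rule ballI)
      fix S assume "S \<in> ?E"
      then have S: "S \<in> shuffles_of_type m n" and kS: "k \<in> S \<longleftrightarrow> Suc k \<in> S" by auto
      show "(\<Sum>x\<in>Poly_Mapping.keys a. \<Sum>y\<in>Poly_Mapping.keys c.
          frag_cmul (Poly_Mapping.lookup a x * Poly_Mapping.lookup c y * ?s S) (?D S x y)) = 0"
      proof (cases "k \<in> S")
        case True
        \<comment> \<open>Both steps around the omitted term belong to the first factor, so its term
          \<open>i\<close> occurs nowhere else in the shuffle. The face depends on \<open>x\<close>
          only through the face omitting list position \<open>i - 1\<close>, and there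
          \<open>a\<close> is a cycle.\<close>
        define i where "i = cin S (Suc k)"
        have ck: "cin S (Suc k) = Suc (cin S k)" "cin S (Suc (Suc k)) = Suc (cin S (Suc k))"
          using True kS by (simp_all only: cin_Suc if_True)
        have i: "0 < i" "i < m" using ck shuffle_counts(3)[OF S, of "Suc (Suc k)"] k' by (auto simp: i_def)
        have ne: "cin S t \<noteq> i" if "t \<noteq> Suc k" for t
          using that ck cin_mono[of t k S] cin_mono[of "Suc (Suc k)" t S] unfolding i_def by linarith
        have 0: "frag_extend (frag_of \<circ> (\<lambda>x. del k (?sh S x y))) a = 0" for y
        proof (rule frag_extend_factor)
          show "frag_extend (frag_of \<circ> del (i - 1)) a = 0" using fa[of "i - 1"] i by simp
          fix x x' assume x: "x \<in> Poly_Mapping.keys a" "x' \<in> Poly_Mapping.keys a" "del (i - 1) x = del (i - 1) x'"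
          show "del k (?sh S x y) = del k (?sh S x' y)"
          proof (rule del_shuffle_eqI[OF k])
            fix t assume t: "0 < t" "t < m + n" "t \<noteq> Suc k"
            have "full_flag m x ! cin S t = full_flag m x' ! cin S t"
              using t by (intro full_flag_del[OF lx[OF x(1)] lx[OF x(2)] i x(3) ne] shuffle_counts(3)[OF S]) auto
            then show "shuffle_term m n S x y t = shuffle_term m n S x' y t" by (simp add: shuffle_term_def)
          qed
        qed
        have "(\<Sum>x\<in>Poly_Mapping.keys a. \<Sum>y\<in>Poly_Mapping.keys c.
            frag_cmul (Poly_Mapping.lookup a x * Poly_Mapping.lookup c y * ?s S) (?D S x y))
          = (\<Sum>y\<in>Poly_Mapping.keys c. frag_cmul (Poly_Mapping.lookup c y * ?s S) (frag_extend (frag_of \<circ> (\<lambda>x. del k (?sh S x y))) a))"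
          by (subst sum.swap) (simp add: frag_extend_def frag_cmul_sum mult_ac)
        then show ?thesis by (simp only: 0 frag_cmul_zero2 sum.neutral_const)
      next
        case False
        define i where "i = cout S (Suc k)"
        have ck: "cout S (Suc k) = Suc (cout S k)" "cout S (Suc (Suc k)) = Suc (cout S (Suc k))"
          using False kS by (simp_all only: cout_Suc if_False)
        have i: "0 < i" "i < n" using ck shuffle_counts(4)[OF S, of "Suc (Suc k)"] k' by (auto simp: i_def)
        have ne: "cout S t \<noteq> i" if "t \<noteq> Suc k" for t
          using that ck cout_mono[of t k S] cout_mono[of "Suc (Suc k)" t S] unfolding i_def by linarith
        have 0: "frag_extend (frag_of \<circ> (\<lambda>y. del k (?sh S x y))) c = 0" for x
        proof (rule frag_extend_factor)
          show "frag_extend (frag_of \<circ> del (i - 1)) c = 0" using fc[of "i - 1"] i by simp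
          fix y y' assume y: "y \<in> Poly_Mapping.keys c" "y' \<in> Poly_Mapping.keys c" "del (i - 1) y = del (i - 1) y'"
          show "del k (?sh S x y) = del k (?sh S x y')"
          proof (rule del_shuffle_eqI[OF k])
            fix t assume t: "0 < t" "t < m + n" "t \<noteq> Suc k"
            have "full_flag n y ! cout S t = full_flag n y' ! cout S t"
              using t by (intro full_flag_del[OF ly[OF y(1)] ly[OF y(2)] i y(3) ne] shuffle_counts(4)[OF S]) auto
            then show "shuffle_term m n S x y t = shuffle_term m n S x y' t" by (simp add: shuffle_term_def)
          qed
        qed
        have "(\<Sum>x\<in>Poly_Mapping.keys a. \<Sum>y\<in>Poly_Mapping.keys c.
            frag_cmul (Poly_Mapping.lookup a x * Poly_Mapping.lookup c y * ?s S) (?D S x y))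
          = (\<Sum>x\<in>Poly_Mapping.keys a. frag_cmul (Poly_Mapping.lookup a x * ?s S) (frag_extend (frag_of \<circ> (\<lambda>y. del k (?sh S x y))) c))"
          by (simp add: frag_extend_def frag_cmul_sum mult_ac)
        then show ?thesis by (simp only: 0 frag_cmul_zero2 sum.neutral_const)
      qed
    qed
    finally show ?thesis .
  qed
  then show ?thesis using steinberg_iff_faces[OF keys_steinberg_mult[OF mn ka kc]] by blast
qed

section \<open>The pairing of two products\<close>

lemma pairing_superset:
  assumes "finite A" "Poly_Mapping.keys a \<subseteq> A"
  shows "steinberg_pairing a b = (\<Sum>x\<in>A. Poly_Mapping.lookup a x * Poly_Mapping.lookup b x)"
  unfolding steinberg_pairing_def by (rule sum.mono_neutral_left) (use assms in \<open>auto simp: in_keys_iff\<close>)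

lemma sum_triple: "(\<Sum>p\<in>A \<times> B \<times> C. f p) = (\<Sum>x\<in>A. \<Sum>y\<in>B. \<Sum>z\<in>C. f (x, y, z))"
  by (simp add: sum.cartesian_product split_def)

lemma steinberg_pairing_mult:
  fixes a b c d :: "'f::field chain"
  assumes mn: "0 < m" "0 < n" and ab: "a \<in> carrier (steinberg m)" "b \<in> carrier (steinberg m)"
    and cd: "c \<in> carrier (steinberg n)" "d \<in> carrier (steinberg n)"
  shows "steinberg_pairing (steinberg_mult m n a c) (steinberg_mult m n b d)
    = int ((m + n) choose m) * steinberg_pairing a b * steinberg_pairing c d"
proof -
  let ?l = "Poly_Mapping.lookup"
  \<comment> \<open>Unions of supports, so that both products are expanded over the same triples; by
    \<open>inj\<close> the flags \<open>e p\<close> are orthonormal.\<close>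
  define X where "X = Poly_Mapping.keys a \<union> Poly_Mapping.keys b"
  define Y where "Y = Poly_Mapping.keys c \<union> Poly_Mapping.keys d"
  define K where "K = X \<times> Y \<times> shuffles_of_type m n"
  have X: "finite X" "X \<subseteq> tits_simplices m (m - 1)" and Y: "finite Y" "Y \<subseteq> tits_simplices n (n - 1)"
    using ab cd by (auto simp: X_def Y_def carrier_steinberg)
  have K: "finite K" using X Y finite_shuffles by (simp add: K_def)
  define e where "e = (\<lambda>(x :: 'f flag, y, S). shuffle_flag m n S x y)"
  have inj: "inj_on e K"
  proof (rule inj_onI)
    fix p q assume "p \<in> K" "q \<in> K" and eq: "e p = e q"
    then obtain x y S x' y' S' where p: "p = (x, y, S)" "q = (x', y', S')" "x \<in> X" "x' \<in> X" "y \<in> Y" "y' \<in> Y"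
      "S \<in> shuffles_of_type m n" "S' \<in> shuffles_of_type m n" unfolding K_def by auto
    have "S = S' \<and> x = x' \<and> y = y'"
      using eq p X(2) Y(2) by (intro shuffle_flag_inj[OF mn]) (auto simp: e_def)
    then show "p = q" using p by simp
  qed
  define w where "w a c = (\<lambda>(x, y, S). ?l a x * ?l c y * shuffle_sign m n S)" for a c :: "'f chain"
  have mult: "steinberg_mult m n a c = (\<Sum>p\<in>K. frag_cmul (w a c p) (frag_of (e p)))"
    if "Poly_Mapping.keys a \<subseteq> X" "Poly_Mapping.keys c \<subseteq> Y" for a c
    unfolding steinberg_mult_def frag_extend_superset[OF X(1) that(1)] frag_extend_superset[OF Y(1) that(2)] K_def
    unfolding sum_triple by (simp add: frag_cmul_sum w_def e_def mult.assoc)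
  have look: "?l (\<Sum>p\<in>K. frag_cmul (u p) (frag_of (e p))) (e q) = u q" if "q \<in> K" for u q
  proof -
    have "?l (\<Sum>p\<in>K. frag_cmul (u p) (frag_of (e p))) (e q) = (\<Sum>p\<in>K. if p = q then u p else 0)"
      unfolding lookup_sum using inj_on_eq_iff[OF inj that] inj_on_eq_iff[OF inj _ that] by (intro sum.cong refl) auto
    then show ?thesis using that K by simp
  qed
  have keys: "Poly_Mapping.keys (\<Sum>p\<in>K. frag_cmul (u p) (frag_of (e p))) \<subseteq> e ` K" for u
  proof
    fix z assume "z \<in> Poly_Mapping.keys (\<Sum>p\<in>K. frag_cmul (u p) (frag_of (e p)))"
    from subsetD[OF keys_sum this]
    obtain p where p: "p \<in> K" and z: "z \<in> Poly_Mapping.keys (frag_cmul (u p) (frag_of (e p)))" by (rule UN_E)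
    from subsetD[OF keys_cmul z] p show "z \<in> e ` K" by simp
  qed
  have sub: "Poly_Mapping.keys a \<subseteq> X" "Poly_Mapping.keys b \<subseteq> X" "Poly_Mapping.keys c \<subseteq> Y" "Poly_Mapping.keys d \<subseteq> Y"
    by (auto simp: X_def Y_def)
  have "steinberg_pairing (steinberg_mult m n a c) (steinberg_mult m n b d) = (\<Sum>z\<in>e ` K. ?l (steinberg_mult m n a c) z * ?l (steinberg_mult m n b d) z)"
    using keys K by (intro pairing_superset) (simp_all add: mult sub)
  also have "\<dots> = (\<Sum>p\<in>K. w a c p * w b d p)"
    unfolding sum.reindex[OF inj] mult[OF sub(1,3)] mult[OF sub(2,4)] by (intro sum.cong refl) (simp add: look)
  also have "\<dots> = (\<Sum>x\<in>X. \<Sum>y\<in>Y. \<Sum>S\<in>shuffles_of_type m n. (?l a x * ?l b x) * (?l c y * ?l d y))"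
    unfolding K_def sum_triple
  proof (intro sum.cong refl)
    fix x y S
    \<comment> \<open>Both products carry the same shuffle sign, so each of the shuffles contributes
      with sign 1 and only their number remains.\<close>
    have "w a c (x, y, S) * w b d (x, y, S) = (?l a x * ?l b x) * (?l c y * ?l d y) * (shuffle_sign m n S * shuffle_sign m n S)"
      by (simp add: w_def mult_ac)
    then show "w a c (x, y, S) * w b d (x, y, S) = (?l a x * ?l b x) * (?l c y * ?l d y)"
      by (simp only: shuffle_sign_square mult_1_right)
  qed
  also have "\<dots> = int ((m + n) choose m) * ((\<Sum>x\<in>X. ?l a x * ?l b x) * (\<Sum>y\<in>Y. ?l c y * ?l d y))"
    unfolding sum_product by (simp add: card_shuffles sum_distrib_left)
  finally show ?thesis
    unfolding pairing_superset[OF X(1) sub(1)] pairing_superset[OF Y(1) sub(3)] by (simp add: mult.assoc)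
qed

lemma steinberg_mult_add:
  fixes a b c d :: "'f::field chain"
  shows "steinberg_mult m n (a + b) c = steinberg_mult m n a c + steinberg_mult m n b c"
  "steinberg_mult m n a (c + d) = steinberg_mult m n a c + steinberg_mult m n a d"
proof -
  show "steinberg_mult m n (a + b) c = steinberg_mult m n a c + steinberg_mult m n b c"
    by (simp add: steinberg_mult_def frag_extend_add)
  have "frag_extend (\<lambda>x. f x + g x) a = frag_extend f a + frag_extend g a" for f g :: "'f flag \<Rightarrow> 'f chain"
    by (simp add: frag_extend_def frag_cmul_distrib2 sum.distrib)
  then show "steinberg_mult m n a (c + d) = steinberg_mult m n a c + steinberg_mult m n a d"
    by (simp add: steinberg_mult_def frag_extend_add)
qed

section \<open>Graded algebras isomorphic to divided powers\<close>

context cring begin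

abbreviation (input) "DP \<equiv> divided_power_algebra R"

abbreviation (input) dterm :: "(nat \<Rightarrow> 'a) \<Rightarrow> (nat \<Rightarrow> 'a) \<Rightarrow> nat \<Rightarrow> nat \<Rightarrow> 'a" where
  "dterm f g n i \<equiv> add_pow R (n choose i) (f i \<otimes> g (n - i))"

lemma carrier_DP: "f \<in> carrier DP \<longleftrightarrow> (\<forall>n. f n \<in> carrier R) \<and> finite {n. f n \<noteq> \<zero>}"
  by (simp add: divided_power_algebra_def)

lemma DP_simps:
  "f \<otimes>\<^bsub>DP\<^esub> g = (\<lambda>n. \<Oplus>i\<in>{..n}. dterm f g n i)"
  "\<one>\<^bsub>DP\<^esub> = (\<lambda>n. if n = 0 then \<one> else \<zero>)"
  "\<zero>\<^bsub>DP\<^esub> = (\<lambda>n. \<zero>)"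
  "f \<oplus>\<^bsub>DP\<^esub> g = (\<lambda>n. f n \<oplus> g n)"
  "r \<odot>\<^bsub>DP\<^esub> f = (\<lambda>n. r \<otimes> f n)"
  by (simp_all add: divided_power_algebra_def)

lemma DP_mult_closed:
  assumes f: "f \<in> carrier DP" and g: "g \<in> carrier DP"
  shows "f \<otimes>\<^bsub>DP\<^esub> g \<in> carrier DP"
proof -
  let ?A = "{n. f n \<noteq> \<zero>}" and ?B = "{n. g n \<noteq> \<zero>}"
  have "{n. (\<Oplus>i\<in>{..n}. dterm f g n i) \<noteq> \<zero>} \<subseteq> (\<lambda>(i, j). i + j) ` (?A \<times> ?B)"
  proof
    fix n assume "n \<in> {n. (\<Oplus>i\<in>{..n}. dterm f g n i) \<noteq> \<zero>}"
    then have "\<exists>i\<le>n. f i \<otimes> g (n - i) \<noteq> \<zero>"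
      using add.finprod_one_eqI[of "{..n}" "dterm f g n"] by fastforce
    then obtain i where i: "i \<le> n" "f i \<otimes> g (n - i) \<noteq> \<zero>" by blast
    then have "f i \<noteq> \<zero>" "g (n - i) \<noteq> \<zero>" using f g by (auto simp: carrier_DP)
    then show "n \<in> (\<lambda>(i, j). i + j) ` (?A \<times> ?B)" using i by (intro image_eqI[where x = "(i, n - i)"]) auto
  qed
  then have "finite {n. (\<Oplus>i\<in>{..n}. dterm f g n i) \<noteq> \<zero>}"
    using f g by (rule_tac finite_subset) (auto simp: carrier_DP)
  moreover have "(\<Oplus>i\<in>{..n}. dterm f g n i) \<in> carrier R" for n
    using f g by (intro finsum_closed) (auto simp: carrier_DP)
  ultimately show ?thesis unfolding carrier_DP DP_simps by blast
qed

lemma DP_mult_comm: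
  assumes f: "f \<in> carrier DP" and g: "g \<in> carrier DP"
  shows "f \<otimes>\<^bsub>DP\<^esub> g = g \<otimes>\<^bsub>DP\<^esub> f"
  unfolding DP_simps
proof
  fix n
  have c: "f i \<in> carrier R" "g i \<in> carrier R" for i using f g by (auto simp: carrier_DP)
  have eq: "dterm g f n (n - i) = dterm f g n i" if "i \<in> {..n}" for i
    using that c by (simp add: binomial_symmetric[symmetric] m_comm)
  show "(\<Oplus>i\<in>{..n}. dterm f g n i) = (\<Oplus>i\<in>{..n}. dterm g f n i)"
    by (rule finsum_reindex_bij_witness[where i = "\<lambda>i. n - i" and j = "\<lambda>i. n - i"]) (use eq c in auto)
qed

text \<open>The pairs \<open>i \<le> k \<le> n\<close> are reparametrised by \<open>i\<close> and
  \<open>j = k - i\<close>.\<close>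

lemma finsum_triangle:
  assumes F: "\<And>k i. F k i \<in> carrier R"
  shows "(\<Oplus>k\<in>{..n::nat}. \<Oplus>i\<in>{..k}. F k i) = (\<Oplus>i\<in>{..n}. \<Oplus>j\<in>{..n - i}. F (i + j) i)"
proof -
  have "(\<Oplus>k\<in>{..n}. \<Oplus>i\<in>{..k}. F k i) = (\<Oplus>k\<in>{..n}. \<Oplus>i\<in>{..n}. if i \<le> k then F k i else \<zero>)"
    by (intro finsum_cong' refl add.finprod_mono_neutral_cong_left) (use F in auto)
  also have "\<dots> = (\<Oplus>i\<in>{..n}. \<Oplus>k\<in>{..n}. if i \<le> k then F k i else \<zero>)"
    by (rule finsum_finsum_swap) (use F in auto)
  also have "\<dots> = (\<Oplus>i\<in>{..n}. \<Oplus>k\<in>{i..n}. F k i)"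
    by (intro finsum_cong' refl add.finprod_mono_neutral_cong_right) (use F in auto)
  also have "\<dots> = (\<Oplus>i\<in>{..n}. \<Oplus>j\<in>{..n - i}. F (i + j) i)"
  proof (rule finsum_cong'[OF refl])
    fix i
    show "(\<Oplus>k\<in>{i..n}. F k i) = (\<Oplus>j\<in>{..n - i}. F (i + j) i)" if "i \<in> {..n}"
      by (rule finsum_reindex_bij_witness[where i = "\<lambda>j. i + j" and j = "\<lambda>k. k - i"]) (use F that in auto)
  qed (use F in auto)
  finally show ?thesis .
qed

lemma finsum_add_pow:
  assumes "finite A" "\<And>i. i \<in> A \<Longrightarrow> f i \<in> carrier R"
  shows "add_pow R (k :: nat) (\<Oplus>i\<in>A. f i) = (\<Oplus>i\<in>A. add_pow R k (f i))"
  using assms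
proof (induction A)
  case (insert x A)
  then have "(\<Oplus>i\<in>A. f i) \<in> carrier R" by (intro finsum_closed) auto
  then show ?case using insert by (simp add: add.nat_pow_distrib Pi_def)
qed (simp add: add.nat_pow_one)

text \<open>Both products sum over the splittings of \<open>n\<close> into \<open>i\<close>,
  \<open>j\<close> and a rest, with the multinomial coefficient, which is factored by two binomials
  in two ways (\<open>choose_mult\<close>).\<close>

lemma DP_mult_assoc:
  assumes f: "f \<in> carrier DP" and g: "g \<in> carrier DP" and h: "h \<in> carrier DP"
  shows "(f \<otimes>\<^bsub>DP\<^esub> g) \<otimes>\<^bsub>DP\<^esub> h = f \<otimes>\<^bsub>DP\<^esub> (g \<otimes>\<^bsub>DP\<^esub> h)"
proof
  fix n
  have c: "f i \<in> carrier R" "g i \<in> carrier R" "h i \<in> carrier R" for i using f g h by (auto simp: carrier_DP)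
  define F where "F k i = add_pow R ((n choose k) * (k choose i)) (f i \<otimes> g (k - i) \<otimes> h (n - k))" for k i
  have F: "F k i \<in> carrier R" for k i unfolding F_def using c by simp
  have "((f \<otimes>\<^bsub>DP\<^esub> g) \<otimes>\<^bsub>DP\<^esub> h) n = (\<Oplus>k\<in>{..n}. \<Oplus>i\<in>{..k}. F k i)"
    unfolding DP_simps
  proof (intro finsum_cong' refl)
    fix k
    have "(\<Oplus>i\<in>{..k}. dterm f g k i) \<otimes> h (n - k) = (\<Oplus>i\<in>{..k}. dterm f g k i \<otimes> h (n - k))"
      using c by (intro finsum_ldistr) auto
    also have "\<dots> = (\<Oplus>i\<in>{..k}. add_pow R (k choose i) (f i \<otimes> g (k - i) \<otimes> h (n - k)))"
      using c by (intro finsum_cong' refl) (auto simp: add_pow_ldistr)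
    finally have "add_pow R (n choose k) ((\<Oplus>i\<in>{..k}. dterm f g k i) \<otimes> h (n - k))
      = add_pow R (n choose k) (\<Oplus>i\<in>{..k}. add_pow R (k choose i) (f i \<otimes> g (k - i) \<otimes> h (n - k)))" by simp
    also have "\<dots> = (\<Oplus>i\<in>{..k}. add_pow R (n choose k) (add_pow R (k choose i) (f i \<otimes> g (k - i) \<otimes> h (n - k))))"
      using c by (intro finsum_add_pow) auto
    also have "\<dots> = (\<Oplus>i\<in>{..k}. F k i)"
      unfolding F_def using c by (intro finsum_cong' refl) (auto simp: add.nat_pow_pow mult.commute)
    finally show "add_pow R (n choose k) ((\<Oplus>i\<in>{..k}. dterm f g k i) \<otimes> h (n - k)) = (\<Oplus>i\<in>{..k}. F k i)" .
  qed (use F in auto)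
  also have "\<dots> = (\<Oplus>i\<in>{..n}. \<Oplus>j\<in>{..n - i}. F (i + j) i)" by (rule finsum_triangle[OF F])
  also have "\<dots> = (f \<otimes>\<^bsub>DP\<^esub> (g \<otimes>\<^bsub>DP\<^esub> h)) n"
    unfolding DP_simps
  proof (intro finsum_cong' refl)
    fix i assume i: "i \<in> {..n}"
    have "f i \<otimes> (\<Oplus>j\<in>{..n - i}. dterm g h (n - i) j) = (\<Oplus>j\<in>{..n - i}. f i \<otimes> dterm g h (n - i) j)"
      using c by (intro finsum_rdistr) auto
    also have "\<dots> = (\<Oplus>j\<in>{..n - i}. add_pow R ((n - i) choose j) (f i \<otimes> (g j \<otimes> h (n - i - j))))"
      using c by (intro finsum_cong' refl) (auto simp: add_pow_rdistr)
    finally have "add_pow R (n choose i) (f i \<otimes> (\<Oplus>j\<in>{..n - i}. dterm g h (n - i) j))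
      = add_pow R (n choose i) (\<Oplus>j\<in>{..n - i}. add_pow R ((n - i) choose j) (f i \<otimes> (g j \<otimes> h (n - i - j))))" by simp
    also have "\<dots> = (\<Oplus>j\<in>{..n - i}. add_pow R (n choose i) (add_pow R ((n - i) choose j) (f i \<otimes> (g j \<otimes> h (n - i - j)))))"
      using c by (intro finsum_add_pow) auto
    also have "\<dots> = (\<Oplus>j\<in>{..n - i}. F (i + j) i)"
    proof (intro finsum_cong' refl)
      fix j assume j: "j \<in> {..n - i}"
      have "(n choose (i + j)) * ((i + j) choose i) = (n choose i) * ((n - i) choose j)"
        using choose_mult[of i "i + j" n] i j by simp
      then show "add_pow R (n choose i) (add_pow R ((n - i) choose j) (f i \<otimes> (g j \<otimes> h (n - i - j)))) = F (i + j) i"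
        unfolding F_def using c by (simp add: add.nat_pow_pow mult.commute m_assoc)
    qed (use F in auto)
    finally show "(\<Oplus>j\<in>{..n - i}. F (i + j) i) = add_pow R (n choose i) (f i \<otimes> (\<Oplus>j\<in>{..n - i}. dterm g h (n - i) j))" ..
  qed (use c in auto)
  finally show "((f \<otimes>\<^bsub>DP\<^esub> g) \<otimes>\<^bsub>DP\<^esub> h) n = (f \<otimes>\<^bsub>DP\<^esub> (g \<otimes>\<^bsub>DP\<^esub> h)) n" .
qed

lemma DP_one_mult:
  assumes f: "f \<in> carrier DP"
  shows "\<one>\<^bsub>DP\<^esub> \<otimes>\<^bsub>DP\<^esub> f = f"
proof
  fix n
  have c: "f i \<in> carrier R" for i using f by (auto simp: carrier_DP)
  have "(\<Oplus>i\<in>{..n}. add_pow R (n choose i) ((if i = 0 then \<one> else \<zero>) \<otimes> f (n - i))) = (\<Oplus>i\<in>{..n}. if 0 = i then f n else \<zero>)"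
    using c by (intro finsum_cong' refl) auto
  also have "\<dots> = f n" using c by (intro finsum_singleton[of 0 "{..n}" "\<lambda>_. f n"]) auto
  finally show "(\<one>\<^bsub>DP\<^esub> \<otimes>\<^bsub>DP\<^esub> f) n = f n" by (simp add: DP_simps)
qed

lemma DP_distrib:
  assumes f: "f \<in> carrier DP" and g: "g \<in> carrier DP" and h: "h \<in> carrier DP"
  shows "(f \<oplus>\<^bsub>DP\<^esub> g) \<otimes>\<^bsub>DP\<^esub> h = f \<otimes>\<^bsub>DP\<^esub> h \<oplus>\<^bsub>DP\<^esub> g \<otimes>\<^bsub>DP\<^esub> h"
proof
  fix n
  have c: "f i \<in> carrier R" "g i \<in> carrier R" "h i \<in> carrier R" for i using f g h by (auto simp: carrier_DP)
  have "(\<Oplus>i\<in>{..n}. add_pow R (n choose i) ((f i \<oplus> g i) \<otimes> h (n - i))) = (\<Oplus>i\<in>{..n}. dterm f h n i \<oplus> dterm g h n i)"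
    using c by (intro finsum_cong' refl) (auto simp: l_distr add.nat_pow_distrib)
  also have "\<dots> = (\<Oplus>i\<in>{..n}. dterm f h n i) \<oplus> (\<Oplus>i\<in>{..n}. dterm g h n i)"
    using c by (intro finsum_addf) auto
  finally show "((f \<oplus>\<^bsub>DP\<^esub> g) \<otimes>\<^bsub>DP\<^esub> h) n = (f \<otimes>\<^bsub>DP\<^esub> h \<oplus>\<^bsub>DP\<^esub> g \<otimes>\<^bsub>DP\<^esub> h) n"
    by (simp add: DP_simps)
qed

lemma DP_abelian_group: "abelian_group DP"
proof (rule abelian_groupI)
  show "x \<oplus>\<^bsub>DP\<^esub> y \<in> carrier DP" if "x \<in> carrier DP" "y \<in> carrier DP" for x y
  proof -
    have "{n. x n \<oplus> y n \<noteq> \<zero>} \<subseteq> {n. x n \<noteq> \<zero>} \<union> {n. y n \<noteq> \<zero>}" using that by (auto simp: carrier_DP)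
    then have "finite {n. x n \<oplus> y n \<noteq> \<zero>}" using that by (rule_tac finite_subset) (auto simp: carrier_DP)
    then show ?thesis using that by (auto simp: carrier_DP DP_simps)
  qed
  show "\<exists>y\<in>carrier DP. y \<oplus>\<^bsub>DP\<^esub> x = \<zero>\<^bsub>DP\<^esub>" if "x \<in> carrier DP" for x
  proof (rule bexI)
    have "{n. \<ominus> x n \<noteq> \<zero>} \<subseteq> {n. x n \<noteq> \<zero>}" using that by (auto simp: carrier_DP)
    then have "finite {n. \<ominus> x n \<noteq> \<zero>}" by (rule finite_subset) (use that in \<open>simp add: carrier_DP\<close>)
    then show "(\<lambda>n. \<ominus> x n) \<in> carrier DP" using that by (auto simp: carrier_DP)
    show "(\<lambda>n. \<ominus> x n) \<oplus>\<^bsub>DP\<^esub> x = \<zero>\<^bsub>DP\<^esub>" using that by (auto simp: carrier_DP DP_simps l_neg)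
  qed
  show "\<zero>\<^bsub>DP\<^esub> \<oplus>\<^bsub>DP\<^esub> x = x" if "x \<in> carrier DP" for x
    using that by (simp add: carrier_DP DP_simps)
qed (auto simp: carrier_DP DP_simps a_ac)

lemma DP_cring: "cring DP"
proof (rule cringI[OF DP_abelian_group])
  have one: "\<one>\<^bsub>DP\<^esub> \<in> carrier DP"
    by (auto simp: carrier_DP DP_simps intro: finite_subset[of _ "{0}"])
  show "Group.comm_monoid DP"
  proof (rule comm_monoidI)
    show "x \<otimes>\<^bsub>DP\<^esub> y \<otimes>\<^bsub>DP\<^esub> z = x \<otimes>\<^bsub>DP\<^esub> (y \<otimes>\<^bsub>DP\<^esub> z)" if "x \<in> carrier DP" "y \<in> carrier DP" "z \<in> carrier DP" for x y z
      using that by (rule DP_mult_assoc)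
    show "x \<otimes>\<^bsub>DP\<^esub> y = y \<otimes>\<^bsub>DP\<^esub> x" if "x \<in> carrier DP" "y \<in> carrier DP" for x y
      using that by (rule DP_mult_comm)
  qed (simp_all add: DP_mult_closed DP_one_mult one)
qed (rule DP_distrib)

lemma DP_smult_closed: "r \<in> carrier R \<Longrightarrow> f \<in> carrier DP \<Longrightarrow> r \<odot>\<^bsub>DP\<^esub> f \<in> carrier DP"
proof -
  assume r: "r \<in> carrier R" and f: "f \<in> carrier DP"
  have "{n. r \<otimes> f n \<noteq> \<zero>} \<subseteq> {n. f n \<noteq> \<zero>}" using r by auto
  then have "finite {n. r \<otimes> f n \<noteq> \<zero>}" using f by (rule_tac finite_subset) (auto simp: carrier_DP)
  then show ?thesis using r f by (auto simp: carrier_DP DP_simps)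
qed

lemma DP_algebra: "algebra R DP"
proof (rule algebraI[OF is_cring DP_cring])
  fix r f g assume r: "r \<in> carrier R" and fg: "f \<in> carrier DP" "g \<in> carrier DP"
  show "(r \<odot>\<^bsub>DP\<^esub> f) \<otimes>\<^bsub>DP\<^esub> g = r \<odot>\<^bsub>DP\<^esub> (f \<otimes>\<^bsub>DP\<^esub> g)"
  proof
    fix n
    have c: "f i \<in> carrier R" "g i \<in> carrier R" for i using fg by (auto simp: carrier_DP)
    have "r \<otimes> (\<Oplus>i\<in>{..n}. dterm f g n i) = (\<Oplus>i\<in>{..n}. r \<otimes> dterm f g n i)"
      using r c by (intro finsum_rdistr) auto
    also have "\<dots> = (\<Oplus>i\<in>{..n}. add_pow R (n choose i) ((r \<otimes> f i) \<otimes> g (n - i)))"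
      using r c by (intro finsum_cong' refl) (auto simp: add_pow_rdistr m_assoc)
    finally show "((r \<odot>\<^bsub>DP\<^esub> f) \<otimes>\<^bsub>DP\<^esub> g) n = (r \<odot>\<^bsub>DP\<^esub> (f \<otimes>\<^bsub>DP\<^esub> g)) n" by (simp add: DP_simps)
  qed
qed (auto simp: DP_smult_closed, auto simp: DP_simps carrier_DP l_distr r_distr m_assoc)

end

section \<open>Transport along a trivialisation of each degree\<close>

lemma (in comm_group) hom_finprod:
  assumes "group_hom H G h" "comm_group H" "f \<in> A \<rightarrow> carrier H"
  shows "h (finprod H f A) = finprod G (\<lambda>i. h (f i)) A"
proof -
  interpret H: comm_group H by fact
  interpret h: group_hom H G h by fact
  show ?thesis using assms(3)
  proof (induction A rule: infinite_finite_induct)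
    case (insert x A)
    then have "f \<in> A \<rightarrow> carrier H" "(\<lambda>i. h (f i)) \<in> A \<rightarrow> carrier G" "f x \<in> carrier H" by (auto intro: h.hom_closed)
    then show ?case using insert by simp
  qed simp_all
qed

text \<open>
  \<open>e n r\<close> plays the role of \<open>r \<gamma>\<^sub>n(x)\<close>.
\<close>

locale graded_trivialisation = cring R for R (structure) +
  fixes C :: "nat \<Rightarrow> 'c monoid" and act :: "nat \<Rightarrow> 'a \<Rightarrow> 'c \<Rightarrow> 'c"
    and P :: "nat \<Rightarrow> nat \<Rightarrow> 'c \<Rightarrow> 'c \<Rightarrow> 'c" and e :: "nat \<Rightarrow> 'a \<Rightarrow> 'c"
  assumes C: "0 < n \<Longrightarrow> comm_group (C n)"
    and e_bij: "0 < n \<Longrightarrow> bij_betw (e n) (carrier R) (carrier (C n))"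
    and e_add: "0 < n \<Longrightarrow> r \<in> carrier R \<Longrightarrow> s \<in> carrier R \<Longrightarrow> e n (r \<oplus> s) = e n r \<otimes>\<^bsub>C n\<^esub> e n s"
    and e_act: "0 < n \<Longrightarrow> r \<in> carrier R \<Longrightarrow> s \<in> carrier R \<Longrightarrow> act n r (e n s) = e n (r \<otimes> s)"
    and e_mult: "0 < i \<Longrightarrow> 0 < j \<Longrightarrow> r \<in> carrier R \<Longrightarrow> s \<in> carrier R \<Longrightarrow>
      P i j (e i r) (e j s) = e (i + j) (add_pow R ((i + j) choose i) (r \<otimes> s))"
begin

abbreviation (input) "GA \<equiv> unital_graded_algebra R C act P"

definition grmap :: "(nat \<Rightarrow> 'a) \<Rightarrow> 'a \<times> (nat \<Rightarrow> 'c)" where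
  "grmap f = (f 0, \<lambda>n\<in>{1..}. e n (f n))"

lemma e_hom: "0 < n \<Longrightarrow> group_hom (add_monoid R) (C n) (e n)"
proof -
  assume n: "0 < n"
  interpret C: comm_group "C n" by (rule C[OF n])
  show ?thesis
    using e_bij[OF n] e_add[OF n] a_group C.is_group
    by (auto simp: group_hom_def group_hom_axioms_def hom_def bij_betw_def)
qed

lemma e_zero: "0 < n \<Longrightarrow> e n \<zero> = \<one>\<^bsub>C n\<^esub>"
  using group_hom.hom_one[OF e_hom] by simp

lemma e_closed: "0 < n \<Longrightarrow> r \<in> carrier R \<Longrightarrow> e n r \<in> carrier (C n)"
  using group_hom.hom_closed[OF e_hom] by simp

lemma e_eq_one_iff: "0 < n \<Longrightarrow> r \<in> carrier R \<Longrightarrow> e n r = \<one>\<^bsub>C n\<^esub> \<longleftrightarrow> r = \<zero>"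
  using inj_on_eq_iff[OF bij_betw_imp_inj_on[OF e_bij], of n r \<zero>] by (simp add: e_zero)

lemma e_finsum: "0 < n \<Longrightarrow> f \<in> A \<rightarrow> carrier R \<Longrightarrow> e n (\<Oplus>i\<in>A. f i) = finprod (C n) (\<lambda>i. e n (f i)) A"
  unfolding finsum_def
  by (rule comm_group.hom_finprod[OF C e_hom]) (simp_all add: a_comm_group)

lemma GA_simps:
  "(r, f) \<otimes>\<^bsub>GA\<^esub> (s, g) = (r \<otimes> s, \<lambda>n\<in>{1..}. act n r (g n) \<otimes>\<^bsub>C n\<^esub> act n s (f n) \<otimes>\<^bsub>C n\<^esub>
         finprod (C n) (\<lambda>i. P i (n - i) (f i) (g (n - i))) {1..<n})"
  "\<one>\<^bsub>GA\<^esub> = (\<one>, \<lambda>n\<in>{1..}. \<one>\<^bsub>C n\<^esub>)"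
  "\<zero>\<^bsub>GA\<^esub> = (\<zero>, \<lambda>n\<in>{1..}. \<one>\<^bsub>C n\<^esub>)"
  "(r, f) \<oplus>\<^bsub>GA\<^esub> (s, g) = (r \<oplus> s, \<lambda>n\<in>{1..}. f n \<otimes>\<^bsub>C n\<^esub> g n)"
  "r \<odot>\<^bsub>GA\<^esub> (s, f) = (r \<otimes> s, \<lambda>n\<in>{1..}. act n r (f n))"
  by (simp_all add: unital_graded_algebra_def)

lemma carrier_GA:
  "carrier GA = carrier R \<times> {x \<in> \<Pi>\<^sub>E n\<in>{1..}. carrier (C n). finite {n \<in> {1..}. x n \<noteq> \<one>\<^bsub>C n\<^esub>}}"
proof -
  have "group (C n)" if "n \<in> {1..}" for n using comm_group.axioms(2)[OF C] that by simp
  from carrier_sum_group[of "{1..}" C, OF this] show ?thesis by (simp add: unital_graded_algebra_def)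
qed

lemma grmap_bij: "bij_betw grmap (carrier DP) (carrier GA)"
  unfolding bij_betw_def
proof
  show "inj_on grmap (carrier DP)"
  proof (rule inj_onI, rule ext)
    fix f g n assume fg: "f \<in> carrier DP" "g \<in> carrier DP" "grmap f = grmap g"
    then have 0: "f 0 = g 0" and eqr: "(\<lambda>n\<in>{1..}. e n (f n)) = (\<lambda>n\<in>{1..}. e n (g n))" by (auto simp: grmap_def)
    have eq: "e n (f n) = e n (g n)" if "0 < n"
      using that arg_cong[OF eqr, of "\<lambda>F. F n"] by simp
    show "f n = g n"
    proof (cases "n = 0")
      case False
      then show ?thesis using inj_onD[OF bij_betw_imp_inj_on[OF e_bij] eq] fg by (simp add: carrier_DP)
    qed (use 0 in simp)
  qed
  show "grmap ` carrier DP = carrier GA"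
  proof
    show "grmap ` carrier DP \<subseteq> carrier GA"
    proof
      fix y assume "y \<in> grmap ` carrier DP"
      then obtain f where f: "f \<in> carrier DP" "y = grmap f" by blast
      then have c: "f n \<in> carrier R" for n by (simp add: carrier_DP)
      have "{n \<in> {1..}. (\<lambda>n\<in>{1..}. e n (f n)) n \<noteq> \<one>\<^bsub>C n\<^esub>} \<subseteq> {n. f n \<noteq> \<zero>}"
        using c by (auto simp: e_zero)
      then have "finite {n \<in> {1..}. (\<lambda>n\<in>{1..}. e n (f n)) n \<noteq> \<one>\<^bsub>C n\<^esub>}"
        by (rule finite_subset) (use f in \<open>simp add: carrier_DP\<close>)
      then show "y \<in> carrier GA" using f c by (auto simp: carrier_GA grmap_def e_closed)
    qed
    show "carrier GA \<subseteq> grmap ` carrier DP"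
    proof
      fix y assume "y \<in> carrier GA"
      then obtain r x where y: "y = (r, x)" "r \<in> carrier R" "x \<in> (\<Pi>\<^sub>E n\<in>{1..}. carrier (C n))"
        "finite {n \<in> {1..}. x n \<noteq> \<one>\<^bsub>C n\<^esub>}" by (auto simp: carrier_GA)
      define f where "f n = (if n = 0 then r else inv_into (carrier R) (e n) (x n))" for n
      have x: "x n \<in> e n ` carrier R" if "0 < n" for n
        using y(3) that e_bij[OF that] by (auto simp: bij_betw_def PiE_iff)
      have c: "f n \<in> carrier R" for n using y(2) x[of n] by (auto simp: f_def intro: inv_into_into)
      have ef: "e n (f n) = x n" if "0 < n" for n using x[OF that] that by (simp add: f_def f_inv_into_f)
      have "{n. f n \<noteq> \<zero>} \<subseteq> insert 0 {n \<in> {1..}. x n \<noteq> \<one>\<^bsub>C n\<^esub>}"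
      proof
        fix n assume n: "n \<in> {n. f n \<noteq> \<zero>}"
        show "n \<in> insert 0 {n \<in> {1..}. x n \<noteq> \<one>\<^bsub>C n\<^esub>}"
        proof (cases "n = 0")
          case False
          then have "x n \<noteq> \<one>\<^bsub>C n\<^esub>" using n ef[of n] e_eq_one_iff[of n "f n"] c by simp
          then show ?thesis using False by simp
        qed simp
      qed
      then have "finite {n. f n \<noteq> \<zero>}" by (rule finite_subset) (use y(4) in simp)
      then have "f \<in> carrier DP" using c by (simp add: carrier_DP)
      moreover have "grmap f = y"
      proof -
        have "(\<lambda>n\<in>{1..}. e n (f n)) = x"
          by (rule extensionalityI[of _ "{1..}"]) (use y(3) ef in \<open>auto simp: PiE_iff\<close>)
        then show ?thesis by (simp add: grmap_def y(1) f_def)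
      qed
      ultimately show "y \<in> grmap ` carrier DP" by blast
    qed
  qed
qed

lemma grmap_closed: "f \<in> carrier DP \<Longrightarrow> grmap f \<in> carrier GA"
  using grmap_bij by (auto simp: bij_betw_def)

lemma grmap_add:
  assumes "f \<in> carrier DP" "g \<in> carrier DP"
  shows "grmap (f \<oplus>\<^bsub>DP\<^esub> g) = grmap f \<oplus>\<^bsub>GA\<^esub> grmap g"
  using assms by (auto simp: grmap_def GA_simps DP_simps carrier_DP e_add intro!: restrict_ext)

lemma grmap_smult:
  assumes "r \<in> carrier R" "f \<in> carrier DP"
  shows "grmap (r \<odot>\<^bsub>DP\<^esub> f) = r \<odot>\<^bsub>GA\<^esub> grmap f"
  using assms by (auto simp: grmap_def GA_simps DP_simps carrier_DP e_act intro!: restrict_ext)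

lemma grmap_one: "grmap \<one>\<^bsub>DP\<^esub> = \<one>\<^bsub>GA\<^esub>" and grmap_zero: "grmap \<zero>\<^bsub>DP\<^esub> = \<zero>\<^bsub>GA\<^esub>"
  by (auto simp: grmap_def GA_simps DP_simps e_zero intro!: restrict_ext)

text \<open>In the target the degree 0 part is the ring itself and not one of the
  \<open>C n\<close>. The two extreme terms of the convolution therefore appear there as scalar
  multiplications and have to be split off.\<close>

lemma finsum_ends:
  assumes "\<And>i. F i \<in> carrier R" "0 < (n::nat)"
  shows "(\<Oplus>i\<in>{..n}. F i) = F 0 \<oplus> F n \<oplus> (\<Oplus>i\<in>{1..<n}. F i)"
proof -
  have "{..n} = insert 0 (insert n {1..<n})" using assms(2) by auto
  then show ?thesis using assms by (simp add: a_assoc)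
qed

lemma grmap_mult:
  assumes f: "f \<in> carrier DP" and g: "g \<in> carrier DP"
  shows "grmap (f \<otimes>\<^bsub>DP\<^esub> g) = grmap f \<otimes>\<^bsub>GA\<^esub> grmap g"
proof -
  have c: "f i \<in> carrier R" "g i \<in> carrier R" for i using f g by (auto simp: carrier_DP)
  have "e n (\<Oplus>i\<in>{..n}. dterm f g n i) =
      act n (f 0) (e n (g n)) \<otimes>\<^bsub>C n\<^esub> act n (g 0) (e n (f n)) \<otimes>\<^bsub>C n\<^esub>
         finprod (C n) (\<lambda>i. P i (n - i) ((\<lambda>n\<in>{1..}. e n (f n)) i) ((\<lambda>n\<in>{1..}. e n (g n)) (n - i))) {1..<n}"
    if n: "0 < n" for n
  proof -
    have "e n (\<Oplus>i\<in>{..n}. dterm f g n i)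
      = e n (f 0 \<otimes> g n) \<otimes>\<^bsub>C n\<^esub> e n (f n \<otimes> g 0) \<otimes>\<^bsub>C n\<^esub> e n (\<Oplus>i\<in>{1..<n}. dterm f g n i)"
      using c n by (simp add: finsum_ends e_add)
    also have "e n (\<Oplus>i\<in>{1..<n}. dterm f g n i) = finprod (C n) (\<lambda>i. e n (dterm f g n i)) {1..<n}"
      using c by (intro e_finsum[OF n]) auto
    also have "\<dots> = finprod (C n) (\<lambda>i. P i (n - i) ((\<lambda>n\<in>{1..}. e n (f n)) i) ((\<lambda>n\<in>{1..}. e n (g n)) (n - i))) {1..<n}"
    proof -
      interpret C: comm_group "C n" by (rule C[OF n])
      have eq0: "e n (dterm f g n i) = P i (n - i) (e i (f i)) (e (n - i) (g (n - i)))" if "i \<in> {1..<n}" for i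
        using e_mult[of i "n - i" "f i" "g (n - i)"] that c by simp
      have eq: "e n (dterm f g n i) = P i (n - i) ((\<lambda>n\<in>{1..}. e n (f n)) i) ((\<lambda>n\<in>{1..}. e n (g n)) (n - i))"
        if "i \<in> {1..<n}" for i
      proof -
        have "i \<in> {1..}" "n - i \<in> {1..}" using that by auto
        then show ?thesis using eq0[OF that] by (simp only: restrict_apply if_True)
      qed
      have cl: "e n (dterm f g n i) \<in> carrier (C n)" for i using c n by (simp add: e_closed)
      have "(\<lambda>i. P i (n - i) ((\<lambda>n\<in>{1..}. e n (f n)) i) ((\<lambda>n\<in>{1..}. e n (g n)) (n - i))) \<in> {1..<n} \<rightarrow> carrier (C n)"
      proof (rule Pi_I)
        fix i assume i: "i \<in> {1..<n}"
        show "P i (n - i) ((\<lambda>n\<in>{1..}. e n (f n)) i) ((\<lambda>n\<in>{1..}. e n (g n)) (n - i)) \<in> carrier (C n)"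
          using cl[of i] unfolding eq[OF i] .
      qed
      then show ?thesis by (rule C.finprod_cong'[OF refl _ eq])
    qed
    finally show ?thesis using c n by (simp add: e_act m_comm)
  qed
  then show ?thesis by (auto simp: grmap_def GA_simps DP_simps c intro!: restrict_ext)
qed

text \<open>All laws are transported along the bijection \<open>grmap\<close>; commutativity and
  associativity of the product on the coinvariants come out as consequences.\<close>

lemma GA_cring: "cring GA"
proof (rule cringI)
  interpret DP: cring DP by (rule DP_cring)
  have ex: "\<exists>f\<in>carrier DP. x = grmap f" if "x \<in> carrier GA" for x
    using that grmap_bij by (auto simp: bij_betw_def)
  show "abelian_group GA"
  proof (rule abelian_groupI)
    show "\<zero>\<^bsub>GA\<^esub> \<in> carrier GA" using grmap_closed[OF DP.zero_closed] by (simp add: grmap_zero)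
    show "x \<oplus>\<^bsub>GA\<^esub> y \<in> carrier GA" if "x \<in> carrier GA" "y \<in> carrier GA" for x y
      using ex[OF that(1)] ex[OF that(2)] by (auto simp: grmap_add[symmetric] intro!: grmap_closed)
    show "x \<oplus>\<^bsub>GA\<^esub> y \<oplus>\<^bsub>GA\<^esub> z = x \<oplus>\<^bsub>GA\<^esub> (y \<oplus>\<^bsub>GA\<^esub> z)" if "x \<in> carrier GA" "y \<in> carrier GA" "z \<in> carrier GA" for x y z
      using ex[OF that(1)] ex[OF that(2)] ex[OF that(3)] by (auto simp: grmap_add[symmetric] DP.a_assoc)
    show "x \<oplus>\<^bsub>GA\<^esub> y = y \<oplus>\<^bsub>GA\<^esub> x" if "x \<in> carrier GA" "y \<in> carrier GA" for x y
      using ex[OF that(1)] ex[OF that(2)] by (auto simp: grmap_add[symmetric] DP.a_comm)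
    show "\<zero>\<^bsub>GA\<^esub> \<oplus>\<^bsub>GA\<^esub> x = x" if "x \<in> carrier GA" for x
      using ex[OF that] by (auto simp: grmap_add[symmetric] grmap_zero[symmetric])
    show "\<exists>y\<in>carrier GA. y \<oplus>\<^bsub>GA\<^esub> x = \<zero>\<^bsub>GA\<^esub>" if "x \<in> carrier GA" for x
    proof -
      from ex[OF that] obtain f where f: "f \<in> carrier DP" "x = grmap f" by blast
      have "grmap (\<ominus>\<^bsub>DP\<^esub> f) \<oplus>\<^bsub>GA\<^esub> x = \<zero>\<^bsub>GA\<^esub>"
        using f DP.l_neg by (simp add: grmap_add[symmetric] grmap_zero[symmetric])
      then show ?thesis using grmap_closed f by blast
    qed
  qed
  show "Group.comm_monoid GA"
  proof (rule comm_monoidI)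
    show "\<one>\<^bsub>GA\<^esub> \<in> carrier GA" using grmap_closed[OF DP.one_closed] by (simp add: grmap_one)
    show "x \<otimes>\<^bsub>GA\<^esub> y \<in> carrier GA" if "x \<in> carrier GA" "y \<in> carrier GA" for x y
      using ex[OF that(1)] ex[OF that(2)] by (auto simp: grmap_mult[symmetric] intro!: grmap_closed)
    show "x \<otimes>\<^bsub>GA\<^esub> y \<otimes>\<^bsub>GA\<^esub> z = x \<otimes>\<^bsub>GA\<^esub> (y \<otimes>\<^bsub>GA\<^esub> z)" if "x \<in> carrier GA" "y \<in> carrier GA" "z \<in> carrier GA" for x y z
      using ex[OF that(1)] ex[OF that(2)] ex[OF that(3)] by (auto simp: grmap_mult[symmetric] DP.m_assoc)
    show "x \<otimes>\<^bsub>GA\<^esub> y = y \<otimes>\<^bsub>GA\<^esub> x" if "x \<in> carrier GA" "y \<in> carrier GA" for x y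
      using ex[OF that(1)] ex[OF that(2)] by (auto simp: grmap_mult[symmetric] DP.m_comm)
    show "\<one>\<^bsub>GA\<^esub> \<otimes>\<^bsub>GA\<^esub> x = x" if "x \<in> carrier GA" for x
      using ex[OF that] by (auto simp: grmap_mult[symmetric] grmap_one[symmetric])
  qed
  show "(x \<oplus>\<^bsub>GA\<^esub> y) \<otimes>\<^bsub>GA\<^esub> z = x \<otimes>\<^bsub>GA\<^esub> z \<oplus>\<^bsub>GA\<^esub> y \<otimes>\<^bsub>GA\<^esub> z"
    if "x \<in> carrier GA" "y \<in> carrier GA" "z \<in> carrier GA" for x y z
    using ex[OF that(1)] ex[OF that(2)] ex[OF that(3)] by (auto simp: grmap_mult[symmetric] grmap_add[symmetric] DP.l_distr)
qed

lemma GA_algebra: "algebra R GA"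
proof (rule algebraI[OF is_cring GA_cring])
  interpret A: algebra R DP by (rule DP_algebra)
  have ex: "\<exists>f\<in>carrier DP. x = grmap f" if "x \<in> carrier GA" for x
    using that grmap_bij by (auto simp: bij_betw_def)
  show "r \<odot>\<^bsub>GA\<^esub> x \<in> carrier GA" if "r \<in> carrier R" "x \<in> carrier GA" for r x
    using ex[OF that(2)] that by (auto simp: grmap_smult[symmetric] intro!: grmap_closed)
  show "(r \<oplus> s) \<odot>\<^bsub>GA\<^esub> x = r \<odot>\<^bsub>GA\<^esub> x \<oplus>\<^bsub>GA\<^esub> s \<odot>\<^bsub>GA\<^esub> x"
    if "r \<in> carrier R" "s \<in> carrier R" "x \<in> carrier GA" for r s x
    using ex[OF that(3)] that by (auto simp: grmap_smult[symmetric] grmap_add[symmetric] A.smult_l_distr)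
  show "r \<odot>\<^bsub>GA\<^esub> (x \<oplus>\<^bsub>GA\<^esub> y) = r \<odot>\<^bsub>GA\<^esub> x \<oplus>\<^bsub>GA\<^esub> r \<odot>\<^bsub>GA\<^esub> y"
    if "r \<in> carrier R" "x \<in> carrier GA" "y \<in> carrier GA" for r x y
    using ex[OF that(2)] ex[OF that(3)] that by (auto simp: grmap_smult[symmetric] grmap_add[symmetric] A.smult_r_distr)
  show "(r \<otimes> s) \<odot>\<^bsub>GA\<^esub> x = r \<odot>\<^bsub>GA\<^esub> (s \<odot>\<^bsub>GA\<^esub> x)"
    if "r \<in> carrier R" "s \<in> carrier R" "x \<in> carrier GA" for r s x
    using ex[OF that(3)] that by (auto simp: grmap_smult[symmetric] A.smult_assoc1)
  show "\<one> \<odot>\<^bsub>GA\<^esub> x = x" if "x \<in> carrier GA" for x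
    using ex[OF that] by (auto simp: grmap_smult[symmetric])
  show "(r \<odot>\<^bsub>GA\<^esub> x) \<otimes>\<^bsub>GA\<^esub> y = r \<odot>\<^bsub>GA\<^esub> (x \<otimes>\<^bsub>GA\<^esub> y)"
    if "r \<in> carrier R" "x \<in> carrier GA" "y \<in> carrier GA" for r x y
    using ex[OF that(2)] ex[OF that(3)] that by (auto simp: grmap_smult[symmetric] grmap_mult[symmetric] A.smult_assoc2)
qed

lemma grmap_ring_iso: "grmap \<in> ring_iso DP GA"
  using grmap_bij ring_hom_memI[of DP grmap GA, OF grmap_closed grmap_mult grmap_add grmap_one] by (simp add: ring_iso_def)

lemma grmap_algebra_iso: "grmap \<in> algebra_iso R DP GA"
  using grmap_ring_iso grmap_smult by (simp add: algebra_iso_def)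

end

section \<open>The algebras of coinvariants\<close>

lemma St2_mult_quad:
  assumes mn: "0 < m" "0 < n"
  shows "tensor_quad (steinberg m :: 'f::field chain monoid) (steinberg m) (steinberg n) (steinberg n) (St2 (m + n))
    (\<lambda>a b c d. pure_tensor (steinberg (m + n)) (steinberg (m + n))
           (steinberg_mult m n a c) (steinberg_mult m n b d) [^]\<^bsub>St2 (m + n)\<^esub> ((-1) ^ (m * n) :: int))"
proof -
  have pow: "(\<lambda>x. x [^]\<^bsub>St2 (m + n)\<^esub> ((-1) ^ (m * n) :: int)) \<in> hom (St2 (m + n)) (St2 (m + n) :: 'f st2 monoid)"
    by (rule hom_int_pow_comm[OF comm_group_St2])
  have l: "(\<lambda>a. steinberg_mult m n a c) \<in> hom (steinberg m) (steinberg (m + n))"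
    if "c \<in> carrier (steinberg n)" for c :: "'f chain"
    using that by (intro homI) (simp_all add: steinberg_mult_closed[OF mn] steinberg_mult_add)
  have r: "(\<lambda>c. steinberg_mult m n a c) \<in> hom (steinberg n) (steinberg (m + n))"
    if "a \<in> carrier (steinberg m)" for a :: "'f chain"
    using that by (intro homI) (simp_all add: steinberg_mult_closed[OF mn] steinberg_mult_add)
  have pt: "bihom (steinberg (m + n)) (steinberg (m + n)) (St2 (m + n) :: 'f st2 monoid)
      (pure_tensor (steinberg (m + n)) (steinberg (m + n)))"
    unfolding St2_def by (rule StSt.bihom_pt)
  show ?thesis
    by (intro tensor_quad.intro tensor_quad_axioms.intro StSt.tensor_pair_axioms comm_group_St2
        bihom_hom_compose[OF _ pow] bihom_compose[OF pt] l r)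
qed

text \<open>For the pairing, both sides are homomorphisms in each tensor; uniqueness on tensors
  reduces the formula to pure tensors, first in \<open>w\<close> and then in \<open>z\<close>. There
  the Koszul sign appears as an exponent and becomes a factor.\<close>

lemma
  assumes mn: "0 < m" "0 < n"
  shows St2_mult_bihom: "bihom (St2 m) (St2 n) (St2 (m + n)) (St2_mult m n :: 'f::field st2 \<Rightarrow> _)"
    and St2_pairing_mult: "z \<in> carrier (St2 m) \<Longrightarrow> w \<in> carrier (St2 n) \<Longrightarrow>
      St2_pairing (St2_mult m n z w) = (-1) ^ (m * n) * int ((m + n) choose m) * St2_pairing z * St2_pairing (w :: 'f::field st2)"
proof -
  interpret Q: tensor_quad "steinberg m :: 'f chain monoid" "steinberg m :: 'f chain monoid" "steinberg n :: 'f chain monoid"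
      "steinberg n :: 'f chain monoid" "St2 (m + n)"
    "\<lambda>a b c d. pure_tensor (steinberg (m + n)) (steinberg (m + n))
           (steinberg_mult m n a c) (steinberg_mult m n b d) [^]\<^bsub>St2 (m + n)\<^esub> ((-1) ^ (m * n) :: int)"
    by (rule St2_mult_quad[OF mn])
  have lift2: "Q.lift2 = St2_mult m n" by (intro ext) (simp add: Q.lift2_def St2_mult_def)
  show bi: "bihom (St2 m) (St2 n) (St2 (m + n)) (St2_mult m n :: 'f st2 \<Rightarrow> _)"
    using Q.lift2_bihom[unfolded lift2, folded St2_def] .
  let ?k = "(-1) ^ (m * n) * int ((m + n) choose m)"
  have Phom: "St2_pairing \<in> hom (St2 (m + n) :: 'f st2 monoid) integer_group" using mn by (intro St2_pairing_hom) simp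
  have pure: "St2_pairing (St2_mult m n (StSt.pt m a b) (StSt.pt n c d)) = ?k * St2_pairing (StSt.pt m a b) * St2_pairing (StSt.pt n c d)"
    if *: "a \<in> carrier (steinberg m)" "b \<in> carrier (steinberg m)" "c \<in> carrier (steinberg n)" "d \<in> carrier (steinberg n)"
    for a b c d :: "'f chain"
  proof -
    note ac = steinberg_mult_closed[OF mn *(1,3)] and bd = steinberg_mult_closed[OF mn *(2,4)]
    have "pure_tensor (steinberg (m + n)) (steinberg (m + n)) (steinberg_mult m n a c) (steinberg_mult m n b d) \<in> carrier (St2 (m + n))"
      unfolding St2_def by (rule StSt.pt_closed[OF ac bd])
    then have "St2_pairing (pure_tensor (steinberg (m + n)) (steinberg (m + n)) (steinberg_mult m n a c) (steinberg_mult m n b d)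
        [^]\<^bsub>St2 (m + n)\<^esub> k) = k * steinberg_pairing (steinberg_mult m n a c) (steinberg_mult m n b d)" for k :: int
      using mn by (simp add: hom_int_pow[OF Phom] comm_group.axioms(2)[OF comm_group_St2] St2_pairing_pure[OF _ ac bd])
    then show ?thesis
      using mn St2_pairing_pure[OF _ ac bd] St2_pairing_pure[OF mn(1) *(1,2)] St2_pairing_pure[OF mn(2) *(3,4)]
      by (simp add: lift2[symmetric] Q.lift2_pure[OF *] steinberg_pairing_mult[OF mn *(1,2) *(3,4)])
  qed
  have scale: "(\<lambda>x. k * x) \<in> hom integer_group integer_group" for k by (rule homI) (simp_all add: algebra_simps)
  have PT: "StSt.T m = St2 m" "StSt.T n = St2 n" by (simp_all add: St2_def)
  have step: "St2_pairing (St2_mult m n (StSt.pt m a b) w) = ?k * St2_pairing (StSt.pt m a b) * St2_pairing w"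
    if ab: "a \<in> carrier (steinberg m)" "b \<in> carrier (steinberg m)" and w: "w \<in> carrier (St2 n)" for a b :: "'f chain" and w
  proof (rule StSt.hom_eq_on_T[OF group_integer_group _ _ _ w[folded PT(2)]])
    have pc: "StSt.pt m a b \<in> carrier (St2 m)" using StSt.pt_closed[OF ab] by (simp add: PT)
    have "St2_mult m n (StSt.pt m a b) \<in> hom (St2 n) (St2 (m + n))"
      by (rule homI) (simp_all add: bihomD[OF bi] pc)
    from hom_compose[OF this Phom] show "(\<lambda>w. St2_pairing (St2_mult m n (StSt.pt m a b) w)) \<in> hom (StSt.T n) integer_group"
      by (simp add: comp_def PT)
    show "(\<lambda>w. ?k * St2_pairing (StSt.pt m a b) * St2_pairing w) \<in> hom (StSt.T n) integer_group"
      using hom_compose[OF St2_pairing_hom[OF mn(2)] scale] by (simp add: comp_def PT)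
  qed (rule pure[OF ab])
  show "St2_pairing (St2_mult m n z w) = ?k * St2_pairing z * St2_pairing w"
    if z: "z \<in> carrier (St2 m)" and w: "w \<in> carrier (St2 n)"
  proof (rule StSt.hom_eq_on_T[OF group_integer_group _ _ _ z[folded PT(1)]])
    have "(\<lambda>z. St2_mult m n z w) \<in> hom (St2 m) (St2 (m + n))"
      by (rule homI) (simp_all add: bihomD[OF bi] w)
    from hom_compose[OF this Phom] show "(\<lambda>z. St2_pairing (St2_mult m n z w)) \<in> hom (StSt.T m) integer_group"
      by (simp add: comp_def PT)
    show "(\<lambda>z. ?k * St2_pairing z * St2_pairing w) \<in> hom (StSt.T m) integer_group"
      using hom_compose[OF St2_pairing_hom[OF mn(1)] scale, of "?k * St2_pairing w"] by (simp add: comp_def PT mult.assoc mult.commute mult.left_commute)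
  qed (rule step[OF _ _ w])
qed

section \<open>Signs and the integral coinvariants\<close>

definition gsign :: "nat \<Rightarrow> int" where
  "gsign n = (-1) ^ (n * (n - 1) div 2)"

lemma gsign_square [simp]: "gsign n * gsign n = 1"
  by (simp add: gsign_def power_add[symmetric])

lemma gsign_add: "(-1) ^ (m * n) * gsign m * gsign n = gsign (m + n)"
proof -
  \<comment> \<open>Since \<open>k * (k - 1)\<close> is even, doubling removes the truncating
    division and leaves an identity of polynomials.\<close>
  have 2: "2 * (k * (k - 1) div 2) = k * (k - 1)" for k :: nat by (cases k) auto
  have "2 * ((m + n) * (m + n - 1) div 2) = 2 * (m * n + m * (m - 1) div 2 + n * (n - 1) div 2)"
    unfolding distrib_left 2 by (cases m; cases n) (simp_all add: algebra_simps)
  then have "(m + n) * (m + n - 1) div 2 = m * n + m * (m - 1) div 2 + n * (n - 1) div 2"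
    by (metis mult_left_cancel zero_neq_numeral)
  then show ?thesis by (simp only: gsign_def power_add)
qed

context
  fixes n :: nat
  assumes n: "0 < n"
begin

interpretation CK: coinvariant_kernel "St2 n" integer_group "St2_act n ` GL n" St2_pairing
  by (rule coinvariant_kernel_St2[OF n])

lemma comm_group_St2_coinv: "comm_group (St2_coinv n)"
  unfolding St2_coinv_def by (rule CK.C_comm_group)

lemma carrier_St2_coinv: "carrier (St2_coinv n) = St2_class n ` carrier (St2 n)"
  unfolding St2_coinv_def St2_class_def by (rule CK.carrier_C)

lemma St2_coinv_pairing_class: "z \<in> carrier (St2 n) \<Longrightarrow> St2_coinv_pairing (St2_class n z) = St2_pairing z"
  unfolding St2_coinv_pairing_def St2_class_def St2_pairing_def[symmetric] by (rule CK.val_cl)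

lemma St2_coinv_pairing_hom: "St2_coinv_pairing \<in> hom (St2_coinv n) integer_group"
  unfolding St2_coinv_pairing_def[abs_def] St2_coinv_def St2_pairing_def[symmetric] by (rule CK.val_hom)

lemma St2_coinv_eqI:
  "X \<in> carrier (St2_coinv n) \<Longrightarrow> Y \<in> carrier (St2_coinv n) \<Longrightarrow> St2_coinv_pairing X = St2_coinv_pairing Y \<Longrightarrow> X = Y"
  unfolding St2_coinv_pairing_def St2_coinv_def St2_pairing_def[symmetric] by (rule CK.val_eqI)

lemma mem_St2_class: "z \<in> carrier (St2 n) \<Longrightarrow> x \<in> St2_class n z \<longleftrightarrow> x \<in> carrier (St2 n) \<and> St2_pairing x = St2_pairing z"
  unfolding St2_class_def by (rule CK.mem_cl)

lemma St2_class_eqI: "z \<in> carrier (St2 n) \<Longrightarrow> w \<in> carrier (St2 n) \<Longrightarrow> St2_pairing z = St2_pairing w \<Longrightarrow> St2_class n z = St2_class n w"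
  unfolding St2_class_def by (simp add: CK.cl_eq_iff)

lemma ex_St2_pairing: "\<exists>z\<in>carrier (St2 n :: 'f::field st2 monoid). St2_pairing z = k"
proof -
  obtain \<tau> :: "'f st2" where \<tau>: "\<tau> \<in> carrier (St2 n)" "St2_pairing \<tau> = 1" using St2_generator[OF n] by metis
  then have "St2_pairing (\<tau> [^]\<^bsub>St2 n\<^esub> k) = k" by (simp add: CK.Q.hom_int_pow)
  then show ?thesis using \<tau>(1) by (intro bexI[of _ "\<tau> [^]\<^bsub>St2 n\<^esub> k"]) simp_all
qed

text \<open>The pairing is injective on the coinvariants, so \<open>inv_into\<close> has no choice:
  any tensor with the prescribed pairing represents \<open>gamma n\<close>.\<close>

lemma gamma_class:
  assumes "x \<in> carrier (St2 n)" "St2_pairing x = gsign n"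
  shows "gamma n = St2_class n x"
proof -
  have x: "St2_class n x \<in> carrier (St2_coinv n)" using assms(1) by (simp add: carrier_St2_coinv)
  have "inj_on St2_coinv_pairing (carrier (St2_coinv n))" by (rule inj_onI) (rule St2_coinv_eqI)
  then have "inv_into (carrier (St2_coinv n)) St2_coinv_pairing (St2_coinv_pairing (St2_class n x)) = St2_class n x"
    using x by (rule inv_into_f_f)
  then show ?thesis using assms by (simp add: gamma_def St2_coinv_pairing_class gsign_def)
qed

lemma
  shows gamma_closed: "gamma n \<in> carrier (St2_coinv n)"
    and St2_coinv_pairing_gamma: "St2_coinv_pairing (gamma n :: 'f::field st2 set) = gsign n"
proof -
  show "gamma n \<in> carrier (St2_coinv n)"
    using ex_St2_pairing gamma_class by (metis carrier_St2_coinv image_eqI)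
  show "St2_coinv_pairing (gamma n :: 'f::field st2 set) = gsign n"
    using ex_St2_pairing gamma_class St2_coinv_pairing_class by metis
qed

lemma
  shows gamma_pow_closed: "gamma n [^]\<^bsub>St2_coinv n\<^esub> (r :: int) \<in> carrier (St2_coinv n)"
    and St2_coinv_pairing_gamma_pow: "St2_coinv_pairing (gamma n [^]\<^bsub>St2_coinv n\<^esub> (r :: int) :: 'f::field st2 set) = r * gsign n"
proof -
  show "gamma n [^]\<^bsub>St2_coinv n\<^esub> (r :: int) \<in> carrier (St2_coinv n)"
    using gamma_closed by (rule group.int_pow_closed[OF comm_group.axioms(2)[OF comm_group_St2_coinv]])
  show "St2_coinv_pairing (gamma n [^]\<^bsub>St2_coinv n\<^esub> (r :: int) :: 'f::field st2 set) = r * gsign n"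
    using hom_int_pow[OF St2_coinv_pairing_hom gamma_closed comm_group.axioms(2)[OF comm_group_St2_coinv] group_integer_group]
    by (simp add: St2_coinv_pairing_gamma)
qed

end

text \<open>The class of a product depends only on its pairing, which by
  \<open>St2_pairing_mult\<close> depends only on the pairings of the factors; this makes the
  product on the coinvariants well defined.\<close>

lemma St2_coinv_mult_class:
  assumes mn: "0 < m" "0 < n" and z: "z \<in> carrier (St2 m)" and w: "w \<in> carrier (St2 n)"
  shows "St2_coinv_mult m n (St2_class m z) (St2_class n w) = St2_class (m + n) (St2_mult m n z w)"
  unfolding St2_coinv_mult_def
proof (rule the_elem_Collect2[of _ z w])
  show "z \<in> St2_class m z \<and> w \<in> St2_class n w" using mem_St2_class mn z w by blast
  fix x y assume "x \<in> St2_class m z \<and> y \<in> St2_class n w"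
  then have xy: "x \<in> carrier (St2 m)" "St2_pairing x = St2_pairing z" "y \<in> carrier (St2 n)" "St2_pairing y = St2_pairing w"
    using mem_St2_class mn z w by blast+
  then show "St2_class (m + n) (St2_mult m n x y) = St2_class (m + n) (St2_mult m n z w)"
    using mn z w bihomD(1)[OF St2_mult_bihom[OF mn]] by (intro St2_class_eqI) (simp_all add: St2_pairing_mult)
qed

lemma
  assumes mn: "0 < m" "0 < n" and Z: "Z \<in> carrier (St2_coinv m)" and W: "W \<in> carrier (St2_coinv n)"
  shows St2_coinv_mult_closed: "St2_coinv_mult m n Z W \<in> carrier (St2_coinv (m + n))"
    and St2_coinv_pairing_mult: "St2_coinv_pairing (St2_coinv_mult m n Z W)
      = (-1) ^ (m * n) * int ((m + n) choose m) * St2_coinv_pairing Z * St2_coinv_pairing W"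
proof -
  obtain z w where zw: "z \<in> carrier (St2 m)" "Z = St2_class m z" "w \<in> carrier (St2 n)" "W = St2_class n w"
    using Z W unfolding carrier_St2_coinv[OF mn(1)] carrier_St2_coinv[OF mn(2)] by blast
  have c: "St2_mult m n z w \<in> carrier (St2 (m + n))" using zw by (intro bihomD(1)[OF St2_mult_bihom[OF mn]])
  then show "St2_coinv_mult m n Z W \<in> carrier (St2_coinv (m + n))"
    using mn zw by (simp add: St2_coinv_mult_class carrier_St2_coinv)
  show "St2_coinv_pairing (St2_coinv_mult m n Z W)
      = (-1) ^ (m * n) * int ((m + n) choose m) * St2_coinv_pairing Z * St2_coinv_pairing W"
    using mn zw c by (simp add: St2_coinv_mult_class St2_coinv_pairing_class St2_pairing_mult)
qed

lemma add_pow_int_ring: "add_pow int_ring (k :: nat) x = int k * x"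
  by (induction k) (simp_all add: add_pow_def algebra_simps)

text \<open>Equalities in the coinvariants are checked after applying the pairing. In the product
  law \<open>gsign_add\<close> absorbs the Koszul sign and leaves the binomial coefficient.\<close>

lemma steinberg_ring_trivialisation:
  "graded_trivialisation int_ring (St2_coinv :: nat \<Rightarrow> 'f::field st2 set monoid) (\<lambda>n r x. x [^]\<^bsub>St2_coinv n\<^esub> r) St2_coinv_mult
    (\<lambda>n r. gamma n [^]\<^bsub>St2_coinv n\<^esub> r)"
proof (intro graded_trivialisation.intro graded_trivialisation_axioms.intro)
  show "cring int_ring" by (rule int_is_cring)
  show "comm_group (St2_coinv n :: 'f st2 set monoid)" if "0 < n" for n using that by (rule comm_group_St2_coinv)
  fix n :: nat assume n: "0 < n"
  interpret C: comm_group "St2_coinv n :: 'f st2 set monoid" by (rule comm_group_St2_coinv[OF n])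
  have g: "gamma n \<in> carrier (St2_coinv n :: 'f st2 set monoid)" by (rule gamma_closed[OF n])
  have pp: "St2_coinv_pairing (gamma n [^]\<^bsub>St2_coinv n\<^esub> r :: 'f st2 set) = r * gsign n" for r :: int
    by (rule St2_coinv_pairing_gamma_pow[OF n])
  show "bij_betw (\<lambda>r. gamma n [^]\<^bsub>St2_coinv n\<^esub> r) (carrier int_ring) (carrier (St2_coinv n :: 'f st2 set monoid))"
  \<comment> \<open>\<open>gamma n\<close> has pairing \<open>gsign n\<close>, which is its own
    inverse, so the exponent is recovered by a second multiplication with it.\<close>
  proof (rule bij_betw_byWitness[where f' = "\<lambda>X. St2_coinv_pairing X * gsign n"])
    show "\<forall>r\<in>carrier int_ring. St2_coinv_pairing (gamma n [^]\<^bsub>St2_coinv n\<^esub> r :: 'f st2 set) * gsign n = r"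
      using pp by (simp add: mult.assoc)
    show "\<forall>X\<in>carrier (St2_coinv n). gamma n [^]\<^bsub>St2_coinv n\<^esub> (St2_coinv_pairing X * gsign n) = (X :: 'f st2 set)"
    proof
      fix X :: "'f st2 set" assume "X \<in> carrier (St2_coinv n)"
      then show "gamma n [^]\<^bsub>St2_coinv n\<^esub> (St2_coinv_pairing X * gsign n) = X"
        by (rule St2_coinv_eqI[OF n gamma_pow_closed[OF n]]) (simp add: pp mult.assoc)
    qed
  qed (use gamma_pow_closed[OF n] in auto)
  show "gamma n [^]\<^bsub>St2_coinv n\<^esub> (r \<oplus>\<^bsub>int_ring\<^esub> s) = gamma n [^]\<^bsub>St2_coinv n\<^esub> r \<otimes>\<^bsub>St2_coinv n\<^esub> (gamma n [^]\<^bsub>St2_coinv n\<^esub> s :: 'f st2 set)"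
    for r s using g by (simp add: C.int_pow_mult)
  show "(gamma n [^]\<^bsub>St2_coinv n\<^esub> s) [^]\<^bsub>St2_coinv n\<^esub> r = (gamma n [^]\<^bsub>St2_coinv n\<^esub> (r \<otimes>\<^bsub>int_ring\<^esub> s) :: 'f st2 set)"
    for r s using g by (simp add: C.int_pow_pow mult.commute)
next
  fix i j :: nat and r s :: int assume ij: "0 < i" "0 < j"
  then have n: "0 < i + j" by simp
  have p: "gamma i [^]\<^bsub>St2_coinv i\<^esub> r \<in> carrier (St2_coinv i :: 'f st2 set monoid)"
    "gamma j [^]\<^bsub>St2_coinv j\<^esub> s \<in> carrier (St2_coinv j :: 'f st2 set monoid)"
    by (rule gamma_pow_closed[OF ij(1)], rule gamma_pow_closed[OF ij(2)])
  show "St2_coinv_mult i j (gamma i [^]\<^bsub>St2_coinv i\<^esub> r) (gamma j [^]\<^bsub>St2_coinv j\<^esub> s)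
    = (gamma (i + j) [^]\<^bsub>St2_coinv (i + j)\<^esub> (add_pow int_ring ((i + j) choose i) (r \<otimes>\<^bsub>int_ring\<^esub> s)) :: 'f st2 set)"
    by (rule St2_coinv_eqI[OF n St2_coinv_mult_closed[OF ij p] gamma_pow_closed[OF n]])
      (simp add: St2_coinv_pairing_mult[OF ij p] St2_coinv_pairing_gamma_pow[OF n] St2_coinv_pairing_gamma_pow[OF ij(1)]
        St2_coinv_pairing_gamma_pow[OF ij(2)] add_pow_int_ring gsign_add[symmetric] mult.assoc mult.left_commute mult.commute)
qed

section \<open>Coefficients in a commutative ring\<close>

text \<open>
  Normalised by the sign so that \<open>gammak R n\<close> has value \<open>1\<close>.
\<close>

definition St2k_pairing :: "('k, 'm) ring_scheme \<Rightarrow> nat \<Rightarrow> ('f::field, 'k) st2k \<Rightarrow> 'k" where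
  "St2k_pairing R n = tensor_lift (add_monoid R) (\<lambda>r x. add_pow R (gsign n * St2_pairing x) r)"

abbreviation "CRk R n \<equiv> coinvariant_relations (St2k R n) (St2k_act R n ` GL n)"

context cring
begin

interpretation RA: comm_group "add_monoid R"
  rewrites "carrier (add_monoid R) = carrier R"
    and "x \<otimes>\<^bsub>add_monoid R\<^esub> y = x \<oplus> y" and "\<one>\<^bsub>add_monoid R\<^esub> = \<zero>"
  by (simp_all add: a_comm_group)

interpretation RS: tensor_pair "add_monoid R" "St2 n :: 'f::field st2 monoid" for n
  by (intro tensor_pair.intro a_comm_group comm_group_St2)

lemma comm_group_St2k: "comm_group (St2k R n)"
  unfolding St2k_def by (rule RS.T.comm_group_axioms)

lemma St2k_pure_closed: "r \<in> carrier R \<Longrightarrow> x \<in> carrier (St2 n) \<Longrightarrow> St2k_pure R n r x \<in> carrier (St2k R n)"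
  unfolding St2k_def by (rule RS.pt_closed) simp_all

lemma St2k_pure_bihom: "bihom (add_monoid R) (St2 n) (St2k R n) (St2k_pure R n)"
  unfolding St2k_def by (rule RS.bihom_pt)

lemma
  assumes n: "0 < n"
  shows St2k_pairing_hom: "St2k_pairing R n \<in> hom (St2k R n :: ('f::field, 'a) st2k monoid) (add_monoid R)"
    and St2k_pairing_pure: "r \<in> carrier R \<Longrightarrow> x \<in> carrier (St2 n) \<Longrightarrow>
      St2k_pairing R n (St2k_pure R n r (x :: 'f st2)) = add_pow R (gsign n * St2_pairing x) r"
proof -
  have P: "St2_pairing \<in> hom (St2 n :: 'f st2 monoid) integer_group" by (rule St2_pairing_hom[OF n])
  have b: "bihom (add_monoid R) (St2 n :: 'f st2 monoid) (add_monoid R) (\<lambda>r x. add_pow R (gsign n * St2_pairing x) r)"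
    unfolding bihom_def
    using hom_mult[OF P]
    by (auto simp: add.int_pow_distrib add.int_pow_mult distrib_left)
  interpret B: tensor_bihom "add_monoid R" "St2 n :: 'f st2 monoid" "add_monoid R" "\<lambda>r x. add_pow R (gsign n * St2_pairing x) r"
    by (intro tensor_bihomI b a_comm_group comm_group_St2)
  show "St2k_pairing R n \<in> hom (St2k R n :: ('f::field, 'a) st2k monoid) (add_monoid R)"
    unfolding St2k_pairing_def St2k_def by (rule B.tensor_lift_hom)
  show "r \<in> carrier R \<Longrightarrow> x \<in> carrier (St2 n) \<Longrightarrow>
      St2k_pairing R n (St2k_pure R n r (x :: 'f st2)) = add_pow R (gsign n * St2_pairing x) r"
    unfolding St2k_pairing_def by (rule B.tensor_lift_pure) simp_all
qed

lemma
  fixes g :: "'f::field mat"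
  assumes g: "g \<in> GL n" and n: "0 < n"
  shows St2k_act_hom: "St2k_act R n g \<in> hom (St2k R n) (St2k R n)"
    and St2k_act_pure: "r \<in> carrier R \<Longrightarrow> x \<in> carrier (St2 n) \<Longrightarrow>
      St2k_act R n g (St2k_pure R n r x) = St2k_pure R n r (St2_act n g x)"
proof -
  interpret B: tensor_bihom "add_monoid R" "St2 n :: 'f st2 monoid" "St2k R n" "\<lambda>r x. St2k_pure R n r (St2_act n g x)"
    by (intro tensor_bihomI a_comm_group comm_group_St2 comm_group_St2k bihom_compose[OF St2k_pure_bihom id_hom] St2_act_hom[OF g n])
  show "St2k_act R n g \<in> hom (St2k R n) (St2k R n)"
    using B.tensor_lift_hom unfolding St2k_act_def St2k_def .
  show "r \<in> carrier R \<Longrightarrow> x \<in> carrier (St2 n) \<Longrightarrow>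
      St2k_act R n g (St2k_pure R n r x) = St2k_pure R n r (St2_act n g x)"
    unfolding St2k_act_def by (rule B.tensor_lift_pure) simp_all
qed

lemma
  fixes s :: 'a
  assumes s: "s \<in> carrier R"
  shows St2k_smult_hom: "St2k_smult R n s \<in> hom (St2k R n :: ('f::field, 'a) st2k monoid) (St2k R n)"
    and St2k_smult_pure: "r \<in> carrier R \<Longrightarrow> x \<in> carrier (St2 n) \<Longrightarrow>
      St2k_smult R n s (St2k_pure R n r (x :: 'f st2)) = St2k_pure R n (s \<otimes> r) x"
proof -
  have "(\<lambda>r. s \<otimes> r) \<in> hom (add_monoid R) (add_monoid R)"
    using s by (intro homI) (simp_all add: r_distr)
  then interpret B: tensor_bihom "add_monoid R" "St2 n :: 'f st2 monoid" "St2k R n" "\<lambda>r x. St2k_pure R n (s \<otimes> r) x"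
    by (intro tensor_bihomI a_comm_group comm_group_St2 comm_group_St2k bihom_compose[OF St2k_pure_bihom] id_hom)
  show "St2k_smult R n s \<in> hom (St2k R n :: ('f, 'a) st2k monoid) (St2k R n)"
    using B.tensor_lift_hom unfolding St2k_smult_def St2k_def .
  show "r \<in> carrier R \<Longrightarrow> x \<in> carrier (St2 n) \<Longrightarrow>
      St2k_smult R n s (St2k_pure R n r (x :: 'f st2)) = St2k_pure R n (s \<otimes> r) x"
    unfolding St2k_smult_def by (rule B.tensor_lift_pure) simp_all
qed

lemma St2k_hom_eq:
  fixes f :: "('f::field, 'a) st2k \<Rightarrow> 'c"
  assumes "group K" "f \<in> hom (St2k R n) K" "g \<in> hom (St2k R n) K" "z \<in> carrier (St2k R n)"
    "\<And>r x. r \<in> carrier R \<Longrightarrow> x \<in> carrier (St2 n) \<Longrightarrow> f (St2k_pure R n r x) = g (St2k_pure R n r x)"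
  shows "f z = g z"
  using RS.hom_eq_on_T[OF assms(1) assms(2,3)[unfolded St2k_def] _ assms(4)[unfolded St2k_def]] assms(5) by simp

lemma St2k_pairing_act:
  fixes g :: "'f::field mat"
  assumes g: "g \<in> GL n" and n: "0 < n" and z: "z \<in> carrier (St2k R n)"
  shows "St2k_pairing R n (St2k_act R n g z) = St2k_pairing R n z"
proof (rule St2k_hom_eq[OF a_group _ _ z])
  show "(\<lambda>z. St2k_pairing R n (St2k_act R n g z)) \<in> hom (St2k R n) (add_monoid R)"
    using hom_compose[OF St2k_act_hom[OF g n] St2k_pairing_hom[OF n]] by (simp add: comp_def)
  show "St2k_pairing R n \<in> hom (St2k R n :: ('f, 'a) st2k monoid) (add_monoid R)" by (rule St2k_pairing_hom[OF n])
  fix r and x :: "'f st2" assume "r \<in> carrier R" "x \<in> carrier (St2 n)"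
  then show "St2k_pairing R n (St2k_act R n g (St2k_pure R n r x)) = St2k_pairing R n (St2k_pure R n r x)"
    by (simp add: St2k_act_pure[OF g n] St2k_pairing_pure[OF n] hom_in_carrier[OF St2_act_hom[OF g n]] St2_pairing_act[OF g n])
qed

lemma St2k_pairing_smult:
  fixes z :: "('f::field, 'a) st2k"
  assumes s: "s \<in> carrier R" and n: "0 < n" and z: "z \<in> carrier (St2k R n)"
  shows "St2k_pairing R n (St2k_smult R n s z) = s \<otimes> St2k_pairing R n z"
proof (rule St2k_hom_eq[OF a_group _ _ z])
  show "(\<lambda>z. St2k_pairing R n (St2k_smult R n s z)) \<in> hom (St2k R n :: ('f, 'a) st2k monoid) (add_monoid R)"
    using hom_compose[OF St2k_smult_hom[OF s] St2k_pairing_hom[OF n]] by (simp add: comp_def)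
  have "(\<lambda>r. s \<otimes> r) \<in> hom (add_monoid R) (add_monoid R)"
    using s by (intro homI) (simp_all add: r_distr)
  from hom_compose[OF St2k_pairing_hom[OF n] this]
  show "(\<lambda>z. s \<otimes> St2k_pairing R n z) \<in> hom (St2k R n :: ('f, 'a) st2k monoid) (add_monoid R)" by (simp add: comp_def)
  fix r and x :: "'f st2" assume "r \<in> carrier R" "x \<in> carrier (St2 n)"
  then show "St2k_pairing R n (St2k_smult R n s (St2k_pure R n r x)) = s \<otimes> St2k_pairing R n (St2k_pure R n r x)"
    using s by (simp add: St2k_smult_pure[OF s] St2k_pairing_pure[OF n] add_pow_rdistr_int)
qed

lemma St2k_mult_quad:
  assumes mn: "0 < m" "0 < n"
  shows "tensor_quad (add_monoid R) (St2 m :: 'f::field st2 monoid) (add_monoid R) (St2 n) (St2k R (m + n))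
    (\<lambda>r x s y. St2k_pure R (m + n) (r \<otimes> s) (St2_mult m n x y))"
proof -
  note b = St2_mult_bihom[OF mn]
  have 1: "(\<lambda>x. St2_mult m n x y) \<in> hom (St2 m) (St2 (m + n))" if "y \<in> carrier (St2 n)" for y :: "'f st2"
    using that by (intro homI) (simp_all add: bihomD[OF b])
  have 2: "(\<lambda>y. St2_mult m n x y) \<in> hom (St2 n) (St2 (m + n))" if "x \<in> carrier (St2 m)" for x :: "'f st2"
    using that by (intro homI) (simp_all add: bihomD[OF b])
  have 3: "(\<lambda>r. r \<otimes> s) \<in> hom (add_monoid R) (add_monoid R)" if "s \<in> carrier (add_monoid R)" for s
    using that by (intro homI) (simp_all add: l_distr)
  have 4: "(\<lambda>r. s \<otimes> r) \<in> hom (add_monoid R) (add_monoid R)" if "s \<in> carrier (add_monoid R)" for s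
    using that by (intro homI) (simp_all add: r_distr)
  show ?thesis
    by (intro tensor_quad.intro tensor_quad_axioms.intro RS.tensor_pair_axioms comm_group_St2k
        bihom_compose[OF St2k_pure_bihom] 1 2 3 4)
qed

lemma
  assumes mn: "0 < m" "0 < n" and z: "z \<in> carrier (St2k R m)" and w: "w \<in> carrier (St2k R n :: ('f::field, 'a) st2k monoid)"
  shows St2k_mult_closed: "St2k_mult R m n z w \<in> carrier (St2k R (m + n))"
    and St2k_pairing_mult: "St2k_pairing R (m + n) (St2k_mult R m n z w)
      = add_pow R ((m + n) choose m) (St2k_pairing R m z \<otimes> St2k_pairing R n w)"
proof -
  interpret Q: tensor_quad "add_monoid R" "St2 m :: 'f st2 monoid" "add_monoid R" "St2 n :: 'f st2 monoid" "St2k R (m + n)"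
    "\<lambda>r x s y. St2k_pure R (m + n) (r \<otimes> s) (St2_mult m n x y)"
    by (rule St2k_mult_quad[OF mn])
  have lift2: "Q.lift2 = St2k_mult R m n" by (intro ext) (simp add: Q.lift2_def St2k_mult_def)
  have bi: "bihom (St2k R m) (St2k R n) (St2k R (m + n)) (St2k_mult R m n :: ('f, 'a) st2k \<Rightarrow> _)"
    using Q.lift2_bihom[unfolded lift2, folded St2k_def] .
  show "St2k_mult R m n z w \<in> carrier (St2k R (m + n))" by (rule bihomD(1)[OF bi z w])
  let ?k = "\<lambda>t. add_pow R ((m + n) choose m) t"
  have Phom: "St2k_pairing R (m + n) \<in> hom (St2k R (m + n) :: ('f, 'a) st2k monoid) (add_monoid R)"
    using mn by (intro St2k_pairing_hom) simp
  have pc: "St2k_pairing R k x \<in> carrier R" if "0 < k" "x \<in> carrier (St2k R k)" for k and x :: "('f, 'a) st2k"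
    using hom_in_carrier[OF St2k_pairing_hom[OF that(1)] that(2)] by simp
  have scale: "(\<lambda>t. ?k (u \<otimes> t)) \<in> hom (add_monoid R) (add_monoid R)" "(\<lambda>t. ?k (t \<otimes> u)) \<in> hom (add_monoid R) (add_monoid R)"
    if "u \<in> carrier R" for u
    using that by (intro homI; simp add: l_distr r_distr add.nat_pow_distrib)+
  have pure: "St2k_pairing R (m + n) (St2k_mult R m n (St2k_pure R m r x) (St2k_pure R n s y))
      = ?k (St2k_pairing R m (St2k_pure R m r x) \<otimes> St2k_pairing R n (St2k_pure R n s y))"
    if *: "r \<in> carrier R" "x \<in> carrier (St2 m)" "s \<in> carrier R" "y \<in> carrier (St2 n)" for r s and x y :: "'f st2"
  proof -
    \<comment> \<open>The Koszul sign and \<open>gsign (m + n)\<close> combine to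
      \<open>gsign m * gsign n\<close>, so the normalised pairing of a product is the product of the
      normalised pairings times the binomial coefficient.\<close>
    have sg: "gsign (m + n) * ((-1) ^ (m * n) * int ((m + n) choose m) * St2_pairing x * St2_pairing y)
        = int ((m + n) choose m) * ((gsign m * St2_pairing x) * (gsign n * St2_pairing y))"
    proof -
      have "(-1) ^ (m * n) * gsign (m + n) = ((-1) ^ (m * n) * (-1) ^ (m * n)) * (gsign m * gsign n)"
        unfolding gsign_add[of m n, symmetric] by (simp only: mult.assoc)
      also have "\<dots> = gsign m * gsign n" by (simp add: power_add[symmetric])
      finally have "((-1) ^ (m * n) * gsign (m + n)) * (int ((m + n) choose m) * St2_pairing x * St2_pairing y)
        = (gsign m * gsign n) * (int ((m + n) choose m) * St2_pairing x * St2_pairing y)" by simp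
      then show ?thesis by (simp only: ac_simps)
    qed
    have mu: "St2k_mult R m n (St2k_pure R m r x) (St2k_pure R n s y) = St2k_pure R (m + n) (r \<otimes> s) (St2_mult m n x y)"
      using Q.lift2_pure[of r x s y] * by (simp add: lift2)
    have pw: "add_pow R (int k * (a * b)) (r \<otimes> s) = add_pow R k (add_pow R a r \<otimes> add_pow R b s)" for k and a b :: int
    proof -
      have "add_pow R a r \<otimes> add_pow R b s = add_pow R (a * b) (r \<otimes> s)"
        using * by (simp add: add_pow_ldistr_int add_pow_rdistr_int add.int_pow_pow mult.commute)
      then have "add_pow R k (add_pow R a r \<otimes> add_pow R b s) = add_pow R (int k) (add_pow R (a * b) (r \<otimes> s))"
        by (simp add: add_pow_def int_pow_int)
      also have "\<dots> = add_pow R (int k * (a * b)) (r \<otimes> s)"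
        using * add.int_pow_pow[of "r \<otimes> s" "int k" "a * b"] by (simp add: mult.commute)
      finally show ?thesis ..
    qed
    have c: "St2_mult m n x y \<in> carrier (St2 (m + n))" using * by (intro bihomD(1)[OF St2_mult_bihom[OF mn]])
    have "0 < m + n" using mn by simp
    note St2k_pairing_pure[OF this m_closed[OF *(1,3)] c]
    then show ?thesis
      unfolding mu St2_pairing_mult[OF mn *(2,4)] sg pw St2k_pairing_pure[OF mn(1) *(1,2)] St2k_pairing_pure[OF mn(2) *(3,4)] .
  qed
  have step: "St2k_pairing R (m + n) (St2k_mult R m n (St2k_pure R m r x) w)
      = ?k (St2k_pairing R m (St2k_pure R m r x) \<otimes> St2k_pairing R n w)"
    if *: "r \<in> carrier R" "x \<in> carrier (St2 m)" for r and x :: "'f st2"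
  proof (rule St2k_hom_eq[OF a_group _ _ w])
    have p: "St2k_pure R m r x \<in> carrier (St2k R m)" by (rule St2k_pure_closed[OF *])
    have "St2k_mult R m n (St2k_pure R m r x) \<in> hom (St2k R n) (St2k R (m + n))"
      by (rule homI) (simp_all add: bihomD[OF bi] p)
    from hom_compose[OF this Phom]
    show "(\<lambda>w. St2k_pairing R (m + n) (St2k_mult R m n (St2k_pure R m r x) w)) \<in> hom (St2k R n) (add_monoid R)"
      by (simp add: comp_def)
    show "(\<lambda>w. ?k (St2k_pairing R m (St2k_pure R m r x) \<otimes> St2k_pairing R n w)) \<in> hom (St2k R n :: ('f, 'a) st2k monoid) (add_monoid R)"
      using hom_compose[OF St2k_pairing_hom[OF mn(2)] scale(1)[OF pc[OF mn(1) p]]] by (simp add: comp_def)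
  qed (rule pure[OF *])
  show "St2k_pairing R (m + n) (St2k_mult R m n z w) = ?k (St2k_pairing R m z \<otimes> St2k_pairing R n w)"
  proof (rule St2k_hom_eq[OF a_group _ _ z])
    have "(\<lambda>z. St2k_mult R m n z w) \<in> hom (St2k R m) (St2k R (m + n))"
      by (rule homI) (simp_all add: bihomD[OF bi] w)
    from hom_compose[OF this Phom]
    show "(\<lambda>z. St2k_pairing R (m + n) (St2k_mult R m n z w)) \<in> hom (St2k R m) (add_monoid R)"
      by (simp add: comp_def)
    show "(\<lambda>z. ?k (St2k_pairing R m z \<otimes> St2k_pairing R n w)) \<in> hom (St2k R m :: ('f, 'a) st2k monoid) (add_monoid R)"
      using hom_compose[OF St2k_pairing_hom[OF mn(1)] scale(2)[OF pc[OF mn(2) w]]] by (simp add: comp_def)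
  qed (rule step)
qed

lemma CRk_subgroup: assumes n: "0 < n" shows "subgroup (CRk R n) (St2k R n)"
proof -
  interpret M: comm_group "St2k R n" by (rule comm_group_St2k)
  show ?thesis
    unfolding coinvariant_relations_def
    by (rule M.generate_is_subgroup) (auto intro!: M.m_closed M.inv_closed hom_in_carrier[OF St2k_act_hom[OF _ n]])
qed

text \<open>For fixed \<open>r\<close> the map \<open>St2k_pure R n r\<close> is a homomorphism that
  commutes with the action, so the preimage of the relations is a subgroup containing the generators
  of \<open>CRel n\<close>.\<close>

lemma St2k_pure_CRel:
  fixes y :: "'f::field st2"
  assumes n: "0 < n" and r: "r \<in> carrier R" and y: "y \<in> CRel n"
  shows "St2k_pure R n r y \<in> CRk R n"
proof -
  interpret Mk: comm_group "St2k R n :: ('f, 'a) st2k monoid" by (rule comm_group_St2k)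
  have CR: "subgroup (CRk R n) (St2k R n :: ('f, 'a) st2k monoid)" by (rule CRk_subgroup[OF n])
  have hom: "St2k_pure R n r \<in> hom (St2 n) (St2k R n :: ('f, 'a) st2k monoid)"
    using r by (intro homI) (simp_all add: bihomD[OF St2k_pure_bihom])
  interpret h: group_hom "St2 n :: 'f st2 monoid" "St2k R n" "St2k_pure R n r"
    using hom by (simp add: group_hom_def group_hom_axioms_def comm_group.axioms(2)[OF comm_group_St2] Mk.is_group)
  have sub: "subgroup {x \<in> carrier (St2 n :: 'f st2 monoid). St2k_pure R n r x \<in> CRk R n} (St2 n)"
    by (rule RS.H.subgroupI)
      (use subgroup.one_closed[OF CR] subgroup.m_closed[OF CR] subgroup.m_inv_closed[OF CR] in \<open>auto intro!: exI[of _ "\<one>\<^bsub>St2 n\<^esub>"]\<close>)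
  have "CRel n \<subseteq> {x \<in> carrier (St2 n :: 'f st2 monoid). St2k_pure R n r x \<in> CRk R n}"
    unfolding coinvariant_relations_def[of "St2 n"]
  proof (rule RS.H.generate_subgroup_incl[OF _ sub], rule subsetI)
    fix u :: "'f st2" assume "u \<in> {\<alpha> x \<otimes>\<^bsub>St2 n\<^esub> inv\<^bsub>St2 n\<^esub> x |\<alpha> x. \<alpha> \<in> St2_act n ` GL n \<and> x \<in> carrier (St2 n)}"
    then obtain g and x :: "'f st2" where g: "g \<in> GL n" and x: "x \<in> carrier (St2 n)"
      and u: "u = St2_act n g x \<otimes>\<^bsub>St2 n\<^esub> inv\<^bsub>St2 n\<^esub> x" by blast
    have gx: "St2_act n g x \<in> carrier (St2 n)" using hom_in_carrier[OF St2_act_hom[OF g n] x] .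
    have "St2k_pure R n r u = St2k_act R n g (St2k_pure R n r x) \<otimes>\<^bsub>St2k R n\<^esub> inv\<^bsub>St2k R n\<^esub> (St2k_pure R n r x)"
      using x gx by (simp add: u St2k_act_pure[OF g n r x])
    also have "\<dots> \<in> CRk R n"
      unfolding coinvariant_relations_def by (rule generate.incl) (use g St2k_pure_closed[OF r x] in blast)
    finally show "u \<in> {x \<in> carrier (St2 n :: 'f st2 monoid). St2k_pure R n r x \<in> CRk R n}"
      using x gx by (simp add: u)
  qed
  then show ?thesis using y by blast
qed

text \<open>For a pure tensor of \<open>r\<close> and \<open>x\<close>, the difference of
  \<open>x\<close> and the multiple of \<open>x0\<close> with the same pairing lies in the integral
  relations, and tensoring with \<open>r\<close> keeps it a relation. The multiple can then be moved
  from \<open>x0\<close> to \<open>r\<close>.\<close>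

lemma St2k_generator:
  fixes z :: "('f::field, 'a) st2k"
  assumes n: "0 < n" and x0: "x0 \<in> carrier (St2 n)" "St2_pairing x0 = gsign n" and z: "z \<in> carrier (St2k R n)"
  shows "z \<otimes>\<^bsub>St2k R n\<^esub> inv\<^bsub>St2k R n\<^esub> (St2k_pure R n (St2k_pairing R n z) x0) \<in> CRk R n"
proof -
  interpret Mk: comm_group "St2k R n :: ('f, 'a) st2k monoid" by (rule comm_group_St2k)
  have CR: "subgroup (CRk R n) (St2k R n :: ('f, 'a) st2k monoid)" by (rule CRk_subgroup[OF n])
  interpret CK: coinvariant_kernel "St2 n :: 'f st2 monoid" integer_group "St2_act n ` GL n" St2_pairing
    by (rule coinvariant_kernel_St2[OF n])
  interpret P: group_hom "St2k R n :: ('f, 'a) st2k monoid" "add_monoid R" "St2k_pairing R n"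
    using St2k_pairing_hom[OF n] by (simp add: group_hom_def group_hom_axioms_def Mk.is_group a_group)
  have hl: "(\<lambda>r. St2k_pure R n r x0) \<in> hom (add_monoid R) (St2k R n :: ('f, 'a) st2k monoid)"
    using x0 by (intro homI) (simp_all add: bihomD[OF St2k_pure_bihom, simplified] St2k_pure_closed)
  interpret hl: group_hom "add_monoid R" "St2k R n :: ('f, 'a) st2k monoid" "\<lambda>r. St2k_pure R n r x0"
    using hl by (simp add: group_hom_def group_hom_axioms_def Mk.is_group a_group)
  let ?u = "\<lambda>x. x \<otimes>\<^bsub>St2k R n\<^esub> inv\<^bsub>St2k R n\<^esub> (St2k_pure R n (St2k_pairing R n x) x0)"
  have "z \<in> carrier (RS.T n)" using z by (simp add: St2k_def)
  then show ?thesis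
  proof (induction rule: RS.tensor_induct)
    case one
    then show ?case
      unfolding St2k_def[symmetric] using P.hom_one hl.hom_one subgroup.one_closed[OF CR] by simp
  next
    case (diff x y)
    note d = diff[folded St2k_def]
    have px: "St2k_pairing R n x \<in> carrier R" "St2k_pairing R n y \<in> carrier R" using d P.hom_closed by simp_all
    have "St2k_pairing R n (x \<otimes>\<^bsub>St2k R n\<^esub> inv\<^bsub>St2k R n\<^esub> y) = St2k_pairing R n x \<otimes>\<^bsub>add_monoid R\<^esub> inv\<^bsub>add_monoid R\<^esub> St2k_pairing R n y"
      using d by simp
    then have "St2k_pure R n (St2k_pairing R n (x \<otimes>\<^bsub>St2k R n\<^esub> inv\<^bsub>St2k R n\<^esub> y)) x0
      = St2k_pure R n (St2k_pairing R n x) x0 \<otimes>\<^bsub>St2k R n\<^esub> inv\<^bsub>St2k R n\<^esub> St2k_pure R n (St2k_pairing R n y) x0"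
      using hl.hom_mult[of "St2k_pairing R n x" "inv\<^bsub>add_monoid R\<^esub> St2k_pairing R n y"]
        hl.hom_inv[of "St2k_pairing R n y"] px group.inv_closed[OF a_group, of "St2k_pairing R n y"] by simp
    then have "?u (x \<otimes>\<^bsub>St2k R n\<^esub> inv\<^bsub>St2k R n\<^esub> y) = ?u x \<otimes>\<^bsub>St2k R n\<^esub> inv\<^bsub>St2k R n\<^esub> (?u y)"
      using d px St2k_pure_closed[OF _ x0(1)] by (simp add: Mk.inv_mult Mk.m_ac)
    also have "\<dots> \<in> CRk R n" using d subgroup.m_closed[OF CR] subgroup.m_inv_closed[OF CR] by blast
    finally show ?case unfolding St2k_def[symmetric] .
  next
    case (pure r x)
    then have r: "r \<in> carrier R" and x: "x \<in> carrier (St2 n)" by simp_all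
    let ?k = "gsign n * St2_pairing x"
    have hr: "St2k_pure R n r \<in> hom (St2 n) (St2k R n :: ('f, 'a) st2k monoid)"
      using r by (intro homI) (simp_all add: bihomD[OF St2k_pure_bihom, simplified] St2k_pure_closed)
    interpret hr: group_hom "St2 n :: 'f st2 monoid" "St2k R n" "St2k_pure R n r"
      using hr by (simp add: group_hom_def group_hom_axioms_def comm_group.axioms(2)[OF comm_group_St2] Mk.is_group)
    have "St2k_pure R n (add_pow R ?k r) x0 = St2k_pure R n r x0 [^]\<^bsub>St2k R n\<^esub> ?k"
      using hl.hom_int_pow[of r ?k] r by (simp add: add_pow_def)
    also have "\<dots> = St2k_pure R n r (x0 [^]\<^bsub>St2 n\<^esub> ?k)" using x0 by (simp add: hr.hom_int_pow)
    finally have eq: "?u (St2k_pure R n r x) = St2k_pure R n r (x \<otimes>\<^bsub>St2 n\<^esub> inv\<^bsub>St2 n\<^esub> (x0 [^]\<^bsub>St2 n\<^esub> ?k))"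
      using x x0 by (simp add: St2k_pairing_pure[OF n r x])
    have "x \<otimes>\<^bsub>St2 n\<^esub> inv\<^bsub>St2 n\<^esub> (x0 [^]\<^bsub>St2 n\<^esub> ?k) \<in> CRel n"
    proof (rule CK.q_kernel)
      \<comment> \<open>The normalising sign occurs in \<open>?k\<close> and in the pairing of
        \<open>x0\<close>, and the two occurrences cancel.\<close>
      have "?k * gsign n = (gsign n * gsign n) * St2_pairing x" by (simp only: ac_simps)
      then have "?k * gsign n = St2_pairing x" by simp
      then show "St2_pairing (x \<otimes>\<^bsub>St2 n\<^esub> inv\<^bsub>St2 n\<^esub> (x0 [^]\<^bsub>St2 n\<^esub> ?k)) = \<one>\<^bsub>integer_group\<^esub>"
        using x x0 by (simp add: CK.Q.hom_int_pow)
    qed (use x x0 in simp)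
    then show ?case unfolding St2k_def[symmetric] eq by (rule St2k_pure_CRel[OF n r])
  qed
qed

lemma coinvariant_kernel_St2k:
  assumes n: "0 < n"
  shows "coinvariant_kernel (St2k R n) (add_monoid R) (St2k_act R n ` GL n) (St2k_pairing R n :: ('f::field, 'a) st2k \<Rightarrow> 'a)"
proof -
  interpret Mk: comm_group "St2k R n :: ('f, 'a) st2k monoid" by (rule comm_group_St2k)
  obtain x0 :: "'f st2" where x0: "x0 \<in> carrier (St2 n)" "St2_pairing x0 = gsign n" using ex_St2_pairing[OF n] by metis
  have one: "St2k_pure R n \<zero> x0 = \<one>\<^bsub>St2k R n\<^esub>"
  proof -
    have hl: "(\<lambda>r. St2k_pure R n r x0) \<in> hom (add_monoid R) (St2k R n :: ('f, 'a) st2k monoid)"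
      using x0 by (intro homI) (simp_all add: bihomD[OF St2k_pure_bihom, simplified] St2k_pure_closed)
    show ?thesis using hom_one[OF hl a_group Mk.is_group] by simp
  qed
  have "z \<in> CRk R n" if "z \<in> carrier (St2k R n)" "St2k_pairing R n z = \<zero>" for z :: "('f, 'a) st2k"
    using St2k_generator[OF n x0 that(1)] that by (simp add: one)
  then show ?thesis
    using St2k_pairing_hom[OF n] hom_in_carrier[OF St2k_act_hom[OF _ n]] St2k_pairing_act[OF _ n]
    by (auto simp: coinvariant_kernel_def coinvariant_kernel_axioms_def comm_group_St2k a_comm_group)
qed

end

section \<open>Coinvariants with coefficients\<close>

context cring
begin

abbreviation St2k_val :: "nat \<Rightarrow> ('f::field, 'a) st2k set \<Rightarrow> 'a" where
  "St2k_val n Z \<equiv> the_elem (St2k_pairing R n ` Z)"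

context
  fixes n :: nat
  assumes n: "0 < n"
begin

interpretation CK: coinvariant_kernel "St2k R n :: ('f::field, 'a) st2k monoid" "add_monoid R" "St2k_act R n ` GL n" "St2k_pairing R n"
  by (rule coinvariant_kernel_St2k[OF n])

lemma comm_group_St2k_coinv: "comm_group (St2k_coinv R n)"
  unfolding St2k_coinv_def by (rule CK.C_comm_group)

lemma carrier_St2k_coinv: "carrier (St2k_coinv R n) = St2k_class R n ` carrier (St2k R n)"
  unfolding St2k_coinv_def St2k_class_def by (rule CK.carrier_C)

lemma St2k_val_class: "z \<in> carrier (St2k R n) \<Longrightarrow> St2k_val n (St2k_class R n z) = St2k_pairing R n z"
  unfolding St2k_class_def by (rule CK.val_cl)

lemma St2k_val_hom: "St2k_val n \<in> hom (St2k_coinv R n) (add_monoid R)"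
  unfolding St2k_coinv_def by (rule CK.val_hom)

lemma St2k_coinv_eqI:
  "X \<in> carrier (St2k_coinv R n) \<Longrightarrow> Y \<in> carrier (St2k_coinv R n) \<Longrightarrow> St2k_val n X = St2k_val n Y \<Longrightarrow> X = Y"
  unfolding St2k_coinv_def by (rule CK.val_eqI)

lemma mem_St2k_class:
  "z \<in> carrier (St2k R n) \<Longrightarrow> x \<in> St2k_class R n z \<longleftrightarrow> x \<in> carrier (St2k R n) \<and> St2k_pairing R n x = St2k_pairing R n z"
  unfolding St2k_class_def by (rule CK.mem_cl)

lemma St2k_class_eqI:
  "z \<in> carrier (St2k R n) \<Longrightarrow> w \<in> carrier (St2k R n) \<Longrightarrow> St2k_pairing R n z = St2k_pairing R n w \<Longrightarrow>
    St2k_class R n z = St2k_class R n w"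
  unfolding St2k_class_def by (simp add: CK.cl_eq_iff)

lemma St2k_coinv_smult_class:
  assumes s: "s \<in> carrier R" and z: "z \<in> carrier (St2k R n)"
  shows "St2k_coinv_smult R n s (St2k_class R n z) = St2k_class R n (St2k_smult R n s z)"
  unfolding St2k_coinv_smult_def
proof (rule the_elem_Collect[of _ z])
  show "z \<in> St2k_class R n z" using mem_St2k_class z by blast
  fix x assume "x \<in> St2k_class R n z"
  then have x: "x \<in> carrier (St2k R n)" "St2k_pairing R n x = St2k_pairing R n z" using mem_St2k_class z by blast+
  then show "St2k_class R n (St2k_smult R n s x) = St2k_class R n (St2k_smult R n s z)"
    using z by (intro St2k_class_eqI) (simp_all add: St2k_pairing_smult[OF s n] hom_in_carrier[OF St2k_smult_hom[OF s]])
qed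

text \<open>All representatives of \<open>gamma n\<close> have the same pairing, hence their images
  have the same normalised pairing and the same class.\<close>

lemma gammak_class:
  fixes x0 :: "'f::field st2"
  assumes x0: "x0 \<in> carrier (St2 n)" "St2_pairing x0 = gsign n"
  shows "gammak R n = St2k_class R n (St2k_pure R n \<one> x0)"
  unfolding gammak_def gamma_class[OF n x0]
proof (rule the_elem_Collect[of _ x0])
  show "x0 \<in> St2_class n x0" using mem_St2_class[OF n x0(1)] x0 by blast
  fix x assume "x \<in> St2_class n x0"
  then have x: "x \<in> carrier (St2 n)" "St2_pairing x = gsign n" using mem_St2_class[OF n x0(1)] x0 by auto
  show "St2k_class R n (St2k_pure R n \<one> x) = St2k_class R n (St2k_pure R n \<one> x0)"
    using x x0 by (intro St2k_class_eqI St2k_pure_closed) (simp_all add: St2k_pairing_pure[OF n])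
qed

lemma
  assumes s: "s \<in> carrier R" and Z: "Z \<in> carrier (St2k_coinv R n)"
  shows St2k_coinv_smult_closed: "St2k_coinv_smult R n s Z \<in> carrier (St2k_coinv R n)"
    and St2k_val_smult: "St2k_val n (St2k_coinv_smult R n s Z) = s \<otimes> St2k_val n Z"
proof -
  obtain z where z: "z \<in> carrier (St2k R n)" "Z = St2k_class R n z" using Z unfolding carrier_St2k_coinv by blast
  have c: "St2k_smult R n s z \<in> carrier (St2k R n)" using hom_in_carrier[OF St2k_smult_hom[OF s] z(1)] .
  then show "St2k_coinv_smult R n s Z \<in> carrier (St2k_coinv R n)"
    unfolding z(2) St2k_coinv_smult_class[OF s z(1)] carrier_St2k_coinv by (rule imageI)
  show "St2k_val n (St2k_coinv_smult R n s Z) = s \<otimes> St2k_val n Z"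
    unfolding z(2) St2k_coinv_smult_class[OF s z(1)] St2k_val_class[OF c] St2k_val_class[OF z(1)]
    by (rule St2k_pairing_smult[OF s n z(1)])
qed

lemma
  shows gammak_closed: "gammak R n \<in> carrier (St2k_coinv R n :: ('f::field, 'a) st2k set monoid)"
    and St2k_val_gammak: "St2k_val n (gammak R n :: ('f, 'a) st2k set) = \<one>"
proof -
  obtain x0 :: "'f st2" where x0: "x0 \<in> carrier (St2 n)" "St2_pairing x0 = gsign n" using ex_St2_pairing[OF n] by metis
  have p: "St2k_pure R n \<one> x0 \<in> carrier (St2k R n)" using x0 by (intro St2k_pure_closed) simp_all
  show "gammak R n \<in> carrier (St2k_coinv R n :: ('f, 'a) st2k set monoid)"
    unfolding gammak_class[OF x0] carrier_St2k_coinv using p by (rule imageI)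
  show "St2k_val n (gammak R n :: ('f, 'a) st2k set) = \<one>"
    unfolding gammak_class[OF x0] St2k_val_class[OF p] using x0 by (simp add: St2k_pairing_pure[OF n])
qed

end

lemma St2k_coinv_mult_class:
  assumes mn: "0 < m" "0 < n" and z: "z \<in> carrier (St2k R m)" and w: "w \<in> carrier (St2k R n)"
  shows "St2k_coinv_mult R m n (St2k_class R m z) (St2k_class R n w) = St2k_class R (m + n) (St2k_mult R m n z w)"
  unfolding St2k_coinv_mult_def
proof (rule the_elem_Collect2[of _ z w])
  show "z \<in> St2k_class R m z \<and> w \<in> St2k_class R n w" using mem_St2k_class mn z w by blast
  fix x y assume "x \<in> St2k_class R m z \<and> y \<in> St2k_class R n w"
  then have xy: "x \<in> carrier (St2k R m)" "St2k_pairing R m x = St2k_pairing R m z"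
    "y \<in> carrier (St2k R n)" "St2k_pairing R n y = St2k_pairing R n w"
    using mem_St2k_class mn z w by blast+
  have "0 < m + n" using mn by simp
  then show "St2k_class R (m + n) (St2k_mult R m n x y) = St2k_class R (m + n) (St2k_mult R m n z w)"
    using xy z w by (intro St2k_class_eqI St2k_mult_closed mn) (simp_all add: St2k_pairing_mult[OF mn])
qed

lemma
  assumes mn: "0 < m" "0 < n" and Z: "Z \<in> carrier (St2k_coinv R m)" and W: "W \<in> carrier (St2k_coinv R n)"
  shows St2k_coinv_mult_closed: "St2k_coinv_mult R m n Z W \<in> carrier (St2k_coinv R (m + n))"
    and St2k_val_mult: "St2k_val (m + n) (St2k_coinv_mult R m n Z W)
      = add_pow R ((m + n) choose m) (St2k_val m Z \<otimes> St2k_val n W)"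
proof -
  obtain z w where zw: "z \<in> carrier (St2k R m)" "Z = St2k_class R m z" "w \<in> carrier (St2k R n)" "W = St2k_class R n w"
    using Z W unfolding carrier_St2k_coinv[OF mn(1)] carrier_St2k_coinv[OF mn(2)] by blast
  have c: "St2k_mult R m n z w \<in> carrier (St2k R (m + n))" using zw by (intro St2k_mult_closed mn)
  have p: "0 < m + n" using mn by simp
  show "St2k_coinv_mult R m n Z W \<in> carrier (St2k_coinv R (m + n))"
    unfolding zw(2,4) St2k_coinv_mult_class[OF mn zw(1,3)] carrier_St2k_coinv[OF p] using c by (rule imageI)
  show "St2k_val (m + n) (St2k_coinv_mult R m n Z W)
      = add_pow R ((m + n) choose m) (St2k_val m Z \<otimes> St2k_val n W)"
    unfolding zw(2,4) St2k_coinv_mult_class[OF mn zw(1,3)] St2k_val_class[OF p c] St2k_val_class[OF mn(1) zw(1)]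
      St2k_val_class[OF mn(2) zw(3)]
    by (rule St2k_pairing_mult[OF mn zw(1,3)])
qed

text \<open>Since \<open>gammak R n\<close> has value 1, its multiple by \<open>r\<close> has value
  \<open>r\<close>. So \<open>St2k_val n\<close> inverts the trivialisation, and each law is read
  off from values in \<open>R\<close>.\<close>

lemma steinberg_algebra_trivialisation:
  "graded_trivialisation R (St2k_coinv R :: nat \<Rightarrow> ('f::field, 'a) st2k set monoid) (St2k_coinv_smult R) (St2k_coinv_mult R)
    (\<lambda>n r. St2k_coinv_smult R n r (gammak R n))"
proof (intro graded_trivialisation.intro graded_trivialisation_axioms.intro is_cring)
  let ?e = "\<lambda>n r. St2k_coinv_smult R n r (gammak R n) :: ('f, 'a) st2k set"
  have e: "?e n r \<in> carrier (St2k_coinv R n)" and v: "St2k_val n (?e n r) = r" if "0 < n" "r \<in> carrier R" for n r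
  proof -
    have g: "gammak R n \<in> carrier (St2k_coinv R n :: ('f, 'a) st2k set monoid)" by (rule gammak_closed[OF that(1)])
    have "St2k_val n (gammak R n :: ('f, 'a) st2k set) = \<one>" by (rule St2k_val_gammak[OF that(1)])
    then show "?e n r \<in> carrier (St2k_coinv R n)" "St2k_val n (?e n r) = r"
      using that St2k_coinv_smult_closed[OF that g] by (simp_all add: St2k_val_smult[OF that g])
  qed
  show "comm_group (St2k_coinv R n :: ('f, 'a) st2k set monoid)" if "0 < n" for n using that by (rule comm_group_St2k_coinv)
  show "bij_betw (?e n) (carrier R) (carrier (St2k_coinv R n :: ('f, 'a) st2k set monoid))" if n: "0 < n" for n
  proof (rule bij_betw_byWitness[where f' = "St2k_val n"])
    have vc: "St2k_val n X \<in> carrier R" if "X \<in> carrier (St2k_coinv R n)" for X :: "('f, 'a) st2k set"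
      using hom_in_carrier[OF St2k_val_hom[OF n] that] by simp
    show "\<forall>r\<in>carrier R. St2k_val n (?e n r) = r" using v[OF n] by blast
    show "\<forall>X\<in>carrier (St2k_coinv R n). ?e n (St2k_val n X) = X"
    proof
      fix X :: "('f, 'a) st2k set" assume X: "X \<in> carrier (St2k_coinv R n)"
      show "?e n (St2k_val n X) = X"
        by (rule St2k_coinv_eqI[OF n e[OF n vc[OF X]] X]) (rule v[OF n vc[OF X]])
    qed
    show "?e n ` carrier R \<subseteq> carrier (St2k_coinv R n)" using e[OF n] by blast
    show "St2k_val n ` carrier (St2k_coinv R n :: ('f, 'a) st2k set monoid) \<subseteq> carrier R" using vc by blast
  qed
  show "?e n (r \<oplus> s) = ?e n r \<otimes>\<^bsub>St2k_coinv R n\<^esub> ?e n s"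
    if n: "0 < n" and rs: "r \<in> carrier R" "s \<in> carrier R" for n r s
  proof (rule St2k_coinv_eqI[OF n e[OF n a_closed[OF rs]]])
    interpret C: comm_group "St2k_coinv R n :: ('f, 'a) st2k set monoid" by (rule comm_group_St2k_coinv[OF n])
    show "?e n r \<otimes>\<^bsub>St2k_coinv R n\<^esub> ?e n s \<in> carrier (St2k_coinv R n)"
      by (rule C.m_closed[OF e[OF n rs(1)] e[OF n rs(2)]])
    show "St2k_val n (?e n (r \<oplus> s)) = St2k_val n (?e n r \<otimes>\<^bsub>St2k_coinv R n\<^esub> ?e n s)"
      unfolding hom_mult[OF St2k_val_hom[OF n] e[OF n rs(1)] e[OF n rs(2)]] v[OF n rs(1)] v[OF n rs(2)] v[OF n a_closed[OF rs]]
      by simp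
  qed
  show "St2k_coinv_smult R n r (?e n s) = ?e n (r \<otimes> s)"
    if n: "0 < n" and rs: "r \<in> carrier R" "s \<in> carrier R" for n r s
    by (rule St2k_coinv_eqI[OF n St2k_coinv_smult_closed[OF n rs(1) e[OF n rs(2)]] e[OF n m_closed[OF rs]]])
      (unfold St2k_val_smult[OF n rs(1) e[OF n rs(2)]] v[OF n rs(2)] v[OF n m_closed[OF rs]], rule refl)
  show "St2k_coinv_mult R i j (?e i r) (?e j s) = ?e (i + j) (add_pow R ((i + j) choose i) (r \<otimes> s))"
    if ij: "0 < i" "0 < j" and rs: "r \<in> carrier R" "s \<in> carrier R" for i j r s
  proof -
    have n: "0 < i + j" using ij by simp
    have c: "add_pow R ((i + j) choose i) (r \<otimes> s) \<in> carrier R" using rs by simp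
    note ee = e[OF ij(1) rs(1)] e[OF ij(2) rs(2)]
    show ?thesis
      by (rule St2k_coinv_eqI[OF n St2k_coinv_mult_closed[OF ij ee] e[OF n c]])
        (unfold St2k_val_mult[OF ij ee] v[OF n c] v[OF ij(1) rs(1)] v[OF ij(2) rs(2)], rule refl)
  qed
qed

end

theorem theorem6p9:
  fixes R :: "('k, 'm) ring_scheme"
  shows "(ring (divided_power_algebra int_ring) \<and>
          ring (steinberg_ring TYPE('f::field)) \<and>
          gamma_map TYPE('f) \<in> ring_iso (divided_power_algebra int_ring) (steinberg_ring TYPE('f)))
       \<and> (cring R \<longrightarrow>
          algebra R (divided_power_algebra R) \<and>
          algebra R (steinberg_algebra TYPE('f) R) \<and>
          gammak_map TYPE('f) R
            \<in> algebra_iso R (divided_power_algebra R) (steinberg_algebra TYPE('f) R))"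
proof (intro conjI impI)
  interpret Z: graded_trivialisation int_ring "St2_coinv :: nat \<Rightarrow> 'f st2 set monoid" "\<lambda>n r x. x [^]\<^bsub>St2_coinv n\<^esub> r"
    St2_coinv_mult "\<lambda>n r. gamma n [^]\<^bsub>St2_coinv n\<^esub> r"
    by (rule steinberg_ring_trivialisation)
  show "ring (divided_power_algebra int_ring)" by (rule cring.axioms(1)[OF cring.DP_cring[OF int_is_cring]])
  show "ring (steinberg_ring TYPE('f))"
    unfolding steinberg_ring_def by (rule cring.axioms(1)[OF Z.GA_cring])
  have "gamma_map TYPE('f) = Z.grmap" by (intro ext) (simp add: gamma_map_def Z.grmap_def)
  then show "gamma_map TYPE('f) \<in> ring_iso (divided_power_algebra int_ring) (steinberg_ring TYPE('f))"
    unfolding steinberg_ring_def using Z.grmap_ring_iso by (simp only:)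
next
  assume "cring R"
  then interpret cring R .
  interpret K: graded_trivialisation R "St2k_coinv R :: nat \<Rightarrow> ('f, 'k) st2k set monoid" "St2k_coinv_smult R"
    "St2k_coinv_mult R" "\<lambda>n r. St2k_coinv_smult R n r (gammak R n)"
    by (rule steinberg_algebra_trivialisation)
  show "algebra R (divided_power_algebra R)" by (rule DP_algebra)
  show "algebra R (steinberg_algebra TYPE('f) R)"
    unfolding steinberg_algebra_def by (rule K.GA_algebra)
  have "gammak_map TYPE('f) R = K.grmap" by (intro ext) (simp add: gammak_map_def K.grmap_def)
  then show "gammak_map TYPE('f) R \<in> algebra_iso R (divided_power_algebra R) (steinberg_algebra TYPE('f) R)"
    unfolding steinberg_algebra_def using K.grmap_algebra_iso by (simp only:)
qed

end
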